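(* Let $\mathcal G$ be a (not necessarily Hausdorff) étale groupoid with locally compact Hausdorff unit space $X=\mathcal G^{(0)}$, equipped with a Fell line bundle $\mathcal L$, and assume that $\mathcal G$ is topologically free. Then, among the collection of all C*-seminorms on $\mathscr C_c(\mathcal G,\mathcal L)$ coinciding with the uniform norm on $C_c(X)$, there exists a smallest member, namely the seminorm given by $$\|b\|_{\min}=\|q_{\mathrm{ess}}(b)\|,\qquad b\in\mathscr C_c(\mathcal G,\mathcal L).$$ The completion of $\mathscr C_c(\mathcal G,\mathcal L)$ under this seminorm is consequently the essential groupoid C*-algebra $C^*_{\mathrm{ess}}(\mathcal G,\mathcal L)$.
   Context: An étale groupoid is a topological groupoid $\mathcal G$ (not necessarily Hausdorff) whose unit space $X=\mathcal G^{(0)}$ is locally compact Hausdorff and whose range map $r:\mathcal G\to X$ (hence also the source map $s$) is a local homeomorphism. $\mathcal G(x)=\{\gamma:s(\gamma)=r(\gamma)=x\}$; $\mathcal G$ is topologically free if $\{x\in X:\mathcal G(x)=\{x\}\}$ is dense in $X$. An open bisection is an open $U\subseteq\mathcal G$ on which $r$ and $s$ are injective. A Fell line bundle over $\mathcal G$ is a topological space $\mathcal L=\bigsqcup_{\gamma\in\mathcal G}\mathcal L_\gamma$ of one-dimensional complex Banach spaces, restricting to a continuous Banach bundle on every open bisection, with a continuous, bilinear, associative, submultiplicative multiplication $\mathcal L_{\gamma_1}\times\mathcal L_{\gamma_2}\to\mathcal L_{\gamma_1\gamma_2}$ (for composable pairs) and a continuous conjugate-linear, involutive, antimultiplicative adjoint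 $\mathcal L_\gamma\to\mathcal L_{\gamma^{-1}}$ satisfying $\|\xi^*\xi\|=\|\xi\|^2$ and $\xi^*\xi\ge0$. For $x\in X$, $\mathcal L_x\cong\mathbb C$ canonically. For an open bisection $U$, $\mathscr C_c(U,\mathcal L)$ is the set of sections of $\mathcal L$ obtained by extending by zero the continuous compactly supported sections over $U$; $\mathscr C_c(\mathcal G,\mathcal L)$ is the linear span of all of these, a $*$-algebra with $(f*g)(\gamma)=\sum_{\gamma_1\gamma_2=\gamma}f(\gamma_1)g(\gamma_2)$ and $f^*(\gamma)=f(\gamma^{-1})^*$; it contains $C_c(X)=\mathscr C_c(X,\mathcal L)$. $C^*(\mathcal G,\mathcal L)$ is its completion in the largest C*-norm, containing $C_0(X)$ as the closure of $C_c(X)$. A point $x\in X$ is free if the evaluation state $\varphi_x$ of $C_0(X)$ has a unique extension to a state $\psi_x$ of $C^*(\mathcal G,\mathcal L)$; with $F$ the set of free points, the gray ideal is $\Gamma=\{b\in C^*(\mathcal G,\mathcal L):\psi_x(b^*b)=0\ \forall x\in F\}$ (a closed two-sided ideal); $C^*_{\mathrm{ess}}(\mathcal G,\mathcal L)=C^*(\mathcal G,\mathcal L)/\Gamma$ and $q_{\mathrm{ess}}$ is the quotient map. The completion under a seminorm means the Hausdorff completion. *)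

theory Defs
  imports "HOL-Analysis.Analysis" "HOL-Algebra.FiniteProduct"
begin

section \<open>Etale groupoids\<close>

text \<open>A groupoid lives on a whole type, with its unit space as a subset of that type. The product
  \<open>gmult G a b\<close> is only meaningful when \<open>gsource G a = grange G b\<close>.\<close>

record 'g groupoid =
  grange :: "'g \<Rightarrow> 'g"
  gsource :: "'g \<Rightarrow> 'g"
  gmult :: "'g \<Rightarrow> 'g \<Rightarrow> 'g"
  ginv :: "'g \<Rightarrow> 'g"

definition units :: "'g groupoid \<Rightarrow> 'g set" where
  "units G = range (grange G)"

definition composable :: "'g groupoid \<Rightarrow> ('g \<times> 'g) set" where
  "composable G = {(a, b). gsource G a = grange G b}"

text \<open>The topology of \<open>'g\<close> is not assumed Hausdorff. Continuity of range and source follows from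
  that of the product and the inverse; that the source map is a local homeomorphism follows from
  the same property of the range map.\<close>

locale etale_groupoid =
  fixes G :: "('g::topological_space) groupoid"
  assumes source_range: "gsource G (grange G a) = grange G a"
    and range_source: "grange G (gsource G a) = gsource G a"
    and range_mult: "(a, b) \<in> composable G \<Longrightarrow> grange G (gmult G a b) = grange G a"
    and source_mult: "(a, b) \<in> composable G \<Longrightarrow> gsource G (gmult G a b) = gsource G b"
    and mult_assoc: "(a, b) \<in> composable G \<Longrightarrow> (b, c) \<in> composable G \<Longrightarrow>
      gmult G (gmult G a b) c = gmult G a (gmult G b c)"
    and range_unit: "gmult G (grange G a) a = a"
    and source_unit: "gmult G a (gsource G a) = a"
    and range_inv: "grange G (ginv G a) = gsource G a"
    and source_inv: "gsource G (ginv G a) = grange G a"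
    and mult_inv: "gmult G a (ginv G a) = grange G a"
    and inv_mult: "gmult G (ginv G a) a = gsource G a"
    and continuous_mult: "continuous_on (composable G) (\<lambda>(a, b). gmult G a b)"
    and continuous_inv: "continuous_on UNIV (ginv G)"
    and locally_compact_units: "locally_compact_space (top_of_set (units G))"
    and Hausdorff_units: "Hausdorff_space (top_of_set (units G))"
    and range_local_homeomorphism: "\<exists>U V h. open U \<and> a \<in> U \<and>
      openin (top_of_set (units G)) V \<and> homeomorphism U V (grange G) h"

definition isotropy :: "'g groupoid \<Rightarrow> 'g \<Rightarrow> 'g set" where
  "isotropy G x = {a. gsource G a = x \<and> grange G a = x}"

definition topologically_free :: "('g::topological_space) groupoid \<Rightarrow> bool" where
  "topologically_free G \<longleftrightarrow> units G \<subseteq> closure {x \<in> units G. isotropy G x = {x}}"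

definition open_bisection :: "('g::topological_space) groupoid \<Rightarrow> 'g set \<Rightarrow> bool" where
  "open_bisection G U \<longleftrightarrow> open U \<and> inj_on (grange G) U \<and> inj_on (gsource G) U"

section \<open>Fell line bundles\<close>

text \<open>The total space is the whole type \<open>'l\<close>. Sums are only meaningful within a fibre, and products
  only for elements over composable pairs.\<close>

record ('g, 'l) line_bundle =
  proj :: "'l \<Rightarrow> 'g"
  lzero :: "'g \<Rightarrow> 'l"
  ladd :: "'l \<Rightarrow> 'l \<Rightarrow> 'l"
  lscale :: "complex \<Rightarrow> 'l \<Rightarrow> 'l"
  lnorm :: "'l \<Rightarrow> real"
  lmult :: "'l \<Rightarrow> 'l \<Rightarrow> 'l"
  lstar :: "'l \<Rightarrow> 'l"

text \<open>The additive group of a fibre, in the multiplicative notation of HOL-Algebra.\<close>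

definition fibre :: "('g, 'l) line_bundle \<Rightarrow> 'g \<Rightarrow> 'l monoid" where
  "fibre L g = \<lparr>carrier = {u. proj L u = g}, mult = ladd L, one = lzero L g\<rparr>"

text \<open>Completeness of the fibres is automatic, because they are one-dimensional.\<close>

locale normed_lines =
  fixes L :: "('g, 'l) line_bundle"
  assumes fibre_group: "comm_group (fibre L g)"
    and proj_scale: "proj L (lscale L c u) = proj L u"
    and scale_add_right: "proj L u = proj L v \<Longrightarrow>
      lscale L c (ladd L u v) = ladd L (lscale L c u) (lscale L c v)"
    and scale_add_left: "lscale L (c + d) u = ladd L (lscale L c u) (lscale L d u)"
    and scale_scale: "lscale L c (lscale L d u) = lscale L (c * d) u"
    and scale_one: "lscale L 1 u = u"
    and norm_nonneg: "0 \<le> lnorm L u"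
    and norm_eq_zero: "lnorm L u = 0 \<longleftrightarrow> u = lzero L (proj L u)"
    and norm_triangle: "proj L u = proj L v \<Longrightarrow> lnorm L (ladd L u v) \<le> lnorm L u + lnorm L v"
    and norm_scale: "lnorm L (lscale L c u) = cmod c * lnorm L u"
    and one_dimensional: "\<exists>e. e \<noteq> lzero L g \<and> carrier (fibre L g) = range (\<lambda>c. lscale L c e)"

text \<open>The Fell--Doran axioms for the restriction of the bundle to \<open>U\<close>. In the last
  one, nets in the total space are replaced by filters.\<close>

definition banach_bundle_on ::
  "('g::topological_space, 'l::topological_space) line_bundle \<Rightarrow> 'g set \<Rightarrow> bool" where
  "banach_bundle_on L U \<longleftrightarrow>
     continuous_on (proj L -` U) (proj L) \<and>
     open_map (top_of_set (proj L -` U)) (top_of_set U) (proj L) \<and>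
     continuous_on (proj L -` U) (lnorm L) \<and>
     continuous_on {(u, v). proj L u = proj L v \<and> proj L u \<in> U} (\<lambda>(u, v). ladd L u v) \<and>
     (\<forall>c. continuous_on (proj L -` U) (lscale L c)) \<and>
     (\<forall>F. \<forall>g\<in>U. eventually (\<lambda>u. proj L u \<in> U) F \<longrightarrow> (proj L \<longlongrightarrow> g) F \<longrightarrow>
        (lnorm L \<longlongrightarrow> 0) F \<longrightarrow> filterlim (\<lambda>u. u) (nhds (lzero L g)) F)"

text \<open>The element of the fibre over the unit \<open>x\<close> that corresponds to 1 under the canonical
  identification of this one-dimensional C*-algebra with the complex numbers.\<close>

definition fibre_unit :: "('g, 'l) line_bundle \<Rightarrow> 'g \<Rightarrow> 'l" where
  "fibre_unit L x = (THE e. proj L e = x \<and> e \<noteq> lzero L x \<and> lmult L e e = e)"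

definition lcomposable :: "'g groupoid \<Rightarrow> ('g, 'l) line_bundle \<Rightarrow> ('l \<times> 'l) set" where
  "lcomposable G L = {(u, v). (proj L u, proj L v) \<in> composable G}"

locale fell_line_bundle = etale_groupoid G + normed_lines L
  for G :: "('g::topological_space) groupoid"
    and L :: "('g, 'l::topological_space) line_bundle" +
  assumes continuous_proj: "continuous_on UNIV (proj L)"
    and banach_bundle: "open_bisection G U \<Longrightarrow> banach_bundle_on L U"
    and proj_mult: "(u, v) \<in> lcomposable G L \<Longrightarrow>
      proj L (lmult L u v) = gmult G (proj L u) (proj L v)"
    and mult_add_left: "(u, v) \<in> lcomposable G L \<Longrightarrow> proj L u' = proj L u \<Longrightarrow>
      lmult L (ladd L u u') v = ladd L (lmult L u v) (lmult L u' v)"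
    and mult_add_right: "(u, v) \<in> lcomposable G L \<Longrightarrow> proj L v' = proj L v \<Longrightarrow>
      lmult L u (ladd L v v') = ladd L (lmult L u v) (lmult L u v')"
    and mult_scale_left: "(u, v) \<in> lcomposable G L \<Longrightarrow>
      lmult L (lscale L c u) v = lscale L c (lmult L u v)"
    and mult_scale_right: "(u, v) \<in> lcomposable G L \<Longrightarrow>
      lmult L u (lscale L c v) = lscale L c (lmult L u v)"
    and lmult_assoc: "(u, v) \<in> lcomposable G L \<Longrightarrow> (v, w) \<in> lcomposable G L \<Longrightarrow>
      lmult L (lmult L u v) w = lmult L u (lmult L v w)"
    and norm_mult: "(u, v) \<in> lcomposable G L \<Longrightarrow> lnorm L (lmult L u v) \<le> lnorm L u * lnorm L v"
    and continuous_lmult: "continuous_on (lcomposable G L) (\<lambda>(u, v). lmult L u v)"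
    and proj_star: "proj L (lstar L u) = ginv G (proj L u)"
    and star_add: "proj L u = proj L v \<Longrightarrow>
      lstar L (ladd L u v) = ladd L (lstar L u) (lstar L v)"
    and star_scale: "lstar L (lscale L c u) = lscale L (cnj c) (lstar L u)"
    and star_star: "lstar L (lstar L u) = u"
    and star_mult: "(u, v) \<in> lcomposable G L \<Longrightarrow>
      lstar L (lmult L u v) = lmult L (lstar L v) (lstar L u)"
    and continuous_star: "continuous_on UNIV (lstar L)"
    and norm_star_mult: "lnorm L (lmult L (lstar L u) u) = (lnorm L u)\<^sup>2"
    and star_mult_nonneg: "\<exists>t\<ge>0. lmult L (lstar L u) u =
      lscale L (complex_of_real t) (fibre_unit L (gsource G (proj L u)))"

section \<open>Star algebras, C*-seminorms, completions and quotients\<close>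

record 'a star_algebra = "'a partial_object" +
  azero :: 'a
  aadd :: "'a \<Rightarrow> 'a \<Rightarrow> 'a"
  ascale :: "complex \<Rightarrow> 'a \<Rightarrow> 'a"
  amult :: "'a \<Rightarrow> 'a \<Rightarrow> 'a"
  astar :: "'a \<Rightarrow> 'a"

record 'a normed_star_algebra = "'a star_algebra" +
  anorm :: "'a \<Rightarrow> real"

definition aminus :: "('a, 'm) star_algebra_scheme \<Rightarrow> 'a \<Rightarrow> 'a \<Rightarrow> 'a" where
  "aminus A a b = aadd A a (ascale A (-1) b)"

definition cstar_seminorm :: "('a, 'm) star_algebra_scheme \<Rightarrow> ('a \<Rightarrow> real) \<Rightarrow> bool" where
  "cstar_seminorm A p \<longleftrightarrow>
     (\<forall>a\<in>carrier A. 0 \<le> p a) \<and>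
     (\<forall>a\<in>carrier A. \<forall>b\<in>carrier A. p (aadd A a b) \<le> p a + p b) \<and>
     (\<forall>c. \<forall>a\<in>carrier A. p (ascale A c a) = cmod c * p a) \<and>
     (\<forall>a\<in>carrier A. \<forall>b\<in>carrier A. p (amult A a b) \<le> p a * p b) \<and>
     (\<forall>a\<in>carrier A. p (amult A (astar A a) a) = (p a)\<^sup>2)"

definition cstar_norm :: "('a, 'm) star_algebra_scheme \<Rightarrow> ('a \<Rightarrow> real) \<Rightarrow> bool" where
  "cstar_norm A p \<longleftrightarrow> cstar_seminorm A p \<and> (\<forall>a\<in>carrier A. p a = 0 \<longrightarrow> a = azero A)"

text \<open>If there is a largest C*-norm, it is the pointwise supremum of all C*-norms.\<close>

definition max_cstar_norm :: "('a, 'm) star_algebra_scheme \<Rightarrow> 'a \<Rightarrow> real" where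
  "max_cstar_norm A a = (SUP p\<in>{p. cstar_norm A p}. p a)"

text \<open>The Hausdorff completion of a star algebra under a seminorm, as the set of classes of Cauchy
  sequences modulo null sequences.\<close>

definition cauchy_seqs :: "('a, 'm) star_algebra_scheme \<Rightarrow> ('a \<Rightarrow> real) \<Rightarrow> (nat \<Rightarrow> 'a) set" where
  "cauchy_seqs A p = {s. (\<forall>n. s n \<in> carrier A) \<and>
     (\<forall>e>0. \<exists>N. \<forall>m\<ge>N. \<forall>n\<ge>N. p (aminus A (s m) (s n)) < e)}"

definition cauchy_class ::
  "('a, 'm) star_algebra_scheme \<Rightarrow> ('a \<Rightarrow> real) \<Rightarrow> (nat \<Rightarrow> 'a) \<Rightarrow> (nat \<Rightarrow> 'a) set" where
  "cauchy_class A p s = {t \<in> cauchy_seqs A p. (\<lambda>n. p (aminus A (t n) (s n))) \<longlonglongrightarrow> 0}"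

definition rep :: "'b set \<Rightarrow> 'b" where
  "rep S = (SOME s. s \<in> S)"

definition hausdorff_completion ::
  "('a, 'm) star_algebra_scheme \<Rightarrow> ('a \<Rightarrow> real) \<Rightarrow> (nat \<Rightarrow> 'a) set normed_star_algebra" where
  "hausdorff_completion A p =
     \<lparr>carrier = cauchy_class A p ` cauchy_seqs A p,
      azero = cauchy_class A p (\<lambda>n. azero A),
      aadd = (\<lambda>S T. cauchy_class A p (\<lambda>n. aadd A (rep S n) (rep T n))),
      ascale = (\<lambda>c S. cauchy_class A p (\<lambda>n. ascale A c (rep S n))),
      amult = (\<lambda>S T. cauchy_class A p (\<lambda>n. amult A (rep S n) (rep T n))),
      astar = (\<lambda>S. cauchy_class A p (\<lambda>n. astar A (rep S n))),
      anorm = (\<lambda>S. lim (\<lambda>n. p (rep S n)))\<rparr>"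

definition into_completion ::
  "('a, 'm) star_algebra_scheme \<Rightarrow> ('a \<Rightarrow> real) \<Rightarrow> 'a \<Rightarrow> (nat \<Rightarrow> 'a) set" where
  "into_completion A p a = cauchy_class A p (\<lambda>n. a)"

definition coset :: "('a, 'm) star_algebra_scheme \<Rightarrow> 'a set \<Rightarrow> 'a \<Rightarrow> 'a set" where
  "coset A I a = {b \<in> carrier A. aminus A b a \<in> I}"

definition quotient_algebra ::
  "('a, 'm) normed_star_algebra_scheme \<Rightarrow> 'a set \<Rightarrow> 'a set normed_star_algebra" where
  "quotient_algebra A I =
     \<lparr>carrier = coset A I ` carrier A,
      azero = coset A I (azero A),
      aadd = (\<lambda>S T. coset A I (aadd A (rep S) (rep T))),
      ascale = (\<lambda>c S. coset A I (ascale A c (rep S))),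
      amult = (\<lambda>S T. coset A I (amult A (rep S) (rep T))),
      astar = (\<lambda>S. coset A I (astar A (rep S))),
      anorm = (\<lambda>S. INF b\<in>S. anorm A b)\<rparr>"

text \<open>States are made extensional on the carrier, so that uniqueness can be expressed by equality of
  functions.\<close>

definition state :: "('a, 'm) normed_star_algebra_scheme \<Rightarrow> ('a \<Rightarrow> complex) \<Rightarrow> bool" where
  "state A \<psi> \<longleftrightarrow>
     \<psi> \<in> extensional (carrier A) \<and>
     (\<forall>a\<in>carrier A. \<forall>b\<in>carrier A. \<psi> (aadd A a b) = \<psi> a + \<psi> b) \<and>
     (\<forall>c. \<forall>a\<in>carrier A. \<psi> (ascale A c a) = c * \<psi> a) \<and>
     (\<forall>a\<in>carrier A. \<psi> (amult A (astar A a) a) \<in> \<real>\<^sub>\<ge>\<^sub>0) \<and>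
     bdd_above ((\<lambda>a. cmod (\<psi> a)) ` {a \<in> carrier A. anorm A a \<le> 1}) \<and>
     (SUP a\<in>{a \<in> carrier A. anorm A a \<le> 1}. cmod (\<psi> a)) = 1"

definition isometric_star_isomorphism ::
  "('a, 'm) normed_star_algebra_scheme \<Rightarrow> ('b, 'n) normed_star_algebra_scheme \<Rightarrow> ('a \<Rightarrow> 'b) \<Rightarrow> bool"
  where
  "isometric_star_isomorphism A B h \<longleftrightarrow>
     bij_betw h (carrier A) (carrier B) \<and>
     (\<forall>a\<in>carrier A. \<forall>b\<in>carrier A. h (aadd A a b) = aadd B (h a) (h b)) \<and>
     (\<forall>c. \<forall>a\<in>carrier A. h (ascale A c a) = ascale B c (h a)) \<and>
     (\<forall>a\<in>carrier A. \<forall>b\<in>carrier A. h (amult A a b) = amult B (h a) (h b)) \<and>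
     (\<forall>a\<in>carrier A. h (astar A a) = astar B (h a)) \<and>
     (\<forall>a\<in>carrier A. anorm B (h a) = anorm A a)"

section \<open>The convolution algebra\<close>

text \<open>Sections over an open bisection \<open>U\<close>, extended by zero. The support is the closure relative to
  \<open>U\<close>; it need not be closed in the groupoid.\<close>

definition bisection_sections ::
  "('g::topological_space, 'l::topological_space) line_bundle \<Rightarrow> 'g set \<Rightarrow> ('g \<Rightarrow> 'l) set" where
  "bisection_sections L U = {f. (\<forall>g. proj L (f g) = g) \<and> continuous_on U f \<and>
     compact (U \<inter> closure {g \<in> U. f g \<noteq> lzero L g}) \<and> (\<forall>g. g \<notin> U \<longrightarrow> f g = lzero L g)}"

definition section_add ::
  "('g, 'l) line_bundle \<Rightarrow> ('g \<Rightarrow> 'l) \<Rightarrow> ('g \<Rightarrow> 'l) \<Rightarrow> 'g \<Rightarrow> 'l" where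
  "section_add L f h = (\<lambda>g. ladd L (f g) (h g))"

definition section_scale ::
  "('g, 'l) line_bundle \<Rightarrow> complex \<Rightarrow> ('g \<Rightarrow> 'l) \<Rightarrow> 'g \<Rightarrow> 'l" where
  "section_scale L c f = (\<lambda>g. lscale L c (f g))"

text \<open>The linear span of the above sections; it contains the zero section, because the empty set is
  an open bisection.\<close>

inductive_set compact_sections ::
  "('g::topological_space) groupoid \<Rightarrow> ('g, 'l::topological_space) line_bundle \<Rightarrow> ('g \<Rightarrow> 'l) set"
  for G L where
  bisection: "open_bisection G U \<Longrightarrow> f \<in> bisection_sections L U \<Longrightarrow> f \<in> compact_sections G L"
| add: "f \<in> compact_sections G L \<Longrightarrow> h \<in> compact_sections G L \<Longrightarrow>
    section_add L f h \<in> compact_sections G L"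
| scale: "f \<in> compact_sections G L \<Longrightarrow> section_scale L c f \<in> compact_sections G L"

text \<open>\<open>finprod\<close> is addition in the fibre here. Only the nonzero terms of the convolution sum, which
  are finite in number for the sections above, are summed.\<close>

definition convolution ::
  "'g groupoid \<Rightarrow> ('g, 'l) line_bundle \<Rightarrow> ('g \<Rightarrow> 'l) \<Rightarrow> ('g \<Rightarrow> 'l) \<Rightarrow> 'g \<Rightarrow> 'l" where
  "convolution G L f h = (\<lambda>g. finprod (fibre L g) (\<lambda>(a, b). lmult L (f a) (h b))
     {(a, b). (a, b) \<in> composable G \<and> gmult G a b = g \<and> lmult L (f a) (h b) \<noteq> lzero L g})"

definition section_algebra ::
  "('g::topological_space) groupoid \<Rightarrow> ('g, 'l::topological_space) line_bundle \<Rightarrow>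
   ('g \<Rightarrow> 'l) star_algebra" where
  "section_algebra G L =
     \<lparr>carrier = compact_sections G L,
      azero = lzero L,
      aadd = section_add L,
      ascale = section_scale L,
      amult = convolution G L,
      astar = (\<lambda>f g. lstar L (f (ginv G g)))\<rparr>"

definition Cc_units :: "('g::topological_space) groupoid \<Rightarrow> ('g \<Rightarrow> complex) set" where
  "Cc_units G = {f. continuous_on (units G) f \<and>
     compact (units G \<inter> closure {x \<in> units G. f x \<noteq> 0})}"

definition C0_units :: "('g::topological_space) groupoid \<Rightarrow> ('g \<Rightarrow> complex) set" where
  "C0_units G = {f. continuous_on (units G) f \<and>
     (\<forall>e>0. compact {x \<in> units G. e \<le> cmod (f x)})}"

definition uniform_norm :: "'g groupoid \<Rightarrow> ('g \<Rightarrow> complex) \<Rightarrow> real" where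
  "uniform_norm G f = (SUP x\<in>units G. cmod (f x))"

definition function_section ::
  "'g groupoid \<Rightarrow> ('g, 'l) line_bundle \<Rightarrow> ('g \<Rightarrow> complex) \<Rightarrow> 'g \<Rightarrow> 'l" where
  "function_section G L f =
     (\<lambda>g. if g \<in> units G then lscale L (f g) (fibre_unit L g) else lzero L g)"

section \<open>Full and essential C*-algebras\<close>

type_synonym ('g, 'l) full_element = "(nat \<Rightarrow> 'g \<Rightarrow> 'l) set"

definition full_cstar ::
  "('g::topological_space) groupoid \<Rightarrow> ('g, 'l::topological_space) line_bundle \<Rightarrow>
   ('g, 'l) full_element normed_star_algebra" where
  "full_cstar G L = hausdorff_completion (section_algebra G L) (max_cstar_norm (section_algebra G L))"

definition into_full ::
  "('g::topological_space) groupoid \<Rightarrow> ('g, 'l::topological_space) line_bundle \<Rightarrow>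
   ('g \<Rightarrow> 'l) \<Rightarrow> ('g, 'l) full_element" where
  "into_full G L = into_completion (section_algebra G L) (max_cstar_norm (section_algebra G L))"

text \<open>The inclusion of C0 of the unit space: the extension by uniform limits of the inclusion of the
  compactly supported functions.\<close>

definition C0_into_full ::
  "('g::topological_space) groupoid \<Rightarrow> ('g, 'l::topological_space) line_bundle \<Rightarrow>
   ('g \<Rightarrow> complex) \<Rightarrow> ('g, 'l) full_element" where
  "C0_into_full G L f = (THE a. a \<in> carrier (full_cstar G L) \<and>
     (\<exists>u. (\<forall>n. u n \<in> Cc_units G) \<and> uniform_limit (units G) u f sequentially \<and>
        (\<lambda>n. anorm (full_cstar G L) (aminus (full_cstar G L)
           (into_full G L (function_section G L (u n))) a)) \<longlonglongrightarrow> 0))"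

definition extends_evaluation ::
  "('g::topological_space) groupoid \<Rightarrow> ('g, 'l::topological_space) line_bundle \<Rightarrow> 'g \<Rightarrow>
   (('g, 'l) full_element \<Rightarrow> complex) \<Rightarrow> bool" where
  "extends_evaluation G L x \<psi> \<longleftrightarrow>
     state (full_cstar G L) \<psi> \<and> (\<forall>f\<in>C0_units G. \<psi> (C0_into_full G L f) = f x)"

definition free_points ::
  "('g::topological_space) groupoid \<Rightarrow> ('g, 'l::topological_space) line_bundle \<Rightarrow> 'g set" where
  "free_points G L = {x \<in> units G. \<exists>!\<psi>. extends_evaluation G L x \<psi>}"

definition free_state ::
  "('g::topological_space) groupoid \<Rightarrow> ('g, 'l::topological_space) line_bundle \<Rightarrow> 'g \<Rightarrow>
   ('g, 'l) full_element \<Rightarrow> complex" where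
  "free_state G L x = (THE \<psi>. extends_evaluation G L x \<psi>)"

definition gray_ideal ::
  "('g::topological_space) groupoid \<Rightarrow> ('g, 'l::topological_space) line_bundle \<Rightarrow>
   ('g, 'l) full_element set" where
  "gray_ideal G L = {b \<in> carrier (full_cstar G L). \<forall>x\<in>free_points G L.
     free_state G L x (amult (full_cstar G L) (astar (full_cstar G L) b) b) = 0}"

definition ess_cstar ::
  "('g::topological_space) groupoid \<Rightarrow> ('g, 'l::topological_space) line_bundle \<Rightarrow>
   ('g, 'l) full_element set normed_star_algebra" where
  "ess_cstar G L = quotient_algebra (full_cstar G L) (gray_ideal G L)"

definition q_ess ::
  "('g::topological_space) groupoid \<Rightarrow> ('g, 'l::topological_space) line_bundle \<Rightarrow>
   ('g, 'l) full_element \<Rightarrow> ('g, 'l) full_element set" where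
  "q_ess G L = coset (full_cstar G L) (gray_ideal G L)"

definition min_seminorm ::
  "('g::topological_space) groupoid \<Rightarrow> ('g, 'l::topological_space) line_bundle \<Rightarrow>
   ('g \<Rightarrow> 'l) \<Rightarrow> real" where
  "min_seminorm G L b = anorm (ess_cstar G L) (q_ess G L (into_full G L b))"

text \<open>The C*-seminorms on the convolution algebra that coincide with the uniform norm on the compactly
  supported functions on the unit space.\<close>

definition uniform_cstar_seminorms ::
  "('g::topological_space) groupoid \<Rightarrow> ('g, 'l::topological_space) line_bundle \<Rightarrow>
   (('g \<Rightarrow> 'l) \<Rightarrow> real) set" where
  "uniform_cstar_seminorms G L = {p. cstar_seminorm (section_algebra G L) p \<and>
     (\<forall>f\<in>Cc_units G. p (function_section G L f) = uniform_norm G f)}"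

end

theory Submission
  imports Defs "HOL-Computational_Algebra.Fundamental_Theorem_Algebra"
begin

text \<open>The smallest seminorm can be written down in advance. Let \<open>T\<close> be the set of units whose isotropy
  group is trivial; topological freeness says that it is dense in the unit space \<open>X\<close>. Evaluation at
  a unit is a positive functional on the convolution algebra, and \<open>ess_norm\<close> is the GNS seminorm
  (\<open>gns_norm\<close>) of the family of evaluations at the points of \<open>T\<close>.

  \<^emph>\<open>Minimality.\<close> Let \<open>p\<close> be a C*-seminorm that agrees with the uniform norm on functions on \<open>X\<close>, let
  \<open>x \<in> T\<close>, and let \<open>\<phi>\<close> be a bump function with value 1 at \<open>x\<close>. If the support of \<open>\<phi>\<close> is small
  enough, then the trivial isotropy of \<open>x\<close> forces the compression \<open>\<phi>b\<phi>\<close> to be a function on \<open>X\<close>,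
  with value \<open>b(x)\<close> at \<open>x\<close> (\<open>exists_compression\<close>). Hence \<open>b(x)\<close> is bounded by the uniform norm of
  \<open>\<phi>b\<phi>\<close>, which is \<open>p(\<phi>b\<phi>) \<le> p(b)\<close>. A positive functional that is dominated by a C*-seminorm has a
  GNS seminorm dominated by it (\<open>fnorm_mult_le_seminorm\<close>), so that \<open>ess_norm \<le> p\<close>. Conversely, no
  C*-seminorm exceeds the uniform norm on functions on \<open>X\<close> (\<open>seminorm_fs_le_uniform_norm\<close>), and
  \<open>ess_norm\<close> is not smaller there because \<open>T\<close> is dense. Thus \<open>ess_norm\<close> is itself one of the
  seminorms in question, and the smallest.

  \<^emph>\<open>The gray ideal.\<close> It is the kernel of the extension of \<open>ess_norm\<close> to the full C*-algebra
  (\<open>gray_ideal_eq\<close>). The points of \<open>T\<close> are free, because the compression argument determines every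
  extension of the evaluation, and the evaluation at any other free point is a weak limit of
  evaluations at points of \<open>T\<close> (\<open>eval_state_square_closure\<close>). So an element of the kernel lies in
  the gray ideal. For the converse, the vanishing of the states at points of \<open>T\<close> on \<open>b\<^sup>*b\<close> has to be
  passed on to \<open>(bc)\<^sup>*bc\<close>; this works because \<open>T\<close> is invariant and the column of \<open>bc\<close> at \<open>x\<close> is a
  combination of finitely many columns of \<open>b\<close>.

  \<^emph>\<open>The quotient.\<close> It remains to see that, for C*-seminorms \<open>p \<le> N\<close> on a star algebra, the quotient
  of the completion under \<open>N\<close> by the kernel of \<open>p\<close> is isometric to the completion under \<open>p\<close>
  (\<open>isometric_star_isomorphism_quot_iso\<close>). The usual argument, that injective star homomorphisms of
  C*-algebras are isometric, becomes a truncation here (\<open>exists_truncation\<close>): if \<open>p(u) < \<epsilon>\<close>, then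
  \<open>u\<close> is close under \<open>p\<close> to an element \<open>R(uu\<^sup>*)u\<close> that has norm at most \<open>\<epsilon>\<close> under \<open>N\<close>, for a
  polynomial \<open>R\<close> that cuts off large values. The norm of a polynomial in a self-adjoint element is
  bounded by its supremum on an interval; \<open>le_sup_on_interval\<close> proves this for C*-seminorms on the
  polynomial ring by elementary means.

  \<^emph>\<open>The algebra.\<close> A choice of unit vectors in all fibres turns sections into scalar functions and
  their product into a convolution twisted by a 2-cocycle, which reduces the algebraic identities to
  identities of finite sums. If \<open>f\<close> is supported in a bisection, then \<open>f\<^sup>*f\<close> is a function on \<open>X\<close>;
  this bounds all C*-seminorms of \<open>f\<close> at once, so that the maximal C*-norm is finite, and it also
  bounds the action of \<open>f\<close> in the regular representation, whose norm shows that there are C*-norms.\<close>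

section \<open>C*-seminorms on complex polynomials\<close>

abbreviation conj_poly :: "complex poly \<Rightarrow> complex poly" where
  "conj_poly \<equiv> map_poly cnj"

lemma conj_poly_mult: "conj_poly (P * Q) = conj_poly P * conj_poly Q"
  by (simp flip: poly_eq_poly_eq_iff add: fun_eq_iff)

lemma conj_poly_add: "conj_poly (P + Q) = conj_poly P + conj_poly Q"
  by (simp flip: poly_eq_poly_eq_iff add: fun_eq_iff)

lemma conj_poly_conj_poly [simp]: "conj_poly (conj_poly P) = P"
  by (simp flip: poly_eq_poly_eq_iff add: fun_eq_iff)

lemma conj_poly_power: "conj_poly (P ^ n) = conj_poly P ^ n"
  by (simp flip: poly_eq_poly_eq_iff add: fun_eq_iff)

lemma conj_poly_smult: "conj_poly (smult c P) = smult (cnj c) (conj_poly P)"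
  by (simp flip: poly_eq_poly_eq_iff add: fun_eq_iff)

text \<open>The model is \<open>M P = \<parallel>P(h)\<parallel>\<close> for a self-adjoint \<open>h\<close> with \<open>\<parallel>h\<parallel> \<le> \<rho>\<close>, where \<open>conj_poly\<close> is the
  adjoint operation.\<close>

locale poly_cstar_seminorm =
  fixes M :: "complex poly \<Rightarrow> real" and \<rho> :: real
  assumes nonneg: "0 \<le> M P"
    and triangle: "M (P + Q) \<le> M P + M Q"
    and smult: "M (smult c P) = cmod c * M P"
    and mult: "M (P * Q) \<le> M P * M Q"
    and cstar: "(M P)\<^sup>2 \<le> M (conj_poly P * P)"
    and one: "M 1 \<le> 1"
    and var: "M [:0, 1:] \<le> \<rho>"
begin

lemma conj_le: "M (conj_poly P) \<le> M P"
proof (cases "M (conj_poly P) = 0")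
  case False
  have "(M (conj_poly P))\<^sup>2 \<le> M P * M (conj_poly P)"
    using order_trans[OF cstar mult, of "conj_poly P"] by simp
  then show ?thesis
    using False nonneg[of "conj_poly P"] by (simp add: power2_eq_square)
qed (simp add: nonneg)

lemma conj_eq: "M (conj_poly P) = M P"
  using conj_le[of P] conj_le[of "conj_poly P"] by simp

lemma conj_mult_self: "M (conj_poly P * P) = (M P)\<^sup>2"
  using mult[of "conj_poly P" P] cstar[of P] by (simp add: conj_eq power2_eq_square)

lemma le_of_conj_mult_eq:
  assumes "conj_poly P * P = conj_poly Q * Q"
  shows "M P = M Q"
  using conj_mult_self[of P] conj_mult_self[of Q] assms nonneg by simp

lemma diff: "M (P - Q) \<le> M P + M Q"
  using triangle[of P "smult (- 1) Q"] smult[of "- 1" Q] by simp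

lemma radius_nonneg: "0 \<le> \<rho>"
  using nonneg var order_trans by blast

text \<open>The factor \<open>X - z\<close> is compared with \<open>X - Re z \<plusminus> ic\<close> for large \<open>c\<close>. The C*-square of the
  latter, \<open>(X - Re z)\<^sup>2 + c\<^sup>2\<close>, has no term linear in \<open>c\<close>, so that its norm is at most \<open>c + K\<^sup>2 / c\<close>
  with a bound \<open>K\<close> on \<open>X - Re z\<close>, whereas the two factors differ by the scalar \<open>\<bar>Im z\<bar> + c\<close> up to a
  unimodular constant.\<close>

lemma linear_ge_Im:
  "\<bar>Im z\<bar> * M P \<le> M ([:- z, 1:] * P)"
proof -
  define s :: real where "s = (if Im z \<ge> 0 then 1 else -1)"
  define K where "K = \<rho> + \<bar>Re z\<bar>"
  have K: "0 \<le> K" using radius_nonneg by (simp add: K_def)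
  have bound: "\<bar>Im z\<bar> * M P \<le> M ([:- z, 1:] * P) + K\<^sup>2 / c * M P" if c: "c > 0" for c :: real
  proof -
    define u where "u = [:- complex_of_real (Re z) + \<i> * of_real (s * c), 1:]"
    define v where "v = [:- complex_of_real (Re z), 1:]"
    have s2: "s * s = 1" by (simp add: s_def)
    have Mv: "M v \<le> K"
    proof -
      have "v = [:0, 1:] + smult (- complex_of_real (Re z)) 1"
        by (simp add: v_def)
      then have "M v \<le> M [:0, 1:] + \<bar>Re z\<bar> * M 1"
        using triangle[of "[:0, 1:]" "smult (- complex_of_real (Re z)) 1"] smult[of "- complex_of_real (Re z)" 1]
        by simp
      also have "\<dots> \<le> K"
        unfolding K_def using var one mult_left_le[OF one, of "\<bar>Re z\<bar>"] by simp
      finally show ?thesis .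
    qed
    have "conj_poly (u * P) * (u * P) =
        conj_poly (v * P) * (v * P) + smult (of_real (c\<^sup>2)) (conj_poly P * P)"
      using s2
      by (simp flip: poly_eq_poly_eq_iff of_real_mult add: fun_eq_iff u_def v_def algebra_simps power2_eq_square)
    then have "(M (u * P))\<^sup>2 \<le> M (conj_poly (v * P) * (v * P)) + c\<^sup>2 * M (conj_poly P * P)"
      using triangle[of "conj_poly (v * P) * (v * P)"] smult[of "of_real (c\<^sup>2)" "conj_poly P * P"]
      by (metis abs_of_nonneg conj_mult_self norm_of_real zero_le_power2)
    also have "\<dots> \<le> (K * M P)\<^sup>2 + c\<^sup>2 * (M P)\<^sup>2"
    proof -
      have "M (v * P) \<le> K * M P"
        using mult[of v P] mult_right_mono[OF Mv nonneg] order_trans by blast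
      then show ?thesis
        using power_mono[of "M (v * P)" "K * M P" 2] by (simp add: conj_mult_self nonneg)
    qed
    also have "\<dots> \<le> ((c + K\<^sup>2 / c) * M P)\<^sup>2"
    proof -
      have "K\<^sup>2 + c\<^sup>2 \<le> (c + K\<^sup>2 / c)\<^sup>2"
      proof -
        have "(c + K\<^sup>2 / c)\<^sup>2 = c\<^sup>2 + 2 * K\<^sup>2 + (K\<^sup>2 / c)\<^sup>2"
          using c by (simp add: power2_sum)
        then show ?thesis by (simp add: add_increasing2)
      qed
      then show ?thesis
        using mult_right_mono[of "K\<^sup>2 + c\<^sup>2" "(c + K\<^sup>2 / c)\<^sup>2" "(M P)\<^sup>2"]
        unfolding power_mult_distrib by (simp only: distrib_right zero_le_power2 simp_thms)
    qed
    finally have uP: "M (u * P) \<le> (c + K\<^sup>2 / c) * M P"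
      using c nonneg by (meson K add_nonneg_nonneg divide_nonneg_pos less_imp_le mult_nonneg_nonneg power2_le_imp_le zero_le_power2)
    have "smult (\<i> * of_real (Im z + s * c)) P = u * P - [:- z, 1:] * P"
      by (simp flip: poly_eq_poly_eq_iff add: fun_eq_iff u_def algebra_simps complex_eq_iff)
    then have "\<bar>Im z + s * c\<bar> * M P \<le> M (u * P) + M ([:- z, 1:] * P)"
      using diff[of "u * P" "[:- z, 1:] * P"] smult[of "\<i> * of_real (Im z + s * c)" P]
      by (simp add: norm_mult del: of_real_add)
    moreover have "\<bar>Im z + s * c\<bar> = \<bar>Im z\<bar> + c"
      using c by (simp add: s_def)
    ultimately show ?thesis
      using uP by (simp add: algebra_simps)
  qed
  have "((\<lambda>c. M ([:- z, 1:] * P) + K\<^sup>2 / c * M P) \<longlongrightarrow> M ([:- z, 1:] * P) + 0 * M P) at_top"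
    by (intro tendsto_intros tendsto_divide_0[OF tendsto_const] filterlim_at_top_imp_at_infinity filterlim_ident)
  moreover have "\<forall>\<^sub>F c in at_top. \<bar>Im z\<bar> * M P \<le> M ([:- z, 1:] * P) + K\<^sup>2 / c * M P"
    using eventually_gt_at_top[of 0] by (rule eventually_mono) (rule bound)
  ultimately show ?thesis
    using tendsto_lowerbound by fastforce
qed

lemma linear_ge_Re: "(cmod z - \<rho>) * M P \<le> M ([:- z, 1:] * P)"
proof -
  have "smult z P = [:0, 1:] * P - [:- z, 1:] * P"
    by (simp flip: poly_eq_poly_eq_iff add: fun_eq_iff algebra_simps)
  then have "cmod z * M P \<le> M ([:0, 1:] * P) + M ([:- z, 1:] * P)"
    using diff[of "[:0, 1:] * P" "[:- z, 1:] * P"] smult[of z P] by simp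
  moreover have "M ([:0, 1:] * P) \<le> \<rho> * M P"
    using mult[of "[:0, 1:]" P] mult_right_mono[OF var nonneg] order_trans by blast
  ultimately show ?thesis by (simp add: algebra_simps)
qed

text \<open>All linear factors of \<open>P\<close> are bounded below: those with nonreal roots by \<open>linear_ge_Im\<close>, and
  those with real roots, which lie outside the interval, by \<open>linear_ge_Re\<close>.\<close>

lemma bounded_below:
  assumes "\<And>t. \<bar>t\<bar> \<le> \<rho> \<Longrightarrow> poly P (complex_of_real t) \<noteq> 0"
  shows "\<exists>c>0. \<forall>Q. c * M Q \<le> M (P * Q)"
  using assms
proof (induction "degree P" arbitrary: P)
  case 0
  then obtain k where k: "P = [:k:]" using degree_eq_zeroE by metis
  then have "k \<noteq> 0" using 0(2)[of 0] radius_nonneg by simp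
  then show ?case using k smult[of k] by (intro exI[of _ "cmod k"]) simp
next
  case (Suc n)
  have "\<not> constant (poly P)"
    using Suc(2) constant_degree by force
  then obtain z where "poly P z = 0"
    using fundamental_theorem_of_algebra by blast
  then obtain R where R: "P = [:- z, 1:] * R"
    by (auto simp: poly_eq_0_iff_dvd)
  have "P \<noteq> 0" using Suc(2) by auto
  then have "R \<noteq> 0" using R by auto
  then have "degree R = n"
    using Suc(2) R degree_mult_eq[of "[:- z, 1:]" R] by simp
  moreover have "poly R (complex_of_real t) \<noteq> 0" if "\<bar>t\<bar> \<le> \<rho>" for t
    using Suc(3)[OF that] R by auto
  ultimately obtain c where c: "c > 0" "\<And>Q. c * M Q \<le> M (R * Q)"
    using Suc(1) by blast
  obtain d where d: "d > 0" "\<And>Q. d * M Q \<le> M ([:- z, 1:] * Q)"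
  proof (cases "Im z = 0")
    case True
    have "\<not> \<bar>Re z\<bar> \<le> \<rho>"
      using Suc(3)[of "Re z"] True R by (auto simp: complex_is_Real_iff complex_eq_iff)
    then have "cmod z - \<rho> > 0"
      using True by (simp add: cmod_eq_Re)
    then show ?thesis using that linear_ge_Re by blast
  next
    case False
    then show ?thesis using that[of "\<bar>Im z\<bar>"] linear_ge_Im by simp
  qed
  have "d * c * M Q \<le> M (P * Q)" for Q
  proof -
    have "d * (c * M Q) \<le> d * M (R * Q)" using c(2) d(1) by simp
    also have "\<dots> \<le> M (P * Q)" using d(2)[of "R * Q"] R by (metis mult.assoc)
    finally show ?thesis by (simp add: mult.assoc)
  qed
  then show ?case using c d by (intro exI[of _ "d * c"]) simp
qed

lemma norm_dyadic_power:
  assumes "conj_poly Q = Q" "M Q = 1"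
  shows "M (Q ^ (2 ^ k)) = 1"
proof (induction k)
  case (Suc k)
  have "conj_poly (Q ^ (2 ^ k)) * Q ^ (2 ^ k) = Q ^ (2 ^ Suc k)"
    by (simp add: conj_poly_power assms mult_2 flip: power_add)
  then show ?case
    using conj_mult_self[of "Q ^ (2 ^ k)"] Suc by simp
qed (simp add: assms)

text \<open>Expanding the product gives the sum of \<open>Q ^ (2 * j)\<close> over \<open>j < 2 ^ k\<close>.\<close>

definition dyadic_sum :: "complex poly \<Rightarrow> nat \<Rightarrow> complex poly" where
  "dyadic_sum Q k = (\<Prod>i<k. 1 + (Q ^ (2 ^ i))\<^sup>2)"

lemma dyadic_sum_telescope: "(1 - Q\<^sup>2) * dyadic_sum Q k = 1 - (Q ^ (2 ^ k))\<^sup>2"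
proof (induction k)
  case (Suc k)
  have "(1 - Q\<^sup>2) * dyadic_sum Q (Suc k) = (1 - (Q ^ (2 ^ k))\<^sup>2) * (1 + (Q ^ (2 ^ k))\<^sup>2)"
    using Suc by (simp add: dyadic_sum_def mult.assoc)
  also have "\<dots> = 1 - ((Q ^ (2 ^ k))\<^sup>2)\<^sup>2"
    by (simp add: algebra_simps power2_eq_square)
  also have "(Q ^ (2 ^ k))\<^sup>2 = Q ^ (2 ^ Suc k)"
    by (simp add: mult.commute flip: power_mult)
  finally show ?case .
qed (simp add: dyadic_sum_def)

text \<open>For self-adjoint \<open>R\<close>, both polynomials \<open>(1 - R\<^sup>2) \<plusminus> 2iR\<close> have the same C*-square as
  \<open>1 + R\<^sup>2\<close>, and their difference is \<open>4iR\<close>. A factor \<open>1 + R\<^sup>2\<close> can therefore be traded for \<open>4iR\<close> at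
  the cost of a factor 2; \<open>y\<close> and \<open>w\<close> collect the factors that have already been treated.\<close>

lemma dyadic_product_le:
  assumes Q: "conj_poly Q = Q" and "conj_poly y * y = conj_poly w * w"
  shows "M (y * (\<Prod>i<k. smult (4 * \<i>) (Q ^ (2 ^ i)))) \<le> 2 ^ k * M (w * dyadic_sum Q k)"
  using assms(2)
proof (induction k arbitrary: y w)
  case 0
  then show ?case using le_of_conj_mult_eq[OF 0] by (simp add: dyadic_sum_def)
next
  case (Suc k)
  define R where "R = Q ^ (2 ^ k)"
  have R: "conj_poly R = R" by (simp add: R_def conj_poly_power Q)
  define W where "W = (\<Prod>i<k. smult (4 * \<i>) (Q ^ (2 ^ i)))"
  define u where "u = (1 - R\<^sup>2) + smult (2 * \<i>) R"
  define v where "v = (1 - R\<^sup>2) - smult (2 * \<i>) R"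
  have cR: "cnj (poly R (cnj x)) = poly R x" for x
    using R by (metis poly_map_poly_cnj)
  have uv: "conj_poly u * u = (1 + R\<^sup>2) * (1 + R\<^sup>2)" "conj_poly v * v = (1 + R\<^sup>2) * (1 + R\<^sup>2)"
    "conj_poly (1 + R\<^sup>2) = 1 + R\<^sup>2"
    by (simp_all flip: poly_eq_poly_eq_iff add: fun_eq_iff u_def v_def cR)
      (auto simp: algebra_simps power2_eq_square)
  have step: "M ((y * a) * W) \<le> 2 ^ k * M (w * dyadic_sum Q (Suc k))"
    if "conj_poly a * a = (1 + R\<^sup>2) * (1 + R\<^sup>2)" for a
  proof -
    have "conj_poly (y * a) * (y * a) = (conj_poly y * y) * (conj_poly a * a)"
      by (simp add: conj_poly_mult algebra_simps)
    also have "\<dots> = conj_poly (w * (1 + R\<^sup>2)) * (w * (1 + R\<^sup>2))"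
      by (simp only: that Suc.prems conj_poly_mult uv(3)) (simp only: mult_ac)
    finally have "M ((y * a) * W) \<le> 2 ^ k * M (w * (1 + R\<^sup>2) * dyadic_sum Q k)"
      unfolding W_def by (rule Suc.IH)
    then show ?thesis by (simp add: dyadic_sum_def R_def mult_ac)
  qed
  have "y * (\<Prod>i<Suc k. smult (4 * \<i>) (Q ^ (2 ^ i))) = (y * u) * W - (y * v) * W"
    by (simp add: u_def v_def W_def R_def algebra_simps flip: smult_add_left)
  then show ?case
    using diff[of "(y * u) * W" "(y * v) * W"] step[OF uv(1)] step[OF uv(2)] by simp
qed

text \<open>The product of the \<open>4i Q ^ (2 ^ j)\<close> over \<open>j < k\<close> becomes \<open>(4i) ^ k Q ^ (2 ^ k)\<close>, of norm
  \<open>4 ^ k\<close>, when it is multiplied by \<open>Q\<close>.\<close>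

lemma dyadic_sum_ge:
  assumes Q: "conj_poly Q = Q" "M Q = 1"
  shows "2 ^ k \<le> M (dyadic_sum Q k)"
proof -
  have prod: "(\<Prod>i<k. smult (4 * \<i>) (Q ^ (2 ^ i))) * Q = smult ((4 * \<i>) ^ k) (Q ^ (2 ^ k))"
  proof (induction k)
    case (Suc k)
    then have "(\<Prod>i<Suc k. smult (4 * \<i>) (Q ^ (2 ^ i))) * Q =
        smult ((4 * \<i>) ^ k) (Q ^ (2 ^ k)) * smult (4 * \<i>) (Q ^ (2 ^ k))"
      by (metis (no_types, lifting) mult.assoc mult.commute prod.lessThan_Suc)
    also have "\<dots> = smult ((4 * \<i>) ^ Suc k) (Q ^ (2 ^ Suc k))"
      by (simp add: mult_2 power_add)
    finally show ?case .
  qed simp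
  have "4 ^ k = M (smult ((4 * \<i>) ^ k) (Q ^ (2 ^ k)))"
    by (simp add: smult norm_dyadic_power[OF Q] norm_mult norm_power)
  also have "\<dots> \<le> M (\<Prod>i<k. smult (4 * \<i>) (Q ^ (2 ^ i))) * M Q"
    unfolding prod[symmetric] by (rule mult)
  also have "\<dots> \<le> 2 ^ k * M (dyadic_sum Q k)"
    using dyadic_product_le[of Q 1 1 k] Q by simp
  finally have "(2::real) ^ k * 2 ^ k \<le> 2 ^ k * M (dyadic_sum Q k)"
    by (simp flip: power_mult_distrib)
  then show ?thesis by simp
qed

text \<open>Scale \<open>Q\<close> to norm 1. If the claim fails, then \<open>1 - Q\<^sup>2\<close> has no zeros in the interval and is
  bounded below by some \<open>c > 0\<close>. However, it maps \<open>dyadic_sum Q k\<close>, of norm at least \<open>2 ^ k\<close>, to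
  \<open>1 - Q ^ (2 ^ (k + 1))\<close>, of norm at most 2.\<close>

theorem le_sup_on_interval:
  assumes Q: "conj_poly Q = Q"
    and B: "\<And>t. \<bar>t\<bar> \<le> \<rho> \<Longrightarrow> cmod (poly Q (complex_of_real t)) \<le> B"
  shows "M Q \<le> B"
proof (rule ccontr)
  assume "\<not> M Q \<le> B"
  then have less: "B < M Q" by simp
  have "0 \<le> B" using B[of 0] radius_nonneg norm_ge_zero order_trans by (metis abs_zero)
  then have pos: "0 < M Q" using less by simp
  define S where "S = smult (of_real (1 / M Q)) Q"
  have S: "conj_poly S = S" "M S = 1"
    using pos by (auto simp: S_def conj_poly_smult Q smult norm_divide)
  have "poly (1 - S\<^sup>2) (complex_of_real t) \<noteq> 0" if "\<bar>t\<bar> \<le> \<rho>" for t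
  proof -
    have "cmod (poly S (complex_of_real t)) < 1"
      using B[OF that] less pos by (simp add: S_def norm_divide)
    then have "cmod ((poly S (complex_of_real t))\<^sup>2) < 1"
      by (simp add: norm_power power_less_one_iff)
    then show ?thesis by auto
  qed
  then obtain c where c: "c > 0" "\<And>R. c * M R \<le> M ((1 - S\<^sup>2) * R)"
    using bounded_below by blast
  have "c * 2 ^ k \<le> 2" for k
  proof -
    have "c * 2 ^ k \<le> c * M (dyadic_sum S k)"
      using dyadic_sum_ge[OF S] c(1) by simp
    also have "\<dots> \<le> M (1 - (S ^ (2 ^ k))\<^sup>2)"
      using c(2) dyadic_sum_telescope by metis
    also have "\<dots> \<le> M 1 + M (S ^ (2 ^ Suc k))"
      using diff[of 1 "S ^ (2 ^ Suc k)"] by (simp add: mult.commute flip: power_mult)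
    also have "\<dots> \<le> 2"
      using one norm_dyadic_power[OF S, of "Suc k"] by linarith
    finally show ?thesis .
  qed
  moreover obtain k where "2 / c < 2 ^ k"
    using real_arch_pow[of 2 "2 / c"] by auto
  ultimately show False
    using c(1) by (metis mult.commute not_less pos_divide_less_eq)
qed

end

section \<open>Polynomials in self-adjoint elements\<close>

locale star_alg =
  fixes A :: "('a, 'm) star_algebra_scheme"
  assumes zero_closed [simp]: "azero A \<in> carrier A"
    and add_closed [simp]: "a \<in> carrier A \<Longrightarrow> b \<in> carrier A \<Longrightarrow> aadd A a b \<in> carrier A"
    and scale_closed [simp]: "a \<in> carrier A \<Longrightarrow> ascale A k a \<in> carrier A"
    and mult_closed [simp]: "a \<in> carrier A \<Longrightarrow> b \<in> carrier A \<Longrightarrow> amult A a b \<in> carrier A"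
    and star_closed [simp]: "a \<in> carrier A \<Longrightarrow> astar A a \<in> carrier A"
    and add_assoc: "a \<in> carrier A \<Longrightarrow> b \<in> carrier A \<Longrightarrow> c \<in> carrier A \<Longrightarrow>
      aadd A (aadd A a b) c = aadd A a (aadd A b c)"
    and add_commute: "a \<in> carrier A \<Longrightarrow> b \<in> carrier A \<Longrightarrow> aadd A a b = aadd A b a"
    and add_zero [simp]: "a \<in> carrier A \<Longrightarrow> aadd A a (azero A) = a"
    and scale_add: "a \<in> carrier A \<Longrightarrow> b \<in> carrier A \<Longrightarrow>
      ascale A k (aadd A a b) = aadd A (ascale A k a) (ascale A k b)"
    and scale_plus: "a \<in> carrier A \<Longrightarrow> ascale A (k + l) a = aadd A (ascale A k a) (ascale A l a)"
    and scale_scale [simp]: "a \<in> carrier A \<Longrightarrow> ascale A k (ascale A l a) = ascale A (k * l) a"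
    and scale_one [simp]: "a \<in> carrier A \<Longrightarrow> ascale A 1 a = a"
    and scale_zero [simp]: "a \<in> carrier A \<Longrightarrow> ascale A 0 a = azero A"
    and mult_assoc: "a \<in> carrier A \<Longrightarrow> b \<in> carrier A \<Longrightarrow> c \<in> carrier A \<Longrightarrow>
      amult A (amult A a b) c = amult A a (amult A b c)"
    and add_mult: "a \<in> carrier A \<Longrightarrow> b \<in> carrier A \<Longrightarrow> c \<in> carrier A \<Longrightarrow>
      amult A (aadd A a b) c = aadd A (amult A a c) (amult A b c)"
    and mult_add: "a \<in> carrier A \<Longrightarrow> b \<in> carrier A \<Longrightarrow> c \<in> carrier A \<Longrightarrow>
      amult A a (aadd A b c) = aadd A (amult A a b) (amult A a c)"
    and scale_mult: "a \<in> carrier A \<Longrightarrow> b \<in> carrier A \<Longrightarrow>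
      amult A (ascale A k a) b = ascale A k (amult A a b)"
    and mult_scale: "a \<in> carrier A \<Longrightarrow> b \<in> carrier A \<Longrightarrow>
      amult A a (ascale A k b) = ascale A k (amult A a b)"
    and star_add: "a \<in> carrier A \<Longrightarrow> b \<in> carrier A \<Longrightarrow> astar A (aadd A a b) = aadd A (astar A a) (astar A b)"
    and star_scale: "a \<in> carrier A \<Longrightarrow> astar A (ascale A k a) = ascale A (cnj k) (astar A a)"
    and star_mult: "a \<in> carrier A \<Longrightarrow> b \<in> carrier A \<Longrightarrow> astar A (amult A a b) = amult A (astar A b) (astar A a)"
    and star_star [simp]: "a \<in> carrier A \<Longrightarrow> astar A (astar A a) = a"
begin

abbreviation add (infixl "\<oplus>" 65) where "a \<oplus> b \<equiv> aadd A a b"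
abbreviation minus (infixl "\<ominus>" 65) where "a \<ominus> b \<equiv> aminus A a b"
abbreviation mult (infixl "\<odot>" 70) where "a \<odot> b \<equiv> amult A a b"
abbreviation scale (infixr "\<cdot>" 75) where "c \<cdot> a \<equiv> ascale A c a"
abbreviation star ("_\<^sup>\<star>" [90] 90) where "a\<^sup>\<star> \<equiv> astar A a"
abbreviation zero ("\<zero>") where "\<zero> \<equiv> azero A"

lemma add_left_commute: "a \<in> carrier A \<Longrightarrow> b \<in> carrier A \<Longrightarrow> c \<in> carrier A \<Longrightarrow> a \<oplus> (b \<oplus> c) = b \<oplus> (a \<oplus> c)"
  by (metis add_assoc add_commute)

lemmas add_ac = add_assoc add_commute add_left_commute

lemma zero_add [simp]: "a \<in> carrier A \<Longrightarrow> \<zero> \<oplus> a = a"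
  by (metis add_commute add_zero zero_closed)

lemma scale_of_zero [simp]: "c \<cdot> \<zero> = \<zero>"
  by (metis mult_zero_right scale_scale scale_zero zero_closed)

lemma mult_zero [simp]: "a \<in> carrier A \<Longrightarrow> a \<odot> \<zero> = \<zero>"
  by (metis mult_closed mult_scale scale_zero zero_closed)

lemma zero_mult [simp]: "a \<in> carrier A \<Longrightarrow> \<zero> \<odot> a = \<zero>"
  by (metis mult_closed scale_mult scale_zero zero_closed)

lemma star_zero [simp]: "\<zero>\<^sup>\<star> = \<zero>"
  by (metis complex_cnj_zero scale_zero star_closed star_scale zero_closed)

lemma minus_closed [simp]: "a \<in> carrier A \<Longrightarrow> b \<in> carrier A \<Longrightarrow> a \<ominus> b \<in> carrier A"
  by (simp add: aminus_def)

lemma minus_self [simp]: "a \<in> carrier A \<Longrightarrow> a \<ominus> a = \<zero>"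
  by (metis add.right_inverse aminus_def scale_one scale_plus scale_zero)

lemma add_neg_cancel [simp]:
  "a \<in> carrier A \<Longrightarrow> b \<in> carrier A \<Longrightarrow> a \<oplus> ((-1) \<cdot> a \<oplus> b) = b"
  "a \<in> carrier A \<Longrightarrow> b \<in> carrier A \<Longrightarrow> (-1) \<cdot> a \<oplus> (a \<oplus> b) = b"
  "a \<in> carrier A \<Longrightarrow> a \<oplus> (-1) \<cdot> a = \<zero>"
  using minus_self[of a] add_assoc[of a "(-1) \<cdot> a" b] add_assoc[of "(-1) \<cdot> a" a b] add_commute[of a "(-1) \<cdot> a"]
  by (simp_all add: aminus_def)

lemma minus_add_minus: "a \<in> carrier A \<Longrightarrow> b \<in> carrier A \<Longrightarrow> c \<in> carrier A \<Longrightarrow> (a \<ominus> b) \<oplus> (b \<ominus> c) = a \<ominus> c"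
  by (simp add: aminus_def add_ac)

lemma add_minus_cancel: "a \<in> carrier A \<Longrightarrow> b \<in> carrier A \<Longrightarrow> b \<oplus> (a \<ominus> b) = a"
  by (simp add: aminus_def add_ac)

lemma minus_swap: "a \<in> carrier A \<Longrightarrow> b \<in> carrier A \<Longrightarrow> b \<ominus> a = (-1) \<cdot> (a \<ominus> b)"
  by (simp add: aminus_def scale_add add_commute)

lemma add_minus_add: "a \<in> carrier A \<Longrightarrow> b \<in> carrier A \<Longrightarrow> c \<in> carrier A \<Longrightarrow> d \<in> carrier A \<Longrightarrow>
    (a \<oplus> b) \<ominus> (c \<oplus> d) = (a \<ominus> c) \<oplus> (b \<ominus> d)"
  by (simp add: aminus_def scale_add add_ac)

lemma minus_minus_add: "a \<in> carrier A \<Longrightarrow> b \<in> carrier A \<Longrightarrow> c \<in> carrier A \<Longrightarrow> a \<ominus> (b \<oplus> c) = (a \<ominus> b) \<ominus> c"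
  by (simp add: aminus_def scale_add add_ac)

lemma scale_minus: "a \<in> carrier A \<Longrightarrow> b \<in> carrier A \<Longrightarrow> c \<cdot> (a \<ominus> b) = c \<cdot> a \<ominus> c \<cdot> b"
  by (simp add: aminus_def scale_add)

lemma star_minus: "a \<in> carrier A \<Longrightarrow> b \<in> carrier A \<Longrightarrow> (a \<ominus> b)\<^sup>\<star> = a\<^sup>\<star> \<ominus> b\<^sup>\<star>"
  by (simp add: aminus_def star_add star_scale)

lemma mult_minus: "a \<in> carrier A \<Longrightarrow> b \<in> carrier A \<Longrightarrow> c \<in> carrier A \<Longrightarrow> a \<odot> (b \<ominus> c) = a \<odot> b \<ominus> a \<odot> c"
  by (simp add: aminus_def mult_add mult_scale)

lemma minus_mult: "a \<in> carrier A \<Longrightarrow> b \<in> carrier A \<Longrightarrow> c \<in> carrier A \<Longrightarrow> (a \<ominus> b) \<odot> c = a \<odot> c \<ominus> b \<odot> c"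
  by (simp add: aminus_def add_mult scale_mult)

lemma mult_minus_mult: "a \<in> carrier A \<Longrightarrow> b \<in> carrier A \<Longrightarrow> c \<in> carrier A \<Longrightarrow> d \<in> carrier A \<Longrightarrow>
    a \<odot> b \<ominus> c \<odot> d = (a \<ominus> c) \<odot> b \<oplus> c \<odot> (b \<ominus> d)"
  by (simp add: mult_minus minus_mult minus_add_minus)

text \<open>The product of \<open>P(h)\<close> and \<open>x\<close>. The algebra need not have a unit, so that \<open>P(h)\<close> makes sense
  only as a multiplier.\<close>

definition poly_act :: "'a \<Rightarrow> complex poly \<Rightarrow> 'a \<Rightarrow> 'a" where
  "poly_act h P x = foldr (\<lambda>c v. c \<cdot> x \<oplus> h \<odot> v) (coeffs P) \<zero>"

lemma poly_act_0 [simp]: "poly_act h 0 x = \<zero>"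
  by (simp add: poly_act_def)

context
  fixes h :: 'a
  assumes h [simp]: "h \<in> carrier A"
begin

lemma poly_act_pCons: "x \<in> carrier A \<Longrightarrow> poly_act h (pCons c P) x = c \<cdot> x \<oplus> h \<odot> poly_act h P x"
  by (auto simp: poly_act_def cCons_def)

lemma poly_act_closed [simp]: "x \<in> carrier A \<Longrightarrow> poly_act h P x \<in> carrier A"
  by (induction P) (simp_all add: poly_act_pCons)

lemma poly_act_plus: "x \<in> carrier A \<Longrightarrow> poly_act h (P + Q) x = poly_act h P x \<oplus> poly_act h Q x"
proof (induction P arbitrary: Q)
  case (pCons c P)
  obtain d R where "Q = pCons d R" by (rule pCons_cases)
  then show ?case using pCons by (simp add: poly_act_pCons scale_plus mult_add add_ac)
qed simp

lemma poly_act_smult: "x \<in> carrier A \<Longrightarrow> poly_act h (smult c P) x = c \<cdot> poly_act h P x"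
  by (induction P) (simp_all add: poly_act_pCons scale_add mult_scale)

lemma poly_act_times: "x \<in> carrier A \<Longrightarrow> poly_act h (P * Q) x = poly_act h P (poly_act h Q x)"
  by (induction P) (simp_all add: poly_act_pCons poly_act_plus poly_act_smult)

lemma poly_act_one: "x \<in> carrier A \<Longrightarrow> poly_act h 1 x = x"
  by (simp add: one_pCons poly_act_pCons)

lemma poly_act_X: "x \<in> carrier A \<Longrightarrow> poly_act h [:0, 1:] x = h \<odot> x"
  by (simp add: poly_act_pCons)

lemma poly_act_scale: "x \<in> carrier A \<Longrightarrow> poly_act h P (c \<cdot> x) = c \<cdot> poly_act h P x"
  by (induction P) (simp_all add: poly_act_pCons scale_add mult_scale mult.commute)

lemma poly_act_mult: "x \<in> carrier A \<Longrightarrow> y \<in> carrier A \<Longrightarrow> poly_act h P x \<odot> y = poly_act h P (x \<odot> y)"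
  by (induction P) (simp_all add: poly_act_pCons add_mult scale_mult mult_assoc)

lemma poly_act_commute: "x \<in> carrier A \<Longrightarrow> h \<odot> poly_act h P x = poly_act h P (h \<odot> x)"
  by (induction P) (simp_all add: poly_act_pCons mult_add mult_scale)

lemma star_poly_act_mult:
  assumes sa: "h\<^sup>\<star> = h"
  shows "x \<in> carrier A \<Longrightarrow> y \<in> carrier A \<Longrightarrow> (poly_act h P x)\<^sup>\<star> \<odot> y = x\<^sup>\<star> \<odot> poly_act h (conj_poly P) y"
proof (induction P arbitrary: y)
  case (pCons c P)
  then show ?case
    by (simp add: poly_act_pCons star_add star_scale star_mult sa add_mult scale_mult mult_add mult_scale
        map_poly_pCons mult_assoc poly_act_mult flip: poly_act_commute)
qed simp

lemma star_poly_act_self: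
  assumes sa: "h\<^sup>\<star> = h"
  shows "(poly_act h P h)\<^sup>\<star> = poly_act h (conj_poly P) h"
proof (induction P)
  case (pCons c P)
  then show ?case
    by (simp add: poly_act_pCons star_add star_scale star_mult sa map_poly_pCons poly_act_mult flip: poly_act_commute)
qed simp

end

end

locale cstar_seminormed = star_alg +
  fixes p
  assumes cstar_seminorm: "cstar_seminorm A p"
begin

lemma nonneg [simp]: "a \<in> carrier A \<Longrightarrow> 0 \<le> p a"
  and triangle: "a \<in> carrier A \<Longrightarrow> b \<in> carrier A \<Longrightarrow> p (a \<oplus> b) \<le> p a + p b"
  and norm_scale: "a \<in> carrier A \<Longrightarrow> p (c \<cdot> a) = cmod c * p a"
  and sub_mult: "a \<in> carrier A \<Longrightarrow> b \<in> carrier A \<Longrightarrow> p (a \<odot> b) \<le> p a * p b"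
  and norm_star_mult: "a \<in> carrier A \<Longrightarrow> p (a\<^sup>\<star> \<odot> a) = (p a)\<^sup>2"
  using cstar_seminorm by (auto simp: cstar_seminorm_def)

lemma norm_zero [simp]: "p \<zero> = 0"
  using norm_scale[of "\<zero>" 0] by simp

lemma norm_star_le: "a \<in> carrier A \<Longrightarrow> p a \<le> p (a\<^sup>\<star>)"
  using norm_star_mult[of a] sub_mult[of "a\<^sup>\<star>" a] nonneg[of "a\<^sup>\<star>"]
  by (cases "p a = 0") (auto simp: power2_eq_square dest: nonneg)

lemma norm_star [simp]: "a \<in> carrier A \<Longrightarrow> p (a\<^sup>\<star>) = p a"
  using norm_star_le[of a] norm_star_le[of "a\<^sup>\<star>"] by simp

lemma norm_mult_star: "a \<in> carrier A \<Longrightarrow> p (a \<odot> a\<^sup>\<star>) = (p a)\<^sup>2"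
  using norm_star_mult[of "a\<^sup>\<star>"] by simp

lemma norm_minus_commute: "a \<in> carrier A \<Longrightarrow> b \<in> carrier A \<Longrightarrow> p (a \<ominus> b) = p (b \<ominus> a)"
  by (simp add: minus_swap[of a b] norm_scale)

lemma norm_minus_triangle:
  "a \<in> carrier A \<Longrightarrow> b \<in> carrier A \<Longrightarrow> c \<in> carrier A \<Longrightarrow> p (a \<ominus> c) \<le> p (a \<ominus> b) + p (b \<ominus> c)"
  using triangle[of "a \<ominus> b" "b \<ominus> c"] by (simp add: minus_add_minus)

lemma norm_diff_le: "a \<in> carrier A \<Longrightarrow> b \<in> carrier A \<Longrightarrow> \<bar>p a - p b\<bar> \<le> p (a \<ominus> b)"
  using triangle[of b "a \<ominus> b"] triangle[of a "b \<ominus> a"] norm_minus_commute[of a b]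
  by (simp add: add_minus_cancel)

context
  fixes h
  assumes h [simp]: "h \<in> carrier A"
begin

lemma poly_act_bounded: "\<exists>K\<ge>0. \<forall>x\<in>carrier A. p (poly_act h P x) \<le> K * p x"
proof (induction P)
  case 0
  then show ?case by (intro exI[of _ 0]) simp
next
  case (pCons c P)
  then obtain K where K: "K \<ge> 0" "\<And>x. x \<in> carrier A \<Longrightarrow> p (poly_act h P x) \<le> K * p x" by blast
  have "p (poly_act h (pCons c P) x) \<le> (cmod c + p h * K) * p x" if x: "x \<in> carrier A" for x
  proof -
    have "p (poly_act h (pCons c P) x) \<le> p (c \<cdot> x) + p (h \<odot> poly_act h P x)"
      using x by (simp add: poly_act_pCons triangle)
    also have "\<dots> \<le> cmod c * p x + p h * (K * p x)"
      using x sub_mult[of h "poly_act h P x"] mult_left_mono[OF K(2)[OF x], of "p h"]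
      by (simp add: norm_scale)
    finally show ?thesis by (simp add: algebra_simps)
  qed
  then show ?case using K by (intro exI[of _ "cmod c + p h * K"]) simp
qed

definition op_norm :: "complex poly \<Rightarrow> real" where
  "op_norm P = (SUP x\<in>{x \<in> carrier A. p x \<le> 1}. p (poly_act h P x))"

lemma op_norm_upper1: "x \<in> carrier A \<Longrightarrow> p x \<le> 1 \<Longrightarrow> p (poly_act h P x) \<le> op_norm P"
  unfolding op_norm_def
proof (rule cSUP_upper)
  obtain K where K: "K \<ge> 0" "\<And>x. x \<in> carrier A \<Longrightarrow> p (poly_act h P x) \<le> K * p x"
    using poly_act_bounded by blast
  have "p (poly_act h P x) \<le> K" if "x \<in> carrier A" "p x \<le> 1" for x
    using K(2)[OF that(1)] mult_left_le[OF that(2) K(1)] by linarith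
  then show "bdd_above ((\<lambda>x. p (poly_act h P x)) ` {x \<in> carrier A. p x \<le> 1})"
    by (auto intro!: bdd_aboveI2[of _ _ K])
qed simp

lemma op_norm_least: "(\<And>x. x \<in> carrier A \<Longrightarrow> p x \<le> 1 \<Longrightarrow> p (poly_act h P x) \<le> B) \<Longrightarrow> op_norm P \<le> B"
  unfolding op_norm_def by (rule cSUP_least) (auto intro!: exI[of _ "\<zero>"])

lemma op_norm_nonneg: "0 \<le> op_norm P"
  using op_norm_upper1[of "\<zero>" P] nonneg[of "poly_act h P \<zero>"] by (simp del: nonneg)

lemma op_norm_upper: 
  assumes x: "x \<in> carrier A"
  shows "p (poly_act h P x) \<le> op_norm P * p x"
proof (cases "p x = 0")
  case True
  then show ?thesis using poly_act_bounded[of P] x by fastforce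
next
  case False
  then have pos: "p x > 0" using nonneg[OF x] by linarith
  have "p (poly_act h P (of_real (1 / p x) \<cdot> x)) \<le> op_norm P"
    using pos x by (intro op_norm_upper1) (simp_all add: norm_scale norm_divide)
  then show ?thesis using pos x by (simp add: poly_act_scale norm_scale norm_divide field_simps)
qed

lemma op_norm_smult_le: "op_norm (smult c P) \<le> cmod c * op_norm P"
  by (rule op_norm_least) (simp add: poly_act_smult norm_scale mult_left_mono op_norm_upper1)

text \<open>The C*-inequality for the operators \<open>x \<mapsto> P(h)x\<close> comes from
  \<open>(P(h)x)\<^sup>*P(h)x = x\<^sup>*(conj_poly P * P)(h)x\<close>.\<close>

lemma poly_cstar_seminorm_op_norm:
  assumes sa: "h\<^sup>\<star> = h"
  shows "poly_cstar_seminorm op_norm (p h)"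
proof
  fix P Q :: "complex poly" and c :: complex
  show "0 \<le> op_norm P" by (rule op_norm_nonneg)
  show "op_norm (P + Q) \<le> op_norm P + op_norm Q"
  proof (rule op_norm_least)
    fix x assume "x \<in> carrier A" "p x \<le> 1"
    then show "p (poly_act h (P + Q) x) \<le> op_norm P + op_norm Q"
      using triangle[of "poly_act h P x" "poly_act h Q x"] op_norm_upper1[of x P] op_norm_upper1[of x Q]
      by (simp add: poly_act_plus)
  qed
  show "op_norm (smult c P) = cmod c * op_norm P"
  proof (cases "c = 0")
    case True
    then show ?thesis using op_norm_smult_le[of 0 P] op_norm_nonneg[of 0] by simp
  next
    case False
    have "op_norm P \<le> cmod (1 / c) * op_norm (smult c P)"
      using op_norm_smult_le[of "1 / c" "smult c P"] False by simp
    then show ?thesis using op_norm_smult_le[of c P] False by (simp add: norm_divide field_simps)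
  qed
  show "op_norm (P * Q) \<le> op_norm P * op_norm Q"
  proof (rule op_norm_least)
    fix x assume x: "x \<in> carrier A" "p x \<le> 1"
    have "p (poly_act h (P * Q) x) \<le> op_norm P * p (poly_act h Q x)"
      using x by (simp add: poly_act_times op_norm_upper)
    also have "\<dots> \<le> op_norm P * op_norm Q"
      using x by (simp add: mult_left_mono op_norm_nonneg op_norm_upper1)
    finally show "p (poly_act h (P * Q) x) \<le> op_norm P * op_norm Q" .
  qed
  show "(op_norm P)\<^sup>2 \<le> op_norm (conj_poly P * P)"
  proof -
    have "op_norm P \<le> sqrt (op_norm (conj_poly P * P))"
    proof (rule op_norm_least)
      fix x assume x: "x \<in> carrier A" "p x \<le> 1"
      have "(p (poly_act h P x))\<^sup>2 = p (x\<^sup>\<star> \<odot> poly_act h (conj_poly P * P) x)"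
        using x sa by (simp add: star_poly_act_mult poly_act_times flip: norm_star_mult)
      also have "\<dots> \<le> p (x\<^sup>\<star>) * p (poly_act h (conj_poly P * P) x)"
        using x by (intro sub_mult) simp_all
      also have "\<dots> \<le> 1 * op_norm (conj_poly P * P)"
        using x by (intro mult_mono op_norm_upper1) simp_all
      finally show "p (poly_act h P x) \<le> sqrt (op_norm (conj_poly P * P))"
        by (simp add: real_le_rsqrt)
    qed
    then show ?thesis
      using power_mono[of "op_norm P" "sqrt (op_norm (conj_poly P * P))" 2] op_norm_nonneg by simp
  qed
  show "op_norm 1 \<le> 1"
    by (rule op_norm_least) (simp add: poly_act_one)
  show "op_norm [:0, 1:] \<le> p h"
  proof (rule op_norm_least)
    fix x assume x: "x \<in> carrier A" "p x \<le> 1"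
    show "p (poly_act h [:0, 1:] x) \<le> p h"
      using x sub_mult[of h x] mult_left_le[of "p x" "p h"] by (simp add: poly_act_X)
  qed
qed

text \<open>The element \<open>y = P(h)h\<close> itself is the product of the polynomial \<open>tP(t)\<close> with the missing
  unit. Its norm is recovered from \<open>y\<^sup>*y\<close>, which is the product of that polynomial with \<open>y\<close>.\<close>

lemma norm_poly_act_self_le:
  assumes sa: "h\<^sup>\<star> = h" and P: "conj_poly P = P"
    and B: "\<And>t. \<bar>t\<bar> \<le> p h \<Longrightarrow> \<bar>t\<bar> * cmod (poly P (complex_of_real t)) \<le> B"
  shows "p (poly_act h P h) \<le> B"
proof -
  interpret poly: poly_cstar_seminorm op_norm "p h"
    using sa by (rule poly_cstar_seminorm_op_norm)
  define y where "y = poly_act h P h"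
  have y: "y \<in> carrier A" by (simp add: y_def)
  have "op_norm (pCons 0 P) \<le> B"
    by (rule poly.le_sup_on_interval) (auto simp: map_poly_pCons P norm_mult intro: B)
  then have *: "p (poly_act h (pCons 0 P) y) \<le> B * p y"
    using op_norm_upper[OF y, of "pCons 0 P"] mult_right_mono[of "op_norm (pCons 0 P)" B "p y"] y by simp
  have "y\<^sup>\<star> \<odot> y = poly_act h (pCons 0 P) y"
    unfolding y_def by (simp add: star_poly_act_mult sa P poly_act_pCons)
  then have "(p y)\<^sup>2 \<le> B * p y"
    using * norm_star_mult[OF y] by simp
  moreover have "0 \<le> B" using B[of 0] nonneg[OF h] by simp
  ultimately show ?thesis
    using y nonneg[OF y] unfolding y_def[symmetric] by (cases "p y = 0") (auto simp: power2_eq_square)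
qed

end

text \<open>If \<open>y = P(uu\<^sup>*)u\<close>, then \<open>yy\<^sup>*\<close> is the self-adjoint polynomial \<open>P\<^sup>2(h)h\<close> of \<open>h = uu\<^sup>*\<close>.\<close>

lemma norm_poly_act_le:
  assumes u: "u \<in> carrier A" and P: "conj_poly P = P"
    and B: "\<And>t. \<bar>t\<bar> \<le> (p u)\<^sup>2 \<Longrightarrow> \<bar>t\<bar> * (cmod (poly P (complex_of_real t)))\<^sup>2 \<le> B\<^sup>2" and "0 \<le> B"
  shows "p (poly_act (u \<odot> u\<^sup>\<star>) P u) \<le> B"
proof -
  define h where "h = u \<odot> u\<^sup>\<star>"
  have h: "h \<in> carrier A" "h\<^sup>\<star> = h" "p h = (p u)\<^sup>2"
    using u by (simp_all add: h_def star_mult norm_mult_star)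
  define y where "y = poly_act h P u"
  have y: "y \<in> carrier A" using u h by (simp add: y_def)
  have "y \<odot> y\<^sup>\<star> = poly_act h P (u \<odot> y\<^sup>\<star>)"
    using h(1) u y by (subst (1) y_def) (simp add: poly_act_mult)
  also have "u \<odot> y\<^sup>\<star> = (y \<odot> u\<^sup>\<star>)\<^sup>\<star>" using u y by (simp add: star_mult)
  also have "y \<odot> u\<^sup>\<star> = poly_act h P h" using u h(1) by (simp add: y_def poly_act_mult) (simp add: h_def)
  also have "(poly_act h P h)\<^sup>\<star> = poly_act h P h" using h P by (simp add: star_poly_act_self)
  finally have "y \<odot> y\<^sup>\<star> = poly_act h (P * P) h" using h(1) by (simp add: poly_act_times)
  then have "(p y)\<^sup>2 \<le> B\<^sup>2"
    using norm_mult_star[OF y] norm_poly_act_self_le[OF h(1,2), of "P * P" "B\<^sup>2"] B h(3)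
    by (simp add: conj_poly_mult conj_poly_power P norm_mult norm_power flip: power2_eq_square)
  then show ?thesis
    unfolding y_def[symmetric] h_def[symmetric] using \<open>0 \<le> B\<close> by (rule power2_le_imp_le)
qed

end

section \<open>Truncation of elements\<close>

lemma exists_real_poly_approx:
  fixes f :: "real \<Rightarrow> real"
  assumes "continuous_on {-K..K} f" "0 < e"
  obtains P where "conj_poly P = P" "\<And>t. \<bar>t\<bar> \<le> K \<Longrightarrow> cmod (poly P (complex_of_real t) - of_real (f t)) < e"
proof -
  obtain g where g: "real_polynomial_function g" "\<And>x. x \<in> {-K..K} \<Longrightarrow> \<bar>f x - g x\<bar> < e"
    using Stone_Weierstrass_real_polynomial_function[OF compact_Icc assms] by blast
  then obtain a n where g_eq: "g = (\<lambda>x. \<Sum>i\<le>n. a i * x ^ i)"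
    using real_polynomial_function_iff_sum by blast
  define P where "P = (\<Sum>i\<le>n. monom (complex_of_real (a i)) i)"
  have P: "poly P (complex_of_real t) = of_real (g t)" for t
    by (simp add: P_def g_eq poly_sum poly_monom)
  have "conj_poly P = P"
    by (simp flip: poly_eq_poly_eq_iff add: fun_eq_iff P_def poly_sum poly_monom)
  moreover have "cmod (poly P (complex_of_real t) - of_real (f t)) < e" if "\<bar>t\<bar> \<le> K" for t
    using g(2)[of t] that unfolding P
    by (metis abs_le_iff abs_minus_commute atLeastAtMost_iff minus_le_iff norm_of_real of_real_diff)
  ultimately show ?thesis using that by blast
qed

text \<open>Take \<open>v = P(uu\<^sup>*)u\<close> for a polynomial \<open>P\<close> close to the function
  \<open>r(t) = min(1, sqrt (b / \<bar>t\<bar>))\<close>, where \<open>sqrt b\<close> is strictly between \<open>p u\<close> and \<open>\<epsilon>\<close>. Since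
  \<open>\<bar>t\<bar> r(t)\<^sup>2 \<le> b\<close>, the norm of \<open>v\<close> under \<open>N\<close> is at most about \<open>sqrt b\<close>. Under \<open>p\<close> nothing happens,
  because \<open>r = 1\<close> on the interval that matters for \<open>p\<close>.\<close>

lemma (in star_alg) exists_truncation:
  assumes N: "cstar_seminorm A N" and p: "cstar_seminorm A p"
    and u: "u \<in> carrier A" and "p u < \<epsilon>" and "0 < \<delta>"
  shows "\<exists>v\<in>carrier A. N v \<le> \<epsilon> \<and> p (u \<ominus> v) < \<delta>"
proof -
  interpret N: cstar_seminormed A N using N by unfold_locales
  interpret p: cstar_seminormed A p using p by unfold_locales
  define b where "b = ((p u + \<epsilon>) / 2)\<^sup>2"
  have mid: "0 \<le> p u" "p u < (p u + \<epsilon>) / 2" "(p u + \<epsilon>) / 2 < \<epsilon>" using u \<open>p u < \<epsilon>\<close> by auto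
  have \<epsilon>: "0 < \<epsilon>" using mid by linarith
  have b: "(p u)\<^sup>2 \<le> b" "b < \<epsilon>\<^sup>2" "0 < b"
    unfolding b_def using mid by (auto intro!: power_mono power_strict_mono zero_less_power)
  \<comment> \<open>The interval \<open>[-K, K]\<close> contains the values of \<open>t\<close> that matter for either seminorm.\<close>
  define K where "K = max ((N u)\<^sup>2) ((p u)\<^sup>2)"
  have K: "0 \<le> K" "(N u)\<^sup>2 \<le> K" "(p u)\<^sup>2 \<le> K" by (simp_all add: K_def le_max_iff_disj)
  \<comment> \<open>The approximation error: it is at most 1 so that \<open>(r + \<eta>)\<^sup>2 \<le> r\<^sup>2 + 3\<eta>\<close>, and the other two
    bounds are what the estimates of \<open>N v\<close> and of \<open>p (u - v)\<close> require.\<close>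
  define \<eta> where "\<eta> = min 1 (min ((\<epsilon>\<^sup>2 - b) / (3 * (K + 1))) ((\<delta> / 2)\<^sup>2 / (K + 1)))"
  have "0 < \<eta>" "\<eta> \<le> 1" using b K \<open>0 < \<delta>\<close> by (auto simp: \<eta>_def)
  have "3 * (K + 1) * \<eta> \<le> \<epsilon>\<^sup>2 - b" "(K + 1) * \<eta> \<le> (\<delta> / 2)\<^sup>2"
  proof -
    have "\<eta> \<le> (\<epsilon>\<^sup>2 - b) / (3 * (K + 1))" "\<eta> \<le> (\<delta> / 2)\<^sup>2 / (K + 1)" unfolding \<eta>_def by auto
    then show "3 * (K + 1) * \<eta> \<le> \<epsilon>\<^sup>2 - b" "(K + 1) * \<eta> \<le> (\<delta> / 2)\<^sup>2"
      using K(1) by (simp_all add: field_simps)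
  qed
  then have \<eta>: "3 * K * \<eta> \<le> \<epsilon>\<^sup>2 - b" "K * \<eta> \<le> (\<delta> / 2)\<^sup>2"
    using \<open>0 < \<eta>\<close> by (simp_all add: algebra_simps)
  define r where "r t = sqrt b / sqrt (max b \<bar>t\<bar>)" for t
  have r: "0 \<le> r t" "r t \<le> 1" "\<bar>t\<bar> * (r t)\<^sup>2 \<le> b" for t
    using b(3) mult_right_mono[of "\<bar>t\<bar>" "max b \<bar>t\<bar>" b] by (auto simp: r_def power_divide field_simps)
  have r1: "r t = 1" if "\<bar>t\<bar> \<le> b" for t using that b(3) by (simp add: r_def)
  have "continuous_on {-K..K} r"
    unfolding r_def using b(3) by (auto intro!: continuous_intros)
  then obtain P where P: "conj_poly P = P"
    "\<And>t. \<bar>t\<bar> \<le> K \<Longrightarrow> cmod (poly P (complex_of_real t) - of_real (r t)) < \<eta>"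
    using exists_real_poly_approx \<open>0 < \<eta>\<close> by blast
  define v where "v = poly_act (u \<odot> u\<^sup>\<star>) P u"
  have v: "v \<in> carrier A" using u by (simp add: v_def)
  have "N v \<le> \<epsilon>"
    unfolding v_def
  proof (rule N.norm_poly_act_le[OF u P(1)])
    fix t assume "\<bar>t\<bar> \<le> (N u)\<^sup>2"
    then have t: "\<bar>t\<bar> \<le> K" using K by linarith
    have "cmod (poly P (complex_of_real t)) \<le> r t + \<eta>"
      using P(2)[OF t] r(1)[of t] norm_triangle_ineq2[of "poly P (complex_of_real t)" "of_real (r t)"]
      by simp
    then have "(cmod (poly P (complex_of_real t)))\<^sup>2 \<le> (r t + \<eta>)\<^sup>2"
      by (intro power_mono) simp_all
    also have "\<dots> \<le> (r t)\<^sup>2 + 3 * \<eta>"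
    proof -
      have "r t * \<eta> \<le> \<eta>" "\<eta> * \<eta> \<le> \<eta>" using r[of t] \<open>0 < \<eta>\<close> \<open>\<eta> \<le> 1\<close> by (auto intro: mult_left_le_one_le mult_left_le)
      then show ?thesis unfolding power2_sum power2_eq_square by (simp add: algebra_simps)
    qed
    finally have "\<bar>t\<bar> * (cmod (poly P (complex_of_real t)))\<^sup>2 \<le> \<bar>t\<bar> * ((r t)\<^sup>2 + 3 * \<eta>)"
      by (rule mult_left_mono) simp
    also have "\<dots> \<le> b + K * (3 * \<eta>)"
      using r(3)[of t] \<open>0 < \<eta>\<close> mult_right_mono[OF t, of "3 * \<eta>"] unfolding distrib_left by linarith
    also have "\<dots> \<le> \<epsilon>\<^sup>2" using \<eta>(1) by simp
    finally show "\<bar>t\<bar> * (cmod (poly P (complex_of_real t)))\<^sup>2 \<le> \<epsilon>\<^sup>2" .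
  qed (use \<epsilon> in simp)
  moreover have "p (u \<ominus> v) \<le> \<delta> / 2"
  proof -
    have "u \<ominus> v = poly_act (u \<odot> u\<^sup>\<star>) (1 - P) u"
      using u poly_act_plus[of "u \<odot> u\<^sup>\<star>" u 1 "smult (-1) P"]
        poly_act_smult[of "u \<odot> u\<^sup>\<star>" u "-1" P]
      by (simp add: v_def aminus_def poly_act_one)
    also have "p \<dots> \<le> \<delta> / 2"
    proof (rule p.norm_poly_act_le[OF u])
      show "conj_poly (1 - P) = 1 - P"
        using conj_poly_add[of 1 "smult (-1) P"] conj_poly_smult[of "-1" P] P(1) by simp
      fix t assume t: "\<bar>t\<bar> \<le> (p u)\<^sup>2"
      have "cmod (poly (1 - P) (complex_of_real t)) < \<eta>"
        using P(2)[of t] r1[of t] t K b by (simp add: norm_minus_commute)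
      then have "(cmod (poly (1 - P) (complex_of_real t)))\<^sup>2 \<le> \<eta>\<^sup>2"
        by (intro power_mono) simp_all
      also have "\<dots> \<le> \<eta>"
        using \<open>0 < \<eta>\<close> \<open>\<eta> \<le> 1\<close> by (simp add: power2_eq_square mult_left_le)
      finally have "\<bar>t\<bar> * (cmod (poly (1 - P) (complex_of_real t)))\<^sup>2 \<le> K * \<eta>"
        using t K by (intro mult_mono) simp_all
      then show "\<bar>t\<bar> * (cmod (poly (1 - P) (complex_of_real t)))\<^sup>2 \<le> (\<delta> / 2)\<^sup>2" using \<eta>(2) by simp
    qed (use \<open>0 < \<delta>\<close> in simp)
    finally show ?thesis .
  qed
  ultimately show ?thesis using v \<open>0 < \<delta>\<close> by (intro bexI[of _ v]) auto
qed

section \<open>Completions\<close>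

context cstar_seminormed
begin

abbreviation completion where "completion \<equiv> hausdorff_completion A p"
abbreviation cauchys where "cauchys \<equiv> cauchy_seqs A p"
abbreviation cls where "cls \<equiv> cauchy_class A p"

lemma cauchysD: "s \<in> cauchys \<Longrightarrow> s n \<in> carrier A"
  by (auto simp: cauchy_seqs_def)

lemma cauchysE:
  assumes "s \<in> cauchys" "0 < e"
  obtains N where "\<And>m n. m \<ge> N \<Longrightarrow> n \<ge> N \<Longrightarrow> p (s m \<ominus> s n) < e"
  using assms unfolding cauchy_seqs_def by blast

lemma cauchys_const: "a \<in> carrier A \<Longrightarrow> (\<lambda>n. a) \<in> cauchys"
  by (auto simp: cauchy_seqs_def)

lemma cauchys_convergent:
  assumes s: "s \<in> cauchys"
  shows "convergent (\<lambda>n. p (s n))"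
  unfolding Cauchy_convergent_iff[symmetric]
proof (rule CauchyI)
  fix e :: real assume "0 < e"
  with s obtain N where N: "\<And>m n. m \<ge> N \<Longrightarrow> n \<ge> N \<Longrightarrow> p (s m \<ominus> s n) < e" using cauchysE by blast
  show "\<exists>N. \<forall>m\<ge>N. \<forall>n\<ge>N. norm (p (s m) - p (s n)) < e"
    using N norm_diff_le[OF cauchysD[OF s] cauchysD[OF s]] unfolding real_norm_def by (meson le_less_trans)
qed

lemma cauchys_tendsto: "s \<in> cauchys \<Longrightarrow> (\<lambda>n. p (s n)) \<longlonglongrightarrow> lim (\<lambda>n. p (s n))"
  using cauchys_convergent convergent_LIMSEQ_iff by blast

lemma cauchys_bounded:
  assumes s: "s \<in> cauchys"
  obtains K where "K > 0" "\<And>n. p (s n) \<le> K"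
proof -
  have "Bseq (\<lambda>n. p (s n))" using cauchys_convergent[OF s] by (rule convergent_imp_Bseq)
  then obtain K where "K > 0" "\<And>n. norm (p (s n)) \<le> K" unfolding Bseq_def by blast
  then show ?thesis using that[of K] by (auto simp: abs_le_iff)
qed

lemma cauchysI:
  assumes "\<And>n. t n \<in> carrier A"
    and "\<And>m n. p (t m \<ominus> t n) \<le> K * p (s m \<ominus> s n) + L * p (r m \<ominus> r n)"
    and s: "s \<in> cauchys" and r: "r \<in> cauchys" and "K \<ge> 0" "L \<ge> 0"
  shows "t \<in> cauchys"
  unfolding cauchy_seqs_def
proof (intro CollectI conjI allI impI assms(1))
  fix e :: real assume "0 < e"
  define d where "d = e / (K + L + 1)"
  have d: "0 < d" using \<open>0 < e\<close> \<open>K \<ge> 0\<close> \<open>L \<ge> 0\<close> by (simp add: d_def)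
  have "(K + L + 1) * d = e" using \<open>K \<ge> 0\<close> \<open>L \<ge> 0\<close> by (simp add: d_def)
  then have d_sum: "K * d + L * d < e" using d by (simp add: distrib_right)
  obtain N1 where N1: "\<And>m n. m \<ge> N1 \<Longrightarrow> n \<ge> N1 \<Longrightarrow> p (s m \<ominus> s n) < d" using cauchysE[OF s d] by blast
  obtain N2 where N2: "\<And>m n. m \<ge> N2 \<Longrightarrow> n \<ge> N2 \<Longrightarrow> p (r m \<ominus> r n) < d" using cauchysE[OF r d] by blast
  have "p (t m \<ominus> t n) < e" if "m \<ge> max N1 N2" "n \<ge> max N1 N2" for m n
  proof -
    have "p (t m \<ominus> t n) \<le> K * p (s m \<ominus> s n) + L * p (r m \<ominus> r n)" by (rule assms(2))
    also have "\<dots> \<le> K * d + L * d"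
      using N1[of m n] N2[of m n] that \<open>K \<ge> 0\<close> \<open>L \<ge> 0\<close> by (intro add_mono mult_left_mono) auto
    finally show ?thesis using d_sum by linarith
  qed
  then show "\<exists>N. \<forall>m\<ge>N. \<forall>n\<ge>N. p (t m \<ominus> t n) < e" by blast
qed

lemma cauchys_add:
  assumes s: "s \<in> cauchys" and t: "t \<in> cauchys"
  shows "(\<lambda>n. s n \<oplus> t n) \<in> cauchys"
proof (rule cauchysI[OF _ _ s t, of _ 1 1])
  fix m n
  show "p ((s m \<oplus> t m) \<ominus> (s n \<oplus> t n)) \<le> 1 * p (s m \<ominus> s n) + 1 * p (t m \<ominus> t n)"
    using cauchysD[OF s] cauchysD[OF t] by (simp add: add_minus_add triangle)
qed (use cauchysD[OF s] cauchysD[OF t] in auto)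

lemma cauchys_scale:
  assumes s: "s \<in> cauchys"
  shows "(\<lambda>n. c \<cdot> s n) \<in> cauchys"
proof (rule cauchysI[OF _ _ s s, of _ "cmod c" 0])
  fix m n
  show "p (c \<cdot> s m \<ominus> c \<cdot> s n) \<le> cmod c * p (s m \<ominus> s n) + 0 * p (s m \<ominus> s n)"
    using cauchysD[OF s] by (simp add: norm_scale flip: scale_minus)
qed (use cauchysD[OF s] in auto)

lemma cauchys_minus: "s \<in> cauchys \<Longrightarrow> t \<in> cauchys \<Longrightarrow> (\<lambda>n. s n \<ominus> t n) \<in> cauchys"
  unfolding aminus_def by (intro cauchys_add cauchys_scale)

lemma cauchys_star:
  assumes s: "s \<in> cauchys"
  shows "(\<lambda>n. (s n)\<^sup>\<star>) \<in> cauchys"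
proof (rule cauchysI[OF _ _ s s, of _ 1 0])
  fix m n
  show "p ((s m)\<^sup>\<star> \<ominus> (s n)\<^sup>\<star>) \<le> 1 * p (s m \<ominus> s n) + 0 * p (s m \<ominus> s n)"
    using cauchysD[OF s] by (simp flip: star_minus)
qed (use cauchysD[OF s] in auto)

lemma norm_mult_minus_mult:
  assumes "a \<in> carrier A" "b \<in> carrier A" "c \<in> carrier A" "d \<in> carrier A" "p b \<le> K" "p c \<le> L"
  shows "p (a \<odot> b \<ominus> c \<odot> d) \<le> K * p (a \<ominus> c) + L * p (b \<ominus> d)"
proof -
  have "p (a \<odot> b \<ominus> c \<odot> d) \<le> p (a \<ominus> c) * p b + p c * p (b \<ominus> d)"
    using assms triangle[of "(a \<ominus> c) \<odot> b" "c \<odot> (b \<ominus> d)"] sub_mult[of "a \<ominus> c" b] sub_mult[of c "b \<ominus> d"]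
    by (simp add: mult_minus_mult)
  also have "\<dots> \<le> p (a \<ominus> c) * K + L * p (b \<ominus> d)"
    using assms by (intro add_mono mult_left_mono mult_right_mono) auto
  finally show ?thesis by (simp add: mult.commute)
qed

lemma cauchys_mult:
  assumes s: "s \<in> cauchys" and t: "t \<in> cauchys"
  shows "(\<lambda>n. s n \<odot> t n) \<in> cauchys"
proof -
  obtain K where K: "K > 0" "\<And>n. p (t n) \<le> K" using cauchys_bounded[OF t] by blast
  obtain L where L: "L > 0" "\<And>n. p (s n) \<le> L" using cauchys_bounded[OF s] by blast
  show ?thesis
  proof (rule cauchysI[OF _ _ s t, of _ K L])
    fix m n
    show "p (s m \<odot> t m \<ominus> s n \<odot> t n) \<le> K * p (s m \<ominus> s n) + L * p (t m \<ominus> t n)"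
      using K L by (intro norm_mult_minus_mult cauchysD s t)
  qed (use cauchysD[OF s] cauchysD[OF t] K L in auto)
qed

lemma mem_cls: "t \<in> cls s \<longleftrightarrow> t \<in> cauchys \<and> (\<lambda>n. p (t n \<ominus> s n)) \<longlonglongrightarrow> 0"
  by (auto simp: cauchy_class_def)

lemma null_trans:
  assumes "\<And>n. r n \<in> carrier A" "\<And>n. s n \<in> carrier A" "\<And>n. t n \<in> carrier A"
    and "(\<lambda>n. p (r n \<ominus> s n)) \<longlonglongrightarrow> 0" "(\<lambda>n. p (s n \<ominus> t n)) \<longlonglongrightarrow> 0"
  shows "(\<lambda>n. p (r n \<ominus> t n)) \<longlonglongrightarrow> 0"
proof (rule tendsto_0_le[where K = 1])
  show "(\<lambda>n. p (r n \<ominus> s n) + p (s n \<ominus> t n)) \<longlonglongrightarrow> 0"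
    using tendsto_add[OF assms(4,5)] by simp
  show "\<forall>\<^sub>F n in sequentially. norm (p (r n \<ominus> t n)) \<le> norm (p (r n \<ominus> s n) + p (s n \<ominus> t n)) * 1"
    using assms norm_minus_triangle by (auto intro!: always_eventually)
qed

lemma null_sym:
  assumes "\<And>n. r n \<in> carrier A" "\<And>n. s n \<in> carrier A"
    and "(\<lambda>n. p (r n \<ominus> s n)) \<longlonglongrightarrow> 0"
  shows "(\<lambda>n. p (s n \<ominus> r n)) \<longlonglongrightarrow> 0"
  using assms by (simp add: norm_minus_commute[of "s _"])

lemma cls_refl: "s \<in> cauchys \<Longrightarrow> s \<in> cls s"
  by (simp add: mem_cls cauchysD)

lemma cls_eqI:
  assumes s: "s \<in> cauchys" and t: "t \<in> cauchys" and "(\<lambda>n. p (s n \<ominus> t n)) \<longlonglongrightarrow> 0"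
  shows "cls s = cls t"
  using null_trans[of _ s t] null_trans[of _ t s] null_sym[of s t] assms cauchysD
  by (auto simp: mem_cls)

lemma cls_eq: "s \<in> cauchys \<Longrightarrow> t \<in> cls s \<Longrightarrow> cls t = cls s"
  by (rule cls_eqI) (auto simp: mem_cls)

lemma carrier_completion: "carrier completion = cls ` cauchys"
  by (simp add: hausdorff_completion_def)

lemma completionE:
  assumes "S \<in> carrier completion"
  obtains s where "s \<in> cauchys" "S = cls s" "s \<in> S"
  using assms cls_refl unfolding carrier_completion by blast

lemma completion_member:
  assumes "S \<in> carrier completion" "s \<in> S"
  shows "s \<in> cauchys" "S = cls s"
  using assms cls_eq by (auto simp: carrier_completion mem_cls)

lemma rep_cls:
  assumes "s \<in> cauchys"
  shows "rep (cls s) \<in> cauchys" "(\<lambda>n. p (rep (cls s) n \<ominus> s n)) \<longlonglongrightarrow> 0"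
proof -
  have "rep (cls s) \<in> cls s" unfolding rep_def using someI[of "\<lambda>t. t \<in> cls s", OF cls_refl[OF assms]] .
  then show "rep (cls s) \<in> cauchys" "(\<lambda>n. p (rep (cls s) n \<ominus> s n)) \<longlonglongrightarrow> 0"
    by (auto simp: mem_cls)
qed

lemma cls_closed: "s \<in> cauchys \<Longrightarrow> cls s \<in> carrier completion"
  by (simp add: carrier_completion)

lemma completion_add:
  assumes s: "s \<in> cauchys" and t: "t \<in> cauchys"
  shows "aadd completion (cls s) (cls t) = cls (\<lambda>n. s n \<oplus> t n)"
proof -
  note r = rep_cls[OF s] rep_cls[OF t]
  have "(\<lambda>n. p ((rep (cls s) n \<oplus> rep (cls t) n) \<ominus> (s n \<oplus> t n))) \<longlonglongrightarrow> 0"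
  proof (rule tendsto_0_le[where K = 1])
    show "(\<lambda>n. p (rep (cls s) n \<ominus> s n) + p (rep (cls t) n \<ominus> t n)) \<longlonglongrightarrow> 0"
      using tendsto_add[OF r(2,4)] by simp
    show "\<forall>\<^sub>F n in sequentially. norm (p ((rep (cls s) n \<oplus> rep (cls t) n) \<ominus> (s n \<oplus> t n)))
        \<le> norm (p (rep (cls s) n \<ominus> s n) + p (rep (cls t) n \<ominus> t n)) * 1"
      using cauchysD[OF s] cauchysD[OF t] cauchysD[OF r(1)] cauchysD[OF r(3)]
      by (auto intro!: always_eventually triangle simp: add_minus_add)
  qed
  then show ?thesis
    using r s t by (simp add: hausdorff_completion_def) (intro cls_eqI cauchys_add; simp)
qed

lemma completion_scale:
  assumes s: "s \<in> cauchys"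
  shows "ascale completion c (cls s) = cls (\<lambda>n. c \<cdot> s n)"
proof -
  note r = rep_cls[OF s]
  have "(\<lambda>n. p (c \<cdot> rep (cls s) n \<ominus> c \<cdot> s n)) \<longlonglongrightarrow> 0"
    using tendsto_mult_right_zero[OF r(2), of "cmod c"] cauchysD[OF s] cauchysD[OF r(1)]
    by (simp add: norm_scale flip: scale_minus)
  then show ?thesis
    using r s by (simp add: hausdorff_completion_def) (intro cls_eqI cauchys_scale; simp)
qed

lemma completion_minus:
  assumes s: "s \<in> cauchys" and t: "t \<in> cauchys"
  shows "aminus completion (cls s) (cls t) = cls (\<lambda>n. s n \<ominus> t n)"
  using assms by (simp add: aminus_def completion_scale completion_add cauchys_scale)

lemma completion_star:
  assumes s: "s \<in> cauchys"
  shows "astar completion (cls s) = cls (\<lambda>n. (s n)\<^sup>\<star>)"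
proof -
  note r = rep_cls[OF s]
  have "(\<lambda>n. p ((rep (cls s) n)\<^sup>\<star> \<ominus> (s n)\<^sup>\<star>)) \<longlonglongrightarrow> 0"
    using r(2) cauchysD[OF s] cauchysD[OF r(1)] by (simp flip: star_minus)
  then show ?thesis
    using r s by (simp add: hausdorff_completion_def) (intro cls_eqI cauchys_star; simp)
qed

lemma completion_mult:
  assumes s: "s \<in> cauchys" and t: "t \<in> cauchys"
  shows "amult completion (cls s) (cls t) = cls (\<lambda>n. s n \<odot> t n)"
proof -
  note r = rep_cls[OF s] rep_cls[OF t]
  obtain K where K: "K > 0" "\<And>n. p (rep (cls t) n) \<le> K" using cauchys_bounded[OF r(3)] by blast
  obtain L where L: "L > 0" "\<And>n. p (s n) \<le> L" using cauchys_bounded[OF s] by blast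
  have "(\<lambda>n. p (rep (cls s) n \<odot> rep (cls t) n \<ominus> s n \<odot> t n)) \<longlonglongrightarrow> 0"
  proof (rule tendsto_0_le[where K = 1])
    show "(\<lambda>n. K * p (rep (cls s) n \<ominus> s n) + L * p (rep (cls t) n \<ominus> t n)) \<longlonglongrightarrow> 0"
      using tendsto_add[OF tendsto_mult_right_zero[OF r(2), of K] tendsto_mult_right_zero[OF r(4), of L]] by simp
    show "\<forall>\<^sub>F n in sequentially. norm (p (rep (cls s) n \<odot> rep (cls t) n \<ominus> s n \<odot> t n))
        \<le> norm (K * p (rep (cls s) n \<ominus> s n) + L * p (rep (cls t) n \<ominus> t n)) * 1"
    proof (intro always_eventually allI)
      fix n
      have "p (rep (cls s) n \<odot> rep (cls t) n \<ominus> s n \<odot> t n)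
          \<le> K * p (rep (cls s) n \<ominus> s n) + L * p (rep (cls t) n \<ominus> t n)"
        using K L by (intro norm_mult_minus_mult cauchysD s t r)
      then show "norm (p (rep (cls s) n \<odot> rep (cls t) n \<ominus> s n \<odot> t n))
        \<le> norm (K * p (rep (cls s) n \<ominus> s n) + L * p (rep (cls t) n \<ominus> t n)) * 1"
        using cauchysD[OF s] cauchysD[OF t] cauchysD[OF r(1)] cauchysD[OF r(3)] by simp
    qed
  qed
  then show ?thesis
    using r s t by (simp add: hausdorff_completion_def) (intro cls_eqI cauchys_mult; simp)
qed

lemma tendsto_norm_completion:
  assumes s: "s \<in> cauchys"
  shows "(\<lambda>n. p (s n)) \<longlonglongrightarrow> anorm completion (cls s)"
proof -
  note r = rep_cls[OF s]
  have "(\<lambda>n. p (rep (cls s) n)) \<longlonglongrightarrow> anorm completion (cls s)"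
    using cauchys_tendsto[OF r(1)] by (simp add: hausdorff_completion_def)
  moreover have "(\<lambda>n. p (s n) - p (rep (cls s) n)) \<longlonglongrightarrow> 0"
  proof (rule tendsto_0_le[OF r(2), where K = 1])
    show "\<forall>\<^sub>F n in sequentially. norm (p (s n) - p (rep (cls s) n)) \<le> norm (p (rep (cls s) n \<ominus> s n)) * 1"
      using norm_diff_le[OF cauchysD[OF r(1)] cauchysD[OF s]] cauchysD[OF s] cauchysD[OF r(1)]
      by (auto intro!: always_eventually simp: abs_minus_commute[of "p (s _)"])
  qed
  ultimately show ?thesis
    using tendsto_add[of "\<lambda>n. p (s n) - p (rep (cls s) n)" 0] by fastforce
qed

lemma norm_completion_eq: "s \<in> cauchys \<Longrightarrow> (\<lambda>n. p (s n)) \<longlonglongrightarrow> x \<Longrightarrow> anorm completion (cls s) = x"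
  using tendsto_norm_completion LIMSEQ_unique by blast

lemma into_closed: "a \<in> carrier A \<Longrightarrow> into_completion A p a \<in> carrier completion"
  by (simp add: into_completion_def cls_closed cauchys_const)

lemma norm_into: "a \<in> carrier A \<Longrightarrow> anorm completion (into_completion A p a) = p a"
  unfolding into_completion_def by (intro norm_completion_eq cauchys_const tendsto_const)

lemma norm_completion_nonneg: "S \<in> carrier completion \<Longrightarrow> 0 \<le> anorm completion S"
  by (erule completionE) (metis LIMSEQ_le_const cauchysD nonneg tendsto_norm_completion)

lemma tendsto_into_completion:
  assumes s: "s \<in> cauchys"
  shows "(\<lambda>n. anorm completion (aminus completion (cls s) (into_completion A p (s n)))) \<longlonglongrightarrow> 0"
proof (rule LIMSEQ_I)
  fix e :: real assume "0 < e"
  then obtain N where N: "\<And>m n. m \<ge> N \<Longrightarrow> n \<ge> N \<Longrightarrow> p (s m \<ominus> s n) < e / 2"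
    using cauchysE[OF s, of "e / 2"] by auto
  have "norm (anorm completion (aminus completion (cls s) (into_completion A p (s n))) - 0) < e" if "n \<ge> N" for n
  proof -
    have c: "(\<lambda>m. s m \<ominus> s n) \<in> cauchys" 
      using s cauchysD[OF s] by (intro cauchys_minus cauchys_const)
    have eq: "aminus completion (cls s) (into_completion A p (s n)) = cls (\<lambda>m. s m \<ominus> s n)"
      using s cauchysD[OF s] by (simp add: into_completion_def completion_minus cauchys_const)
    have "anorm completion (cls (\<lambda>m. s m \<ominus> s n)) \<le> e / 2"
      using tendsto_norm_completion[OF c]
      by (rule LIMSEQ_le_const2) (use N that in \<open>auto intro!: exI[of _ N] less_imp_le\<close>)
    moreover have "0 \<le> anorm completion (cls (\<lambda>m. s m \<ominus> s n))"
      using c by (intro norm_completion_nonneg cls_closed)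
    ultimately show ?thesis using eq \<open>0 < e\<close> by simp
  qed
  then show "\<exists>N. \<forall>n\<ge>N. norm (anorm completion (aminus completion (cls s) (into_completion A p (s n))) - 0) < e"
    by blast
qed

end

section \<open>Quotients of completions\<close>

locale two_cstar_seminorms = N: cstar_seminormed A N + p: cstar_seminormed A p
  for A :: "('a, 'm) star_algebra_scheme" and N p +
  assumes p_le_N: "a \<in> carrier A \<Longrightarrow> p a \<le> N a"
begin

text \<open>The kernel of the canonical map from the completion under \<open>N\<close> to the completion under \<open>p\<close>.\<close>

definition null_ideal :: "(nat \<Rightarrow> 'a) set set" where
  "null_ideal = {S \<in> carrier N.completion. \<exists>s\<in>S. (\<lambda>n. p (s n)) \<longlonglongrightarrow> 0}"

abbreviation quot where "quot \<equiv> quotient_algebra N.completion null_ideal"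

text \<open>The canonical map sends the class of a sequence under \<open>N\<close> to the class under \<open>p\<close> that
  contains it. Hence \<open>quot_iso T\<close> is the preimage of \<open>T\<close>, which is a coset of the kernel
  (\<open>coset_cls\<close>).\<close>

definition quot_iso :: "(nat \<Rightarrow> 'a) set \<Rightarrow> (nat \<Rightarrow> 'a) set set" where
  "quot_iso T = {S \<in> carrier N.completion. S \<subseteq> T}"

lemma cauchys_mono: "s \<in> N.cauchys \<Longrightarrow> s \<in> p.cauchys"
  unfolding cauchy_seqs_def using p_le_N
  by (auto intro!: N.minus_closed) (meson N.minus_closed le_less_trans)

lemma null_mono:
  assumes "\<And>n. s n \<in> carrier A" "(\<lambda>n. N (s n)) \<longlonglongrightarrow> 0"
  shows "(\<lambda>n. p (s n)) \<longlonglongrightarrow> 0"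
  by (rule tendsto_0_le[OF assms(2), where K = 1]) (use assms p_le_N in \<open>auto intro!: always_eventually\<close>)

lemma cls_mono:
  assumes "s \<in> N.cauchys"
  shows "N.cls s \<subseteq> p.cls s"
  using cauchys_mono assms N.cauchysD
  by (auto simp: N.mem_cls p.mem_cls intro!: null_mono)

lemma cls_mem_null_ideal:
  assumes r: "r \<in> N.cauchys"
  shows "N.cls r \<in> null_ideal \<longleftrightarrow> (\<lambda>n. p (r n)) \<longlonglongrightarrow> 0"
proof
  assume "N.cls r \<in> null_ideal"
  then obtain s where s: "s \<in> N.cls r" "(\<lambda>n. p (s n)) \<longlonglongrightarrow> 0" by (auto simp: null_ideal_def)
  then have "s \<in> p.cls r" using cls_mono[OF r] by blast
  then have "p.cls s = p.cls r" using cauchys_mono[OF r] by (intro p.cls_eq)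
  then show "(\<lambda>n. p (r n)) \<longlonglongrightarrow> 0"
    using s(2) p.norm_completion_eq[of s 0] p.tendsto_norm_completion[of r] cauchys_mono[OF r] \<open>s \<in> p.cls r\<close>
    by (simp add: p.mem_cls)
next
  assume "(\<lambda>n. p (r n)) \<longlonglongrightarrow> 0"
  then show "N.cls r \<in> null_ideal" using r N.cls_refl N.cls_closed by (auto simp: null_ideal_def)
qed

lemma coset_cls:
  assumes s: "s \<in> N.cauchys"
  shows "coset N.completion null_ideal (N.cls s) = quot_iso (p.cls s)"
proof -
  have "aminus N.completion S (N.cls s) \<in> null_ideal \<longleftrightarrow> S \<subseteq> p.cls s" if S: "S \<in> carrier N.completion" for S
  proof -
    obtain t where t: "t \<in> N.cauchys" "S = N.cls t" "t \<in> S" using S by (rule N.completionE)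
    have "aminus N.completion S (N.cls s) \<in> null_ideal \<longleftrightarrow> t \<in> p.cls s"
      using s t by (simp add: N.completion_minus cls_mem_null_ideal N.cauchys_minus p.mem_cls cauchys_mono)
    also have "\<dots> \<longleftrightarrow> S \<subseteq> p.cls s"
      using t cls_mono[OF t(1)] p.cls_eq[OF cauchys_mono[OF s], of t] by auto
    finally show ?thesis .
  qed
  then show ?thesis by (auto simp: coset_def quot_iso_def)
qed

lemma quot_iso_member:
  assumes "S \<in> quot_iso T" "T \<in> carrier p.completion"
  obtains t where "t \<in> N.cauchys" "S = N.cls t" "T = p.cls t"
proof -
  have "S \<in> carrier N.completion" "S \<subseteq> T" using assms by (auto simp: quot_iso_def)
  then obtain t where "t \<in> N.cauchys" "S = N.cls t" "t \<in> S" by (auto elim: N.completionE)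
  then show ?thesis using that p.completion_member[OF assms(2), of t] \<open>S \<subseteq> T\<close> by blast
qed

text \<open>The canonical map of the completions is onto, and lifts can be chosen with almost the same
  norm. The lift \<open>t\<close> is a series: its first term is a truncation of an element of a subsequence of
  \<open>s\<close>, and each further term is a truncation of the error that has been left so far. The errors
  decrease geometrically under \<open>p\<close>, and so do the terms under \<open>N\<close>.\<close>

lemma exists_dominated_lift:
  assumes s: "s \<in> p.cauchys" and e: "anorm p.completion (p.cls s) < e"
  obtains t where "t \<in> N.cauchys" "p.cls t = p.cls s" "\<And>n. N (t n) \<le> e"
proof -
  define L where "L = anorm p.completion (p.cls s)"
  \<comment> \<open>The first term of the series has norm at most \<open>L + \<eta>\<close>, and the others add up to at most
    \<open>4 * \<eta>\<close>.\<close>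
  define \<eta> where "\<eta> = (e - L) / 8"
  have \<eta>: "0 < \<eta>" using e by (simp add: \<eta>_def L_def)
  note sD = p.cauchysD[OF s]
  have "\<exists>M. \<forall>m\<ge>M. \<forall>n\<ge>M. p (aminus A (s m) (s n)) < \<eta> / 2 ^ k" for k
    using p.cauchysE[OF s, of "\<eta> / 2 ^ k"] \<eta> by (metis divide_pos_pos zero_less_numeral zero_less_power)
  then obtain M where M: "\<And>k m n. m \<ge> M k \<Longrightarrow> n \<ge> M k \<Longrightarrow> p (aminus A (s m) (s n)) < \<eta> / 2 ^ k" by metis
  have "\<forall>\<^sub>F n in sequentially. p (s n) < L + \<eta>"
    using p.tendsto_norm_completion[OF s] \<eta> unfolding L_def by (intro order_tendstoD(2)) auto
  then obtain n0 where n0: "\<And>n. n \<ge> n0 \<Longrightarrow> p (s n) < L + \<eta>" unfolding eventually_sequentially by blast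
  \<comment> \<open>The indices of the subsequence, from which on the elements of \<open>s\<close> differ by less than
    \<open>\<eta> / 2 ^ k\<close> under \<open>p\<close>.\<close>
  define r where "r k = Max (insert n0 (M ` {..Suc k})) + k" for k
  have r_ge: "x \<le> r k" if "x \<in> insert n0 (M ` {..Suc k})" for x k
    unfolding r_def by (rule trans_le_add1) (rule Max_ge, use that in auto)
  have r: "M k \<le> r k" "M (Suc k) \<le> r k" "n0 \<le> r k" "M k \<le> r (Suc k)" for k
    by (intro r_ge; simp)+
  have r_Suc: "k \<le> r k" for k by (simp add: r_def)
  obtain t where t0: "t 0 \<in> carrier A \<and> p (aminus A (s (r 0)) (t 0)) < \<eta> / 2 ^ 0 \<and> N (t 0) \<le> L + \<eta>"
    and t: "\<And>k. (t k \<in> carrier A \<and> p (aminus A (s (r k)) (t k)) < \<eta> / 2 ^ k \<and> (k = 0 \<longrightarrow> N (t 0) \<le> L + \<eta>)) \<and>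
      N (aminus A (t (Suc k)) (t k)) \<le> 2 * \<eta> / 2 ^ k"
  proof -
    have "\<exists>t. \<forall>k. (t k \<in> carrier A \<and> p (aminus A (s (r k)) (t k)) < \<eta> / 2 ^ k \<and> (k = 0 \<longrightarrow> N (t k) \<le> L + \<eta>)) \<and>
      N (aminus A (t (Suc k)) (t k)) \<le> 2 * \<eta> / 2 ^ k"
    proof (rule dependent_nat_choice)
      show "\<exists>x. x \<in> carrier A \<and> p (aminus A (s (r 0)) x) < \<eta> / 2 ^ 0 \<and> (0 = 0 \<longrightarrow> N x \<le> L + \<eta>)"
        using N.exists_truncation[OF N.cstar_seminorm p.cstar_seminorm sD n0[OF r(3)[of 0]], of \<eta>] \<eta> by auto
    next
      fix x k
      assume x: "x \<in> carrier A \<and> p (aminus A (s (r k)) x) < \<eta> / 2 ^ k \<and> (k = 0 \<longrightarrow> N x \<le> L + \<eta>)"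
      define u where "u = aminus A (s (r (Suc k))) x"
      have u: "u \<in> carrier A" using x sD by (simp add: u_def)
      have "p u \<le> p (aminus A (s (r (Suc k))) (s (r k))) + p (aminus A (s (r k)) x)"
        unfolding u_def using x sD by (intro p.norm_minus_triangle) auto
      also have "\<dots> < 2 * \<eta> / 2 ^ k"
        using x M[OF r(4)[of k] r(1)[of k]] by simp
      finally obtain v where v: "v \<in> carrier A" "N v \<le> 2 * \<eta> / 2 ^ k" "p (aminus A u v) < \<eta> / 2 ^ Suc k"
        using N.exists_truncation[OF N.cstar_seminorm p.cstar_seminorm u, of "2 * \<eta> / 2 ^ k" "\<eta> / 2 ^ Suc k"] \<eta>
        by auto
      have "aminus A (s (r (Suc k))) (aadd A x v) = aminus A u v"
        unfolding u_def using x sD v by (simp add: N.minus_minus_add)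
      moreover have "aminus A (aadd A x v) x = v"
        using x v by (simp add: aminus_def N.add_ac)
      ultimately show "\<exists>y. (y \<in> carrier A \<and> p (aminus A (s (r (Suc k))) y) < \<eta> / 2 ^ Suc k \<and>
          (Suc k = 0 \<longrightarrow> N y \<le> L + \<eta>)) \<and> N (aminus A y x) \<le> 2 * \<eta> / 2 ^ k"
        using x v by (intro exI[of _ "aadd A x v"]) simp
    qed
    then show ?thesis using that by metis
  qed
  have tD: "t k \<in> carrier A" for k using t by blast
  have step: "N (aminus A (t (k + j)) (t k)) \<le> 4 * \<eta> / 2 ^ k * (1 - 1 / 2 ^ j)" for k j
  proof (induction j)
    case 0
    then show ?case using tD by simp
  next
    case (Suc j)
    have "N (aminus A (t (k + Suc j)) (t k)) \<le>
        N (aminus A (t (Suc (k + j))) (t (k + j))) + N (aminus A (t (k + j)) (t k))"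
      using N.norm_minus_triangle[of "t (Suc (k + j))" "t (k + j)" "t k"] tD by simp
    also have "\<dots> \<le> 2 * \<eta> / 2 ^ (k + j) + 4 * \<eta> / 2 ^ k * (1 - 1 / 2 ^ j)"
      using t Suc by (intro add_mono) auto
    also have "\<dots> = 4 * \<eta> / 2 ^ k * (1 - 1 / 2 ^ Suc j)"
      by (simp add: power_add field_simps)
    finally show ?case .
  qed
  have dist: "N (aminus A (t m) (t k)) \<le> 4 * \<eta> / 2 ^ k" if "k \<le> m" for k m
  proof -
    have "N (aminus A (t m) (t k)) \<le> 4 * \<eta> / 2 ^ k * (1 - 1 / 2 ^ (m - k))"
      using step[of k "m - k"] that by simp
    also have "\<dots> \<le> 4 * \<eta> / 2 ^ k * 1" using \<eta> by (intro mult_left_mono) auto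
    finally show ?thesis by simp
  qed
  have small: "\<exists>n. C / 2 ^ n < x" if "0 < x" for x C :: real
  proof -
    obtain n where "C / x < 2 ^ n" using real_arch_pow[of 2 "C / x"] by auto
    then show ?thesis using that by (auto simp: field_simps intro!: exI[of _ n])
  qed
  have tc: "t \<in> N.cauchys"
    unfolding cauchy_seqs_def
  proof (intro CollectI conjI allI impI tD)
    fix x :: real assume "0 < x"
    then obtain K where K: "8 * \<eta> / 2 ^ K < x" using small by blast
    have "N (aminus A (t m) (t n)) < x" if "m \<ge> K" "n \<ge> K" for m n
    proof -
      have "N (aminus A (t m) (t n)) \<le> N (aminus A (t m) (t K)) + N (aminus A (t K) (t n))"
        by (intro N.norm_minus_triangle tD)
      also have "\<dots> \<le> 4 * \<eta> / 2 ^ K + 4 * \<eta> / 2 ^ K"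
        using dist that by (intro add_mono) (simp_all add: N.norm_minus_commute[OF tD tD, of K n])
      finally show ?thesis using K by simp
    qed
    then show "\<exists>K. \<forall>m\<ge>K. \<forall>n\<ge>K. N (aminus A (t m) (t n)) < x" by blast
  qed
  have "(\<lambda>n. p (aminus A (t n) (s n))) \<longlonglongrightarrow> 0"
  proof (rule LIMSEQ_I)
    fix x :: real assume "0 < x"
    then obtain K where K: "2 * \<eta> / 2 ^ K < x" using small by blast
    have "p (aminus A (t n) (s n)) < x" if n: "n \<ge> max K (M K)" for n
    proof -
      have "p (aminus A (t n) (s n)) \<le> p (aminus A (t n) (s (r n))) + p (aminus A (s (r n)) (s n))"
        by (intro p.norm_minus_triangle tD sD)
      also have "p (aminus A (t n) (s (r n))) \<le> \<eta> / 2 ^ n"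
        using t[of n] by (simp add: p.norm_minus_commute[OF tD sD])
      also have "\<eta> / 2 ^ n \<le> \<eta> / 2 ^ K"
        using n \<eta> by (intro divide_left_mono power_increasing) auto
      also have "p (aminus A (s (r n)) (s n)) < \<eta> / 2 ^ K"
        using n r_Suc[of n] by (intro M) auto
      finally show ?thesis using K by simp
    qed
    then show "\<exists>K. \<forall>n\<ge>K. norm (p (aminus A (t n) (s n)) - 0) < x"
      using p.nonneg[OF N.minus_closed[OF tD sD]] by (intro exI[of _ "max K (M K)"]) auto
  qed
  then have "p.cls t = p.cls s"
    using tc s cauchys_mono by (intro p.cls_eqI)
  moreover have "N (t n) \<le> e" for n
  proof -
    have "N (t n) \<le> N (t 0) + N (aminus A (t n) (t 0))"
      using N.norm_diff_le[OF tD tD, of n 0] by linarith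
    also have "\<dots> \<le> (L + \<eta>) + 4 * \<eta> / 2 ^ 0"
      using t0 dist[of 0 n] by (intro add_mono) auto
    also have "\<dots> \<le> e"
    proof -
      have "e = L + 8 * \<eta>" by (simp add: \<eta>_def field_simps)
      then show ?thesis using \<eta> by simp
    qed
    finally show ?thesis .
  qed
  ultimately show ?thesis using that tc by blast
qed

lemma quot_iso_nonempty:
  assumes "T \<in> carrier p.completion"
  obtains S where "S \<in> quot_iso T"
proof -
  obtain s where s: "s \<in> p.cauchys" "T = p.cls s" using assms by (auto elim: p.completionE)
  obtain t where "t \<in> N.cauchys" "p.cls t = p.cls s"
    using exists_dominated_lift[OF s(1), of "anorm p.completion (p.cls s) + 1"] by (metis less_add_one)
  then have "N.cls t \<in> quot_iso T" using cls_mono s by (auto simp: quot_iso_def N.cls_closed)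
  then show ?thesis using that by blast
qed

lemma quot_iso_mem_carrier:
  assumes "T \<in> carrier p.completion"
  shows "quot_iso T \<in> carrier quot"
proof -
  obtain S where "S \<in> quot_iso T" using quot_iso_nonempty[OF assms] .
  then obtain t where t: "t \<in> N.cauchys" "S = N.cls t" "T = p.cls t" using quot_iso_member[OF _ assms] by blast
  then show ?thesis by (auto simp: quotient_algebra_def N.cls_closed simp flip: coset_cls)
qed

lemma rep_quot_iso:
  assumes "T \<in> carrier p.completion"
  obtains t where "t \<in> N.cauchys" "rep (quot_iso T) = N.cls t" "T = p.cls t"
proof -
  obtain S where "S \<in> quot_iso T" using quot_iso_nonempty[OF assms] .
  then have "rep (quot_iso T) \<in> quot_iso T" unfolding rep_def by (rule someI)
  then show ?thesis using quot_iso_member[OF _ assms] that by blast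
qed

lemma norm_quot_iso:
  assumes T: "T \<in> carrier p.completion"
  shows "anorm quot (quot_iso T) = anorm p.completion T"
proof -
  have lower: "anorm p.completion T \<le> anorm N.completion S" if S: "S \<in> quot_iso T" for S
  proof -
    obtain t where t: "t \<in> N.cauchys" "S = N.cls t" "T = p.cls t" using quot_iso_member[OF S T] .
    show ?thesis
      unfolding t
      using p.tendsto_norm_completion[OF cauchys_mono[OF t(1)]] N.tendsto_norm_completion[OF t(1)]
      by (rule LIMSEQ_le) (use p_le_N N.cauchysD[OF t(1)] in auto)
  qed
  have bdd: "bdd_below (anorm N.completion ` quot_iso T)"
    using lower by (auto intro!: bdd_belowI2)
  have "(INF S\<in>quot_iso T. anorm N.completion S) \<le> anorm p.completion T + d" if d: "0 < d" for d
  proof -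
    obtain s where s: "s \<in> p.cauchys" "T = p.cls s" using T by (auto elim: p.completionE)
    obtain t where t: "t \<in> N.cauchys" "p.cls t = p.cls s" "\<And>n. N (t n) \<le> anorm p.completion T + d"
      using exists_dominated_lift[OF s(1), of "anorm p.completion T + d"] d s(2)
      by (metis less_add_same_cancel1)
    have "N.cls t \<in> quot_iso T" using t cls_mono s by (auto simp: quot_iso_def N.cls_closed)
    then have "(INF S\<in>quot_iso T. anorm N.completion S) \<le> anorm N.completion (N.cls t)"
      using bdd by (intro cINF_lower)
    also have "\<dots> \<le> anorm p.completion T + d"
      using N.tendsto_norm_completion[OF t(1)] by (rule LIMSEQ_le_const2) (use t in auto)
    finally show ?thesis .
  qed
  then have "(INF S\<in>quot_iso T. anorm N.completion S) \<le> anorm p.completion T"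
    by (rule field_le_epsilon)
  moreover have "anorm p.completion T \<le> (INF S\<in>quot_iso T. anorm N.completion S)"
    using lower quot_iso_nonempty[OF T] by (intro cINF_greatest) auto
  ultimately show ?thesis by (simp add: quotient_algebra_def)
qed

theorem isometric_star_isomorphism_quot_iso:
  "isometric_star_isomorphism p.completion quot quot_iso"
  unfolding isometric_star_isomorphism_def
proof (intro conjI ballI allI)
  show "bij_betw quot_iso (carrier p.completion) (carrier quot)"
    unfolding bij_betw_def
  proof
    show "inj_on quot_iso (carrier p.completion)"
    proof (rule inj_onI)
      fix S T assume ST: "S \<in> carrier p.completion" "T \<in> carrier p.completion" "quot_iso S = quot_iso T"
      obtain X where X: "X \<in> quot_iso S" using quot_iso_nonempty[OF ST(1)] .
      then have X': "X \<in> quot_iso T" using ST(3) by simp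
      obtain s where s: "s \<in> N.cauchys" "X = N.cls s" "S = p.cls s" using quot_iso_member[OF X ST(1)] .
      obtain t where t: "t \<in> N.cauchys" "X = N.cls t" "T = p.cls t" using quot_iso_member[OF X' ST(2)] .
      have "t \<in> p.cls s" using cls_mono[OF s(1)] N.cls_refl[OF t(1)] s(2) t(2) by blast
      then show "S = T" using s(3) t(3) p.cls_eq[OF cauchys_mono[OF s(1)]] by simp
    qed
    show "quot_iso ` carrier p.completion = carrier quot"
    proof
      show "quot_iso ` carrier p.completion \<subseteq> carrier quot" using quot_iso_mem_carrier by blast
      show "carrier quot \<subseteq> quot_iso ` carrier p.completion"
        by (auto simp: quotient_algebra_def N.carrier_completion coset_cls p.carrier_completion cauchys_mono)
    qed
  qed
next
  fix S T assume ST: "S \<in> carrier p.completion" "T \<in> carrier p.completion"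
  obtain s where s: "s \<in> N.cauchys" "rep (quot_iso S) = N.cls s" "S = p.cls s" using rep_quot_iso[OF ST(1)] .
  obtain t where t: "t \<in> N.cauchys" "rep (quot_iso T) = N.cls t" "T = p.cls t" using rep_quot_iso[OF ST(2)] .
  show "quot_iso (aadd p.completion S T) = aadd quot (quot_iso S) (quot_iso T)"
    using s t by (simp add: quotient_algebra_def N.completion_add coset_cls N.cauchys_add p.completion_add cauchys_mono)
  show "quot_iso (amult p.completion S T) = amult quot (quot_iso S) (quot_iso T)"
    using s t by (simp add: quotient_algebra_def N.completion_mult coset_cls N.cauchys_mult p.completion_mult cauchys_mono)
next
  fix S c assume S: "S \<in> carrier p.completion"
  obtain s where s: "s \<in> N.cauchys" "rep (quot_iso S) = N.cls s" "S = p.cls s" using rep_quot_iso[OF S] .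
  show "quot_iso (ascale p.completion c S) = ascale quot c (quot_iso S)"
    using s by (simp add: quotient_algebra_def N.completion_scale coset_cls N.cauchys_scale p.completion_scale cauchys_mono)
  show "quot_iso (astar p.completion S) = astar quot (quot_iso S)"
    using s by (simp add: quotient_algebra_def N.completion_star coset_cls N.cauchys_star p.completion_star cauchys_mono)
  show "anorm quot (quot_iso S) = anorm p.completion S"
    using S by (rule norm_quot_iso)
qed

lemma quot_iso_into:
  "a \<in> carrier A \<Longrightarrow>
    quot_iso (into_completion A p a) = coset N.completion null_ideal (into_completion A N a)"
  by (simp add: into_completion_def coset_cls N.cauchys_const)

corollary norm_coset_into:
  "a \<in> carrier A \<Longrightarrow> anorm quot (coset N.completion null_ideal (into_completion A N a)) = p a"
  by (simp add: norm_quot_iso p.into_closed p.norm_into flip: quot_iso_into)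

end

section \<open>Open bisections of etale groupoids\<close>

context etale_groupoid
begin

abbreviation \<r> where "\<r> \<equiv> grange G"
abbreviation \<s> where "\<s> \<equiv> gsource G"
abbreviation \<iota> where "\<iota> \<equiv> ginv G"
abbreviation gprod (infixl "\<diamondop>" 70) where "a \<diamondop> b \<equiv> gmult G a b"
abbreviation X where "X \<equiv> units G"
abbreviation Cc where "Cc \<equiv> Cc_units G"

lemma range_range [simp]: "\<r> (\<r> a) = \<r> a"
  using range_source[of "\<r> a"] source_range[of a] by simp

lemma source_source [simp]: "\<s> (\<s> a) = \<s> a"
  using source_range[of "\<s> a"] range_source[of a] by simp

lemma range_mem [simp]: "\<r> a \<in> X"
  by (simp add: units_def)

lemma source_mem [simp]: "\<s> a \<in> X"
  using range_mem[of "\<s> a"] by (simp add: range_source)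

lemma range_of_unit [simp]: "x \<in> X \<Longrightarrow> \<r> x = x"
  by (auto simp: units_def)

lemma source_of_unit [simp]: "x \<in> X \<Longrightarrow> \<s> x = x"
  by (metis source_range range_of_unit)

lemma mem_units_iff: "a \<in> X \<longleftrightarrow> \<r> a = a"
  by (metis range_mem range_of_unit)

lemma composable_iff [simp]: "(a, b) \<in> composable G \<longleftrightarrow> \<s> a = \<r> b"
  by (simp add: composable_def)

lemma mult_range [simp]: "\<s> a = \<r> b \<Longrightarrow> \<r> (a \<diamondop> b) = \<r> a"
  and mult_source [simp]: "\<s> a = \<r> b \<Longrightarrow> \<s> (a \<diamondop> b) = \<s> b"
  and assoc: "\<s> a = \<r> b \<Longrightarrow> \<s> b = \<r> c \<Longrightarrow> a \<diamondop> b \<diamondop> c = a \<diamondop> (b \<diamondop> c)"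
  by (simp_all add: range_mult source_mult mult_assoc)

lemmas inverse_simps [simp] = range_inv source_inv mult_inv inv_mult source_range range_source

lemma unit_mult [simp]: "x \<in> X \<Longrightarrow> x = \<r> a \<Longrightarrow> x \<diamondop> a = a"
  and mult_unit [simp]: "x \<in> X \<Longrightarrow> x = \<s> a \<Longrightarrow> a \<diamondop> x = a"
  by (simp_all add: range_unit source_unit)

lemma inv_inv [simp]: "\<iota> (\<iota> a) = a"
proof -
  have "a \<diamondop> \<iota> a \<diamondop> \<iota> (\<iota> a) = a \<diamondop> (\<iota> a \<diamondop> \<iota> (\<iota> a))"
    by (rule assoc) simp_all
  then show ?thesis by simp
qed

lemma inv_mult_cancel [simp]: "\<s> a = \<r> b \<Longrightarrow> \<iota> a \<diamondop> (a \<diamondop> b) = b"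
  using assoc[of "\<iota> a" a b] by simp

lemma mult_inv_cancel [simp]: "\<r> a = \<r> b \<Longrightarrow> a \<diamondop> (\<iota> a \<diamondop> b) = b"
  using assoc[of a "\<iota> a" b] by simp

lemma mult_inv_cancel_right [simp]: "\<s> a = \<r> b \<Longrightarrow> a \<diamondop> b \<diamondop> \<iota> b = a"
  using assoc[of a b "\<iota> b"] by simp

lemma inv_mult_cancel_right [simp]: "\<s> a = \<s> b \<Longrightarrow> a \<diamondop> \<iota> b \<diamondop> b = a"
  using assoc[of a "\<iota> b" b] by simp

lemma inv_of_mult: "\<s> a = \<r> b \<Longrightarrow> \<iota> (a \<diamondop> b) = \<iota> b \<diamondop> \<iota> a"
proof -
  assume ab: "\<s> a = \<r> b"
  have "\<iota> (a \<diamondop> b) = \<iota> b \<diamondop> (b \<diamondop> \<iota> (a \<diamondop> b))" using ab by simp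
  also have "b \<diamondop> \<iota> (a \<diamondop> b) = \<iota> a \<diamondop> (a \<diamondop> (b \<diamondop> \<iota> (a \<diamondop> b)))" using ab by simp
  also have "a \<diamondop> (b \<diamondop> \<iota> (a \<diamondop> b)) = \<r> a"
    using ab assoc[of a b "\<iota> (a \<diamondop> b)"] by simp
  finally show ?thesis by simp
qed

lemma inv_of_unit [simp]: "x \<in> X \<Longrightarrow> \<iota> x = x"
  by (metis inv_mult mult_inv mult_unit range_inv range_of_unit source_of_unit unit_mult)

subsection \<open>Topology\<close>

lemma inv_image_eq_vimage: "\<iota> ` S = \<iota> -` S"
  by (auto simp: image_iff) (metis inv_inv)

lemma open_inv_image: "open S \<Longrightarrow> open (\<iota> ` S)"
  unfolding inv_image_eq_vimage using continuous_inv open_vimage by blast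

lemma continuous_range: "continuous_on UNIV \<r>"
proof -
  have "\<forall>a. \<exists>U. open U \<and> a \<in> U \<and> continuous_on U \<r>"
    using range_local_homeomorphism unfolding homeomorphism_def by meson
  then obtain U where U: "\<And>a. open (U a)" "\<And>a. a \<in> U a" "\<And>a. continuous_on (U a) \<r>" by metis
  have "continuous_on (\<Union>a. U a) \<r>" by (rule continuous_on_open_UN) (use U in auto)
  moreover have "(\<Union>a. U a) = UNIV" using U(2) by blast
  ultimately show ?thesis by simp
qed

lemma source_eq_range_inv: "\<s> = (\<lambda>a. \<r> (\<iota> a))"
  by auto

lemma continuous_source: "continuous_on UNIV \<s>"
  unfolding source_eq_range_inv
  by (rule continuous_on_compose2[OF continuous_range continuous_inv]) auto

lemma continuous_on_range [continuous_intros]: "continuous_on S f \<Longrightarrow> continuous_on S (\<lambda>x. \<r> (f x))"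
  by (rule continuous_on_compose2[OF continuous_range]) auto

lemma continuous_on_source [continuous_intros]: "continuous_on S f \<Longrightarrow> continuous_on S (\<lambda>x. \<s> (f x))"
  by (rule continuous_on_compose2[OF continuous_source]) auto

lemma continuous_on_inv [continuous_intros]: "continuous_on S f \<Longrightarrow> continuous_on S (\<lambda>x. \<iota> (f x))"
  by (rule continuous_on_compose2[OF continuous_inv]) auto

lemma continuous_on_mult:
  assumes "continuous_on S f" "continuous_on S h" "\<And>x. x \<in> S \<Longrightarrow> \<s> (f x) = \<r> (h x)"
  shows "continuous_on S (\<lambda>x. f x \<diamondop> h x)"
proof -
  have "continuous_on S (\<lambda>x. case (f x, h x) of (a, b) \<Rightarrow> a \<diamondop> b)"
    by (rule continuous_on_compose2[OF continuous_mult]) (use assms in \<open>auto intro: continuous_on_Pair\<close>)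
  then show ?thesis by simp
qed

text \<open>Near a unit, an arrow and its range lie in a common set on which \<open>\<r>\<close> is injective. They have
  the same range, so that they agree.\<close>

lemma open_units: "open X"
proof (subst open_subopen, intro ballI)
  fix x assume x: "x \<in> X"
  obtain U V h where U: "open U" "x \<in> U" "homeomorphism U V \<r> h"
    using range_local_homeomorphism by blast
  have "open (U \<inter> \<r> -` U)" using U(1) open_vimage[OF U(1) continuous_range] by blast
  moreover have "a \<in> X" if "a \<in> U \<inter> \<r> -` U" for a
    using that homeomorphism_apply1[OF U(3), of a] homeomorphism_apply1[OF U(3), of "\<r> a"]
    by (simp add: mem_units_iff)
  ultimately show "\<exists>T. open T \<and> x \<in> T \<and> T \<subseteq> X"
    using U x by (intro exI[of _ "U \<inter> \<r> -` U"]) auto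
qed

lemma openin_units: "openin (top_of_set X) S \<longleftrightarrow> open S \<and> S \<subseteq> X"
  using open_units openin_open_eq by blast

lemma open_range_image:
  assumes "open S"
  shows "open (\<r> ` S)"
proof (subst open_subopen, intro ballI)
  fix y assume "y \<in> \<r> ` S"
  then obtain a where a: "a \<in> S" "y = \<r> a" by auto
  obtain U V h where U: "open U" "a \<in> U" "openin (top_of_set X) V" "homeomorphism U V \<r> h"
    using range_local_homeomorphism by blast
  have "openin (top_of_set V) (\<r> ` (U \<inter> S))"
    using U assms by (intro homeomorphism_imp_open_map[OF U(4)]) (simp add: openin_open_Int)
  then have "open (\<r> ` (U \<inter> S))"
    using U(3) openin_trans openin_units by blast
  then show "\<exists>T. open T \<and> y \<in> T \<and> T \<subseteq> \<r> ` S"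
    using U a by (intro exI[of _ "\<r> ` (U \<inter> S)"]) auto
qed

lemma open_source_image:
  assumes "open S"
  shows "open (\<s> ` S)"
proof -
  have "\<s> ` S = \<r> ` (\<iota> ` S)" by (auto simp: image_image)
  then show ?thesis using open_range_image open_inv_image assms by metis
qed

lemma open_bisection_units: "open_bisection G X"
  by (auto simp: open_bisection_def open_units inj_on_def)

lemma open_bisection_subset: "open_bisection G U \<Longrightarrow> open V \<Longrightarrow> V \<subseteq> U \<Longrightarrow> open_bisection G V"
  by (auto simp: open_bisection_def intro: inj_on_subset)

lemma open_bisection_inv:
  assumes "open_bisection G U"
  shows "open_bisection G (\<iota> ` U)"
  using assms open_inv_image[of U] by (auto simp: open_bisection_def inj_on_def)

lemma bisection_range_eq: "open_bisection G U \<Longrightarrow> a \<in> U \<Longrightarrow> b \<in> U \<Longrightarrow> \<r> a = \<r> b \<Longrightarrow> a = b"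
  and bisection_source_eq: "open_bisection G U \<Longrightarrow> a \<in> U \<Longrightarrow> b \<in> U \<Longrightarrow> \<s> a = \<s> b \<Longrightarrow> a = b"
  by (auto simp: open_bisection_def inj_on_def)

definition range_lift :: "'g set \<Rightarrow> 'g \<Rightarrow> 'g" where
  "range_lift U = inv_into U \<r>"

lemma range_lift_range: "open_bisection G U \<Longrightarrow> a \<in> U \<Longrightarrow> range_lift U (\<r> a) = a"
  by (simp add: range_lift_def open_bisection_def)

lemma continuous_on_range_lift:
  assumes "open_bisection G U"
  shows "continuous_on (\<r> ` U) (range_lift U)"
proof -
  have "range_lift U -` B \<inter> \<r> ` U = \<r> ` (U \<inter> B)" for B
    using range_lift_range[OF assms] by auto
  then show ?thesis
    using assms by (subst continuous_on_open_vimage) (auto simp: open_bisection_def open_range_image open_Int)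
qed

definition set_mult :: "'g set \<Rightarrow> 'g set \<Rightarrow> 'g set" where
  "set_mult U V = (\<lambda>(a, b). a \<diamondop> b) ` {(a, b). a \<in> U \<and> b \<in> V \<and> \<s> a = \<r> b}"

lemma set_multI: "a \<in> U \<Longrightarrow> b \<in> V \<Longrightarrow> \<s> a = \<r> b \<Longrightarrow> a \<diamondop> b \<in> set_mult U V"
  by (auto simp: set_mult_def)

lemma set_multE:
  assumes "g \<in> set_mult U V"
  obtains a b where "a \<in> U" "b \<in> V" "\<s> a = \<r> b" "g = a \<diamondop> b"
  using assms by (auto simp: set_mult_def)

definition left_factor :: "'g set \<Rightarrow> 'g \<Rightarrow> 'g" where
  "left_factor U g = range_lift U (\<r> g)"

definition right_factor :: "'g set \<Rightarrow> 'g \<Rightarrow> 'g" where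
  "right_factor U g = \<iota> (left_factor U g) \<diamondop> g"

lemma factors_mult:
  "open_bisection G U \<Longrightarrow> a \<in> U \<Longrightarrow> \<s> a = \<r> b \<Longrightarrow> left_factor U (a \<diamondop> b) = a"
  "open_bisection G U \<Longrightarrow> a \<in> U \<Longrightarrow> \<s> a = \<r> b \<Longrightarrow> right_factor U (a \<diamondop> b) = b"
  by (simp_all add: left_factor_def right_factor_def range_lift_range)

lemma left_factor_mem:
  assumes "open_bisection G U" "\<r> g \<in> \<r> ` U"
  shows "left_factor U g \<in> U" "\<r> (left_factor U g) = \<r> g"
  using assms by (auto simp: left_factor_def range_lift_def inv_into_into f_inv_into_f)

lemma continuous_on_factors:
  assumes "open_bisection G U"
  shows "continuous_on (\<r> -` \<r> ` U) (left_factor U)" "continuous_on (\<r> -` \<r> ` U) (right_factor U)"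
proof -
  show *: "continuous_on (\<r> -` \<r> ` U) (left_factor U)"
    unfolding left_factor_def
    by (rule continuous_on_compose2[OF continuous_on_range_lift[OF assms]]) (auto intro!: continuous_intros)
  show "continuous_on (\<r> -` \<r> ` U) (right_factor U)"
    unfolding right_factor_def
    using left_factor_mem[OF assms] by (intro continuous_on_mult continuous_intros *) auto
qed

text \<open>Because \<open>\<r>\<close> is injective on \<open>U\<close>, the left factor can be recovered from the range of the
  product, and it depends continuously on it.\<close>

lemma set_mult_eq:
  assumes U: "open_bisection G U"
  shows "set_mult U V = \<r> -` \<r> ` U \<inter> right_factor U -` V"
proof (intro equalityI subsetI)
  fix g assume "g \<in> set_mult U V"
  then obtain a b where "a \<in> U" "b \<in> V" "\<s> a = \<r> b" "g = a \<diamondop> b" by (rule set_multE)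
  then show "g \<in> \<r> -` \<r> ` U \<inter> right_factor U -` V" using U by (auto simp: factors_mult)
next
  fix g assume g: "g \<in> \<r> -` \<r> ` U \<inter> right_factor U -` V"
  then have "left_factor U g \<diamondop> right_factor U g \<in> set_mult U V"
    using left_factor_mem[OF U] by (intro set_multI) (auto simp: right_factor_def)
  moreover have "left_factor U g \<diamondop> right_factor U g = g"
    using g left_factor_mem[OF U] by (simp add: right_factor_def)
  ultimately show "g \<in> set_mult U V" by simp
qed

lemma open_bisection_set_mult:
  assumes U: "open_bisection G U" and V: "open_bisection G V"
  shows "open_bisection G (set_mult U V)"
  unfolding open_bisection_def
proof (intro conjI)
  have "open (\<r> -` \<r> ` U)"
    using U by (intro open_vimage continuous_range open_range_image) (auto simp: open_bisection_def)
  then show "open (set_mult U V)"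
    unfolding set_mult_eq[OF U] using V continuous_on_factors(2)[OF U]
    by (metis Int_commute continuous_on_open_vimage open_bisection_def)
  show "inj_on \<r> (set_mult U V)"
  proof (rule inj_onI)
    fix g h assume g: "g \<in> set_mult U V" and h: "h \<in> set_mult U V" and eq: "\<r> g = \<r> h"
    obtain a b where ab: "a \<in> U" "b \<in> V" "\<s> a = \<r> b" "g = a \<diamondop> b" using g by (rule set_multE)
    obtain c d where cd: "c \<in> U" "d \<in> V" "\<s> c = \<r> d" "h = c \<diamondop> d" using h by (rule set_multE)
    have "a = c" using bisection_range_eq[OF U ab(1) cd(1)] ab cd eq by simp
    then show "g = h" using bisection_range_eq[OF V ab(2) cd(2)] ab cd by simp
  qed
  show "inj_on \<s> (set_mult U V)"
  proof (rule inj_onI)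
    fix g h assume g: "g \<in> set_mult U V" and h: "h \<in> set_mult U V" and eq: "\<s> g = \<s> h"
    obtain a b where ab: "a \<in> U" "b \<in> V" "\<s> a = \<r> b" "g = a \<diamondop> b" using g by (rule set_multE)
    obtain c d where cd: "c \<in> U" "d \<in> V" "\<s> c = \<r> d" "h = c \<diamondop> d" using h by (rule set_multE)
    have "b = d" using bisection_source_eq[OF V ab(2) cd(2)] ab cd eq by simp
    then show "g = h" using bisection_source_eq[OF U ab(1) cd(1)] ab cd by simp
  qed
qed

lemma open_units_diff_compact:
  assumes "compact K" "K \<subseteq> X"
  shows "open (X - K)"
proof -
  have "compactin (top_of_set X) K" using assms by (simp add: compactin_subtopology)
  then have "closedin (top_of_set X) K" using Hausdorff_units by (rule compactin_imp_closedin[rotated])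
  then show ?thesis using openin_units by (auto simp: closedin_def)
qed

lemma compact_range_image: "compact K \<Longrightarrow> compact (\<r> ` K)"
  and compact_source_image: "compact K \<Longrightarrow> compact (\<s> ` K)"
  using compact_continuous_image continuous_range continuous_source continuous_on_subset subset_UNIV by metis+

text \<open>Compact sets need not be closed, because the groupoid need not be Hausdorff. A bisection,
  however, is embedded into the Hausdorff unit space by the range map.\<close>

lemma compact_subset_bisection_closed:
  assumes U: "open_bisection G U" and K: "compact K" "K \<subseteq> U"
  shows "U \<inter> closure K = K" "open (U - K)"
proof -
  have eq: "U - K = U \<inter> \<r> -` (X - \<r> ` K)"
    using K(2) by auto (metis bisection_range_eq[OF U] subsetD)
  have "open (X - \<r> ` K)" using K by (intro open_units_diff_compact compact_range_image) auto
  then show *: "open (U - K)"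
    unfolding eq using U by (intro open_Int open_vimage continuous_range) (auto simp: open_bisection_def)
  have "closure K \<subseteq> - (U - K)"
    using closed_Compl[OF *] by (intro closure_minimal) auto
  then show "U \<inter> closure K = K" using K(2) closure_subset[of K] by blast
qed

lemma compact_support_bisection:
  assumes U: "open_bisection G U" and K: "compact K" "K \<subseteq> U" and S: "S \<subseteq> K"
  shows "compact (U \<inter> closure S)"
proof -
  have "U \<inter> closure S = K \<inter> closure S"
    using compact_subset_bisection_closed(1)[OF U K] closure_mono[OF S] K(2) by blast
  then show ?thesis using K(1) compact_Int_closed closed_closure by metis
qed

text \<open>The composable pairs form a closed subset of \<open>K \<times> L\<close>, as they are defined by an equation
  between points of the Hausdorff unit space.\<close>

lemma compact_set_mult:
  assumes U: "compact K" and V: "compact L"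
  shows "compact (set_mult K L)"
proof -
  define P where "P = {(a, b). a \<in> K \<and> b \<in> L \<and> \<s> a = \<r> b}"
  have "open {(y, z). y \<in> X \<and> z \<in> X \<and> y \<noteq> z}"
  proof (subst open_subopen, intro ballI)
    fix q assume q: "q \<in> {(y, z). y \<in> X \<and> z \<in> X \<and> y \<noteq> z}"
    then obtain y z where yz: "q = (y, z)" "y \<in> X" "z \<in> X" "y \<noteq> z" by auto
    then obtain S T where "open S" "open T" "S \<subseteq> X" "T \<subseteq> X" "y \<in> S" "z \<in> T" "S \<inter> T = {}"
      using Hausdorff_units unfolding Hausdorff_space_def openin_units disjnt_def by (metis topspace_euclidean_subtopology)
    then show "\<exists>T. open T \<and> q \<in> T \<and> T \<subseteq> {(y, z). y \<in> X \<and> z \<in> X \<and> y \<noteq> z}"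
      using yz by (intro exI[of _ "S \<times> T"]) (auto intro: open_Times)
  qed
  then have "open ((\<lambda>(a, b). (\<s> a, \<r> b)) -` {(y, z). y \<in> X \<and> z \<in> X \<and> y \<noteq> z})"
    by (rule open_vimage) (auto simp: case_prod_unfold intro!: continuous_intros)
  moreover have "P = (K \<times> L) \<inter> - ((\<lambda>(a, b). (\<s> a, \<r> b)) -` {(y, z). y \<in> X \<and> z \<in> X \<and> y \<noteq> z})"
    by (auto simp: P_def)
  ultimately have "compact P"
    using compact_Int_closed[OF compact_Times[OF U V]] by (simp add: closed_Compl)
  then have "compact ((\<lambda>(a, b). a \<diamondop> b) ` P)"
    by (intro compact_continuous_image continuous_on_subset[OF continuous_mult]) (auto simp: P_def)
  then show ?thesis by (simp add: set_mult_def P_def)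
qed

lemma set_mult_mono: "K \<subseteq> U \<Longrightarrow> L \<subseteq> V \<Longrightarrow> set_mult K L \<subseteq> set_mult U V"
  by (auto simp: set_mult_def)

subsection \<open>Functions on the unit space\<close>

lemma Cc_unitsI:
  assumes "continuous_on X f" "compact K" "K \<subseteq> X" "\<And>x. x \<in> X \<Longrightarrow> x \<notin> K \<Longrightarrow> f x = 0"
  shows "f \<in> Cc"
proof -
  have "{x \<in> X. f x \<noteq> 0} \<subseteq> K" using assms(4) by blast
  then show ?thesis
    unfolding Cc_units_def using assms compact_support_bisection[OF open_bisection_units, of K] by auto
qed

lemma Cc_unitsE:
  assumes "f \<in> Cc"
  obtains K where "continuous_on X f" "compact K" "K \<subseteq> X" "\<And>x. x \<in> X \<Longrightarrow> x \<notin> K \<Longrightarrow> f x = 0"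
proof -
  have "{x \<in> X. f x \<noteq> 0} \<subseteq> closure {x \<in> X. f x \<noteq> 0}" by (rule closure_subset)
  then show ?thesis
    using assms that[of "X \<inter> closure {x \<in> X. f x \<noteq> 0}"] by (auto simp: Cc_units_def)
qed

text \<open>Urysohn's lemma, applied to \<open>K\<close> and the complement of a neighbourhood of \<open>K\<close> that is
  contained in a compact subset of \<open>W\<close>.\<close>

lemma exists_cutoff:
  assumes K: "compact K" "K \<subseteq> W" and W: "open W" "W \<subseteq> X"
  obtains a :: "'g \<Rightarrow> real" and L where "continuous_on X a" "\<And>x. 0 \<le> a x" "\<And>x. a x \<le> 1"
    "\<And>x. x \<in> K \<Longrightarrow> a x = 1" "compact L" "L \<subseteq> W" "\<And>x. x \<in> X \<Longrightarrow> x \<notin> L \<Longrightarrow> a x = 0"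
proof -
  have top_W: "top_of_set W = subtopology (top_of_set X) W"
    using W(2) by (simp add: subtopology_subtopology Int_absorb1)
  have "openin (top_of_set X) W" using W openin_units by blast
  then have "locally_compact_space (top_of_set W)"
    unfolding top_W by (rule locally_compact_space_open_subset[OF disjI1[OF Hausdorff_units] locally_compact_units])
  moreover have "Hausdorff_space (top_of_set W)"
    unfolding top_W by (rule Hausdorff_space_subtopology[OF Hausdorff_units])
  moreover have "compactin (top_of_set W) K" using K by (simp add: compactin_subtopology)
  ultimately obtain U L where U: "openin (top_of_set W) U" "compactin (top_of_set W) L" "K \<subseteq> U" "U \<subseteq> L"
    using locally_compact_space_compact_closed_compact[of "top_of_set W"] by metis
  have oU: "open U" "U \<subseteq> W" "compact L" "L \<subseteq> W"
    using U W(1) openin_open_eq by (auto simp: compactin_subtopology)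
  have "completely_regular_space (top_of_set X)"
    using locally_compact_units Hausdorff_units locally_compact_regular_imp_completely_regular_space by blast
  moreover have "compactin (top_of_set X) K" using K W by (simp add: compactin_subtopology)
  moreover have "closedin (top_of_set X) (X - U)"
    using oU W by (auto simp: closedin_def openin_units double_diff)
  moreover have "disjnt K (X - U)" using U by (auto simp: disjnt_def)
  ultimately obtain f :: "'g \<Rightarrow> real" where f: "continuous_map (top_of_set X) (top_of_set {0..1}) f"
    "f ` (X - U) \<subseteq> {0}" "f ` K \<subseteq> {1}"
    using Urysohn_completely_regular_compact_closed[of 0 1] zero_le_one by metis
  define a where "a x = max 0 (min 1 (f x))" for x
  have "continuous_on X f" using f(1) by (auto simp: continuous_map_in_subtopology)
  then have "continuous_on X a" unfolding a_def by (intro continuous_intros)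
  moreover have "a x = 1" if "x \<in> K" for x using f(3) that by (auto simp: a_def)
  moreover have "a x = 0" if "x \<in> X" "x \<notin> L" for x
  proof -
    have "f x = 0" using f(2) that U(4) by blast
    then show ?thesis by (simp add: a_def)
  qed
  moreover have "0 \<le> a x" "a x \<le> 1" for x by (simp_all add: a_def)
  ultimately show ?thesis using that oU by blast
qed

end

section \<open>Fell line bundles in coordinates\<close>

context normed_lines
begin

lemma proj_zero [simp]: "proj L (lzero L g) = g"
proof -
  interpret comm_group "fibre L g" by (rule fibre_group)
  show ?thesis using one_closed by (simp add: fibre_def)
qed

lemma proj_add: "proj L u = proj L v \<Longrightarrow> proj L (ladd L u v) = proj L u"
proof -
  assume uv: "proj L u = proj L v"
  interpret comm_group "fibre L (proj L u)" by (rule fibre_group)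
  show ?thesis using m_closed[of u v] uv by (simp add: fibre_def)
qed

lemma add_zero_right: "ladd L u (lzero L (proj L u)) = u"
proof -
  interpret comm_group "fibre L (proj L u)" by (rule fibre_group)
  show ?thesis using r_one[of u] by (simp add: fibre_def)
qed

lemma scale_0: "lscale L 0 u = lzero L (proj L u)"
  using norm_eq_zero[of "lscale L 0 u"] by (simp add: norm_scale proj_scale)

lemma norm_zero [simp]: "lnorm L (lzero L g) = 0"
  using norm_eq_zero[of "lzero L g"] by simp

lemma scale_inj:
  assumes "lscale L c u = lscale L d u" "lnorm L u \<noteq> 0"
  shows "c = d"
proof -
  have "lscale L (c + (- d)) u = lscale L (d + (- d)) u"
    unfolding scale_add_left using assms by simp
  then have "lnorm L (lscale L (c + (- d)) u) = lnorm L (lscale L (d + (- d)) u)" by simp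
  then show ?thesis using assms(2) by (simp add: norm_scale)
qed

lemma exists_unit_vector: "\<exists>e. proj L e = g \<and> lnorm L e = 1"
proof -
  obtain e where e: "e \<noteq> lzero L g" "carrier (fibre L g) = range (\<lambda>c. lscale L c e)"
    using one_dimensional by blast
  have "lscale L 1 e \<in> carrier (fibre L g)" using e(2) by blast
  then have "proj L e = g" by (simp add: fibre_def scale_one)
  moreover have "lnorm L e \<noteq> 0" using e(1) calculation norm_eq_zero by blast
  ultimately show ?thesis
    using norm_nonneg[of e]
    by (intro exI[of _ "lscale L (of_real (1 / lnorm L e)) e"]) (simp add: proj_scale norm_scale norm_divide)
qed

lemma exists_scalar:
  assumes "proj L u = proj L v" "lnorm L v \<noteq> 0"
  shows "\<exists>c. u = lscale L c v"
proof -
  obtain e where e: "e \<noteq> lzero L (proj L v)" "carrier (fibre L (proj L v)) = range (\<lambda>c. lscale L c e)"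
    using one_dimensional by blast
  have "u \<in> range (\<lambda>c. lscale L c e)" "v \<in> range (\<lambda>c. lscale L c e)"
    using assms by (auto simp: fibre_def simp flip: e(2))
  then obtain a b where ab: "u = lscale L a e" "v = lscale L b e" by blast
  then have "b \<noteq> 0" using assms(2) by (auto simp: norm_scale)
  then have "u = lscale L (a / b) v" using ab by (simp add: scale_scale)
  then show ?thesis by blast
qed

end

context fell_line_bundle
begin

text \<open>A unit vector \<open>e\<close> satisfies \<open>ee = ke\<close> for a scalar \<open>k\<close>, which is nonzero by the C*-identity,
  so that \<open>e / k\<close> is idempotent. A multiple of an idempotent by \<open>c\<close> is idempotent only if
  \<open>c\<^sup>2 = c\<close>.\<close>

lemma fibre_unit_exists1: "x \<in> X \<Longrightarrow> \<exists>!e. proj L e = x \<and> e \<noteq> lzero L x \<and> lmult L e e = e"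
proof -
  assume x: "x \<in> X"
  obtain e where e: "proj L e = x" "lnorm L e = 1" using exists_unit_vector by blast
  have comp: "(u, v) \<in> lcomposable G L" if "proj L u = x" "proj L v = x" for u v
    using that x by (simp add: lcomposable_def)
  have projm: "proj L (lmult L u v) = x" if "proj L u = x" "proj L v = x" for u v
    using that x comp[OF that] by (simp add: proj_mult)
  obtain k where k: "lmult L e e = lscale L k e" using exists_scalar[of "lmult L e e" e] e projm by auto
  obtain m where m: "lstar L e = lscale L m e" using exists_scalar[of "lstar L e" e] e x by (auto simp: proj_star)
  have "lmult L (lstar L e) e = lscale L (m * k) e"
    using mult_scale_left[OF comp[OF e(1) e(1)]] k m by (simp add: scale_scale)
  then have "k \<noteq> 0" using norm_star_mult[of e] e by (auto simp: norm_scale)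
  define i where "i = lscale L (1 / k) e"
  have i: "proj L i = x" "lnorm L i \<noteq> 0" using e \<open>k \<noteq> 0\<close> by (simp_all add: i_def proj_scale norm_scale norm_divide)
  have "lmult L i i = i"
    unfolding i_def using e \<open>k \<noteq> 0\<close> k
    by (simp add: mult_scale_left mult_scale_right comp proj_scale scale_scale)
  show ?thesis
  proof (rule ex1I[of _ i])
    show "proj L i = x \<and> i \<noteq> lzero L x \<and> lmult L i i = i" using i \<open>lmult L i i = i\<close> norm_eq_zero by auto
  next
    fix j assume j: "proj L j = x \<and> j \<noteq> lzero L x \<and> lmult L j j = j"
    obtain c where c: "j = lscale L c i" using exists_scalar[of j i] i j by auto
    have "lscale L (c * c) i = lmult L j j"
      unfolding c using i \<open>lmult L i i = i\<close> by (simp add: mult_scale_left mult_scale_right comp proj_scale scale_scale)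
    then have "c * c = c" using j c scale_inj i by metis
    moreover have "c \<noteq> 0" using j c i scale_0[of i] by auto
    ultimately show "j = i" using c by (simp add: scale_one)
  qed
qed

lemma fibre_unit:
  assumes x: "x \<in> X"
  shows proj_fibre_unit: "proj L (fibre_unit L x) = x"
    and fibre_unit_nonzero: "lnorm L (fibre_unit L x) \<noteq> 0"
    and fibre_unit_mult_self: "lmult L (fibre_unit L x) (fibre_unit L x) = fibre_unit L x"
  using theI'[OF fibre_unit_exists1[OF x]] norm_eq_zero[of "fibre_unit L x"]
  unfolding fibre_unit_def[symmetric] by auto

lemma star_fibre_unit:
  assumes x: "x \<in> X"
  shows "lstar L (fibre_unit L x) = fibre_unit L x"
proof -
  let ?e = "fibre_unit L x"
  have comp: "(?e, ?e) \<in> lcomposable G L" using x by (simp add: lcomposable_def proj_fibre_unit)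
  have proj: "proj L (lstar L ?e) = x" using x by (simp add: proj_star proj_fibre_unit)
  have "lmult L (lstar L ?e) (lstar L ?e) = lstar L ?e"
    using star_mult[OF comp] x by (simp add: fibre_unit_mult_self)
  moreover have "lstar L ?e \<noteq> lzero L x"
  proof
    assume "lstar L ?e = lzero L x"
    then have "lstar L ?e = lscale L 0 (lstar L ?e)" using proj by (simp add: scale_0)
    then have "?e = lscale L 0 ?e" using star_scale[of 0 "lstar L ?e"] by (simp add: star_star)
    then have "lnorm L ?e = 0" using norm_scale[of 0 ?e] by simp
    then show False using fibre_unit_nonzero[OF x] by simp
  qed
  ultimately show ?thesis
    using proj fibre_unit_exists1[OF x] fibre_unit[OF x] by (metis norm_zero)
qed

lemma norm_fibre_unit:
  assumes x: "x \<in> X"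
  shows "lnorm L (fibre_unit L x) = 1"
  using norm_star_mult[of "fibre_unit L x"] fibre_unit_nonzero[OF x]
  by (simp add: star_fibre_unit[OF x] fibre_unit_mult_self[OF x] power2_eq_square)

lemma star_mult_self: "lmult L (lstar L u) u = lscale L (of_real ((lnorm L u)\<^sup>2)) (fibre_unit L (\<s> (proj L u)))"
proof -
  obtain t where t: "t \<ge> 0" "lmult L (lstar L u) u = lscale L (of_real t) (fibre_unit L (\<s> (proj L u)))"
    using star_mult_nonneg by blast
  then show ?thesis using norm_star_mult[of u] by (simp add: norm_scale norm_fibre_unit)
qed

text \<open>The fibre unit acts by an idempotent scalar \<open>k\<close>. If \<open>k\<close> were 0, then \<open>vv\<^sup>*\<close>, a multiple of
  the fibre unit, would vanish.\<close>

lemma fibre_unit_mult: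
  assumes x: "x = \<r> (proj L v)"
  shows "lmult L (fibre_unit L x) v = v"
proof (cases "lnorm L v = 0")
  let ?e = "fibre_unit L x"
  have xX: "x \<in> X" using x by simp
  have comp: "(?e, v) \<in> lcomposable G L" using x by (simp add: lcomposable_def proj_fibre_unit)
  have pw: "proj L (lmult L ?e v) = proj L v" using comp x by (simp add: proj_mult proj_fibre_unit)
  {
    case True
    then have "lnorm L (lmult L ?e v) = 0"
      using norm_mult[OF comp] norm_nonneg[of "lmult L ?e v"] by simp
    then show ?thesis using True pw norm_eq_zero by metis
  next
    case False
    then obtain k where k: "lmult L ?e v = lscale L k v" using exists_scalar[of "lmult L ?e v" v] pw by auto
    have "lscale L (k * k) v = lmult L ?e (lmult L ?e v)"
      using k mult_scale_right[OF comp] by (simp add: scale_scale)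
    also have "\<dots> = lmult L (lmult L ?e ?e) v"
      using comp xX by (subst lmult_assoc) (auto simp: lcomposable_def proj_fibre_unit)
    also have "\<dots> = lscale L k v" using xX k by (simp add: fibre_unit_mult_self)
    finally have kk: "k * k = k" using scale_inj False by blast
    have "k \<noteq> 0"
    proof
      assume "k = 0"
      have comp2: "(v, lstar L v) \<in> lcomposable G L" by (simp add: lcomposable_def proj_star)
      have vv: "lmult L v (lstar L v) = lscale L (of_real ((lnorm L (lstar L v))\<^sup>2)) ?e"
        using star_mult_self[of "lstar L v"] x by (simp add: star_star proj_star)
      have "lmult L (lmult L ?e v) (lstar L v) = lmult L ?e (lmult L v (lstar L v))"
        using lmult_assoc[OF comp comp2] .
      also have "\<dots> = lmult L v (lstar L v)"
        unfolding vv using xX mult_scale_right[of ?e ?e]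
        by (simp add: lcomposable_def proj_fibre_unit fibre_unit_mult_self)
      finally have "lmult L v (lstar L v) = lscale L 0 (lmult L v (lstar L v))"
        using k \<open>k = 0\<close> mult_scale_left[OF comp2] by simp
      then have "lnorm L (lmult L v (lstar L v)) = cmod 0 * lnorm L (lmult L v (lstar L v))"
        by (metis norm_scale)
      then have "lnorm L (lstar L v) = 0" using norm_star_mult[of "lstar L v"] by (simp add: star_star)
      then have "lstar L v = lscale L 0 (lstar L v)" using norm_eq_zero scale_0 by metis
      then have "v = lscale L 0 v" using star_scale[of 0 "lstar L v"] star_star by (metis complex_cnj_zero)
      then show False using False norm_scale[of 0 v] by simp
    qed
    then show ?thesis using kk k by (simp add: scale_one)
  }
qed

lemma mult_fibre_unit:
  assumes "x = \<s> (proj L v)"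
  shows "lmult L v (fibre_unit L x) = v"
proof -
  have "lmult L (fibre_unit L x) (lstar L v) = lstar L v"
    using assms by (intro fibre_unit_mult) (simp add: proj_star)
  then have "lstar L (lmult L (fibre_unit L x) (lstar L v)) = v" by (simp add: star_star)
  moreover have "(fibre_unit L x, lstar L v) \<in> lcomposable G L"
    using assms by (simp add: lcomposable_def proj_star proj_fibre_unit)
  ultimately show ?thesis using assms by (simp add: star_mult star_star star_fibre_unit)
qed

lemma norm_star: "lnorm L (lstar L u) = lnorm L u"
proof -
  have le: "lnorm L u \<le> lnorm L (lstar L u)" for u
  proof -
    have "lnorm L u * lnorm L u \<le> lnorm L (lstar L u) * lnorm L u"
      using norm_star_mult[of u] norm_mult[of "lstar L u" u]
      by (simp add: lcomposable_def proj_star power2_eq_square)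
    then show ?thesis
      using norm_nonneg[of u] norm_nonneg[of "lstar L u"] mult_le_cancel_right[of "lnorm L u" "lnorm L u"]
      by (cases "lnorm L u = 0") auto
  qed
  from le[of u] le[of "lstar L u"] show ?thesis by (simp add: star_star)
qed

text \<open>In the C*-square of \<open>uv\<close>, the factor \<open>u\<^sup>*u\<close> is a multiple of a fibre unit, which can be
  absorbed by \<open>v\<close>.\<close>

lemma norm_mult_eq:
  assumes "(u, v) \<in> lcomposable G L"
  shows "lnorm L (lmult L u v) = lnorm L u * lnorm L v"
proof -
  have uv: "\<s> (proj L u) = \<r> (proj L v)" using assms by (simp add: lcomposable_def)
  have "lmult L (lstar L (lmult L u v)) (lmult L u v) = lmult L (lmult L (lstar L v) (lstar L u)) (lmult L u v)"
    using star_mult[OF assms] by simp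
  also have "\<dots> = lmult L (lstar L v) (lmult L (lstar L u) (lmult L u v))"
    using uv assms by (intro lmult_assoc) (auto simp: lcomposable_def proj_star proj_mult)
  also have "lmult L (lstar L u) (lmult L u v) = lmult L (lmult L (lstar L u) u) v"
    using uv assms by (intro lmult_assoc[symmetric]) (auto simp: lcomposable_def proj_star proj_mult)
  also have "\<dots> = lscale L (of_real ((lnorm L u)\<^sup>2)) v"
    unfolding star_mult_self using uv
    by (simp add: mult_scale_left lcomposable_def proj_fibre_unit fibre_unit_mult)
  finally have "lmult L (lstar L (lmult L u v)) (lmult L u v) = lscale L (of_real ((lnorm L u)\<^sup>2)) (lmult L (lstar L v) v)"
    by (simp add: mult_scale_right lcomposable_def proj_star)
  then have "(lnorm L (lmult L u v))\<^sup>2 = (lnorm L u * lnorm L v)\<^sup>2"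
    by (metis abs_of_nonneg norm_of_real norm_scale norm_star_mult power_mult_distrib zero_le_power2)
  then show ?thesis using norm_nonneg by (simp add: mult_nonneg_nonneg)
qed

subsection \<open>Coordinates\<close>

text \<open>A choice of unit vectors in the fibres, without any continuity off the unit space. On the
  unit space it is prescribed, which normalises the cocycle and makes coordinates there continuous
  (\<open>continuous_on_hat\<close>).\<close>

definition frame :: "'g \<Rightarrow> 'l" where
  "frame g = (if g \<in> X then fibre_unit L g else (SOME e. proj L e = g \<and> lnorm L e = 1))"

lemma frame: "proj L (frame g) = g \<and> lnorm L (frame g) = 1"
  using someI_ex[OF exists_unit_vector, of g] by (auto simp: frame_def proj_fibre_unit norm_fibre_unit)

lemmas proj_frame [simp] = frame[THEN conjunct1]
lemmas norm_frame [simp] = frame[THEN conjunct2]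

lemma frame_unit: "x \<in> X \<Longrightarrow> frame x = fibre_unit L x"
  by (simp add: frame_def)

definition coord :: "'l \<Rightarrow> complex" where
  "coord u = (SOME c. u = lscale L c (frame (proj L u)))"

lemma coord: "u = lscale L (coord u) (frame (proj L u))"
  unfolding coord_def by (rule someI_ex) (rule exists_scalar, simp_all)

lemma coord_unique: "u = lscale L c (frame g) \<Longrightarrow> coord u = c"
proof -
  assume u: "u = lscale L c (frame g)"
  then have "proj L u = g" by (simp add: proj_scale)
  then show ?thesis using coord[of u] u by (metis norm_frame scale_inj zero_neq_one)
qed

lemma coord_eqI: "proj L u = proj L v \<Longrightarrow> coord u = coord v \<Longrightarrow> u = v"
  using coord[of u] coord[of v] by simp

lemma coord_scale [simp]: "coord (lscale L c u) = c * coord u"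
  by (rule coord_unique[of _ _ "proj L u"]) (subst coord[of u], simp add: scale_scale)

lemma coord_zero [simp]: "coord (lzero L g) = 0"
  by (rule coord_unique[of _ _ g]) (simp add: scale_0)

lemma coord_add: "proj L u = proj L v \<Longrightarrow> coord (ladd L u v) = coord u + coord v"
  by (rule coord_unique[of _ _ "proj L u"]) (metis coord scale_add_left)

lemma norm_eq_coord: "lnorm L u = cmod (coord u)"
  by (subst coord[of u]) (simp only: norm_scale norm_frame mult_1_right)

lemma coord_eq_0: "coord u = 0 \<longleftrightarrow> u = lzero L (proj L u)"
  using norm_eq_coord[of u] norm_eq_zero[of u] by auto

lemma coord_frame [simp]: "coord (frame g) = 1"
  by (rule coord_unique[of _ _ g]) (simp add: scale_one)

lemma coord_fibre_unit [simp]: "x \<in> X \<Longrightarrow> coord (fibre_unit L x) = 1"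
  using coord_frame[of x] by (simp add: frame_unit)

text \<open>The structure constants of the bundle in the chosen frame. The axioms of a Fell bundle make
  the first a unimodular 2-cocycle, and relate the second to it.\<close>

definition cocycle :: "'g \<Rightarrow> 'g \<Rightarrow> complex" where
  "cocycle a b = coord (lmult L (frame a) (frame b))"

definition star_coeff :: "'g \<Rightarrow> complex" where
  "star_coeff a = coord (lstar L (frame a))"

lemma coord_mult:
  assumes "\<s> (proj L u) = \<r> (proj L v)"
  shows "coord (lmult L u v) = coord u * coord v * cocycle (proj L u) (proj L v)"
proof -
  have "lmult L u v = lmult L (lscale L (coord u) (frame (proj L u))) (lscale L (coord v) (frame (proj L v)))"
    using coord by metis
  also have "\<dots> = lscale L (coord u * coord v) (lmult L (frame (proj L u)) (frame (proj L v)))"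
    using assms by (simp add: mult_scale_left mult_scale_right lcomposable_def proj_scale scale_scale mult.commute)
  finally show ?thesis by (simp add: cocycle_def)
qed

lemma coord_star: "coord (lstar L u) = cnj (coord u) * star_coeff (proj L u)"
proof -
  have "lstar L u = lscale L (cnj (coord u)) (lstar L (frame (proj L u)))"
    using coord star_scale by metis
  then show ?thesis by (simp add: star_coeff_def)
qed

lemma norm_cocycle: "\<s> a = \<r> b \<Longrightarrow> cmod (cocycle a b) = 1"
  unfolding cocycle_def by (simp flip: norm_eq_coord add: norm_mult_eq lcomposable_def)

lemma cocycle_left_unit [simp]: "x \<in> X \<Longrightarrow> x = \<r> a \<Longrightarrow> cocycle x a = 1"
  by (simp add: cocycle_def frame_unit fibre_unit_mult)

lemma cocycle_right_unit [simp]: "x \<in> X \<Longrightarrow> x = \<s> a \<Longrightarrow> cocycle a x = 1"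
  by (simp add: cocycle_def frame_unit mult_fibre_unit)

lemma cocycle_assoc:
  assumes "\<s> a = \<r> b" "\<s> b = \<r> c"
  shows "cocycle a b * cocycle (a \<diamondop> b) c = cocycle b c * cocycle a (b \<diamondop> c)"
proof -
  have "coord (lmult L (lmult L (frame a) (frame b)) (frame c)) = coord (lmult L (frame a) (lmult L (frame b) (frame c)))"
    using assms by (simp add: lmult_assoc lcomposable_def)
  then show ?thesis using assms by (simp add: coord_mult proj_mult lcomposable_def cocycle_def[symmetric])
qed

lemma star_coeff_inv: "star_coeff a * cocycle (\<iota> a) a = 1"
proof -
  have "coord (lmult L (lstar L (frame a)) (frame a)) = 1"
    by (simp add: star_mult_self)
  then show ?thesis by (simp add: coord_mult proj_star star_coeff_def)
qed

lemma star_coeff_mult: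
  assumes "\<s> a = \<r> b"
  shows "cnj (cocycle a b) * star_coeff (a \<diamondop> b) = star_coeff b * star_coeff a * cocycle (\<iota> b) (\<iota> a)"
proof -
  have "coord (lstar L (lmult L (frame a) (frame b))) = coord (lmult L (lstar L (frame b)) (lstar L (frame a)))"
    using assms by (simp add: star_mult lcomposable_def)
  then show ?thesis
    using assms by (simp add: coord_star coord_mult proj_star proj_mult lcomposable_def cocycle_def[symmetric] star_coeff_def[symmetric])
qed

lemma norm_star_coeff: "cmod (star_coeff a) = 1"
  unfolding star_coeff_def by (simp flip: norm_eq_coord add: norm_star)

lemma star_coeff_nonzero [simp]: "star_coeff a \<noteq> 0"
  using norm_star_coeff[of a] by auto

subsection \<open>Twisted convolution of scalar functions\<close>

definition factor_pairs :: "('g \<Rightarrow> complex) \<Rightarrow> ('g \<Rightarrow> complex) \<Rightarrow> 'g \<Rightarrow> ('g \<times> 'g) set" where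
  "factor_pairs \<phi> \<psi> g = {(a, b). \<s> a = \<r> b \<and> a \<diamondop> b = g \<and> \<phi> a \<noteq> 0 \<and> \<psi> b \<noteq> 0}"

definition twisted_conv :: "('g \<Rightarrow> complex) \<Rightarrow> ('g \<Rightarrow> complex) \<Rightarrow> 'g \<Rightarrow> complex" where
  "twisted_conv \<phi> \<psi> g = (\<Sum>(a, b)\<in>factor_pairs \<phi> \<psi> g. \<phi> a * \<psi> b * cocycle a b)"

definition twisted_star :: "('g \<Rightarrow> complex) \<Rightarrow> 'g \<Rightarrow> complex" where
  "twisted_star \<phi> g = cnj (\<phi> (\<iota> g)) * star_coeff (\<iota> g)"

text \<open>Sections in the convolution algebra have this property, since a bisection contains at most
  one arrow with a given range or source; it makes the convolution sums finite.\<close>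

definition fibre_finite :: "('g \<Rightarrow> complex) \<Rightarrow> bool" where
  "fibre_finite \<phi> \<longleftrightarrow> (\<forall>x. finite {a. \<r> a = x \<and> \<phi> a \<noteq> 0}) \<and> (\<forall>x. finite {a. \<s> a = x \<and> \<phi> a \<noteq> 0})"

lemma fibre_finiteD:
  "fibre_finite \<phi> \<Longrightarrow> finite {a. \<r> a = x \<and> \<phi> a \<noteq> 0}"
  "fibre_finite \<phi> \<Longrightarrow> finite {a. \<s> a = x \<and> \<phi> a \<noteq> 0}"
  by (auto simp: fibre_finite_def)

lemma fibre_finite_subset:
  assumes "fibre_finite \<phi>" "fibre_finite \<psi>" "\<And>a. \<theta> a \<noteq> 0 \<Longrightarrow> \<phi> a \<noteq> 0 \<or> \<psi> a \<noteq> 0"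
  shows "fibre_finite \<theta>"
  unfolding fibre_finite_def
proof (intro conjI allI)
  fix x
  show "finite {a. \<r> a = x \<and> \<theta> a \<noteq> 0}"
    by (rule finite_subset[OF _ finite_UnI[OF fibre_finiteD(1)[OF assms(1), of x] fibre_finiteD(1)[OF assms(2), of x]]])
      (use assms(3) in blast)
  show "finite {a. \<s> a = x \<and> \<theta> a \<noteq> 0}"
    by (rule finite_subset[OF _ finite_UnI[OF fibre_finiteD(2)[OF assms(1), of x] fibre_finiteD(2)[OF assms(2), of x]]])
      (use assms(3) in blast)
qed

lemma finite_factor_pairs:
  assumes "fibre_finite \<phi>"
  shows "finite (factor_pairs \<phi> \<psi> g)"
proof (rule finite_subset)
  show "factor_pairs \<phi> \<psi> g \<subseteq> (\<lambda>a. (a, \<iota> a \<diamondop> g)) ` {a. \<r> a = \<r> g \<and> \<phi> a \<noteq> 0}"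
    by (auto simp: factor_pairs_def image_iff)
qed (use fibre_finiteD[OF assms] in auto)

text \<open>Convolutions with different supports can be compared over a common index set.\<close>

lemma twisted_conv_eq_sum:
  assumes "finite S" "factor_pairs \<phi> \<psi> g \<subseteq> S" "S \<subseteq> {(a, b). \<s> a = \<r> b \<and> a \<diamondop> b = g}"
  shows "twisted_conv \<phi> \<psi> g = (\<Sum>(a, b)\<in>S. \<phi> a * \<psi> b * cocycle a b)"
  unfolding twisted_conv_def
  by (rule sum.mono_neutral_left) (use assms in \<open>auto simp: factor_pairs_def\<close>)

lemma twisted_conv_add_left:
  assumes "fibre_finite \<phi>" "fibre_finite \<phi>'"
  shows "twisted_conv (\<lambda>a. \<phi> a + \<phi>' a) \<psi> g = twisted_conv \<phi> \<psi> g + twisted_conv \<phi>' \<psi> g"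
proof -
  define S where "S = factor_pairs \<phi> \<psi> g \<union> factor_pairs \<phi>' \<psi> g"
  have S: "finite S" "S \<subseteq> {(a, b). \<s> a = \<r> b \<and> a \<diamondop> b = g}"
    using assms finite_factor_pairs by (auto simp: S_def factor_pairs_def)
  have sub: "factor_pairs \<phi> \<psi> g \<subseteq> S" "factor_pairs \<phi>' \<psi> g \<subseteq> S"
    "factor_pairs (\<lambda>a. \<phi> a + \<phi>' a) \<psi> g \<subseteq> S" by (auto simp: S_def factor_pairs_def)
  show ?thesis
    unfolding twisted_conv_eq_sum[OF S(1) sub(1) S(2)] twisted_conv_eq_sum[OF S(1) sub(2) S(2)]
      twisted_conv_eq_sum[OF S(1) sub(3) S(2)] sum.distrib[symmetric]
    by (rule sum.cong) (auto simp: algebra_simps)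
qed

lemma twisted_conv_add_right:
  assumes "fibre_finite \<phi>"
  shows "twisted_conv \<phi> (\<lambda>a. \<psi> a + \<psi>' a) g = twisted_conv \<phi> \<psi> g + twisted_conv \<phi> \<psi>' g"
proof -
  define S where "S = factor_pairs \<phi> \<psi> g \<union> factor_pairs \<phi> \<psi>' g"
  have S: "finite S" "S \<subseteq> {(a, b). \<s> a = \<r> b \<and> a \<diamondop> b = g}"
    using assms finite_factor_pairs by (auto simp: S_def factor_pairs_def)
  have sub: "factor_pairs \<phi> \<psi> g \<subseteq> S" "factor_pairs \<phi> \<psi>' g \<subseteq> S"
    "factor_pairs \<phi> (\<lambda>a. \<psi> a + \<psi>' a) g \<subseteq> S" by (auto simp: S_def factor_pairs_def)
  show ?thesis
    unfolding twisted_conv_eq_sum[OF S(1) sub(1) S(2)] twisted_conv_eq_sum[OF S(1) sub(2) S(2)]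
      twisted_conv_eq_sum[OF S(1) sub(3) S(2)] sum.distrib[symmetric]
    by (rule sum.cong) (auto simp: algebra_simps)
qed

lemma twisted_conv_scale_left: "twisted_conv (\<lambda>a. c * \<phi> a) \<psi> g = c * twisted_conv \<phi> \<psi> g"
proof (cases "c = 0")
  case False
  then have "factor_pairs (\<lambda>a. c * \<phi> a) \<psi> g = factor_pairs \<phi> \<psi> g" by (auto simp: factor_pairs_def)
  then show ?thesis
    unfolding twisted_conv_def sum_distrib_left by (auto intro!: sum.cong)
qed (simp add: twisted_conv_def factor_pairs_def)

lemma twisted_conv_scale_right: "twisted_conv \<phi> (\<lambda>a. c * \<psi> a) g = c * twisted_conv \<phi> \<psi> g"
proof (cases "c = 0")
  case False
  then have "factor_pairs \<phi> (\<lambda>a. c * \<psi> a) g = factor_pairs \<phi> \<psi> g" by (auto simp: factor_pairs_def)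
  then show ?thesis
    unfolding twisted_conv_def sum_distrib_left by (auto intro!: sum.cong)
qed (simp add: twisted_conv_def factor_pairs_def)

text \<open>Both iterated convolutions are sums over the factorisations of \<open>g\<close> into three factors, and
  their coefficients agree by the cocycle identity.\<close>

lemma twisted_conv_assoc:
  assumes f: "fibre_finite \<phi>" "fibre_finite \<psi>"
  shows "twisted_conv (twisted_conv \<phi> \<psi>) \<theta> g = twisted_conv \<phi> (twisted_conv \<psi> \<theta>) g"
proof -
  define T where "T = {(a, b, c). \<s> a = \<r> b \<and> \<s> b = \<r> c \<and> a \<diamondop> (b \<diamondop> c) = g \<and> \<phi> a \<noteq> 0 \<and> \<psi> b \<noteq> 0 \<and> \<theta> c \<noteq> 0}"
  define A where "A = {a. \<r> a = \<r> g \<and> \<phi> a \<noteq> 0}"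
  have A: "finite A" using fibre_finiteD[OF f(1)] by (simp add: A_def)
  have "finite T"
  proof (rule finite_subset)
    show "T \<subseteq> (\<Union>a\<in>A. \<Union>b\<in>{b. \<r> b = \<s> a \<and> \<psi> b \<noteq> 0}. {(a, b, \<iota> b \<diamondop> (\<iota> a \<diamondop> g))})"
      by (auto simp: T_def A_def)
    show "finite (\<Union>a\<in>A. \<Union>b\<in>{b. \<r> b = \<s> a \<and> \<psi> b \<noteq> 0}. {(a, b, \<iota> b \<diamondop> (\<iota> a \<diamondop> g))})"
      using A fibre_finiteD[OF f(2)] by auto
  qed
  have nonzero: "\<exists>a b. (a, b) \<in> factor_pairs \<alpha> \<beta> h" if "twisted_conv \<alpha> \<beta> h \<noteq> 0" for \<alpha> \<beta> h
  proof (rule ccontr)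
    assume "\<not> ?thesis"
    then have "factor_pairs \<alpha> \<beta> h = {}" by auto
    then show False using that by (simp add: twisted_conv_def)
  qed
  have eq1: "twisted_conv (twisted_conv \<phi> \<psi>) \<theta> g = (\<Sum>(a, b, c)\<in>T. \<phi> a * \<psi> b * \<theta> c * (cocycle a b * cocycle (a \<diamondop> b) c))"
  proof -
    define S where "S = (\<lambda>(a, b, c). (a \<diamondop> b, c)) ` T"
    have S_D: "\<s> p = \<r> c \<and> p \<diamondop> c = g \<and> \<theta> c \<noteq> 0" if "(p, c) \<in> S" for p c
      using that by (auto simp: S_def T_def assoc)
    have S_I: "(a \<diamondop> b, c) \<in> S" if "(a, b, c) \<in> T" for a b c
      using that by (force simp: S_def)
    have "twisted_conv (twisted_conv \<phi> \<psi>) \<theta> g = (\<Sum>(p, c)\<in>S. twisted_conv \<phi> \<psi> p * \<theta> c * cocycle p c)"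
    proof (rule twisted_conv_eq_sum)
      show "finite S" using \<open>finite T\<close> by (simp add: S_def)
      show "S \<subseteq> {(a, b). \<s> a = \<r> b \<and> a \<diamondop> b = g}" by (auto simp: S_def T_def assoc)
      show "factor_pairs (twisted_conv \<phi> \<psi>) \<theta> g \<subseteq> S"
      proof
        fix q assume "q \<in> factor_pairs (twisted_conv \<phi> \<psi>) \<theta> g"
        then obtain p c where q: "q = (p, c)" "\<s> p = \<r> c" "p \<diamondop> c = g" "twisted_conv \<phi> \<psi> p \<noteq> 0" "\<theta> c \<noteq> 0"
          by (auto simp: factor_pairs_def)
        then obtain a b where "(a, b) \<in> factor_pairs \<phi> \<psi> p" using nonzero by blast
        then have "(a, b, c) \<in> T" "p = a \<diamondop> b" using q by (auto simp: T_def factor_pairs_def assoc)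
        then show "q \<in> S" using q by (force simp: S_def)
      qed
    qed
    also have "\<dots> = (\<Sum>(p, c)\<in>S. \<Sum>(a, b)\<in>factor_pairs \<phi> \<psi> p. \<phi> a * \<psi> b * \<theta> c * (cocycle a b * cocycle p c))"
      unfolding twisted_conv_def by (intro sum.cong) (auto simp: sum_distrib_right sum_distrib_left case_prod_unfold algebra_simps)
    also have "\<dots> = (\<Sum>((p, c), (a, b))\<in>Sigma S (\<lambda>(p, c). factor_pairs \<phi> \<psi> p). \<phi> a * \<psi> b * \<theta> c * (cocycle a b * cocycle p c))"
      using \<open>finite T\<close> finite_factor_pairs[OF f(1)]
      by (subst sum.Sigma[symmetric]) (auto simp: S_def case_prod_unfold)
    also have "\<dots> = (\<Sum>(a, b, c)\<in>T. \<phi> a * \<psi> b * \<theta> c * (cocycle a b * cocycle (a \<diamondop> b) c))"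
      by (rule sum.reindex_bij_witness[of _ "\<lambda>(a, b, c). ((a \<diamondop> b, c), (a, b))" "\<lambda>((p, c), (a, b)). (a, b, c)"])
        (auto simp: T_def factor_pairs_def assoc dest!: S_D intro!: S_I)
    finally show ?thesis .
  qed
  have eq2: "twisted_conv \<phi> (twisted_conv \<psi> \<theta>) g = (\<Sum>(a, b, c)\<in>T. \<phi> a * \<psi> b * \<theta> c * (cocycle b c * cocycle a (b \<diamondop> c)))"
  proof -
    define S where "S = (\<lambda>(a, b, c). (a, b \<diamondop> c)) ` T"
    have S_D: "\<s> a = \<r> p \<and> a \<diamondop> p = g \<and> \<phi> a \<noteq> 0" if "(a, p) \<in> S" for a p
      using that by (auto simp: S_def T_def)
    have S_I: "(a, b \<diamondop> c) \<in> S" if "(a, b, c) \<in> T" for a b c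
      using that by (force simp: S_def)
    have "twisted_conv \<phi> (twisted_conv \<psi> \<theta>) g = (\<Sum>(a, p)\<in>S. \<phi> a * twisted_conv \<psi> \<theta> p * cocycle a p)"
    proof (rule twisted_conv_eq_sum)
      show "finite S" using \<open>finite T\<close> by (simp add: S_def)
      show "S \<subseteq> {(a, b). \<s> a = \<r> b \<and> a \<diamondop> b = g}" by (auto simp: S_def T_def)
      show "factor_pairs \<phi> (twisted_conv \<psi> \<theta>) g \<subseteq> S"
      proof
        fix q assume "q \<in> factor_pairs \<phi> (twisted_conv \<psi> \<theta>) g"
        then obtain a p where q: "q = (a, p)" "\<s> a = \<r> p" "a \<diamondop> p = g" "twisted_conv \<psi> \<theta> p \<noteq> 0" "\<phi> a \<noteq> 0"
          by (auto simp: factor_pairs_def)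
        then obtain b c where "(b, c) \<in> factor_pairs \<psi> \<theta> p" using nonzero by blast
        then have "(a, b, c) \<in> T" "p = b \<diamondop> c" using q by (auto simp: T_def factor_pairs_def)
        then show "q \<in> S" using q by (force simp: S_def)
      qed
    qed
    also have "\<dots> = (\<Sum>(a, p)\<in>S. \<Sum>(b, c)\<in>factor_pairs \<psi> \<theta> p. \<phi> a * \<psi> b * \<theta> c * (cocycle b c * cocycle a p))"
      unfolding twisted_conv_def
      by (intro sum.cong) (auto simp: sum_distrib_right sum_distrib_left case_prod_unfold algebra_simps)
    also have "\<dots> = (\<Sum>((a, p), (b, c))\<in>Sigma S (\<lambda>(a, p). factor_pairs \<psi> \<theta> p). \<phi> a * \<psi> b * \<theta> c * (cocycle b c * cocycle a p))"
      using \<open>finite T\<close> finite_factor_pairs[OF f(2)]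
      by (subst sum.Sigma[symmetric]) (auto simp: S_def case_prod_unfold)
    also have "\<dots> = (\<Sum>(a, b, c)\<in>T. \<phi> a * \<psi> b * \<theta> c * (cocycle b c * cocycle a (b \<diamondop> c)))"
      by (rule sum.reindex_bij_witness[of _ "\<lambda>(a, b, c). ((a, b \<diamondop> c), (b, c))" "\<lambda>((a, p), (b, c)). (a, b, c)"])
        (auto simp: T_def factor_pairs_def dest!: S_D intro!: S_I)
    finally show ?thesis .
  qed
  show ?thesis
    unfolding eq1 eq2 by (rule sum.cong) (auto simp: T_def cocycle_assoc)
qed

lemma twisted_star_conv:
  "twisted_star (twisted_conv \<phi> \<psi>) g = twisted_conv (twisted_star \<psi>) (twisted_star \<phi>) g"
proof -
  have nz: "twisted_star \<alpha> a \<noteq> 0 \<longleftrightarrow> \<alpha> (\<iota> a) \<noteq> 0" for \<alpha> a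
    using norm_star_coeff[of "\<iota> a"] by (auto simp: twisted_star_def)
  have "twisted_star (twisted_conv \<phi> \<psi>) g = (\<Sum>(a, b)\<in>factor_pairs \<phi> \<psi> (\<iota> g).
      cnj (\<phi> a) * cnj (\<psi> b) * (cnj (cocycle a b) * star_coeff (a \<diamondop> b)))"
    unfolding twisted_star_def twisted_conv_def cnj_sum sum_distrib_right
    by (rule sum.cong) (auto simp: factor_pairs_def)
  also have "\<dots> = (\<Sum>(a, b)\<in>factor_pairs \<phi> \<psi> (\<iota> g).
      cnj (\<phi> a) * cnj (\<psi> b) * (star_coeff b * star_coeff a * cocycle (\<iota> b) (\<iota> a)))"
    by (rule sum.cong) (auto simp: factor_pairs_def simp flip: star_coeff_mult)
  also have "\<dots> = twisted_conv (twisted_star \<psi>) (twisted_star \<phi>) g"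
    unfolding twisted_conv_def
    by (rule sum.reindex_bij_witness[of _ "\<lambda>(a, b). (\<iota> b, \<iota> a)" "\<lambda>(a, b). (\<iota> b, \<iota> a)"])
      (auto simp: factor_pairs_def nz inv_of_mult[symmetric] twisted_star_def)
  finally show ?thesis .
qed

end

section \<open>The convolution algebra\<close>

context fell_line_bundle
begin

abbreviation conv where "conv \<equiv> convolution G L"
abbreviation adj where "adj f \<equiv> (\<lambda>g. lstar L (f (\<iota> g)))"
abbreviation \<A> where "\<A> \<equiv> compact_sections G L"

text \<open>A section is determined by its coordinate function, so that identities in the convolution
  algebra can be checked for scalar functions.\<close>

definition hat :: "('g \<Rightarrow> 'l) \<Rightarrow> 'g \<Rightarrow> complex" where
  "hat f g = coord (f g)"

definition is_section :: "('g \<Rightarrow> 'l) \<Rightarrow> bool" where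
  "is_section f \<longleftrightarrow> (\<forall>g. proj L (f g) = g)"

lemma section_eqI: "is_section f \<Longrightarrow> is_section h \<Longrightarrow> (\<And>g. hat f g = hat h g) \<Longrightarrow> f = h"
  by (rule ext, rule coord_eqI) (simp_all add: hat_def is_section_def)

lemma hat_eq_0: "is_section f \<Longrightarrow> hat f g = 0 \<longleftrightarrow> f g = lzero L g"
  by (simp add: hat_def coord_eq_0 is_section_def)

lemma norm_eq_hat: "lnorm L (f g) = cmod (hat f g)"
  by (simp add: hat_def norm_eq_coord)

lemma hat_zero [simp]: "hat (lzero L) = (\<lambda>g. 0)"
  by (simp add: hat_def fun_eq_iff)

lemma is_section_add: "is_section f \<Longrightarrow> is_section h \<Longrightarrow> is_section (section_add L f h)"
  by (simp add: is_section_def section_add_def proj_add)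

lemma hat_add: "is_section f \<Longrightarrow> is_section h \<Longrightarrow> hat (section_add L f h) = (\<lambda>g. hat f g + hat h g)"
  by (simp add: fun_eq_iff hat_def section_add_def coord_add is_section_def)

lemma is_section_scale: "is_section f \<Longrightarrow> is_section (section_scale L c f)"
  by (simp add: is_section_def section_scale_def proj_scale)

lemma hat_scale: "hat (section_scale L c f) = (\<lambda>g. c * hat f g)"
  by (simp add: fun_eq_iff hat_def section_scale_def)

lemma is_section_star: "is_section f \<Longrightarrow> is_section (adj f)"
  by (simp add: is_section_def proj_star)

lemma hat_star: "is_section f \<Longrightarrow> hat (adj f) = twisted_star (hat f)"
  by (simp add: fun_eq_iff hat_def twisted_star_def coord_star is_section_def)

lemma coord_finprod:
  assumes "finite S" "\<And>q. q \<in> S \<Longrightarrow> proj L (t q) = g"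
  shows "proj L (finprod (fibre L g) t S) = g \<and> coord (finprod (fibre L g) t S) = (\<Sum>q\<in>S. coord (t q))"
proof -
  interpret comm_group "fibre L g" by (rule fibre_group)
  show ?thesis
    using assms
  proof (induction S rule: finite_induct)
    case empty
    show ?case by (simp only: finprod_empty sum.empty) (simp add: fibre_def)
  next
    case (insert q S)
    then have IH: "proj L (finprod (fibre L g) t S) = g" "coord (finprod (fibre L g) t S) = (\<Sum>q\<in>S. coord (t q))"
      by auto
    have "finprod (fibre L g) t (insert q S) = mult (fibre L g) (t q) (finprod (fibre L g) t S)"
      using insert by (intro finprod_insert) (auto simp: fibre_def)
    also have "\<dots> = ladd L (t q) (finprod (fibre L g) t S)" by (simp add: fibre_def)
    finally show ?case using insert IH by (simp add: proj_add coord_add)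
  qed
qed

lemma convolution_coord:
  assumes f: "is_section f" and h: "is_section h" and fin: "fibre_finite (hat f)"
  shows "proj L (conv f h g) = g \<and> hat (conv f h) g = twisted_conv (hat f) (hat h) g"
proof -
  have pr: "proj L (f a) = a" "proj L (h a) = a" for a using f h by (auto simp: is_section_def)
  have coord_t: "coord (lmult L (f a) (h b)) = hat f a * hat h b * cocycle a b" if "\<s> a = \<r> b" for a b
    using that by (simp add: coord_mult pr hat_def)
  have proj_t: "proj L (lmult L (f a) (h b)) = a \<diamondop> b" if "\<s> a = \<r> b" for a b
    using that by (simp add: proj_mult lcomposable_def pr)
  have "cocycle a b \<noteq> 0" if "\<s> a = \<r> b" for a b
    using norm_cocycle[OF that] by auto
  then have set_eq: "{(a, b). (a, b) \<in> composable G \<and> a \<diamondop> b = g \<and> lmult L (f a) (h b) \<noteq> lzero L g} =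
      factor_pairs (hat f) (hat h) g"
    using coord_t proj_t coord_eq_0 by (fastforce simp: factor_pairs_def)
  have "proj L (conv f h g) = g \<and> coord (conv f h g) =
      (\<Sum>q\<in>factor_pairs (hat f) (hat h) g. coord ((\<lambda>(a, b). lmult L (f a) (h b)) q))"
    unfolding convolution_def set_eq
    by (rule coord_finprod) (use finite_factor_pairs[OF fin] proj_t in \<open>auto simp: factor_pairs_def\<close>)
  moreover have "(\<Sum>q\<in>factor_pairs (hat f) (hat h) g. coord ((\<lambda>(a, b). lmult L (f a) (h b)) q)) =
      twisted_conv (hat f) (hat h) g"
    unfolding twisted_conv_def by (rule sum.cong) (auto simp: factor_pairs_def coord_t)
  ultimately show ?thesis by (simp add: hat_def)
qed

lemma is_section_convolution:
  "is_section f \<Longrightarrow> is_section h \<Longrightarrow> fibre_finite (hat f) \<Longrightarrow> is_section (conv f h)"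
  using convolution_coord by (simp add: is_section_def)

lemma hat_convolution:
  "is_section f \<Longrightarrow> is_section h \<Longrightarrow> fibre_finite (hat f) \<Longrightarrow> hat (conv f h) = twisted_conv (hat f) (hat h)"
  using convolution_coord by (simp add: fun_eq_iff)

subsection \<open>Continuity of sections\<close>

context
  fixes U
  assumes U: "open_bisection G U"
begin

lemma continuous_on_section_add:
  assumes "continuous_on U f" "continuous_on U h" "is_section f" "is_section h"
  shows "continuous_on U (\<lambda>g. ladd L (f g) (h g))"
proof -
  have "continuous_on {(u, v). proj L u = proj L v \<and> proj L u \<in> U} (\<lambda>(u, v). ladd L u v)"
    using banach_bundle[OF U] by (simp add: banach_bundle_on_def)
  then have "continuous_on U (\<lambda>g. case (f g, h g) of (u, v) \<Rightarrow> ladd L u v)"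
    by (rule continuous_on_compose2) (use assms in \<open>auto simp: is_section_def intro!: continuous_on_Pair\<close>)
  then show ?thesis by simp
qed

lemma continuous_on_section_norm:
  assumes "continuous_on U f" "is_section f"
  shows "continuous_on U (\<lambda>g. lnorm L (f g))"
proof -
  have "continuous_on (proj L -` U) (lnorm L)" using banach_bundle[OF U] by (simp add: banach_bundle_on_def)
  then show ?thesis by (rule continuous_on_compose2) (use assms in \<open>auto simp: is_section_def\<close>)
qed

lemma continuous_on_section_scale_const:
  assumes "continuous_on U f" "is_section f"
  shows "continuous_on U (\<lambda>g. lscale L c (f g))"
proof -
  have "continuous_on (proj L -` U) (lscale L c)" using banach_bundle[OF U] by (simp add: banach_bundle_on_def)
  then show ?thesis by (rule continuous_on_compose2) (use assms in \<open>auto simp: is_section_def\<close>)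
qed

lemma tendsto_lzero:
  assumes "g \<in> U" "\<forall>\<^sub>F x in F. proj L (w x) \<in> U" "((\<lambda>x. proj L (w x)) \<longlongrightarrow> g) F" "((\<lambda>x. lnorm L (w x)) \<longlongrightarrow> 0) F"
  shows "(w \<longlongrightarrow> lzero L g) F"
proof -
  have "\<forall>F. \<forall>g\<in>U. eventually (\<lambda>u. proj L u \<in> U) F \<longrightarrow> (proj L \<longlongrightarrow> g) F \<longrightarrow>
      (lnorm L \<longlongrightarrow> 0) F \<longrightarrow> filterlim (\<lambda>u. u) (nhds (lzero L g)) F"
    using banach_bundle[OF U] unfolding banach_bundle_on_def by blast
  from this[rule_format, of g "filtermap w F"] have "filterlim (\<lambda>u. u) (nhds (lzero L g)) (filtermap w F)"
    using assms by (simp add: filterlim_filtermap eventually_filtermap)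
  then show ?thesis by (simp add: filterlim_filtermap)
qed

lemma tendsto_ladd:
  assumes "g \<in> U" "\<forall>\<^sub>F x in F. proj L (v x) = proj L (w x) \<and> proj L (v x) \<in> U"
    "(v \<longlongrightarrow> u) F" "(w \<longlongrightarrow> u') F" "proj L u = g" "proj L u' = g"
  shows "((\<lambda>x. ladd L (v x) (w x)) \<longlongrightarrow> ladd L u u') F"
proof -
  have "continuous_on {(u, v). proj L u = proj L v \<and> proj L u \<in> U} (\<lambda>(u, v). ladd L u v)"
    using banach_bundle[OF U] by (simp add: banach_bundle_on_def)
  then have "((\<lambda>x. case (v x, w x) of (u, v) \<Rightarrow> ladd L u v) \<longlongrightarrow> (case (u, u') of (u, v) \<Rightarrow> ladd L u v)) F"
    by (rule continuous_on_tendsto_compose) (use assms in \<open>auto intro!: tendsto_Pair\<close>)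
  then show ?thesis by simp
qed

text \<open>The axioms provide continuity of scaling by constants only. The remaining term
  \<open>(\<phi> g - \<phi> g0) f g\<close> tends to 0 in norm, and hence to the zero vector by the axiom about small
  vectors.\<close>

lemma continuous_on_section_scale:
  assumes f: "continuous_on U f" "is_section f" and \<phi>: "continuous_on U \<phi>"
  shows "continuous_on U (\<lambda>g. lscale L (\<phi> g) (f g))"
  unfolding continuous_on_def
proof
  fix g0 assume g0: "g0 \<in> U"
  let ?F = "at g0 within U"
  have pr: "proj L (f g) = g" for g using f by (simp add: is_section_def)
  have ev: "\<forall>\<^sub>F g in ?F. g \<in> U" by (simp add: eventually_at_filter)
  define w where "w g = lscale L (\<phi> g - \<phi> g0) (f g)" for g
  have proj_w: "proj L (w g) = g" for g by (simp add: w_def proj_scale pr)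
  have w0: "(w \<longlongrightarrow> lzero L g0) ?F"
  proof (rule tendsto_lzero[OF g0])
    show "\<forall>\<^sub>F g in ?F. proj L (w g) \<in> U" using ev by (simp add: w_def proj_scale pr)
    show "((\<lambda>g. proj L (w g)) \<longlongrightarrow> g0) ?F" by (simp add: w_def proj_scale pr tendsto_ident_at)
    have "((\<lambda>g. cmod (\<phi> g - \<phi> g0) * lnorm L (f g)) \<longlongrightarrow> cmod (\<phi> g0 - \<phi> g0) * lnorm L (f g0)) ?F"
      using \<phi> continuous_on_section_norm[OF f] g0 unfolding continuous_on_def
      by (intro tendsto_mult tendsto_norm tendsto_diff tendsto_const) blast+
    then show "((\<lambda>g. lnorm L (w g)) \<longlongrightarrow> 0) ?F" by (simp add: w_def norm_scale)
  qed
  have "((\<lambda>g. lscale L (\<phi> g0) (f g)) \<longlongrightarrow> lscale L (\<phi> g0) (f g0)) ?F"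
    using continuous_on_section_scale_const[OF f] g0 by (simp add: continuous_on_def)
  then have "((\<lambda>g. ladd L (lscale L (\<phi> g0) (f g)) (w g)) \<longlongrightarrow> ladd L (lscale L (\<phi> g0) (f g0)) (lzero L g0)) ?F"
    using w0 ev proj_w by (intro tendsto_ladd[OF g0]) (simp_all add: proj_scale pr)
  moreover have "ladd L (lscale L (\<phi> g0) (f g)) (w g) = lscale L (\<phi> g) (f g)" for g
    unfolding w_def scale_add_left[symmetric] by simp
  moreover have "ladd L (lscale L (\<phi> g0) (f g0)) (lzero L g0) = lscale L (\<phi> g0) (f g0)"
    using add_zero_right[of "lscale L (\<phi> g0) (f g0)"] by (simp add: proj_scale pr)
  ultimately show "((\<lambda>g. lscale L (\<phi> g) (f g)) \<longlongrightarrow> lscale L (\<phi> g0) (f g0)) ?F" by simp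
qed

end

text \<open>Let \<open>u\<close> be a vector near the fibre unit \<open>e0\<close> over \<open>x0\<close>, with coordinate \<open>c\<close>. As \<open>e0\<close> is
  idempotent, continuity of the product gives \<open>c\<^sup>2 - c \<longlonglongrightarrow> 0\<close>, and continuity of the norm gives
  \<open>\<bar>c\<bar> \<longlonglongrightarrow> 1\<close>. Hence \<open>c \<longlonglongrightarrow> 1\<close>, and the fibre unit over the base point of \<open>u\<close> tends to \<open>e0\<close> along with
  \<open>u\<close>. As the projection is open, the base points of the vectors near \<open>e0\<close> fill a neighbourhood of
  \<open>x0\<close>.\<close>

lemma continuous_on_fibre_unit: "continuous_on X (fibre_unit L)"
  unfolding continuous_on_def
proof
  fix x0 assume x0: "x0 \<in> X"
  define e0 where "e0 = fibre_unit L x0"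
  have e0: "proj L e0 = x0" "lnorm L e0 = 1" "lmult L e0 e0 = e0"
    using x0 by (simp_all add: e0_def proj_fibre_unit norm_fibre_unit fibre_unit_mult_self)
  note bb = banach_bundle[OF open_bisection_units, unfolded banach_bundle_on_def]
  define F where "F = inf (nhds e0) (principal (proj L -` X))"
  have evX: "\<forall>\<^sub>F u in F. proj L u \<in> X"
    unfolding F_def by (simp add: eventually_inf_principal)
  have id: "((\<lambda>u. u) \<longlongrightarrow> e0) F"
    unfolding F_def filterlim_def by simp
  have proj_lim: "((\<lambda>u. proj L u) \<longlongrightarrow> x0) F"
    using continuous_on_tendsto_compose[OF continuous_proj id] e0 by simp
  have "((\<lambda>u. lnorm L u) \<longlongrightarrow> lnorm L e0) F"
    using bb evX e0 x0 by (intro continuous_on_tendsto_compose[of "proj L -` X" "lnorm L", OF _ id]) auto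
  then have norm_lim: "((\<lambda>u. cmod (coord u)) \<longlongrightarrow> 1) F" using e0 by (simp flip: norm_eq_coord)
  have cu: "coord (lmult L u u) = coord u * coord u" "proj L (lmult L u u) = proj L u" if "proj L u \<in> X" for u
    using that by (simp_all add: coord_mult proj_mult lcomposable_def)
  have "((\<lambda>u. case (u, u) of (u, v) \<Rightarrow> lmult L u v) \<longlongrightarrow> (case (e0, e0) of (u, v) \<Rightarrow> lmult L u v)) F"
    by (rule continuous_on_tendsto_compose[OF continuous_lmult])
      (use evX id e0 x0 in \<open>auto intro!: tendsto_Pair simp: lcomposable_def elim: eventually_mono\<close>)
  then have sq: "((\<lambda>u. lmult L u u) \<longlongrightarrow> e0) F" using e0 by simp
  have "((\<lambda>u. lscale L (- 1) u) \<longlongrightarrow> lscale L (- 1) e0) F"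
    using bb evX e0 x0 by (intro continuous_on_tendsto_compose[of "proj L -` X" "lscale L (- 1)", OF _ id]) auto
  then have "((\<lambda>u. ladd L (lmult L u u) (lscale L (- 1) u)) \<longlongrightarrow> ladd L e0 (lscale L (- 1) e0)) F"
    using sq e0 evX
    by (intro tendsto_ladd[OF open_bisection_units x0]) (auto simp: proj_scale cu elim!: eventually_mono)
  moreover have "ladd L e0 (lscale L (- 1) e0) = lzero L x0"
    using e0 scale_add_left[of 1 "- 1" e0] by (simp add: scale_one scale_0)
  ultimately have "((\<lambda>u. lnorm L (ladd L (lmult L u u) (lscale L (- 1) u))) \<longlongrightarrow> lnorm L (lzero L x0)) F"
    using bb evX x0
    by (intro continuous_on_tendsto_compose[of "proj L -` X" "lnorm L"])
      (auto simp: proj_add proj_scale cu elim!: eventually_mono)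
  moreover have "\<forall>\<^sub>F u in F. lnorm L (ladd L (lmult L u u) (lscale L (- 1) u)) = cmod (coord u) * cmod (coord u - 1)"
    using evX by (rule eventually_mono)
      (simp add: norm_eq_coord coord_add proj_scale cu Real_Vector_Spaces.norm_mult[symmetric] algebra_simps)
  ultimately have "((\<lambda>u. cmod (coord u) * cmod (coord u - 1)) \<longlongrightarrow> 0) F"
    by (simp add: tendsto_cong)
  then have "((\<lambda>u. cmod (coord u) * cmod (coord u - 1) / cmod (coord u)) \<longlongrightarrow> 0 / 1) F"
    using norm_lim by (intro tendsto_divide) auto
  moreover have "\<forall>\<^sub>F u in F. cmod (coord u) * cmod (coord u - 1) / cmod (coord u) = cmod (coord u - 1)"
    using order_tendstoD(1)[OF norm_lim, of 0] by (auto elim!: eventually_mono)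
  ultimately have small: "((\<lambda>u. cmod (coord u - 1)) \<longlongrightarrow> 0) F" by (simp add: tendsto_cong)
  have lim: "((\<lambda>u. fibre_unit L (proj L u)) \<longlongrightarrow> e0) F"
  proof -
    define w where "w u = lscale L (1 - coord u) (frame (proj L u))" for u
    have proj_w: "proj L (w u) = proj L u" for u by (simp add: w_def proj_scale)
    have "(w \<longlongrightarrow> lzero L x0) F"
      using evX proj_lim small
      by (intro tendsto_lzero[OF open_bisection_units x0])
        (auto simp: w_def proj_scale norm_scale norm_minus_commute[of 1])
    then have "((\<lambda>u. ladd L u (w u)) \<longlongrightarrow> ladd L e0 (lzero L x0)) F"
      using id e0(1) evX proj_w by (intro tendsto_ladd[OF open_bisection_units x0]) simp_all
    moreover have "ladd L u (w u) = frame (proj L u)" for u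
      unfolding w_def by (subst (1) coord[of u]) (simp add: scale_one flip: scale_add_left)
    moreover have "ladd L e0 (lzero L x0) = e0" using add_zero_right[of e0] e0 by simp
    ultimately have "((\<lambda>u. frame (proj L u)) \<longlongrightarrow> e0) F" by simp
    then show ?thesis
      by (rule tendsto_cong[THEN iffD1, rotated]) (use evX in \<open>auto elim!: eventually_mono simp: frame_unit\<close>)
  qed
  show "(fibre_unit L \<longlongrightarrow> fibre_unit L x0) (at x0 within X)"
  proof (rule topological_tendstoI)
    fix N assume "open N" "fibre_unit L x0 \<in> N"
    then have "\<forall>\<^sub>F u in F. fibre_unit L (proj L u) \<in> N"
      using lim unfolding e0_def[symmetric] by (rule topological_tendstoD[rotated 1])
    then obtain W where W: "open W" "e0 \<in> W" "\<And>u. u \<in> W \<Longrightarrow> proj L u \<in> X \<Longrightarrow> fibre_unit L (proj L u) \<in> N"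
      unfolding F_def eventually_inf_principal eventually_nhds by auto
    have "openin (top_of_set (proj L -` X)) (proj L -` X \<inter> W)" using W(1) by (simp add: openin_open_Int)
    then have "openin (top_of_set X) (proj L ` (proj L -` X \<inter> W))"
      using bb by (auto simp: open_map_def)
    then have "open (proj L ` (proj L -` X \<inter> W))" using openin_units by blast
    moreover have "x0 \<in> proj L ` (proj L -` X \<inter> W)" using W(2) e0 x0 by (auto intro!: image_eqI[of _ _ e0])
    ultimately have "\<forall>\<^sub>F x in nhds x0. x \<in> proj L ` (proj L -` X \<inter> W)" by (rule eventually_nhds_in_open)
    then have "\<forall>\<^sub>F x in nhds x0. fibre_unit L x \<in> N"
      by (rule eventually_mono) (use W(3) in auto)
    then show "\<forall>\<^sub>F x in at x0 within X. fibre_unit L x \<in> N"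
      by (simp add: eventually_at_filter eventually_mono)
  qed
qed

lemma continuous_on_frame: "continuous_on X frame"
  using continuous_on_fibre_unit by (rule continuous_on_cong[THEN iffD1, rotated 2]) (auto simp: frame_unit)

lemma is_section_frame: "is_section frame"
  by (simp add: is_section_def)

text \<open>The coordinates at \<open>x\<close> and \<open>x0\<close> differ in modulus by the norm at \<open>x\<close> of the continuous
  section \<open>f - hat f x0 \<cdot> frame\<close>.\<close>

lemma continuous_on_hat:
  assumes f: "continuous_on X f" "is_section f"
  shows "continuous_on X (hat f)"
  unfolding continuous_on_def
proof
  fix x0 assume x0: "x0 \<in> X"
  define h where "h = section_add L f (section_scale L (- hat f x0) frame)"
  have h: "is_section h" "continuous_on X h"
    unfolding h_def section_add_def section_scale_def
    using f is_section_frame continuous_on_frame is_section_scale[OF is_section_frame] is_section_add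
    by (auto intro!: continuous_on_section_add continuous_on_section_scale_const open_bisection_units
        simp: section_add_def section_scale_def)
  have "hat h x = hat f x - hat f x0" for x
    using f by (simp add: h_def hat_add is_section_scale is_section_frame hat_scale) (simp add: hat_def)
  then have norm_h: "lnorm L (h x) = cmod (hat f x - hat f x0)" for x by (simp add: norm_eq_hat)
  have "((\<lambda>x. lnorm L (h x)) \<longlongrightarrow> lnorm L (h x0)) (at x0 within X)"
    using continuous_on_section_norm[OF open_bisection_units h(2,1)] x0 by (simp add: continuous_on_def)
  then show "(hat f \<longlongrightarrow> hat f x0) (at x0 within X)"
    unfolding norm_h by (simp add: tendsto_norm_zero_iff LIM_zero_iff)
qed

subsection \<open>Compactly supported sections over bisections\<close>

lemma bisection_sectionsI:
  assumes U: "open_bisection G U" and "is_section f" "continuous_on U f" "compact K" "K \<subseteq> U"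
    and "\<And>g. g \<notin> K \<Longrightarrow> f g = lzero L g"
  shows "f \<in> bisection_sections L U"
proof -
  have "{g \<in> U. f g \<noteq> lzero L g} \<subseteq> K" using assms(6) by blast
  then show ?thesis
    unfolding bisection_sections_def
    using assms compact_support_bisection[OF U, of K] by (auto simp: is_section_def)
qed

lemma bisection_sectionsE:
  assumes "f \<in> bisection_sections L U"
  obtains K where "is_section f" "continuous_on U f" "compact K" "K \<subseteq> U" "\<And>g. g \<notin> K \<Longrightarrow> f g = lzero L g"
proof -
  have "{g \<in> U. f g \<noteq> lzero L g} \<subseteq> closure {g \<in> U. f g \<noteq> lzero L g}" by (rule closure_subset)
  then have out: "f g = lzero L g" if "g \<notin> U \<inter> closure {g \<in> U. f g \<noteq> lzero L g}" for g
    using assms that unfolding bisection_sections_def by blast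
  have "is_section f" "continuous_on U f" "compact (U \<inter> closure {g \<in> U. f g \<noteq> lzero L g})"
    using assms unfolding bisection_sections_def is_section_def by blast+
  then show ?thesis using out by (rule that[OF _ _ _ Int_lower1])
qed

lemma bisection_sections_section: "f \<in> bisection_sections L U \<Longrightarrow> is_section f"
  by (auto simp: bisection_sections_def is_section_def)

lemma bisection_sections_outside: "f \<in> bisection_sections L U \<Longrightarrow> hat f g \<noteq> 0 \<Longrightarrow> g \<in> U"
  using hat_eq_0[OF bisection_sections_section, of f U g] unfolding bisection_sections_def by blast

lemma finite_at_most_one: "(\<And>a b. a \<in> S \<Longrightarrow> b \<in> S \<Longrightarrow> a = b) \<Longrightarrow> finite S"
  by (metis finite.emptyI finite.insertI finite_subset insertI1 subsetI)

lemma fibre_finite_bisection_section: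
  assumes U: "open_bisection G U" and f: "f \<in> bisection_sections L U"
  shows "fibre_finite (hat f)"
  unfolding fibre_finite_def
  using bisection_sections_outside[OF f] bisection_range_eq[OF U] bisection_source_eq[OF U]
  by (auto intro!: finite_at_most_one)

lemma compact_sections_section_finite: "f \<in> \<A> \<Longrightarrow> is_section f \<and> fibre_finite (hat f)"
proof (induction rule: compact_sections.induct)
  case (bisection U f)
  then show ?case using fibre_finite_bisection_section bisection_sections_section by blast
next
  case (add f h)
  then show ?case by (auto simp: is_section_add hat_add intro: fibre_finite_subset[of "hat f" "hat h"])
next
  case (scale f c)
  then show ?case by (auto simp: is_section_scale hat_scale intro: fibre_finite_subset[of "hat f" "hat f"])
qed

lemmas compact_sections_section = compact_sections_section_finite[THEN conjunct1]
lemmas compact_sections_finite = compact_sections_section_finite[THEN conjunct2]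

lemma hat_function_section: "hat (function_section G L \<phi>) g = (if g \<in> X then \<phi> g else 0)"
  by (simp add: hat_def function_section_def)

lemma is_section_function_section: "is_section (function_section G L \<phi>)"
  by (simp add: is_section_def function_section_def proj_scale proj_fibre_unit)

lemma function_section_mem_bisection:
  assumes "\<phi> \<in> Cc"
  shows "function_section G L \<phi> \<in> bisection_sections L X"
proof -
  obtain K where K: "continuous_on X \<phi>" "compact K" "K \<subseteq> X" "\<And>x. x \<in> X \<Longrightarrow> x \<notin> K \<Longrightarrow> \<phi> x = 0"
    using assms by (rule Cc_unitsE) blast
  show ?thesis
  proof (rule bisection_sectionsI[OF open_bisection_units is_section_function_section _ K(2,3)])
    have "continuous_on X (\<lambda>g. lscale L (\<phi> g) (frame g))"
      by (intro continuous_on_section_scale open_bisection_units continuous_on_frame is_section_frame K(1))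
    then show "continuous_on X (function_section G L \<phi>)"
      by (rule continuous_on_cong[THEN iffD1, rotated 2]) (auto simp: function_section_def frame_unit)
    fix g assume "g \<notin> K"
    then show "function_section G L \<phi> g = lzero L g"
      using K(4)[of g] by (auto simp: function_section_def scale_0 proj_fibre_unit)
  qed
qed

lemma function_section_mem: "\<phi> \<in> Cc \<Longrightarrow> function_section G L \<phi> \<in> \<A>"
  using function_section_mem_bisection open_bisection_units by (rule compact_sections.bisection[rotated])

lemma bisection_section_units:
  assumes f: "f \<in> bisection_sections L X"
  shows "hat f \<in> Cc" "f = function_section G L (hat f)"
proof -
  obtain K where K: "is_section f" "continuous_on X f" "compact K" "K \<subseteq> X" "\<And>g. g \<notin> K \<Longrightarrow> f g = lzero L g"
    using f by (rule bisection_sectionsE) blast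
  show "hat f \<in> Cc"
    by (rule Cc_unitsI[of _ K]) (use K continuous_on_hat in \<open>auto simp: hat_def\<close>)
  show "f = function_section G L (hat f)"
    by (rule section_eqI) (use K bisection_sections_outside[OF f] in
        \<open>auto simp: is_section_function_section hat_function_section\<close>)
qed

lemma factor_pairs_bisection:
  assumes U: "open_bisection G U" and out: "\<And>a. \<phi> a \<noteq> 0 \<Longrightarrow> a \<in> U" and ab: "a \<in> U" "\<s> a = \<r> b"
  shows "factor_pairs \<phi> \<psi> (a \<diamondop> b) \<subseteq> {(a, b)}"
proof (clarsimp simp: factor_pairs_def)
  fix c d assume cd: "\<s> c = \<r> d" "c \<diamondop> d = a \<diamondop> b" "\<phi> c \<noteq> 0"
  have "\<r> c = \<r> a" using mult_range[OF cd(1)] mult_range[OF ab(2)] cd(2) by simp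
  then have "c = a" using bisection_range_eq[OF U out[OF cd(3)] ab(1)] by simp
  then show "c = a \<and> d = b" using cd ab by (metis inv_mult_cancel)
qed

lemma twisted_conv_bisection:
  assumes U: "open_bisection G U" and out: "\<And>a. \<phi> a \<noteq> 0 \<Longrightarrow> a \<in> U" and ab: "a \<in> U" "\<s> a = \<r> b"
  shows "twisted_conv \<phi> \<psi> (a \<diamondop> b) = \<phi> a * \<psi> b * cocycle a b"
  using twisted_conv_eq_sum[OF _ factor_pairs_bisection[OF assms]] ab by simp

lemma twisted_conv_eq_0:
  assumes "\<And>a b. \<s> a = \<r> b \<Longrightarrow> a \<diamondop> b = g \<Longrightarrow> \<phi> a \<noteq> 0 \<Longrightarrow> \<psi> b \<noteq> 0 \<Longrightarrow> False"
  shows "twisted_conv \<phi> \<psi> g = 0"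
proof -
  have "factor_pairs \<phi> \<psi> g = {}" using assms by (auto simp: factor_pairs_def)
  then show ?thesis by (simp add: twisted_conv_def)
qed

text \<open>An arrow in the product of two bisections has one factorisation, and its factors depend
  continuously on it. Hence the convolution sum has a single term.\<close>

lemma convolution_bisection:
  assumes U: "open_bisection G U" and f: "f \<in> bisection_sections L U"
    and V: "open_bisection G V" and h: "h \<in> bisection_sections L V"
  shows "conv f h \<in> bisection_sections L (set_mult U V)"
proof -
  obtain K where K: "is_section f" "continuous_on U f" "compact K" "K \<subseteq> U" "\<And>g. g \<notin> K \<Longrightarrow> f g = lzero L g"
    using f by (rule bisection_sectionsE) blast
  obtain M where M: "is_section h" "continuous_on V h" "compact M" "M \<subseteq> V" "\<And>g. g \<notin> M \<Longrightarrow> h g = lzero L g"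
    using h by (rule bisection_sectionsE) blast
  note fin = fibre_finite_bisection_section[OF U f]
  note sec = is_section_convolution[OF K(1) M(1) fin]
  note out = bisection_sections_outside[OF f]
  show ?thesis
  proof (rule bisection_sectionsI[OF open_bisection_set_mult[OF U V] sec])
    have factors: "left_factor U g \<in> U \<and> right_factor U g \<in> V \<and> \<s> (left_factor U g) = \<r> (right_factor U g)
        \<and> g = left_factor U g \<diamondop> right_factor U g \<and> \<r> g \<in> \<r> ` U" if g: "g \<in> set_mult U V" for g
    proof -
      obtain a b where ab: "a \<in> U" "b \<in> V" "\<s> a = \<r> b" "g = a \<diamondop> b" using g by (rule set_multE)
      then show ?thesis using factors_mult[OF U ab(1,3)] by auto
    qed
    have cl: "continuous_on (set_mult U V) (left_factor U)" "continuous_on (set_mult U V) (right_factor U)"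
      using continuous_on_factors[OF U] by (auto elim!: continuous_on_subset dest: factors)
    have "continuous_on (set_mult U V) (\<lambda>g. case (f (left_factor U g), h (right_factor U g)) of (u, v) \<Rightarrow> lmult L u v)"
    proof (rule continuous_on_compose2[OF continuous_lmult])
      show "continuous_on (set_mult U V) (\<lambda>g. (f (left_factor U g), h (right_factor U g)))"
        by (intro continuous_on_Pair continuous_on_compose2[OF K(2) cl(1)] continuous_on_compose2[OF M(2) cl(2)])
          (use factors in auto)
      show "(\<lambda>g. (f (left_factor U g), h (right_factor U g))) ` set_mult U V \<subseteq> lcomposable G L"
        using factors K(1) M(1) by (auto simp: lcomposable_def is_section_def)
    qed
    moreover have "conv f h g = lmult L (f (left_factor U g)) (h (right_factor U g))" if g: "g \<in> set_mult U V" for g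
    proof -
      define a b where "a = left_factor U g" and "b = right_factor U g"
      have ab: "a \<in> U" "\<s> a = \<r> b" "g = a \<diamondop> b" using factors[OF g] by (auto simp: a_def b_def)
      have pr: "proj L (f a) = a" "proj L (h b) = b" using K(1) M(1) by (auto simp: is_section_def)
      have "coord (conv f h g) = coord (lmult L (f a) (h b))"
        using fun_cong[OF hat_convolution[OF K(1) M(1) fin], of g] twisted_conv_bisection[of U "hat f", OF U out ab(1,2)] ab pr
        by (simp add: coord_mult) (simp add: hat_def)
      then show ?thesis
        unfolding a_def[symmetric] b_def[symmetric]
        by (rule coord_eqI[rotated]) (use sec ab pr in \<open>simp add: is_section_def proj_mult lcomposable_def\<close>)
    qed
    ultimately show "continuous_on (set_mult U V) (conv f h)"
      by (simp cong: continuous_on_cong)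
    show "compact (set_mult K M)" using K M by (intro compact_set_mult)
    show "set_mult K M \<subseteq> set_mult U V" using K M by (intro set_mult_mono)
    fix g assume g: "g \<notin> set_mult K M"
    have "hat (conv f h) g = 0"
      unfolding hat_convolution[OF K(1) M(1) fin]
    proof (rule twisted_conv_eq_0)
      fix a b assume ab: "\<s> a = \<r> b" "a \<diamondop> b = g" "hat f a \<noteq> 0" "hat h b \<noteq> 0"
      have "a \<in> K" "b \<in> M" using ab K(5)[of a] M(5)[of b] hat_eq_0[OF K(1)] hat_eq_0[OF M(1)] by blast+
      then show False using ab g set_multI by blast
    qed
    then show "conv f h g = lzero L g" using hat_eq_0[OF sec] by simp
  qed
qed

lemma star_bisection:
  assumes U: "open_bisection G U" and f: "f \<in> bisection_sections L U"
  shows "adj f \<in> bisection_sections L (\<iota> ` U)"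
proof -
  obtain K where K: "is_section f" "continuous_on U f" "compact K" "K \<subseteq> U" "\<And>g. g \<notin> K \<Longrightarrow> f g = lzero L g"
    using f by (rule bisection_sectionsE) blast
  show ?thesis
  proof (rule bisection_sectionsI[OF open_bisection_inv[OF U] is_section_star[OF K(1)], of "\<iota> ` K"])
    show "continuous_on (\<iota> ` U) (adj f)"
      by (intro continuous_on_compose2[OF continuous_star] continuous_on_compose2[OF K(2)] continuous_intros) auto
    show "compact (\<iota> ` K)" using K(3) by (intro compact_continuous_image continuous_intros)
    show "\<iota> ` K \<subseteq> \<iota> ` U" using K(4) by blast
    fix g assume "g \<notin> \<iota> ` K"
    then have "\<iota> g \<notin> K" by (metis image_eqI inv_inv)
    then have "hat (adj f) g = 0"
      using K(5) by (simp add: hat_star[OF K(1)] twisted_star_def hat_eq_0[OF K(1)])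
    then show "lstar L (f (\<iota> g)) = lzero L g" using hat_eq_0[OF is_section_star[OF K(1)]] by simp
  qed
qed

lemma convolution_mem:
  assumes "f \<in> \<A>" "h \<in> \<A>"
  shows "conv f h \<in> \<A>"
  using assms
proof (induction f arbitrary: h rule: compact_sections.induct)
  case (bisection U f)
  note U = bisection(1,2)
  note f = compact_sections.bisection[OF U]
  note f' = compact_sections_section[OF f] compact_sections_finite[OF f]
  show ?case
    using bisection(3)
  proof (induction h rule: compact_sections.induct)
    case (bisection V h)
    then show ?case
      using convolution_bisection[OF U] open_bisection_set_mult U by (blast intro: compact_sections.bisection)
  next
    case (add h k)
    note sec = compact_sections_section[OF add(1)] compact_sections_section[OF add(2)]
    have "conv f (section_add L h k) = section_add L (conv f h) (conv f k)"
      by (rule section_eqI) (simp_all add: f' sec is_section_add is_section_convolution hat_add hat_convolution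
          twisted_conv_add_right)
    then show ?case using add by (simp add: compact_sections.add)
  next
    case (scale h c)
    note sec = compact_sections_section[OF scale(1)]
    have "conv f (section_scale L c h) = section_scale L c (conv f h)"
      by (rule section_eqI) (simp_all add: f' sec is_section_scale is_section_convolution hat_scale hat_convolution
          twisted_conv_scale_right)
    then show ?case using scale by (simp add: compact_sections.scale)
  qed
next
  case (add f k)
  note sec = compact_sections_section[OF add(1)] compact_sections_section[OF add(2)] compact_sections_section[OF add(5)]
    compact_sections_finite[OF add(1)] compact_sections_finite[OF add(2)]
    compact_sections_finite[OF compact_sections.add[OF add(1,2)]]
  have "conv (section_add L f k) h = section_add L (conv f h) (conv k h)"
  proof (rule section_eqI)
    show "hat (conv (section_add L f k) h) g = hat (section_add L (conv f h) (conv k h)) g" for g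
      using sec by (simp add: is_section_add is_section_convolution hat_convolution hat_add[of "conv f h"])
        (simp add: hat_add twisted_conv_add_left)
  qed (use sec in \<open>simp_all add: is_section_add is_section_convolution\<close>)
  then show ?case using add by (simp add: compact_sections.add)
next
  case (scale f c)
  note sec = compact_sections_section[OF scale(1)] compact_sections_section[OF scale(3)]
    compact_sections_finite[OF scale(1)] compact_sections_finite[OF compact_sections.scale[OF scale(1)]]
  have "conv (section_scale L c f) h = section_scale L c (conv f h)"
  proof (rule section_eqI)
    show "hat (conv (section_scale L c f) h) g = hat (section_scale L c (conv f h)) g" for g
      using sec by (simp add: is_section_scale is_section_convolution hat_convolution) 
        (simp add: hat_scale hat_convolution twisted_conv_scale_left)
  qed (use sec in \<open>simp_all add: is_section_scale is_section_convolution\<close>)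
  then show ?case using scale by (simp add: compact_sections.scale)
qed

lemma star_mem:
  assumes "f \<in> \<A>"
  shows "adj f \<in> \<A>"
  using assms
proof (induction rule: compact_sections.induct)
  case (bisection U f)
  then show ?case using star_bisection open_bisection_inv by (blast intro: compact_sections.bisection)
next
  case (add f h)
  then have "adj (section_add L f h) =
      section_add L (adj f) (adj h)"
    using compact_sections_section by (auto simp: section_add_def fun_eq_iff is_section_def star_add)
  then show ?case using add by (simp add: compact_sections.add)
next
  case (scale f c)
  have "adj (section_scale L c f) = section_scale L (cnj c) (adj f)"
    by (simp add: section_scale_def fun_eq_iff star_scale)
  then show ?case using scale by (simp add: compact_sections.scale)
qed

lemma zero_mem: "lzero L \<in> \<A>"
proof (rule compact_sections.bisection)
  show "open_bisection G {}" by (simp add: open_bisection_def)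
  show "lzero L \<in> bisection_sections L {}" by (simp add: bisection_sections_def)
qed

abbreviation alg where "alg \<equiv> section_algebra G L"

lemma alg_simps [simp]:
  "carrier alg = \<A>" "azero alg = lzero L" "aadd alg = section_add L"
  "ascale alg = section_scale L" "amult alg = conv"
  "astar alg = adj"
  by (simp_all add: section_algebra_def)

lemma alg_eqI:
  "f \<in> \<A> \<Longrightarrow> h \<in> \<A> \<Longrightarrow> (\<And>g. hat f g = hat h g) \<Longrightarrow> f = h"
  using section_eqI compact_sections_section by blast

lemma hat_alg_simps:
  "f \<in> \<A> \<Longrightarrow> h \<in> \<A> \<Longrightarrow>
    hat (section_add L f h) = (\<lambda>g. hat f g + hat h g)"
  "f \<in> \<A> \<Longrightarrow> h \<in> \<A> \<Longrightarrow>
    hat (conv f h) = twisted_conv (hat f) (hat h)"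
  "f \<in> \<A> \<Longrightarrow> hat (adj f) = twisted_star (hat f)"
  using compact_sections_section compact_sections_finite by (auto simp: hat_add hat_convolution hat_star)

lemmas mem_simps = zero_mem compact_sections.add compact_sections.scale convolution_mem star_mem

\<comment> \<open>Each axiom is an identity of sections, which is checked in coordinates.\<close>
sublocale alg: star_alg alg
proof (unfold_locales, goal_cases)
  case 6 then show ?case by (intro alg_eqI) (simp_all add: mem_simps hat_alg_simps)
next
  case 7 then show ?case by (intro alg_eqI) (simp_all add: mem_simps hat_alg_simps)
next
  case 8 then show ?case by (intro alg_eqI) (simp_all add: mem_simps hat_alg_simps)
next
  case 9 then show ?case by (intro alg_eqI) (simp_all add: mem_simps hat_alg_simps hat_scale algebra_simps)
next
  case 10 then show ?case by (intro alg_eqI) (simp_all add: mem_simps hat_alg_simps hat_scale algebra_simps)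
next
  case 11 then show ?case by (intro alg_eqI) (simp_all add: mem_simps hat_alg_simps hat_scale)
next
  case 12 then show ?case by (intro alg_eqI) (simp_all add: mem_simps hat_alg_simps hat_scale)
next
  case 13 then show ?case by (intro alg_eqI) (simp_all add: mem_simps hat_alg_simps hat_scale)
next
  case 14 then show ?case
    by (intro alg_eqI) (simp_all add: mem_simps hat_alg_simps twisted_conv_assoc compact_sections_finite)
next
  case 15 then show ?case
    by (intro alg_eqI) (simp_all add: mem_simps hat_alg_simps twisted_conv_add_left compact_sections_finite)
next
  case 16 then show ?case
    by (intro alg_eqI) (simp_all add: mem_simps hat_alg_simps twisted_conv_add_right compact_sections_finite)
next
  case 17 then show ?case
    by (intro alg_eqI) (simp_all add: mem_simps hat_alg_simps hat_scale twisted_conv_scale_left)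
next
  case 18 then show ?case
    by (intro alg_eqI) (simp_all add: mem_simps hat_alg_simps hat_scale twisted_conv_scale_right)
next
  case 19 then show ?case
    by (intro alg_eqI) (simp_all only: alg_simps mem_simps hat_alg_simps twisted_star_def, simp add: algebra_simps)
next
  case 20 then show ?case
    by (intro alg_eqI) (simp_all only: alg_simps mem_simps hat_alg_simps hat_scale twisted_star_def, simp add: algebra_simps)
next
  case 21 then show ?case
    by (intro alg_eqI) (simp_all only: alg_simps mem_simps hat_alg_simps twisted_star_conv)
next
  case 22 then show ?case by (simp add: star_star)
qed (simp_all add: mem_simps)

end

section \<open>GNS seminorms of positive functionals\<close>

text \<open>The seminorm of the GNS space of \<open>\<psi>\<close>.\<close>

definition (in star_alg) functional_norm :: "('a \<Rightarrow> complex) \<Rightarrow> 'a \<Rightarrow> real" where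
  "functional_norm \<psi> a = sqrt (Re (\<psi> (a\<^sup>\<star> \<odot> a)))"

locale positive_functional = star_alg A
  for A :: "('a, 'm) star_algebra_scheme" +
  fixes \<psi> :: "'a \<Rightarrow> complex"
  assumes add: "a \<in> carrier A \<Longrightarrow> b \<in> carrier A \<Longrightarrow> \<psi> (a \<oplus> b) = \<psi> a + \<psi> b"
    and scale: "a \<in> carrier A \<Longrightarrow> \<psi> (k \<cdot> a) = k * \<psi> a"
    and positive: "a \<in> carrier A \<Longrightarrow> \<psi> (a\<^sup>\<star> \<odot> a) \<in> \<real>\<^sub>\<ge>\<^sub>0"
begin

abbreviation fnorm where "fnorm \<equiv> functional_norm \<psi>"

lemma minus: "a \<in> carrier A \<Longrightarrow> b \<in> carrier A \<Longrightarrow> \<psi> (a \<ominus> b) = \<psi> a - \<psi> b"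
  by (simp add: aminus_def add scale)

lemma fnorm_square: "a \<in> carrier A \<Longrightarrow> \<psi> (a\<^sup>\<star> \<odot> a) = complex_of_real ((fnorm a)\<^sup>2)"
  using positive[of a] by (auto simp: functional_norm_def nonneg_Reals_def complex_eq_iff elim!: Reals_cases simp: complex_nonneg_Reals_iff)

lemma fnorm_nonneg [simp]: "a \<in> carrier A \<Longrightarrow> 0 \<le> fnorm a"
  using positive[of a] by (simp add: functional_norm_def complex_nonneg_Reals_iff)

lemma square_add_scale:
  assumes [simp]: "a \<in> carrier A" "b \<in> carrier A"
  shows "\<psi> ((a \<oplus> t \<cdot> b)\<^sup>\<star> \<odot> (a \<oplus> t \<cdot> b)) =
    \<psi> (a\<^sup>\<star> \<odot> a) + t * \<psi> (a\<^sup>\<star> \<odot> b) + cnj t * \<psi> (b\<^sup>\<star> \<odot> a) + cnj t * t * \<psi> (b\<^sup>\<star> \<odot> b)"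
  by (simp add: star_add star_scale add_mult mult_add scale_mult mult_scale add scale algebra_simps)

lemma hermitian:
  assumes ab: "a \<in> carrier A" "b \<in> carrier A"
  shows "\<psi> (a\<^sup>\<star> \<odot> b) = cnj (\<psi> (b\<^sup>\<star> \<odot> a))"
proof -
  have im: "Im (\<psi> ((a \<oplus> t \<cdot> b)\<^sup>\<star> \<odot> (a \<oplus> t \<cdot> b))) = 0" for t
    using positive[of "a \<oplus> t \<cdot> b"] ab by (auto simp: complex_nonneg_Reals_iff)
  have "Im (\<psi> (a\<^sup>\<star> \<odot> a)) = 0" "Im (\<psi> (b\<^sup>\<star> \<odot> b)) = 0"
    using positive[of a] positive[of b] ab by (auto simp: complex_nonneg_Reals_iff)
  with im[of 1] im[of \<i>] show ?thesis
    unfolding square_add_scale[OF ab] by (simp add: complex_eq_iff)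
qed

lemma Cauchy_Schwarz:
  assumes ab: "a \<in> carrier A" "b \<in> carrier A"
  shows "cmod (\<psi> (b\<^sup>\<star> \<odot> a)) \<le> fnorm b * fnorm a"
proof -
  define z where "z = \<psi> (b\<^sup>\<star> \<odot> a)"
  have ineq: "0 \<le> (fnorm a)\<^sup>2 - 2 * s * (cmod z)\<^sup>2 + s\<^sup>2 * (cmod z)\<^sup>2 * (fnorm b)\<^sup>2" for s :: real
  proof -
    \<comment> \<open>With this phase of \<open>t\<close>, both mixed terms become equal to \<open>- s * (cmod z)\<^sup>2\<close>.\<close>
    define t where "t = - complex_of_real s * z"
    have "\<psi> ((a \<oplus> t \<cdot> b)\<^sup>\<star> \<odot> (a \<oplus> t \<cdot> b)) =
        of_real ((fnorm a)\<^sup>2) + t * cnj z + cnj t * z + cnj t * t * of_real ((fnorm b)\<^sup>2)"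
      unfolding square_add_scale[OF ab] using ab hermitian[OF ab]
      by (simp add: fnorm_square z_def)
    also have "\<dots> = of_real ((fnorm a)\<^sup>2) - 2 * of_real s * (z * cnj z) + (of_real s)\<^sup>2 * (z * cnj z) * of_real ((fnorm b)\<^sup>2)"
      by (simp add: t_def algebra_simps power2_eq_square)
    also have "\<dots> = of_real ((fnorm a)\<^sup>2 - 2 * s * (cmod z)\<^sup>2 + s\<^sup>2 * (cmod z)\<^sup>2 * (fnorm b)\<^sup>2)"
      by (simp flip: complex_norm_square)
    finally show ?thesis
      using positive[of "a \<oplus> t \<cdot> b"] ab by (simp add: complex_nonneg_Reals_iff)
  qed
  have sq: "(cmod z)\<^sup>2 \<le> (fnorm b * fnorm a)\<^sup>2"
  proof (cases "fnorm b = 0")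
    case True
    \<comment> \<open>For \<open>fnorm b = 0\<close> the inequality is linear in \<open>s\<close>, and fails for large \<open>s\<close> unless \<open>z = 0\<close>.\<close>
    have "(cmod z)\<^sup>2 \<le> 0"
    proof (rule ccontr)
      assume "\<not> (cmod z)\<^sup>2 \<le> 0"
      then show False
        using ineq[of "((fnorm a)\<^sup>2 + 1) / (2 * (cmod z)\<^sup>2)"] True by simp
    qed
    then show ?thesis using True by simp
  next
    case False
    then have pos: "0 < (fnorm b)\<^sup>2" by simp
    define B where "B = (fnorm b)\<^sup>2"
    have "0 \<le> (fnorm a)\<^sup>2 - 2 * (1 / B) * (cmod z)\<^sup>2 + (1 / B)\<^sup>2 * (cmod z)\<^sup>2 * B"
      using ineq[of "1 / B"] by (simp add: B_def)
    also have "\<dots> = (fnorm a)\<^sup>2 - (cmod z)\<^sup>2 / B"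
      using pos unfolding B_def[symmetric] by (simp add: power2_eq_square[of "1 / B"])
    finally have "(cmod z)\<^sup>2 \<le> (fnorm a)\<^sup>2 * B"
      using pos unfolding B_def[symmetric] by (simp add: pos_divide_le_eq)
    then show ?thesis by (simp add: B_def power_mult_distrib mult.commute)
  qed
  show ?thesis
    unfolding z_def[symmetric] by (rule power2_le_imp_le[OF sq]) (use ab in simp)
qed

lemma fnorm_add: 
  assumes ab: "a \<in> carrier A" "b \<in> carrier A"
  shows "fnorm (a \<oplus> b) \<le> fnorm a + fnorm b"
proof -
  have "\<psi> ((a \<oplus> b)\<^sup>\<star> \<odot> (a \<oplus> b)) = of_real ((fnorm a)\<^sup>2) + \<psi> (a\<^sup>\<star> \<odot> b) + \<psi> (b\<^sup>\<star> \<odot> a) + of_real ((fnorm b)\<^sup>2)"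
    using square_add_scale[OF ab, of 1] ab by (simp add: fnorm_square)
  then have "(fnorm (a \<oplus> b))\<^sup>2 = (fnorm a)\<^sup>2 + Re (\<psi> (a\<^sup>\<star> \<odot> b)) + Re (\<psi> (b\<^sup>\<star> \<odot> a)) + (fnorm b)\<^sup>2"
    using fnorm_square[of "a \<oplus> b"] ab by (metis Re_complex_of_real add_closed plus_complex.sel(1))
  also have "\<dots> \<le> (fnorm a)\<^sup>2 + fnorm a * fnorm b + fnorm b * fnorm a + (fnorm b)\<^sup>2"
    using Cauchy_Schwarz[OF ab] Cauchy_Schwarz[OF ab(2,1)] complex_Re_le_cmod[of "\<psi> (a\<^sup>\<star> \<odot> b)"]
      complex_Re_le_cmod[of "\<psi> (b\<^sup>\<star> \<odot> a)"] by linarith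
  also have "\<dots> = (fnorm a + fnorm b)\<^sup>2" by (simp add: power2_sum)
  finally show ?thesis by (rule power2_le_imp_le) (use ab in simp)
qed

lemma fnorm_scale: 
  assumes a: "a \<in> carrier A"
  shows "fnorm (c \<cdot> a) = cmod c * fnorm a"
proof -
  have "\<psi> ((c \<cdot> a)\<^sup>\<star> \<odot> (c \<cdot> a)) = (c * cnj c) * \<psi> (a\<^sup>\<star> \<odot> a)"
    using a by (simp add: star_scale scale_mult mult_scale scale)
  also have "\<dots> = of_real ((cmod c * fnorm a)\<^sup>2)"
    using a by (simp add: fnorm_square power_mult_distrib flip: complex_norm_square)
  finally have "(fnorm (c \<cdot> a))\<^sup>2 = (cmod c * fnorm a)\<^sup>2"
    using a fnorm_square[of "c \<cdot> a"] by (metis of_real_eq_iff scale_closed)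
  then show ?thesis by (rule power2_eq_imp_eq) (use a in simp_all)
qed

lemma fnorm_mult_square:
  assumes "b \<in> carrier A" "c \<in> carrier A"
  shows "of_real ((fnorm (b \<odot> c))\<^sup>2) = \<psi> (c\<^sup>\<star> \<odot> ((b\<^sup>\<star> \<odot> b) \<odot> c))"
  using fnorm_square[of "b \<odot> c"] assms by (simp add: star_mult mult_assoc)

lemma fnorm_mult_le:
  assumes b: "b \<in> carrier A" and c: "c \<in> carrier A"
  shows "(fnorm (b \<odot> c))\<^sup>2 \<le> fnorm c * fnorm ((b\<^sup>\<star> \<odot> b) \<odot> c)"
proof -
  have "(fnorm (b \<odot> c))\<^sup>2 = cmod (\<psi> (c\<^sup>\<star> \<odot> ((b\<^sup>\<star> \<odot> b) \<odot> c)))"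
    unfolding fnorm_mult_square[OF b c, symmetric] by (simp add: norm_power)
  also have "\<dots> \<le> fnorm c * fnorm ((b\<^sup>\<star> \<odot> b) \<odot> c)"
    using b c by (intro Cauchy_Schwarz) simp_all
  finally show ?thesis .
qed

text \<open>Let \<open>y k\<close> be the power of \<open>b\<^sup>\<star> \<odot> b\<close> with exponent \<open>2 ^ (k - 1)\<close>. Iterated Cauchy--Schwarz
  estimates bound the power of \<open>fnorm (b \<odot> c) / fnorm c\<close> with exponent \<open>2 ^ k\<close> by
  \<open>fnorm (y k \<odot> c) / fnorm c\<close>, which is at most a constant times the same power of \<open>q b\<close>. The
  constant disappears in the limit of the roots.\<close>

lemma fnorm_mult_le_seminorm:
  assumes q: "cstar_seminorm A q" and le: "\<And>a. a \<in> carrier A \<Longrightarrow> cmod (\<psi> a) \<le> q a"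
    and b: "b \<in> carrier A" and c: "c \<in> carrier A"
  shows "fnorm (b \<odot> c) \<le> q b * fnorm c"
proof (rule ccontr)
  interpret q: cstar_seminormed A q using q by unfold_locales
  assume "\<not> ?thesis"
  then have less: "q b * fnorm c < fnorm (b \<odot> c)" by simp
  then have pos: "0 < fnorm (b \<odot> c)"
    using b c by (meson fnorm_nonneg le_less_trans mult_nonneg_nonneg q.nonneg)
  define y where "y = rec_nat b (\<lambda>_ z. z\<^sup>\<star> \<odot> z)"
  have y_Suc: "y (Suc k) = (y k)\<^sup>\<star> \<odot> y k" and y_0: "y 0 = b" for k by (simp_all add: y_def)
  have y: "y k \<in> carrier A" for k by (induction k) (simp_all add: y_Suc y_0 b)
  have qy: "q (y k) = q b ^ (2 ^ k)" for k
    by (induction k) (simp_all add: y_Suc y_0 q.norm_star_mult y mult_2 power_add power2_eq_square)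
  have chain: "(fnorm (y k \<odot> c))\<^sup>2 \<le> fnorm c * fnorm (y (Suc k) \<odot> c)" for k
    unfolding y_Suc by (rule fnorm_mult_le[OF y c])
  have c_pos: "0 < fnorm c"
    using chain[of 0] pos c y_0 by (cases "fnorm c = 0") (auto simp: less_le)
  define \<rho> where "\<rho> k = fnorm (y k \<odot> c) / fnorm c" for k
  have \<rho>0: "q b < \<rho> 0" "0 < \<rho> 0" using less pos c_pos by (simp_all add: \<rho>_def y_0 field_simps)
  have \<rho>_nonneg: "0 \<le> \<rho> k" for k using y c c_pos by (simp add: \<rho>_def)
  have \<rho>_chain: "(\<rho> k)\<^sup>2 \<le> \<rho> (Suc k)" for k
    using chain[of k] c_pos by (simp add: \<rho>_def power_divide power2_eq_square field_simps)
  have lower: "\<rho> 0 ^ (2 ^ k) \<le> \<rho> k" for k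
  proof (induction k)
    case (Suc k)
    have "\<rho> 0 ^ (2 ^ Suc k) = (\<rho> 0 ^ (2 ^ k))\<^sup>2" by (simp add: mult.commute flip: power_mult)
    also have "\<dots> \<le> (\<rho> k)\<^sup>2" using Suc \<rho>0 by (intro power_mono) simp_all
    also have "\<dots> \<le> \<rho> (Suc k)" by (rule \<rho>_chain)
    finally show ?case .
  qed simp
  have upper: "\<rho> k \<le> (q c / fnorm c) * q b ^ (2 ^ k)" for k
  proof -
    have "(fnorm (y k \<odot> c))\<^sup>2 \<le> q ((y k \<odot> c)\<^sup>\<star> \<odot> (y k \<odot> c))"
      using le[of "(y k \<odot> c)\<^sup>\<star> \<odot> (y k \<odot> c)"] y c by (simp add: fnorm_square norm_power)
    also have "\<dots> = (q (y k \<odot> c))\<^sup>2" using y c by (simp add: q.norm_star_mult)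
    finally have "fnorm (y k \<odot> c) \<le> q (y k \<odot> c)" by (rule power2_le_imp_le) (use y c in simp)
    also have "\<dots> \<le> q b ^ (2 ^ k) * q c" using q.sub_mult[OF y c, of k] by (simp add: qy)
    finally show ?thesis using c_pos by (simp add: \<rho>_def field_simps)
  qed
  define D where "D = q c / fnorm c"
  have le_D: "\<rho> 0 ^ (2 ^ k) \<le> D * q b ^ (2 ^ k)" for k
    using lower[of k] upper[of k] by (simp add: D_def)
  have qb: "0 < q b"
  proof (rule ccontr)
    assume "\<not> 0 < q b"
    then have "q b = 0" using q.nonneg[OF b] by simp
    then show False using le_D[of 0] \<rho>0 by simp
  qed
  have "(\<rho> 0 / q b) ^ (2 ^ k) \<le> D" for k
    using le_D[of k] qb by (simp add: power_divide field_simps)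
  moreover obtain n where "D < (\<rho> 0 / q b) ^ n"
    using real_arch_pow[of "\<rho> 0 / q b" D] \<rho>0 qb by auto
  moreover have "(\<rho> 0 / q b) ^ n \<le> (\<rho> 0 / q b) ^ (2 ^ n)"
    using \<rho>0 qb less_exp[of n] by (intro power_increasing) (auto simp: less_imp_le)
  ultimately show False by (meson le_less_trans not_less)
qed

end

text \<open>The last assumption says that left multiplications act as bounded operators on the GNS
  spaces, uniformly in the family.\<close>

locale gns_family = star_alg A
  for A :: "('a, 'm) star_algebra_scheme" +
  fixes \<Psi> :: "('a \<Rightarrow> complex) set"
  assumes nonempty: "\<Psi> \<noteq> {}"
    and positive_functional: "\<psi> \<in> \<Psi> \<Longrightarrow> positive_functional A \<psi>"
    and bounded: "b \<in> carrier A \<Longrightarrow> \<exists>K. \<forall>\<psi>\<in>\<Psi>. \<forall>c\<in>carrier A.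
      functional_norm \<psi> (b \<odot> c) \<le> K * functional_norm \<psi> c"
begin

definition gns_index where
  "gns_index = {(\<psi>, c). \<psi> \<in> \<Psi> \<and> c \<in> carrier A \<and> functional_norm \<psi> c \<le> 1}"

text \<open>The operator norm of \<open>b\<close> in the direct sum of the GNS representations.\<close>

definition gns_norm :: "'a \<Rightarrow> real" where
  "gns_norm b = (SUP (\<psi>, c)\<in>gns_index. functional_norm \<psi> (b \<odot> c))"

lemma gns_index_nonempty: "gns_index \<noteq> {}"
proof -
  obtain \<psi> where \<psi>: "\<psi> \<in> \<Psi>" using nonempty by blast
  then interpret positive_functional A \<psi> by (rule positive_functional)
  have "functional_norm \<psi> \<zero> = 0" using fnorm_scale[of "\<zero>" 0] by simp
  then have "(\<psi>, \<zero>) \<in> gns_index" using \<psi> by (simp add: gns_index_def)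
  then show ?thesis by blast
qed

lemma gns_norm_least: "(\<And>\<psi> c. \<psi> \<in> \<Psi> \<Longrightarrow> c \<in> carrier A \<Longrightarrow> functional_norm \<psi> c \<le> 1 \<Longrightarrow>
    functional_norm \<psi> (b \<odot> c) \<le> B) \<Longrightarrow> gns_norm b \<le> B"
  unfolding gns_norm_def by (rule cSUP_least[OF gns_index_nonempty]) (auto simp: gns_index_def)

lemma bdd_gns:
  assumes "b \<in> carrier A"
  shows "bdd_above ((\<lambda>(\<psi>, c). functional_norm \<psi> (b \<odot> c)) ` gns_index)"
proof -
  obtain K where K: "\<And>\<psi> c. \<psi> \<in> \<Psi> \<Longrightarrow> c \<in> carrier A \<Longrightarrow> functional_norm \<psi> (b \<odot> c) \<le> K * functional_norm \<psi> c"
    using bounded[OF assms] by blast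
  have "functional_norm \<psi> (b \<odot> c) \<le> \<bar>K\<bar>" if i: "(\<psi>, c) \<in> gns_index" for \<psi> c
  proof -
    interpret positive_functional A \<psi> using i by (intro positive_functional) (simp add: gns_index_def)
    have c: "c \<in> carrier A" "fnorm c \<le> 1" using i by (auto simp: gns_index_def)
    have "functional_norm \<psi> (b \<odot> c) \<le> K * fnorm c" using i by (intro K) (auto simp: gns_index_def)
    also have "\<dots> \<le> \<bar>K\<bar> * 1" using c by (intro mult_mono) auto
    finally show ?thesis by simp
  qed
  then show ?thesis by (auto intro!: bdd_aboveI2)
qed

lemma gns_norm_upper1: "b \<in> carrier A \<Longrightarrow> \<psi> \<in> \<Psi> \<Longrightarrow> c \<in> carrier A \<Longrightarrow> functional_norm \<psi> c \<le> 1 \<Longrightarrow>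
    functional_norm \<psi> (b \<odot> c) \<le> gns_norm b"
  unfolding gns_norm_def using cSUP_upper[OF _ bdd_gns, of "(\<psi>, c)" b] by (simp add: gns_index_def)

lemma gns_norm_nonneg: "b \<in> carrier A \<Longrightarrow> 0 \<le> gns_norm b"
proof -
  assume b: "b \<in> carrier A"
  obtain \<psi> c where i: "\<psi> \<in> \<Psi>" "c \<in> carrier A" "functional_norm \<psi> c \<le> 1"
    using gns_index_nonempty by (auto simp: gns_index_def)
  interpret positive_functional A \<psi> using i(1) by (rule positive_functional)
  show ?thesis using fnorm_nonneg[of "b \<odot> c"] gns_norm_upper1[OF b i] b i by (metis mult_closed order_trans)
qed

lemma gns_norm_upper:
  assumes b: "b \<in> carrier A" and \<psi>: "\<psi> \<in> \<Psi>" and c: "c \<in> carrier A"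
  shows "functional_norm \<psi> (b \<odot> c) \<le> gns_norm b * functional_norm \<psi> c"
proof -
  interpret positive_functional A \<psi> using \<psi> by (rule positive_functional)
  show ?thesis
  proof (cases "fnorm c = 0")
    case True
    obtain K where "fnorm (b \<odot> c) \<le> K * fnorm c" using bounded[OF b] \<psi> c by blast
    then show ?thesis using True by simp
  next
    case False
    then have pos: "0 < fnorm c" using c by (simp add: less_le)
    have "fnorm (b \<odot> (of_real (1 / fnorm c) \<cdot> c)) \<le> gns_norm b"
      using pos c by (intro gns_norm_upper1 b \<psi>) (simp_all add: fnorm_scale norm_divide)
    then show ?thesis using pos b c by (simp add: mult_scale fnorm_scale norm_divide field_simps)
  qed
qed

lemma gns_norm_scale_le: "b \<in> carrier A \<Longrightarrow> gns_norm (k \<cdot> b) \<le> cmod k * gns_norm b"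
proof (rule gns_norm_least)
  fix \<psi> c assume b: "b \<in> carrier A" and i: "\<psi> \<in> \<Psi>" "c \<in> carrier A" "functional_norm \<psi> c \<le> 1"
  interpret positive_functional A \<psi> using i(1) by (rule positive_functional)
  show "fnorm (k \<cdot> b \<odot> c) \<le> cmod k * gns_norm b"
    using b i gns_norm_upper1[OF b i] by (simp add: scale_mult fnorm_scale mult_left_mono)
qed

lemma gns_norm_mult_le:
  assumes a: "a \<in> carrier A" and b: "b \<in> carrier A"
  shows "gns_norm (a \<odot> b) \<le> gns_norm a * gns_norm b"
proof (rule gns_norm_least)
  fix \<psi> c assume i: "\<psi> \<in> \<Psi>" "c \<in> carrier A" "functional_norm \<psi> c \<le> 1"
  have "functional_norm \<psi> (a \<odot> b \<odot> c) \<le> gns_norm a * functional_norm \<psi> (b \<odot> c)"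
    using gns_norm_upper[OF a i(1), of "b \<odot> c"] a b i by (simp add: mult_assoc)
  also have "\<dots> \<le> gns_norm a * gns_norm b"
    using gns_norm_upper1[OF b i] gns_norm_nonneg[OF a] by (rule mult_left_mono)
  finally show "functional_norm \<psi> (a \<odot> b \<odot> c) \<le> gns_norm a * gns_norm b" .
qed

lemma gns_norm_square_le: 
  assumes b: "b \<in> carrier A"
  shows "(gns_norm b)\<^sup>2 \<le> gns_norm (b\<^sup>\<star> \<odot> b)"
proof -
  have "gns_norm b \<le> sqrt (gns_norm (b\<^sup>\<star> \<odot> b))"
  proof (rule gns_norm_least)
    fix \<psi> c assume i: "\<psi> \<in> \<Psi>" "c \<in> carrier A" "functional_norm \<psi> c \<le> 1"
    interpret positive_functional A \<psi> using i(1) by (rule positive_functional)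
    have "(fnorm (b \<odot> c))\<^sup>2 \<le> fnorm c * fnorm ((b\<^sup>\<star> \<odot> b) \<odot> c)" using b i by (intro fnorm_mult_le)
    also have "\<dots> \<le> 1 * gns_norm (b\<^sup>\<star> \<odot> b)"
      using b i gns_norm_upper1[of "b\<^sup>\<star> \<odot> b", OF _ i] by (intro mult_mono) simp_all
    finally show "fnorm (b \<odot> c) \<le> sqrt (gns_norm (b\<^sup>\<star> \<odot> b))" by (simp add: real_le_rsqrt)
  qed
  then show ?thesis
    using power_mono[of "gns_norm b" "sqrt (gns_norm (b\<^sup>\<star> \<odot> b))" 2] b by (simp add: gns_norm_nonneg)
qed

lemma gns_norm_le_star: "b \<in> carrier A \<Longrightarrow> gns_norm b \<le> gns_norm (b\<^sup>\<star>)"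
  using gns_norm_square_le[of b] gns_norm_mult_le[of "b\<^sup>\<star>" b] gns_norm_nonneg[of b] gns_norm_nonneg[of "b\<^sup>\<star>"]
  by (cases "gns_norm b = 0") (auto simp: power2_eq_square dest: order_trans)

theorem cstar_seminorm_gns_norm: "cstar_seminorm A gns_norm"
  unfolding cstar_seminorm_def
proof (intro conjI ballI allI)
  fix a assume a: "a \<in> carrier A"
  show "0 \<le> gns_norm a" using a by (rule gns_norm_nonneg)
  show "gns_norm (k \<cdot> a) = cmod k * gns_norm a" for k
  proof (cases "k = 0")
    case True
    then show ?thesis using gns_norm_scale_le[OF a, of 0] gns_norm_nonneg[of "0 \<cdot> a"] a by simp
  next
    case False
    have "gns_norm a \<le> cmod (1 / k) * gns_norm (k \<cdot> a)"
      using gns_norm_scale_le[of "k \<cdot> a" "1 / k"] False a by simp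
    then show ?thesis using gns_norm_scale_le[OF a, of k] False by (simp add: norm_divide field_simps)
  qed
  have "gns_norm (a\<^sup>\<star> \<odot> a) \<le> gns_norm (a\<^sup>\<star>) * gns_norm a" using a by (intro gns_norm_mult_le) simp_all
  also have "\<dots> \<le> gns_norm a * gns_norm a"
    using a gns_norm_le_star[of "a\<^sup>\<star>"] by (intro mult_right_mono gns_norm_nonneg) simp_all
  finally show "gns_norm (a\<^sup>\<star> \<odot> a) = (gns_norm a)\<^sup>2"
    using gns_norm_square_le[OF a] by (simp add: power2_eq_square)
  fix b assume b: "b \<in> carrier A"
  show "gns_norm (a \<odot> b) \<le> gns_norm a * gns_norm b" using a b by (rule gns_norm_mult_le)
  show "gns_norm (a \<oplus> b) \<le> gns_norm a + gns_norm b"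
  proof (rule gns_norm_least)
    fix \<psi> c assume i: "\<psi> \<in> \<Psi>" "c \<in> carrier A" "functional_norm \<psi> c \<le> 1"
    interpret positive_functional A \<psi> using i(1) by (rule positive_functional)
    show "fnorm ((a \<oplus> b) \<odot> c) \<le> gns_norm a + gns_norm b"
      using fnorm_add[of "a \<odot> c" "b \<odot> c"] gns_norm_upper1[OF a i] gns_norm_upper1[OF b i] a b i
      by (simp add: add_mult)
  qed
qed

lemma gns_norm_le:
  assumes q: "cstar_seminorm A q" and le: "\<And>\<psi> a. \<psi> \<in> \<Psi> \<Longrightarrow> a \<in> carrier A \<Longrightarrow> cmod (\<psi> a) \<le> q a"
    and b: "b \<in> carrier A"
  shows "gns_norm b \<le> q b"
proof (rule gns_norm_least)
  interpret q: cstar_seminormed A q using q by unfold_locales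
  fix \<psi> c assume i: "\<psi> \<in> \<Psi>" "c \<in> carrier A" "functional_norm \<psi> c \<le> 1"
  interpret positive_functional A \<psi> using i(1) by (rule positive_functional)
  have "fnorm (b \<odot> c) \<le> q b * fnorm c" using i b le by (intro fnorm_mult_le_seminorm[OF q])
  also have "\<dots> \<le> q b" using i b by (simp add: mult_left_le)
  finally show "fnorm (b \<odot> c) \<le> q b" .
qed

end

section \<open>C*-norms on the convolution algebra\<close>

context fell_line_bundle
begin

abbreviation fs where "fs \<equiv> function_section G L"

lemma of_real_norm_square: "(complex_of_real (cmod z))\<^sup>2 = z * cnj z"
  by (metis complex_norm_square of_real_power)

lemma Cc_units_compose:
  assumes "\<phi> \<in> Cc" "\<psi> \<in> Cc"
    and F: "continuous_on UNIV (\<lambda>(z, w). F z w)" "F 0 0 = 0"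
  shows "(\<lambda>x. F (\<phi> x) (\<psi> x)) \<in> Cc"
proof -
  obtain K where K: "continuous_on X \<phi>" "compact K" "K \<subseteq> X" "\<And>x. x \<in> X \<Longrightarrow> x \<notin> K \<Longrightarrow> \<phi> x = 0"
    using assms(1) by (rule Cc_unitsE) blast
  obtain M where M: "continuous_on X \<psi>" "compact M" "M \<subseteq> X" "\<And>x. x \<in> X \<Longrightarrow> x \<notin> M \<Longrightarrow> \<psi> x = 0"
    using assms(2) by (rule Cc_unitsE) blast
  show ?thesis
  proof (rule Cc_unitsI[of _ "K \<union> M"])
    have "continuous_on X (\<lambda>x. case (\<phi> x, \<psi> x) of (z, w) \<Rightarrow> F z w)"
      by (rule continuous_on_compose2[OF F(1)]) (auto intro!: continuous_on_Pair K M)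
    then show "continuous_on X (\<lambda>x. F (\<phi> x) (\<psi> x))" by simp
  qed (use K M F(2) in auto)
qed

lemma Cc_units_times: "\<phi> \<in> Cc \<Longrightarrow> \<psi> \<in> Cc \<Longrightarrow> (\<lambda>x. \<phi> x * \<psi> x) \<in> Cc"
  by (rule Cc_units_compose) (auto simp: case_prod_unfold intro!: continuous_intros)

lemma Cc_units_plus: "\<phi> \<in> Cc \<Longrightarrow> \<psi> \<in> Cc \<Longrightarrow> (\<lambda>x. \<phi> x + \<psi> x) \<in> Cc"
  by (rule Cc_units_compose) (auto simp: case_prod_unfold intro!: continuous_intros)

lemma Cc_units_scale: "\<phi> \<in> Cc \<Longrightarrow> (\<lambda>x. c * \<phi> x) \<in> Cc"
  by (rule Cc_units_compose[of \<phi> \<phi> "\<lambda>z w. c * z"]) (auto simp: case_prod_unfold intro!: continuous_intros)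

lemma Cc_units_diff: "\<phi> \<in> Cc \<Longrightarrow> \<psi> \<in> Cc \<Longrightarrow> (\<lambda>x. \<phi> x - \<psi> x) \<in> Cc"
  by (rule Cc_units_compose) (auto simp: case_prod_unfold intro!: continuous_intros)

lemma Cc_units_cnj: "\<phi> \<in> Cc \<Longrightarrow> (\<lambda>x. cnj (\<phi> x)) \<in> Cc"
  by (rule Cc_units_compose[of \<phi> \<phi> "\<lambda>z w. cnj z"]) (auto simp: case_prod_unfold intro!: continuous_intros)

lemma Cc_units_norm: "\<phi> \<in> Cc \<Longrightarrow> (\<lambda>x. complex_of_real (cmod (\<phi> x))) \<in> Cc"
  by (rule Cc_units_compose[of \<phi> \<phi> "\<lambda>z w. complex_of_real (cmod z)"])
    (auto simp: case_prod_unfold intro!: continuous_intros)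

lemma uniform_norm_upper:
  assumes \<phi>: "\<phi> \<in> Cc" and x: "x \<in> X"
  shows "cmod (\<phi> x) \<le> uniform_norm G \<phi>"
proof -
  obtain K where K: "continuous_on X \<phi>" "compact K" "K \<subseteq> X" "\<And>x. x \<in> X \<Longrightarrow> x \<notin> K \<Longrightarrow> \<phi> x = 0"
    using \<phi> by (rule Cc_unitsE) blast
  have "bounded (\<phi> ` K)"
    using K by (intro compact_imp_bounded compact_continuous_image continuous_on_subset[OF K(1)])
  then obtain B where B: "\<And>y. y \<in> K \<Longrightarrow> cmod (\<phi> y) \<le> B" unfolding bounded_iff by auto
  have "cmod (\<phi> y) \<le> max B 0" if "y \<in> X" for y
    using B[of y] K(4)[OF that] by (cases "y \<in> K") (auto simp: le_max_iff_disj)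
  then show ?thesis
    unfolding uniform_norm_def using x by (intro cSUP_upper bdd_aboveI2) auto
qed

lemma uniform_norm_least: "(\<And>x. x \<in> X \<Longrightarrow> cmod (\<phi> x) \<le> B) \<Longrightarrow> uniform_norm G \<phi> \<le> B"
  unfolding uniform_norm_def by (rule cSUP_least) (use range_mem in blast, simp)

lemma uniform_norm_nonneg: "\<phi> \<in> Cc \<Longrightarrow> 0 \<le> uniform_norm G \<phi>"
  using uniform_norm_upper[of \<phi>, OF _ range_mem] norm_ge_zero order_trans by blast

subsection \<open>Functions on the unit space inside the convolution algebra\<close>

lemma twisted_conv_fs_left: "twisted_conv (hat (fs \<phi>)) \<psi> g = \<phi> (\<r> g) * \<psi> g"
proof -
  have "twisted_conv (hat (fs \<phi>)) \<psi> (\<r> g \<diamondop> g) = hat (fs \<phi>) (\<r> g) * \<psi> g * cocycle (\<r> g) g"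
    by (rule twisted_conv_bisection[OF open_bisection_units])
      (auto simp: hat_function_section split: if_splits)
  then show ?thesis by (simp add: hat_function_section)
qed

lemma twisted_conv_fs_right: "twisted_conv \<psi> (hat (fs \<phi>)) g = \<psi> g * \<phi> (\<s> g)"
proof -
  have "factor_pairs \<psi> (hat (fs \<phi>)) g \<subseteq> {(g, \<s> g)}"
    by (auto simp: factor_pairs_def hat_function_section split: if_splits)
  then have "twisted_conv \<psi> (hat (fs \<phi>)) g = (\<Sum>(a, b)\<in>{(g, \<s> g)}. \<psi> a * hat (fs \<phi>) b * cocycle a b)"
    by (intro twisted_conv_eq_sum) auto
  then show ?thesis by (simp add: hat_function_section)
qed

lemma star_coeff_unit [simp]: "x \<in> X \<Longrightarrow> star_coeff x = 1"
  by (simp add: star_coeff_def frame_unit star_fibre_unit)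

text \<open>The only factorisations of \<open>x\<close> are those into \<open>\<iota> a\<close> and \<open>a\<close> with \<open>\<s> a = x\<close>, and the cocycle
  cancels against the coefficient of the adjoint.\<close>

lemma twisted_conv_star_unit:
  assumes x: "x \<in> X" and fin: "fibre_finite \<phi>"
  shows "twisted_conv (twisted_star \<phi>) \<psi> x = (\<Sum>a\<in>{a. \<s> a = x \<and> \<phi> a \<noteq> 0}. cnj (\<phi> a) * \<psi> a)"
proof -
  define S where "S = {a. \<s> a = x \<and> \<phi> a \<noteq> 0}"
  have fS: "finite S" using fibre_finiteD[OF fin] by (simp add: S_def)
  have "twisted_conv (twisted_star \<phi>) \<psi> x =
      (\<Sum>(c, d)\<in>(\<lambda>a. (\<iota> a, a)) ` S. twisted_star \<phi> c * \<psi> d * cocycle c d)"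
  proof (rule twisted_conv_eq_sum)
    show "factor_pairs (twisted_star \<phi>) \<psi> x \<subseteq> (\<lambda>a. (\<iota> a, a)) ` S"
    proof (clarsimp simp: factor_pairs_def)
      fix c d assume cd: "\<s> c = \<r> d" "x = c \<diamondop> d" "twisted_star \<phi> c \<noteq> 0"
      have "\<r> c = x" using x cd mult_range[of c d] by simp
      then have "d = \<iota> c" using cd x inv_mult_cancel[of c d] mult_unit[of x "\<iota> c"] by simp
      then have "c = \<iota> d" "\<s> d = x" using \<open>\<r> c = x\<close> by simp_all
      moreover have "\<phi> d \<noteq> 0" using cd(3) \<open>d = \<iota> c\<close> by (auto simp: twisted_star_def)
      ultimately show "(c, d) \<in> (\<lambda>a. (\<iota> a, a)) ` S" by (auto simp: S_def)
    qed
  qed (use fS in \<open>auto simp: S_def\<close>)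
  also have "\<dots> = (\<Sum>a\<in>S. twisted_star \<phi> (\<iota> a) * \<psi> a * cocycle (\<iota> a) a)"
    by (subst sum.reindex) (auto intro!: inj_onI)
  also have "\<dots> = (\<Sum>a\<in>S. cnj (\<phi> a) * \<psi> a)"
  proof (rule sum.cong)
    fix a
    have "twisted_star \<phi> (\<iota> a) * \<psi> a * cocycle (\<iota> a) a = cnj (\<phi> a) * \<psi> a * (star_coeff a * cocycle (\<iota> a) a)"
      by (simp add: twisted_star_def)
    then show "twisted_star \<phi> (\<iota> a) * \<psi> a * cocycle (\<iota> a) a = cnj (\<phi> a) * \<psi> a"
      by (simp add: star_coeff_inv)
  qed simp
  finally show ?thesis by (simp add: S_def)
qed

lemma fs_mult: "\<phi> \<in> Cc \<Longrightarrow> \<psi> \<in> Cc \<Longrightarrow> conv (fs \<phi>) (fs \<psi>) = fs (\<lambda>x. \<phi> x * \<psi> x)"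
  by (rule alg_eqI)
    (auto simp: convolution_mem function_section_mem Cc_units_times hat_alg_simps twisted_conv_fs_left hat_function_section)

lemma fs_star: "\<phi> \<in> Cc \<Longrightarrow> adj (fs \<phi>) = fs (\<lambda>x. cnj (\<phi> x))"
proof (rule alg_eqI)
  fix g assume \<phi>: "\<phi> \<in> Cc"
  have "\<iota> g \<in> X \<longleftrightarrow> g \<in> X" by (metis inv_inv inv_of_unit)
  then show "hat (adj (fs \<phi>)) g = hat (fs (\<lambda>x. cnj (\<phi> x))) g"
    using \<phi> by (auto simp: hat_alg_simps function_section_mem twisted_star_def hat_function_section)
qed (simp_all add: star_mem function_section_mem Cc_units_cnj)

lemma fs_add: "\<phi> \<in> Cc \<Longrightarrow> \<psi> \<in> Cc \<Longrightarrow> section_add L (fs \<phi>) (fs \<psi>) = fs (\<lambda>x. \<phi> x + \<psi> x)"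
  by (rule alg_eqI) (auto simp: mem_simps function_section_mem Cc_units_plus hat_alg_simps hat_function_section)

lemma fs_scale: "\<phi> \<in> Cc \<Longrightarrow> section_scale L c (fs \<phi>) = fs (\<lambda>x. c * \<phi> x)"
  by (rule alg_eqI) (auto simp: mem_simps function_section_mem Cc_units_scale hat_scale hat_function_section)

lemma fs_minus: "\<phi> \<in> Cc \<Longrightarrow> \<psi> \<in> Cc \<Longrightarrow> aminus alg (fs \<phi>) (fs \<psi>) = fs (\<lambda>x. \<phi> x - \<psi> x)"
  using fs_add[of \<phi> "\<lambda>x. (-1) * \<psi> x"] Cc_units_scale[of \<psi> "-1"] by (simp add: aminus_def fs_scale)

lemma hat_minus: "f \<in> \<A> \<Longrightarrow> h \<in> \<A> \<Longrightarrow> hat (aminus alg f h) g = hat f g - hat h g"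
  by (simp add: aminus_def hat_alg_simps mem_simps hat_scale)

subsection \<open>C*-seminorms on functions on the unit space\<close>

context
  fixes q
  assumes q: "cstar_seminorm alg q"
begin

interpretation q: cstar_seminormed alg q
  by unfold_locales (rule q)

lemma seminorm_fs_square: "\<phi> \<in> Cc \<Longrightarrow> (q (fs \<phi>))\<^sup>2 = q (fs (\<lambda>x. cnj (\<phi> x) * \<phi> x))"
  using q.norm_star_mult[of "fs \<phi>"] by (simp add: function_section_mem fs_star fs_mult Cc_units_cnj)

text \<open>The function \<open>\<theta> = \<bar>\<phi>\<bar> + i sqrt (\<bar>\<psi>\<bar>\<^sup>2 - \<bar>\<phi>\<bar>\<^sup>2)\<close> has the same modulus as \<open>\<psi>\<close>, and hence the
  same seminorm by the C*-identity. The mean of \<open>\<theta>\<close> and its conjugate is \<open>\<bar>\<phi>\<bar>\<close>.\<close>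

lemma seminorm_fs_mono:
  assumes \<phi>: "\<phi> \<in> Cc" and \<psi>: "\<psi> \<in> Cc" and le: "\<And>x. x \<in> X \<Longrightarrow> cmod (\<phi> x) \<le> cmod (\<psi> x)"
  shows "q (fs \<phi>) \<le> q (fs \<psi>)"
proof -
  define u where "u x = complex_of_real (cmod (\<phi> x))" for x
  define v where "v x = complex_of_real (sqrt ((cmod (\<psi> x))\<^sup>2 - (cmod (\<phi> x))\<^sup>2))" for x
  define \<theta> where "\<theta> x = u x + \<i> * v x" for x
  have u: "u \<in> Cc" unfolding u_def by (rule Cc_units_norm[OF \<phi>])
  have v: "v \<in> Cc"
    unfolding v_def
    by (rule Cc_units_compose[OF \<phi> \<psi>, of "\<lambda>z w. complex_of_real (sqrt ((cmod w)\<^sup>2 - (cmod z)\<^sup>2))"])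
      (auto simp: case_prod_unfold intro!: continuous_intros)
  have \<theta>: "\<theta> \<in> Cc" unfolding \<theta>_def by (intro Cc_units_plus Cc_units_scale u v)
  have mod: "cnj (\<theta> x) * \<theta> x = cnj (\<psi> x) * \<psi> x" if x: "x \<in> X" for x
  proof -
    have "(cmod (\<phi> x))\<^sup>2 \<le> (cmod (\<psi> x))\<^sup>2" using le[OF x] by (intro power_mono) simp_all
    then have "(sqrt ((cmod (\<psi> x))\<^sup>2 - (cmod (\<phi> x))\<^sup>2))\<^sup>2 = (cmod (\<psi> x))\<^sup>2 - (cmod (\<phi> x))\<^sup>2" by simp
    moreover have "cnj (\<theta> x) * \<theta> x = of_real ((cmod (\<phi> x))\<^sup>2 + (sqrt ((cmod (\<psi> x))\<^sup>2 - (cmod (\<phi> x))\<^sup>2))\<^sup>2)"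
      by (simp add: \<theta>_def u_def v_def complex_eq_iff power2_eq_square)
    ultimately have "cnj (\<theta> x) * \<theta> x = of_real ((cmod (\<psi> x))\<^sup>2)" by simp
    then show ?thesis by (simp add: of_real_norm_square mult.commute)
  qed
  have fs_cong: "fs \<alpha> = fs \<beta>" if "\<And>x. x \<in> X \<Longrightarrow> \<alpha> x = \<beta> x" for \<alpha> \<beta>
    using that by (auto simp: function_section_def)
  have "(q (fs \<theta>))\<^sup>2 = (q (fs \<psi>))\<^sup>2"
    unfolding seminorm_fs_square[OF \<theta>] seminorm_fs_square[OF \<psi>]
    by (rule arg_cong[where f = q]) (rule fs_cong, rule mod)
  then have eq: "q (fs \<theta>) = q (fs \<psi>)" using q.nonneg \<theta> \<psi> by (simp add: function_section_mem)
  have star: "q (fs (\<lambda>x. cnj (\<theta> x))) = q (fs \<theta>)"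
    using q.norm_star[of "fs \<theta>"] \<theta> by (simp add: fs_star function_section_mem)
  have "fs u = section_add L (section_scale L (1/2) (fs \<theta>)) (section_scale L (1/2) (fs (\<lambda>x. cnj (\<theta> x))))"
    unfolding fs_scale[OF \<theta>] fs_scale[OF Cc_units_cnj[OF \<theta>]]
      fs_add[OF Cc_units_scale[OF \<theta>] Cc_units_scale[OF Cc_units_cnj[OF \<theta>]]]
    by (rule fs_cong) (simp add: \<theta>_def u_def v_def complex_eq_iff)
  then have "q (fs u) \<le> q (section_scale L (1/2) (fs \<theta>)) + q (section_scale L (1/2) (fs (\<lambda>x. cnj (\<theta> x))))"
    using q.triangle[of "section_scale L (1/2) (fs \<theta>)" "section_scale L (1/2) (fs (\<lambda>x. cnj (\<theta> x)))"] \<theta>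
    by (simp add: mem_simps function_section_mem Cc_units_cnj)
  also have "\<dots> = q (fs \<psi>)"
    using q.norm_scale[of "fs \<theta>" "1/2"] q.norm_scale[of "fs (\<lambda>x. cnj (\<theta> x))" "1/2"] \<theta> eq star
    by (simp add: function_section_mem Cc_units_cnj norm_divide)
  finally have "q (fs u) \<le> q (fs \<psi>)" .
  moreover have "(q (fs \<phi>))\<^sup>2 = (q (fs u))\<^sup>2"
    unfolding seminorm_fs_square[OF \<phi>] seminorm_fs_square[OF u]
    by (rule arg_cong[where f = q], rule fs_cong)
      (simp add: u_def mult.commute[of "cnj _"] of_real_norm_square[symmetric] power2_eq_square)
  then have "q (fs \<phi>) = q (fs u)" using q.nonneg \<phi> u by (simp add: function_section_mem)
  ultimately show ?thesis by simp
qed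

text \<open>With \<open>M = uniform_norm G \<phi>\<close>, monotonicity gives \<open>q(\<phi>)\<^sup>2 = q(\<bar>\<phi>\<bar>\<^sup>2) \<le> q(M\<phi>) = M q(\<phi>)\<close>.\<close>

lemma seminorm_fs_le_uniform_norm:
  assumes \<phi>: "\<phi> \<in> Cc"
  shows "q (fs \<phi>) \<le> uniform_norm G \<phi>"
proof -
  define M where "M = uniform_norm G \<phi>"
  have M: "0 \<le> M" using uniform_norm_nonneg[OF \<phi>] by (simp add: M_def)
  have "(q (fs \<phi>))\<^sup>2 = q (fs (\<lambda>x. cnj (\<phi> x) * \<phi> x))" by (rule seminorm_fs_square[OF \<phi>])
  also have "\<dots> \<le> q (fs (\<lambda>x. of_real M * \<phi> x))"
  proof (rule seminorm_fs_mono)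
    fix x assume x: "x \<in> X"
    show "cmod (cnj (\<phi> x) * \<phi> x) \<le> cmod (of_real M * \<phi> x)"
      using uniform_norm_upper[OF \<phi> x] M by (simp add: Real_Vector_Spaces.norm_mult M_def mult_right_mono)
  qed (intro Cc_units_times Cc_units_cnj Cc_units_scale \<phi>)+
  also have "\<dots> = M * q (fs \<phi>)"
    using q.norm_scale[of "fs \<phi>" "of_real M"] \<phi> M by (simp add: fs_scale function_section_mem)
  finally have "q (fs \<phi>) * q (fs \<phi>) \<le> M * q (fs \<phi>)" by (simp add: power2_eq_square)
  moreover have "0 \<le> q (fs \<phi>)" using q.nonneg[of "fs \<phi>"] \<phi> by (simp add: function_section_mem)
  ultimately show ?thesis
    unfolding M_def[symmetric] using M mult_le_cancel_right[of "q (fs \<phi>)" "q (fs \<phi>)" M]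
    by (cases "q (fs \<phi>) = 0") auto
qed

end

subsection \<open>Sections over smaller bisections\<close>

lemma continuous_on_zero_section:
  assumes U: "open_bisection G U"
  shows "continuous_on U (lzero L)"
  unfolding continuous_on_def
proof
  fix g assume g: "g \<in> U"
  show "(lzero L \<longlongrightarrow> lzero L g) (at g within U)"
    by (rule tendsto_lzero[OF U g]) (simp_all add: eventually_at_filter tendsto_ident_at)
qed

text \<open>The extension by zero is continuous on \<open>U\<close> because the compact support is closed relative to
  \<open>U\<close>.\<close>

lemma bisection_sections_mono:
  assumes U: "open_bisection G U" and V: "open_bisection G V" and "V \<subseteq> U" and f: "f \<in> bisection_sections L V"
  shows "f \<in> bisection_sections L U"
proof -
  obtain K where K: "is_section f" "continuous_on V f" "compact K" "K \<subseteq> V" "\<And>g. g \<notin> K \<Longrightarrow> f g = lzero L g"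
    using f by (rule bisection_sectionsE) blast
  have KU: "K \<subseteq> U" using K(4) \<open>V \<subseteq> U\<close> by blast
  have "continuous_on (U - K) (lzero L)"
    using continuous_on_zero_section[OF U] by (rule continuous_on_subset) blast
  then have "continuous_on (U - K) f"
    by (rule continuous_on_cong[THEN iffD1, rotated 2]) (use K(5) in auto)
  then have "continuous_on (V \<union> (U - K)) f"
    using K(2) V compact_subset_bisection_closed(2)[OF U K(3) KU]
    by (intro continuous_on_open_Un) (auto simp: open_bisection_def)
  moreover have "V \<union> (U - K) = U" using \<open>V \<subseteq> U\<close> K(4) by blast
  ultimately show ?thesis using K KU by (intro bisection_sectionsI[OF U K(1)]) auto
qed

text \<open>Products of the inverse of an arrow in \<open>U\<close> with an arrow in \<open>U\<close> are units.\<close>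

lemma star_mult_bisection:
  assumes U: "open_bisection G U" and f: "f \<in> bisection_sections L U"
  obtains \<phi> where "\<phi> \<in> Cc" "conv (adj f) f = fs \<phi>"
proof -
  have V: "open_bisection G (set_mult (\<iota> ` U) U)"
    using U by (intro open_bisection_set_mult open_bisection_inv)
  have "set_mult (\<iota> ` U) U \<subseteq> X"
  proof
    fix g assume "g \<in> set_mult (\<iota> ` U) U"
    then obtain a b where ab: "a \<in> \<iota> ` U" "b \<in> U" "\<s> a = \<r> b" "g = a \<diamondop> b" by (rule set_multE)
    then have "a = \<iota> b" using bisection_range_eq[OF U] by (metis imageE source_inv)
    then show "g \<in> X" using ab by simp
  qed
  then have "conv (adj f) f \<in> bisection_sections L X"
    using convolution_bisection[OF open_bisection_inv[OF U] star_bisection[OF U f] U f]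
    by (rule bisection_sections_mono[OF open_bisection_units V])
  then show ?thesis using bisection_section_units that by blast
qed

subsection \<open>The evaluation functionals\<close>

definition ev :: "'g \<Rightarrow> ('g \<Rightarrow> 'l) \<Rightarrow> complex" where
  "ev x f = hat f x"

abbreviation evnorm where "evnorm x \<equiv> alg.functional_norm (ev x)"

text \<open>The GNS space of the evaluation at \<open>x\<close> consists of the square summable functions on the
  arrows with source \<open>x\<close>. The evaluations at all units together give the regular representation.\<close>

lemma ev_star_mult:
  assumes "x \<in> X" "f \<in> \<A>" "h \<in> \<A>"
  shows "ev x (conv (adj f) h) = (\<Sum>a\<in>{a. \<s> a = x \<and> hat f a \<noteq> 0}. cnj (hat f a) * hat h a)"
  using assms by (simp add: ev_def hat_alg_simps star_mem twisted_conv_star_unit compact_sections_finite)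

lemma ev_star_mult_self:
  assumes "x \<in> X" "f \<in> \<A>"
  shows "ev x (conv (adj f) f) = of_real (\<Sum>a\<in>{a. \<s> a = x \<and> hat f a \<noteq> 0}. (cmod (hat f a))\<^sup>2)"
  using assms by (simp add: ev_star_mult of_real_norm_square mult.commute)

lemma positive_functional_ev:
  assumes x: "x \<in> X"
  shows "positive_functional alg (ev x)"
proof
  fix f assume f: "f \<in> carrier alg"
  show "ev x (amult alg (astar alg f) f) \<in> \<real>\<^sub>\<ge>\<^sub>0"
    using ev_star_mult_self[OF x, of f] f
    by (simp only: alg_simps nonneg_Reals_of_real_iff) (simp add: sum_nonneg)
qed (simp_all add: ev_def hat_alg_simps hat_scale)

lemma evnorm_square:
  assumes "x \<in> X" "f \<in> \<A>"
  shows "(evnorm x f)\<^sup>2 = (\<Sum>a\<in>{a. \<s> a = x \<and> hat f a \<noteq> 0}. (cmod (hat f a))\<^sup>2)"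
  using ev_star_mult_self[OF assms] by (simp add: alg.functional_norm_def sum_nonneg)

lemma hat_le_evnorm:
  assumes f: "f \<in> \<A>"
  shows "cmod (hat f g) \<le> evnorm (\<s> g) f"
proof (cases "hat f g = 0")
  case True
  interpret positive_functional alg "ev (\<s> g)" by (rule positive_functional_ev) simp
  show ?thesis using True f fnorm_nonneg[of f] by simp
next
  case False
  have "(cmod (hat f g))\<^sup>2 \<le> (\<Sum>a\<in>{a. \<s> a = \<s> g \<and> hat f a \<noteq> 0}. (cmod (hat f a))\<^sup>2)"
    by (rule member_le_sum) (use False fibre_finiteD(2)[OF compact_sections_finite[OF f]] in auto)
  then have "(cmod (hat f g))\<^sup>2 \<le> (evnorm (\<s> g) f)\<^sup>2" using f by (simp add: evnorm_square)
  moreover interpret positive_functional alg "ev (\<s> g)" by (rule positive_functional_ev) simp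
  have "0 \<le> evnorm (\<s> g) f" using f by simp
  ultimately show ?thesis by (rule power2_le_imp_le)
qed

lemma evnorm_mult_fs:
  assumes x: "x \<in> X" and f: "f \<in> \<A>" and \<phi>: "\<phi> \<in> Cc" "\<phi> x = 1"
  shows "evnorm x (conv f (fs \<phi>)) = evnorm x f"
proof -
  interpret positive_functional alg "ev x" using x by (rule positive_functional_ev)
  have m: "conv f (fs \<phi>) \<in> \<A>" using f \<phi> by (simp add: convolution_mem function_section_mem)
  have "hat (conv f (fs \<phi>)) a = hat f a" if "\<s> a = x" for a
    using that \<phi> f by (simp add: hat_alg_simps function_section_mem twisted_conv_fs_right)
  then have "(evnorm x (conv f (fs \<phi>)))\<^sup>2 = (evnorm x f)\<^sup>2"
    unfolding evnorm_square[OF x m] evnorm_square[OF x f] by (intro sum.cong) auto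
  then show ?thesis by (rule power2_eq_imp_eq) (use m f in simp_all)
qed

lemma evnorm_fs:
  assumes x: "x \<in> X" and \<phi>: "\<phi> \<in> Cc" "\<phi> x = 1"
  shows "evnorm x (fs \<phi>) = 1"
proof -
  interpret positive_functional alg "ev x" using x by (rule positive_functional_ev)
  have "{a. \<s> a = x \<and> hat (fs \<phi>) a \<noteq> 0} = {x}"
    using x \<phi> by (auto simp: hat_function_section split: if_splits)
  then have "(evnorm x (fs \<phi>))\<^sup>2 = 1\<^sup>2"
    using evnorm_square[OF x function_section_mem[OF \<phi>(1)]] x \<phi> by (simp add: hat_function_section)
  then show ?thesis by (rule power2_eq_imp_eq) (use function_section_mem[OF \<phi>(1)] in simp_all)
qed

text \<open>If \<open>b\<close> is supported in a bisection, then \<open>b\<^sup>*b\<close> is a function \<open>\<phi>\<close> on the unit space. It acts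
  on the GNS space as the multiplication by \<open>\<phi> \<circ> \<r>\<close>, whose norm is at most the uniform norm of \<open>\<phi>\<close>.\<close>

lemma evnorm_mult_bounded:
  assumes "b \<in> \<A>"
  shows "\<exists>K\<ge>0. \<forall>x\<in>X. \<forall>c\<in>\<A>. evnorm x (conv b c) \<le> K * evnorm x c"
  using assms
proof (induction rule: compact_sections.induct)
  case (bisection U b)
  note b = compact_sections.bisection[OF bisection]
  obtain \<phi> where \<phi>: "\<phi> \<in> Cc" "conv (adj b) b = fs \<phi>"
    using star_mult_bisection[OF bisection] by blast
  define M where "M = uniform_norm G \<phi>"
  have M: "0 \<le> M" using uniform_norm_nonneg[OF \<phi>(1)] by (simp add: M_def)
  have "evnorm x (conv b c) \<le> sqrt M * evnorm x c" if x: "x \<in> X" and c: "c \<in> \<A>" for x c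
  proof -
    interpret positive_functional alg "ev x" using x by (rule positive_functional_ev)
    have m: "conv (fs \<phi>) c \<in> \<A>" using c \<phi> by (simp add: convolution_mem function_section_mem)
    have "of_real ((evnorm x (conv b c))\<^sup>2) = ev x (conv (adj c) (conv (fs \<phi>) c))"
      using fnorm_mult_square[of b c] b c \<phi>(2) by simp
    also have "\<dots> = (\<Sum>a\<in>{a. \<s> a = x \<and> hat c a \<noteq> 0}. \<phi> (\<r> a) * of_real ((cmod (hat c a))\<^sup>2))"
      unfolding ev_star_mult[OF x c m] using c \<phi>(1)
      by (intro sum.cong) (auto simp: hat_alg_simps function_section_mem twisted_conv_fs_left of_real_norm_square)
    finally have "(evnorm x (conv b c))\<^sup>2 = cmod (\<Sum>a\<in>{a. \<s> a = x \<and> hat c a \<noteq> 0}. \<phi> (\<r> a) * of_real ((cmod (hat c a))\<^sup>2))"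
      by (metis norm_of_real abs_of_nonneg zero_le_power2)
    also have "\<dots> \<le> (\<Sum>a\<in>{a. \<s> a = x \<and> hat c a \<noteq> 0}. M * (cmod (hat c a))\<^sup>2)"
      by (rule sum_norm_le)
        (auto simp: Real_Vector_Spaces.norm_mult norm_power M_def intro!: mult_right_mono uniform_norm_upper \<phi>(1))
    also have "\<dots> = (sqrt M * evnorm x c)\<^sup>2"
      using M x c by (simp add: power_mult_distrib evnorm_square sum_distrib_left)
    finally show ?thesis
      by (rule power2_le_imp_le) (use M c in simp)
  qed
  then show ?case using M by (intro exI[of _ "sqrt M"]) simp
next
  case (add f h)
  then obtain K M where K: "K \<ge> 0" "\<And>x c. x \<in> X \<Longrightarrow> c \<in> \<A> \<Longrightarrow> evnorm x (conv f c) \<le> K * evnorm x c"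
    and M: "M \<ge> 0" "\<And>x c. x \<in> X \<Longrightarrow> c \<in> \<A> \<Longrightarrow> evnorm x (conv h c) \<le> M * evnorm x c"
    by blast
  have "evnorm x (conv (section_add L f h) c) \<le> (K + M) * evnorm x c" if x: "x \<in> X" and c: "c \<in> \<A>" for x c
  proof -
    interpret pf: positive_functional alg "ev x" using x by (rule positive_functional_ev)
    show ?thesis
      using pf.fnorm_add[of "conv f c" "conv h c"] alg.add_mult[of f h c] add(1,2) c K(2)[OF x c] M(2)[OF x c]
      by (simp add: convolution_mem distrib_right)
  qed
  then show ?case using K M by (intro exI[of _ "K + M"]) simp
next
  case (scale f k)
  then obtain K where K: "K \<ge> 0" "\<And>x c. x \<in> X \<Longrightarrow> c \<in> \<A> \<Longrightarrow> evnorm x (conv f c) \<le> K * evnorm x c"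
    by blast
  have "evnorm x (conv (section_scale L k f) c) \<le> (cmod k * K) * evnorm x c" if x: "x \<in> X" and c: "c \<in> \<A>" for x c
  proof -
    interpret pf: positive_functional alg "ev x" using x by (rule positive_functional_ev)
    show ?thesis
      using pf.fnorm_scale[of "conv f c" k] alg.scale_mult[of f c k] scale(1) c K(2)[OF x c]
      by (simp add: convolution_mem mult_left_mono mult.assoc)
  qed
  then show ?case using K by (intro exI[of _ "cmod k * K"]) simp
qed

lemma gns_family_ev:
  assumes S: "S \<subseteq> X" "S \<noteq> {}"
  shows "gns_family alg (ev ` S)"
proof (rule gns_family.intro[OF alg.star_alg_axioms], rule gns_family_axioms.intro)
  fix b assume "b \<in> carrier alg"
  then obtain K where "\<And>x c. x \<in> X \<Longrightarrow> c \<in> \<A> \<Longrightarrow> evnorm x (conv b c) \<le> K * evnorm x c"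
    using evnorm_mult_bounded[of b] by auto
  then show "\<exists>K. \<forall>\<psi>\<in>ev ` S. \<forall>c\<in>carrier alg. alg.functional_norm \<psi> (amult alg b c) \<le> K * alg.functional_norm \<psi> c"
    using S by (intro exI[of _ K]) auto
qed (use S positive_functional_ev in auto)

lemma exists_bump:
  assumes x: "x \<in> W" and W: "open W" "W \<subseteq> X"
  obtains \<phi> K where "\<phi> \<in> Cc" "\<phi> x = 1" "uniform_norm G \<phi> \<le> 1" "compact K" "K \<subseteq> W"
    "\<And>y. y \<in> X \<Longrightarrow> y \<notin> K \<Longrightarrow> \<phi> y = 0"
proof -
  have "compact {x}" "{x} \<subseteq> W" using x by auto
  then obtain a :: "'g \<Rightarrow> real" and K where a: "continuous_on X a" "\<And>x. 0 \<le> a x" "\<And>x. a x \<le> 1"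
    "\<And>y. y \<in> {x} \<Longrightarrow> a y = 1" "compact K" "K \<subseteq> W" "\<And>y. y \<in> X \<Longrightarrow> y \<notin> K \<Longrightarrow> a y = 0"
    using exists_cutoff[OF _ _ W] by metis
  define \<phi> where "\<phi> y = complex_of_real (a y)" for y
  have "\<phi> \<in> Cc"
    by (rule Cc_unitsI[of _ K]) (use a W in \<open>auto simp: \<phi>_def intro!: continuous_intros\<close>)
  moreover have "uniform_norm G \<phi> \<le> 1"
    by (rule uniform_norm_least) (use a in \<open>simp add: \<phi>_def\<close>)
  ultimately show ?thesis using a by (intro that[of \<phi> K]) (simp_all add: \<phi>_def)
qed

context
  fixes S
  assumes S: "S \<subseteq> X" "S \<noteq> {}"
begin

interpretation gns: gns_family alg "ev ` S"
  using S by (rule gns_family_ev)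

lemma evnorm_le_gns_norm:
  assumes x: "x \<in> S" and b: "b \<in> \<A>"
  shows "evnorm x b \<le> gns.gns_norm b"
proof -
  have xX: "x \<in> X" using x S by blast
  obtain \<phi> where \<phi>: "\<phi> \<in> Cc" "\<phi> x = 1" using exists_bump[OF xX open_units subset_refl] by metis
  have "evnorm x (conv b (fs \<phi>)) \<le> gns.gns_norm b * evnorm x (fs \<phi>)"
    using gns.gns_norm_upper[of b "ev x" "fs \<phi>"] b x \<phi> by (simp add: function_section_mem)
  then show ?thesis by (simp add: evnorm_mult_fs[OF xX b \<phi>] evnorm_fs[OF xX \<phi>])
qed

lemma hat_le_gns_norm: "\<s> g \<in> S \<Longrightarrow> b \<in> \<A> \<Longrightarrow> cmod (hat b g) \<le> gns.gns_norm b"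
  using hat_le_evnorm evnorm_le_gns_norm order_trans by blast

end

text \<open>The norm of the regular representation. It shows that there are C*-norms, so that the
  maximal one is the supremum of a nonempty set.\<close>

definition reduced_norm :: "('g \<Rightarrow> 'l) \<Rightarrow> real" where
  "reduced_norm = gns_family.gns_norm alg (ev ` X)"

lemma cstar_norm_reduced_norm: "cstar_norm alg reduced_norm"
proof -
  have X: "X \<noteq> {}" using range_mem by blast
  interpret gns: gns_family alg "ev ` X" using X by (rule gns_family_ev[OF subset_refl])
  have "b = lzero L" if "b \<in> \<A>" "gns.gns_norm b = 0" for b
    using hat_le_gns_norm[OF subset_refl X source_mem that(1)] that by (intro alg_eqI) (auto simp: zero_mem)
  then show ?thesis
    unfolding cstar_norm_def reduced_norm_def using gns.cstar_seminorm_gns_norm by simp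
qed

lemma hat_le_reduced_norm: "b \<in> \<A> \<Longrightarrow> cmod (hat b g) \<le> reduced_norm b"
  unfolding reduced_norm_def by (rule hat_le_gns_norm[OF subset_refl _ source_mem]) (use range_mem in blast)

subsection \<open>The maximal C*-norm\<close>

text \<open>For sections over a bisection, \<open>b\<^sup>*b\<close> is a function on the unit space, where all
  C*-seminorms are bounded by the uniform norm.\<close>

lemma exists_seminorm_bound:
  assumes "b \<in> \<A>"
  shows "\<exists>K. \<forall>q. cstar_seminorm alg q \<longrightarrow> q b \<le> K"
  using assms
proof (induction rule: compact_sections.induct)
  case (bisection U b)
  note b = compact_sections.bisection[OF bisection]
  obtain \<phi> where \<phi>: "\<phi> \<in> Cc" "conv (adj b) b = fs \<phi>"
    using star_mult_bisection[OF bisection] by blast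
  have "q b \<le> sqrt (uniform_norm G \<phi>)" if q: "cstar_seminorm alg q" for q
  proof -
    interpret q: cstar_seminormed alg q using q by unfold_locales
    have "(q b)\<^sup>2 \<le> uniform_norm G \<phi>"
      using q.norm_star_mult[of b] b \<phi> seminorm_fs_le_uniform_norm[OF q \<phi>(1)] by simp
    then show ?thesis by (rule real_le_rsqrt)
  qed
  then show ?case by blast
next
  case (add f h)
  then obtain K M where KM: "\<And>q. cstar_seminorm alg q \<Longrightarrow> q f \<le> K" "\<And>q. cstar_seminorm alg q \<Longrightarrow> q h \<le> M"
    by blast
  have "q (section_add L f h) \<le> K + M" if q: "cstar_seminorm alg q" for q
  proof -
    interpret q: cstar_seminormed alg q using q by unfold_locales
    show ?thesis using q.triangle[of f h] KM(1)[OF q] KM(2)[OF q] add(1,2) by simp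
  qed
  then show ?case by blast
next
  case (scale f c)
  then obtain K where K: "\<And>q. cstar_seminorm alg q \<Longrightarrow> q f \<le> K" by blast
  have "q (section_scale L c f) \<le> cmod c * K" if q: "cstar_seminorm alg q" for q
  proof -
    interpret q: cstar_seminormed alg q using q by unfold_locales
    show ?thesis using q.norm_scale[of f c] K[OF q] scale(1) by (simp add: mult_left_mono)
  qed
  then show ?case by blast
qed

abbreviation max_norm where "max_norm \<equiv> max_cstar_norm alg"

lemma max_norm_upper:
  assumes "cstar_norm alg q" "b \<in> \<A>"
  shows "q b \<le> max_norm b"
proof -
  obtain K where "\<And>q. cstar_seminorm alg q \<Longrightarrow> q b \<le> K" using exists_seminorm_bound[OF assms(2)] by blast
  then have "bdd_above ((\<lambda>p. p b) ` {p. cstar_norm alg p})"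
    by (intro bdd_aboveI2[of _ _ K]) (simp add: cstar_norm_def)
  then show ?thesis unfolding max_cstar_norm_def using assms(1) by (intro cSUP_upper) simp_all
qed

lemma max_norm_least: "(\<And>q. cstar_norm alg q \<Longrightarrow> q b \<le> B) \<Longrightarrow> max_norm b \<le> B"
  unfolding max_cstar_norm_def by (rule cSUP_least) (use cstar_norm_reduced_norm in auto)

lemma reduced_norm_le_max_norm: "b \<in> \<A> \<Longrightarrow> reduced_norm b \<le> max_norm b"
  using cstar_norm_reduced_norm by (rule max_norm_upper)

lemma cstar_norm_max_norm: "cstar_norm alg max_norm"
  unfolding cstar_norm_def
proof (intro conjI ballI impI)
  note red = cstar_norm_reduced_norm[unfolded cstar_norm_def]
  interpret red: cstar_seminormed alg reduced_norm using red by unfold_locales blast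
  fix a assume a: "a \<in> carrier alg" "max_norm a = 0"
  then have "reduced_norm a = 0"
    using reduced_norm_le_max_norm[of a] red.nonneg[of a] by (intro antisym) simp_all
  then show "a = azero alg" using red a(1) by blast
next
  note red = cstar_norm_reduced_norm[unfolded cstar_norm_def]
  interpret red: cstar_seminormed alg reduced_norm using red by unfold_locales blast
  have max_nonneg: "0 \<le> max_norm a" if "a \<in> \<A>" for a
    by (rule order_trans[OF red.nonneg reduced_norm_le_max_norm]) (use that in simp_all)
  have semi: "cstar_seminormed alg q" if "cstar_norm alg q" for q
    using that by unfold_locales (simp add: cstar_norm_def)
  show "cstar_seminorm alg max_norm"
    unfolding cstar_seminorm_def
  proof (intro conjI ballI allI)
    fix a assume "a \<in> carrier alg"
    then have a: "a \<in> \<A>" by simp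
    show "0 \<le> max_norm a" by (rule max_nonneg[OF a])
    have scale_le: "max_norm (section_scale L c f) \<le> cmod c * max_norm f" if f: "f \<in> \<A>" for c f
    proof (rule max_norm_least)
      fix q assume q: "cstar_norm alg q"
      interpret cstar_seminormed alg q using q by (rule semi)
      show "q (section_scale L c f) \<le> cmod c * max_norm f"
        using norm_scale[of f c] max_norm_upper[OF q f] f by (simp add: mult_left_mono)
    qed
    show "max_norm (ascale alg c a) = cmod c * max_norm a" for c
    proof (cases "c = 0")
      case True
      then show ?thesis
        using scale_le[OF a, of 0] max_nonneg[OF compact_sections.scale[OF a, of 0]] by simp
    next
      case False
      have "max_norm a \<le> cmod (1 / c) * max_norm (section_scale L c a)"
        using scale_le[OF compact_sections.scale[OF a], of "1 / c" c] False alg.scale_scale[of a "1 / c" c] alg.scale_one[of a] a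
        by simp
      then show ?thesis using scale_le[OF a, of c] False by (simp add: norm_divide field_simps)
    qed
    have am: "conv (adj a) a \<in> \<A>" using a by (simp add: mem_simps)
    have "max_norm (conv (adj a) a) \<le> (max_norm a)\<^sup>2"
    proof (rule max_norm_least)
      fix q assume q: "cstar_norm alg q"
      interpret cstar_seminormed alg q using q by (rule semi)
      show "q (conv (adj a) a) \<le> (max_norm a)\<^sup>2"
        using norm_star_mult[of a] power_mono[OF max_norm_upper[OF q a], of 2] a by simp
    qed
    moreover have "max_norm a \<le> sqrt (max_norm (conv (adj a) a))"
    proof (rule max_norm_least)
      fix q assume q: "cstar_norm alg q"
      interpret cstar_seminormed alg q using q by (rule semi)
      show "q a \<le> sqrt (max_norm (conv (adj a) a))"
        using norm_star_mult[of a] max_norm_upper[OF q am] a by (simp add: real_le_rsqrt)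
    qed
    then have "(max_norm a)\<^sup>2 \<le> max_norm (conv (adj a) a)"
      using power_mono[OF _ max_nonneg[OF a], of "sqrt (max_norm (conv (adj a) a))" 2] max_nonneg[OF am]
      by simp
    ultimately show "max_norm (amult alg (astar alg a) a) = (max_norm a)\<^sup>2" by simp
    fix b assume "b \<in> carrier alg"
    then have b: "b \<in> \<A>" by simp
    show "max_norm (aadd alg a b) \<le> max_norm a + max_norm b"
    proof (rule max_norm_least)
      fix q assume q: "cstar_norm alg q"
      interpret cstar_seminormed alg q using q by (rule semi)
      show "q (aadd alg a b) \<le> max_norm a + max_norm b"
        using triangle[of a b] max_norm_upper[OF q a] max_norm_upper[OF q b] a b by simp
    qed
    show "max_norm (amult alg a b) \<le> max_norm a * max_norm b"
    proof (rule max_norm_least)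
      fix q assume q: "cstar_norm alg q"
      interpret cstar_seminormed alg q using q by (rule semi)
      have "q (conv a b) \<le> q a * q b" using sub_mult[of a b] a b by simp
      also have "\<dots> \<le> max_norm a * max_norm b"
        using max_norm_upper[OF q a] max_norm_upper[OF q b] max_nonneg[of a] a b
        by (intro mult_mono) simp_all
      finally show "q (amult alg a b) \<le> max_norm a * max_norm b" by simp
    qed
  qed
qed

sublocale N: cstar_seminormed alg max_norm
  by unfold_locales (use cstar_norm_max_norm in \<open>simp add: cstar_norm_def\<close>)

lemma hat_le_max_norm: "b \<in> \<A> \<Longrightarrow> cmod (hat b g) \<le> max_norm b"
  using hat_le_reduced_norm reduced_norm_le_max_norm order_trans by blast

lemma uniform_max_norm: "max_norm \<in> uniform_cstar_seminorms G L"
  unfolding uniform_cstar_seminorms_def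
proof (intro CollectI conjI ballI N.cstar_seminorm)
  fix \<phi> assume \<phi>: "\<phi> \<in> Cc"
  have "uniform_norm G \<phi> \<le> max_norm (fs \<phi>)"
  proof (rule uniform_norm_least)
    fix x assume "x \<in> X"
    then show "cmod (\<phi> x) \<le> max_norm (fs \<phi>)"
      using hat_le_max_norm[OF function_section_mem[OF \<phi>], of x] by (simp add: hat_function_section)
  qed
  then show "max_norm (fs \<phi>) = uniform_norm G \<phi>"
    using seminorm_fs_le_uniform_norm[OF N.cstar_seminorm \<phi>] by simp
qed

subsection \<open>Points with trivial isotropy\<close>

definition T where "T = {x \<in> X. isotropy G x = {x}}"

lemma T_D: "x \<in> T \<Longrightarrow> x \<in> X" "x \<in> T \<Longrightarrow> \<s> a = x \<Longrightarrow> \<r> a = x \<Longrightarrow> a = x"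
  by (auto simp: T_def isotropy_def)

lemma compression_mem: "b \<in> \<A> \<Longrightarrow> \<phi> \<in> Cc \<Longrightarrow>
    conv (fs \<phi>) (conv b (fs \<phi>)) \<in> \<A>"
  by (simp add: convolution_mem function_section_mem)

lemma hat_compression: "b \<in> \<A> \<Longrightarrow> \<phi> \<in> Cc \<Longrightarrow>
    hat (conv (fs \<phi>) (conv b (fs \<phi>))) g = \<phi> (\<r> g) * hat b g * \<phi> (\<s> g)"
  by (simp add: hat_alg_simps convolution_mem function_section_mem twisted_conv_fs_left twisted_conv_fs_right)

text \<open>Compression by all functions supported in \<open>V\<close>, and not just by one, makes the property
  additive in \<open>b\<close>: neighbourhoods can be intersected.\<close>

definition compressible :: "'g \<Rightarrow> 'g set \<Rightarrow> ('g \<Rightarrow> 'l) \<Rightarrow> bool" where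
  "compressible x V b \<longleftrightarrow> open V \<and> V \<subseteq> X \<and> x \<in> V \<and> (\<forall>\<phi> K. \<phi> \<in> Cc \<longrightarrow> compact K \<longrightarrow> K \<subseteq> V \<longrightarrow>
     (\<forall>y\<in>X. y \<notin> K \<longrightarrow> \<phi> y = 0) \<longrightarrow> 
     (\<exists>\<psi>\<in>Cc. conv (fs \<phi>) (conv b (fs \<phi>)) = fs \<psi>))"

lemma compressibleD:
  assumes "compressible x V b" "\<phi> \<in> Cc" "compact K" "K \<subseteq> V" "\<And>y. y \<in> X \<Longrightarrow> y \<notin> K \<Longrightarrow> \<phi> y = 0"
  obtains \<psi> where "\<psi> \<in> Cc" "conv (fs \<phi>) (conv b (fs \<phi>)) = fs \<psi>"
  using assms unfolding compressible_def by blast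

lemma compressible_disjoint:
  assumes V: "open V" "V \<subseteq> X" "x \<in> V" and b: "b \<in> \<A>"
    and none: "\<And>g. hat b g \<noteq> 0 \<Longrightarrow> \<r> g \<in> V \<Longrightarrow> \<s> g \<in> V \<Longrightarrow> False"
  shows "compressible x V b"
  unfolding compressible_def
proof (intro conjI allI impI V)
  fix \<phi> K assume \<phi>: "\<phi> \<in> Cc" and K: "K \<subseteq> V" "\<forall>y\<in>X. y \<notin> K \<longrightarrow> \<phi> y = 0"
  have zero: "(\<lambda>x. 0) \<in> Cc" by (rule Cc_unitsI[of _ "{}"]) auto
  have "conv (fs \<phi>) (conv b (fs \<phi>)) = fs (\<lambda>x. 0)"
  proof (rule alg_eqI)
    fix g
    have "\<phi> (\<r> g) * hat b g * \<phi> (\<s> g) = 0"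
    proof (rule ccontr)
      assume nz: "\<phi> (\<r> g) * hat b g * \<phi> (\<s> g) \<noteq> 0"
      then have "\<r> g \<in> K" "\<s> g \<in> K" using K(2) by auto
      then show False using none[of g] nz K(1) by auto
    qed
    then show "hat (conv (fs \<phi>) (conv b (fs \<phi>))) g = hat (fs (\<lambda>x. 0)) g"
      using b \<phi> by (simp add: hat_compression hat_function_section)
  qed (use b \<phi> zero in \<open>simp_all add: compression_mem function_section_mem\<close>)
  then show "\<exists>\<psi>\<in>Cc. conv (fs \<phi>) (conv b (fs \<phi>)) = fs \<psi>" using zero by blast
qed

text \<open>If an arrow of \<open>U\<close> leads from \<open>x\<close> to a different point, then \<open>V\<close> is taken so small that all
  arrows of \<open>U\<close> starting in \<open>V\<close> leave it, and the compression vanishes. If \<open>x \<in> U\<close>, then the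
  compression lives on \<open>U \<inter> X\<close>. An arrow from \<open>x\<close> to \<open>x\<close> is \<open>x\<close> itself, as the isotropy is trivial.
  If no arrow of \<open>U\<close> starts at \<open>x\<close>, then the same is true near \<open>x\<close> for the arrows in the compact
  support.\<close>

lemma exists_compressible_bisection:
  assumes x: "x \<in> T" and U: "open_bisection G U" and b: "b \<in> bisection_sections L U"
  shows "\<exists>V. compressible x V b"
proof -
  note xX = T_D(1)[OF x]
  note bm = compact_sections.bisection[OF U b]
  obtain K where K: "is_section b" "continuous_on U b" "compact K" "K \<subseteq> U" "\<And>g. g \<notin> K \<Longrightarrow> b g = lzero L g"
    using b by (rule bisection_sectionsE) blast
  have outK: "g \<in> K" if "hat b g \<noteq> 0" for g using that K(5)[of g] hat_eq_0[OF K(1)] by blast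
  consider (none) "x \<notin> \<s> ` U" | (move) a where "a \<in> U" "\<s> a = x" "\<r> a \<noteq> x" | (unit) "x \<in> U"
    using T_D(2)[OF x] by (metis imageE)
  then show ?thesis
  proof cases
    case none
    define V where "V = X - \<s> ` K"
    have "open V" unfolding V_def using K(3) by (intro open_units_diff_compact compact_source_image) auto
    moreover have "x \<in> V" using none K(4) xX by (auto simp: V_def)
    ultimately have "compressible x V b"
      by (intro compressible_disjoint bm) (use outK in \<open>auto simp: V_def\<close>)
    then show ?thesis by blast
  next
    case move
    obtain A B where AB: "open A" "open B" "A \<subseteq> X" "B \<subseteq> X" "x \<in> A" "\<r> a \<in> B" "A \<inter> B = {}"
      using Hausdorff_units xX move(3) range_mem[of a] unfolding Hausdorff_space_def openin_units disjnt_def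
      by (metis topspace_euclidean_subtopology)
    define V where "V = A \<inter> \<s> ` (U \<inter> \<r> -` B)"
    have "open (U \<inter> \<r> -` B)" using U AB(2) by (intro open_Int open_vimage continuous_range) (auto simp: open_bisection_def)
    then have "open V" unfolding V_def by (intro open_Int[OF AB(1)] open_source_image)
    moreover have "x \<in> V" using AB move by (auto simp: V_def)
    moreover have False if g: "hat b g \<noteq> 0" "\<r> g \<in> V" "\<s> g \<in> V" for g
    proof -
      obtain h where h: "h \<in> U" "\<r> h \<in> B" "\<s> g = \<s> h" using g(3) by (auto simp: V_def)
      have "g = h" using bisection_source_eq[OF U _ h(1,3)] outK[OF g(1)] K(4) by blast
      then show False using h g(2) AB(7) by (auto simp: V_def)
    qed
    ultimately have "compressible x V b" by (intro compressible_disjoint bm) (use AB in \<open>auto simp: V_def\<close>)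
    then show ?thesis by blast
  next
    case unit
    define V where "V = U \<inter> X"
    have V: "open V" "V \<subseteq> X" "x \<in> V" using U unit xX open_units by (auto simp: V_def open_bisection_def)
    have "compressible x V b"
      unfolding compressible_def
    proof (intro conjI allI impI V)
      fix \<phi> M assume \<phi>: "\<phi> \<in> Cc" and M: "compact M" "M \<subseteq> V" "\<forall>y\<in>X. y \<notin> M \<longrightarrow> \<phi> y = 0"
      define f where "f = conv (fs \<phi>) (conv b (fs \<phi>))"
      have fm: "f \<in> \<A>" using bm \<phi> by (simp add: f_def compression_mem)
      note fsec = compact_sections_section[OF fm]
      have hf: "hat f g = \<phi> (\<r> g) * hat b g * \<phi> (\<s> g)" for g using bm \<phi> by (simp add: f_def hat_compression)
      have outM: "g \<in> M" if nz: "hat f g \<noteq> 0" for g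
      proof -
        have "g \<in> U" using nz outK[of g] K(4) by (auto simp: hf)
        moreover have rM: "\<r> g \<in> M" using nz M(3) by (auto simp: hf)
        moreover have "\<r> g \<in> U" using rM M(2) by (auto simp: V_def)
        ultimately have "g = \<r> g" using bisection_range_eq[OF U, of g "\<r> g"] by simp
        then show ?thesis using rM by simp
      qed
      have "f \<in> bisection_sections L V"
      proof (rule bisection_sectionsI[OF open_bisection_subset[OF U V(1)] fsec _ M(1,2)])
        have ob: "open_bisection G V" by (rule open_bisection_subset[OF U V(1)]) (simp add: V_def)
        obtain P where "continuous_on X \<phi>" using \<phi> by (rule Cc_unitsE) blast
        then have c\<phi>: "continuous_on V \<phi>" using V(2) by (rule continuous_on_subset)
        have "continuous_on V b" using K(2) by (rule continuous_on_subset) (simp add: V_def)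
        then have "continuous_on V (\<lambda>g. lscale L (\<phi> g * \<phi> g) (b g))"
          using c\<phi> by (intro continuous_on_section_scale[OF ob] K(1) continuous_intros)
        moreover have "f g = lscale L (\<phi> g * \<phi> g) (b g)" if "g \<in> V" for g
        proof (rule coord_eqI)
          show "proj L (f g) = proj L (lscale L (\<phi> g * \<phi> g) (b g))"
            using fsec K(1) by (simp add: is_section_def proj_scale)
          show "coord (f g) = coord (lscale L (\<phi> g * \<phi> g) (b g))"
            using hf[of g] that V(2) by (simp add: hat_def subset_iff)
        qed
        ultimately show "continuous_on V f" by (simp cong: continuous_on_cong)
        show "g \<notin> M \<Longrightarrow> f g = lzero L g" for g using outM[of g] hat_eq_0[OF fsec] by blast
      qed (simp add: V_def)
      then have "f \<in> bisection_sections L X"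
        by (rule bisection_sections_mono[OF open_bisection_units open_bisection_subset[OF U V(1)] V(2), rotated])
          (simp add: V_def)
      then show "\<exists>\<psi>\<in>Cc. conv (fs \<phi>) (conv b (fs \<phi>)) = fs \<psi>"
        using bisection_section_units unfolding f_def[symmetric] by blast
    qed
    then show ?thesis by blast
  qed
qed

lemma exists_compressible:
  assumes x: "x \<in> T" and "b \<in> \<A>"
  shows "\<exists>V. compressible x V b"
  using assms(2)
proof (induction rule: compact_sections.induct)
  case (bisection U f)
  then show ?case using exists_compressible_bisection[OF x] by blast
next
  case (add f h)
  then obtain V W where VW: "compressible x V f" "compressible x W h" by blast
  have "compressible x (V \<inter> W) (section_add L f h)"
    unfolding compressible_def
  proof (intro conjI allI impI)
    fix \<phi> K assume \<phi>: "\<phi> \<in> Cc" and K: "compact K" "K \<subseteq> V \<inter> W" "\<forall>y\<in>X. y \<notin> K \<longrightarrow> \<phi> y = 0"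
    obtain \<psi> where \<psi>: "\<psi> \<in> Cc" "conv (fs \<phi>) (conv f (fs \<phi>)) = fs \<psi>"
      using VW(1) \<phi> K unfolding compressible_def by blast
    obtain \<psi>' where \<psi>': "\<psi>' \<in> Cc" "conv (fs \<phi>) (conv h (fs \<phi>)) = fs \<psi>'"
      using VW(2) \<phi> K unfolding compressible_def by blast
    have "conv (fs \<phi>) (conv (section_add L f h) (fs \<phi>)) = fs (\<lambda>x. \<psi> x + \<psi>' x)"
      using alg.add_mult[of f h "fs \<phi>"] alg.mult_add[of "fs \<phi>" "conv f (fs \<phi>)" "conv h (fs \<phi>)"]
        add(1,2) \<phi> \<psi> \<psi>' by (simp add: function_section_mem convolution_mem fs_add)
    then show "\<exists>\<psi>\<in>Cc. conv (fs \<phi>) (conv (section_add L f h) (fs \<phi>)) = fs \<psi>"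
      using Cc_units_plus[OF \<psi>(1) \<psi>'(1)] by blast
  qed (use VW in \<open>auto simp: compressible_def\<close>)
  then show ?case by blast
next
  case (scale f c)
  then obtain V where V: "compressible x V f" by blast
  have "compressible x V (section_scale L c f)"
    unfolding compressible_def
  proof (intro conjI allI impI)
    fix \<phi> K assume \<phi>: "\<phi> \<in> Cc" and K: "compact K" "K \<subseteq> V" "\<forall>y\<in>X. y \<notin> K \<longrightarrow> \<phi> y = 0"
    obtain \<psi> where \<psi>: "\<psi> \<in> Cc" "conv (fs \<phi>) (conv f (fs \<phi>)) = fs \<psi>"
      using V \<phi> K unfolding compressible_def by blast
    have "conv (fs \<phi>) (conv (section_scale L c f) (fs \<phi>)) = fs (\<lambda>x. c * \<psi> x)"
      using alg.scale_mult[of f "fs \<phi>" c] alg.mult_scale[of "fs \<phi>" "conv f (fs \<phi>)" c]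
        scale(1) \<phi> \<psi> by (simp add: function_section_mem convolution_mem fs_scale)
    then show "\<exists>\<psi>\<in>Cc. conv (fs \<phi>) (conv (section_scale L c f) (fs \<phi>)) = fs \<psi>"
      using Cc_units_scale[OF \<psi>(1)] by blast
  qed (use V in \<open>auto simp: compressible_def\<close>)
  then show ?case by blast
qed

lemma exists_compression:
  assumes x: "x \<in> T" and b: "b \<in> \<A>"
  obtains \<phi> \<psi> where "\<phi> \<in> Cc" "\<phi> x = 1" "uniform_norm G \<phi> \<le> 1" "\<psi> \<in> Cc" "\<psi> x = hat b x"
    "conv (fs \<phi>) (conv b (fs \<phi>)) = fs \<psi>"
proof -
  note xX = T_D(1)[OF x]
  obtain V where V: "compressible x V b" using exists_compressible[OF assms] by blast
  then have "x \<in> V" "open V" "V \<subseteq> X" by (auto simp: compressible_def)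
  then obtain \<phi> K where \<phi>: "\<phi> \<in> Cc" "\<phi> x = 1" "uniform_norm G \<phi> \<le> 1" "compact K" "K \<subseteq> V"
    "\<And>y. y \<in> X \<Longrightarrow> y \<notin> K \<Longrightarrow> \<phi> y = 0"
    by (rule exists_bump) blast
  obtain \<psi> where \<psi>: "\<psi> \<in> Cc" "conv (fs \<phi>) (conv b (fs \<phi>)) = fs \<psi>"
    using compressibleD[OF V \<phi>(1,4,5,6)] by blast
  have "\<psi> x = hat b x"
    using hat_compression[OF b \<phi>(1), of x] \<phi>(2) \<psi>(2) xX by (simp add: hat_function_section)
  then show ?thesis using that \<phi> \<psi> by blast
qed

text \<open>The compression at \<open>x\<close> has the value \<open>hat b x\<close> at \<open>x\<close>, is measured by its uniform norm, and
  does not increase the seminorm.\<close>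

lemma hat_le_uniform_seminorm:
  assumes x: "x \<in> T" and b: "b \<in> \<A>" and q: "q \<in> uniform_cstar_seminorms G L"
  shows "cmod (hat b x) \<le> q b"
proof -
  have qs: "cstar_seminorm alg q" and qf: "\<And>\<phi>. \<phi> \<in> Cc \<Longrightarrow> q (fs \<phi>) = uniform_norm G \<phi>"
    using q by (auto simp: uniform_cstar_seminorms_def)
  interpret q: cstar_seminormed alg q using qs by unfold_locales
  obtain \<phi> \<psi> where \<phi>: "\<phi> \<in> Cc" "\<phi> x = 1" "uniform_norm G \<phi> \<le> 1" and \<psi>: "\<psi> \<in> Cc" "\<psi> x = hat b x"
    "conv (fs \<phi>) (conv b (fs \<phi>)) = fs \<psi>" using exists_compression[OF x b] by metis
  have m: "fs \<phi> \<in> carrier alg" "conv b (fs \<phi>) \<in> carrier alg" "b \<in> carrier alg"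
    using b \<phi> by (auto simp: function_section_mem convolution_mem)
  have "cmod (hat b x) \<le> uniform_norm G \<psi>" using uniform_norm_upper[OF \<psi>(1) T_D(1)[OF x]] \<psi>(2) by simp
  also have "\<dots> = q (conv (fs \<phi>) (conv b (fs \<phi>)))" using qf \<psi> by simp
  also have "\<dots> \<le> q (fs \<phi>) * q (conv b (fs \<phi>))" using q.sub_mult[OF m(1,2)] by simp
  also have "\<dots> \<le> q (fs \<phi>) * (q b * q (fs \<phi>))" using q.sub_mult[OF m(3,1)] m by (intro mult_left_mono) simp_all
  also have "\<dots> \<le> 1 * (q b * 1)"
    using \<phi> qf m uniform_norm_nonneg[OF \<phi>(1)] q.nonneg[OF m(3)] by (intro mult_mono mult_nonneg_nonneg) simp_all
  finally show ?thesis by simp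
qed

end

section \<open>The gray ideal and the minimal seminorm\<close>

lemma (in cstar_seminormed) tendsto_of_tendsto_into:
  assumes s: "s \<in> cauchys" and t: "\<And>n. t n \<in> carrier A"
    and lim: "(\<lambda>n. anorm completion (aminus completion (into_completion A p (t n)) (cls s))) \<longlonglongrightarrow> 0"
  shows "(\<lambda>n. p (t n \<ominus> s n)) \<longlonglongrightarrow> 0"
proof -
  note sD = cauchysD[OF s]
  have eqs: "aminus completion (into_completion A p (t n)) (cls s) = cls (\<lambda>m. t n \<ominus> s m)"
    "aminus completion (cls s) (into_completion A p (s n)) = cls (\<lambda>m. s m \<ominus> s n)"
    "(\<lambda>m. t n \<ominus> s m) \<in> cauchys" "(\<lambda>m. s m \<ominus> s n) \<in> cauchys" for n
    using s t sD by (auto simp: into_completion_def completion_minus cauchys_const intro!: cauchys_minus cauchys_const)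
  have le: "p (t n \<ominus> s n) \<le> anorm completion (cls (\<lambda>m. t n \<ominus> s m)) + anorm completion (cls (\<lambda>m. s m \<ominus> s n))" for n
    using tendsto_add[OF tendsto_norm_completion[OF eqs(3)] tendsto_norm_completion[OF eqs(4)]]
    by (rule LIMSEQ_le_const) (intro exI[of _ 0] allI impI norm_minus_triangle t sD)
  have "(\<lambda>n. anorm completion (cls (\<lambda>m. t n \<ominus> s m)) + anorm completion (cls (\<lambda>m. s m \<ominus> s n))) \<longlonglongrightarrow> 0 + 0"
    using lim tendsto_into_completion[OF s] unfolding eqs by (rule tendsto_add)
  then have lim0: "(\<lambda>n. anorm completion (cls (\<lambda>m. t n \<ominus> s m)) + anorm completion (cls (\<lambda>m. s m \<ominus> s n))) \<longlonglongrightarrow> 0"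
    by simp
  show ?thesis
    by (rule tendsto_sandwich[OF _ _ tendsto_const lim0]) (use t sD le in \<open>auto intro!: always_eventually\<close>)
qed

context fell_line_bundle
begin

abbreviation full where "full \<equiv> full_cstar G L"

lemma full_eq: "full = N.completion" "into_full G L = into_completion alg max_norm"
  by (simp_all add: full_cstar_def into_full_def fun_eq_iff)

lemma cauchys_mem: "s \<in> N.cauchys \<Longrightarrow> s n \<in> \<A>"
  using N.cauchysD[of s n] by simp

subsection \<open>Continuous functions vanishing at infinity\<close>

lemma Cc_subset_C0:
  assumes "\<phi> \<in> Cc"
  shows "\<phi> \<in> C0_units G"
proof -
  obtain K where K: "continuous_on X \<phi>" "compact K" "K \<subseteq> X" "\<And>x. x \<in> X \<Longrightarrow> x \<notin> K \<Longrightarrow> \<phi> x = 0"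
    using assms by (rule Cc_unitsE) blast
  have "compact {x \<in> X. e \<le> cmod (\<phi> x)}" if e: "0 < e" for e
  proof -
    have "closedin (top_of_set K) (K \<inter> (\<lambda>x. cmod (\<phi> x)) -` {e..})"
      using K(1,3) by (intro continuous_closedin_preimage continuous_intros) (auto intro: continuous_on_subset)
    moreover have "K \<inter> (\<lambda>x. cmod (\<phi> x)) -` {e..} = {x \<in> X. e \<le> cmod (\<phi> x)}"
      using K(3,4) e by force
    ultimately show ?thesis using closedin_compact[OF K(2)] by simp
  qed
  then show ?thesis using K(1) by (simp add: C0_units_def)
qed

lemma C0_approx:
  assumes f: "f \<in> C0_units G"
  obtains u where "\<And>n. u n \<in> Cc" "uniform_limit X u f sequentially"
proof -
  define e where "e n = 1 / real (Suc n)" for n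
  have e: "0 < e n" for n by (simp add: e_def)
  \<comment> \<open>This lowers the modulus of \<open>z\<close> by \<open>\<epsilon>\<close>, or to 0 if it is smaller than that; the maximum in the
    denominator keeps it continuous at 0.\<close>
  define F where "F \<epsilon> z = z * complex_of_real (max 0 (cmod z - \<epsilon>) / max (cmod z) \<epsilon>)" for \<epsilon> z
  have F_zero: "F \<epsilon> z = 0" if "cmod z \<le> \<epsilon>" for \<epsilon> z using that by (simp add: F_def)
  have F_close: "cmod (F \<epsilon> z - z) \<le> \<epsilon>" if "0 < \<epsilon>" for \<epsilon> z
  proof (cases "cmod z \<le> \<epsilon>")
    case True
    then show ?thesis by (simp add: F_zero)
  next
    case False
    then have "z \<noteq> 0" using that by auto
    have "F \<epsilon> z - z = z * complex_of_real ((cmod z - \<epsilon>) / cmod z - 1)"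
      using False by (simp add: F_def algebra_simps)
    also have "(cmod z - \<epsilon>) / cmod z - 1 = - \<epsilon> / cmod z"
      using \<open>z \<noteq> 0\<close> by (simp add: diff_divide_distrib)
    finally have "cmod (F \<epsilon> z - z) = cmod z * \<bar>- \<epsilon> / cmod z\<bar>"
      by (simp only: Real_Vector_Spaces.norm_mult norm_of_real)
    then show ?thesis using \<open>z \<noteq> 0\<close> that by simp
  qed
  define u where "u n x = F (e n) (f x)" for n x
  have f_cont: "continuous_on X f" using f by (simp add: C0_units_def)
  have "u n \<in> Cc" for n
  proof (rule Cc_unitsI[of _ "{x \<in> X. e n \<le> cmod (f x)}"])
    have "max (cmod (f x)) (e n) \<noteq> 0" for x using e[of n] by (simp add: less_max_iff_disj less_imp_neq[symmetric])
    then show "continuous_on X (u n)"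
      unfolding u_def F_def by (intro continuous_intros f_cont) blast
    show "compact {x \<in> X. e n \<le> cmod (f x)}" using f e[of n] by (simp add: C0_units_def)
  qed (auto simp: u_def F_zero)
  moreover have "uniform_limit X u f sequentially"
  proof (rule uniform_limitI)
    fix d :: real assume "0 < d"
    then obtain n0 where n0: "1 / real (Suc n0) < d" using nat_approx_posE by blast
    have "dist (u n x) (f x) < d" if "n \<ge> n0" for n x
    proof -
      have "dist (u n x) (f x) \<le> e n" unfolding dist_norm u_def by (rule F_close[OF e])
      also have "e n \<le> 1 / real (Suc n0)" using that by (simp add: e_def frac_le)
      finally show ?thesis using n0 by simp
    qed
    then show "\<forall>\<^sub>F n in sequentially. \<forall>x\<in>X. dist (u n x) (f x) < d"
      by (auto simp: eventually_sequentially)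
  qed
  ultimately show ?thesis using that by blast
qed

lemma max_norm_fs: "\<phi> \<in> Cc \<Longrightarrow> max_norm (fs \<phi>) = uniform_norm G \<phi>"
  using uniform_max_norm by (simp add: uniform_cstar_seminorms_def)

lemma max_norm_fs_minus_le:
  assumes "\<phi> \<in> Cc" "\<psi> \<in> Cc" "\<And>x. x \<in> X \<Longrightarrow> dist (\<phi> x) (\<psi> x) \<le> d"
  shows "max_norm (aminus alg (fs \<phi>) (fs \<psi>)) \<le> d"
  using assms by (simp add: fs_minus max_norm_fs Cc_units_diff dist_norm uniform_norm_least)

lemma uniform_limit_fs_null:
  assumes u: "\<And>n. u n \<in> Cc" "uniform_limit X u f sequentially"
    and v: "\<And>n. v n \<in> Cc" "uniform_limit X v f sequentially"
  shows "(\<lambda>n. max_norm (aminus alg (fs (u n)) (fs (v n)))) \<longlonglongrightarrow> 0"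
proof (rule LIMSEQ_I)
  fix e :: real assume "0 < e"
  then have "\<forall>\<^sub>F n in sequentially. (\<forall>x\<in>X. dist (u n x) (f x) < e / 4) \<and> (\<forall>x\<in>X. dist (v n x) (f x) < e / 4)"
    using u(2) v(2) by (intro eventually_conj uniform_limitD) simp_all
  then obtain M where M: "\<And>n x. n \<ge> M \<Longrightarrow> x \<in> X \<Longrightarrow> dist (u n x) (f x) < e / 4 \<and> dist (v n x) (f x) < e / 4"
    unfolding eventually_sequentially by blast
  have le: "max_norm (aminus alg (fs (u n)) (fs (v n))) \<le> e / 2" if "n \<ge> M" for n
  proof (rule max_norm_fs_minus_le[OF u(1) v(1)])
    fix x assume "x \<in> X"
    then show "dist (u n x) (v n x) \<le> e / 2"
      using M[OF that, of x] dist_triangle2[of "u n x" "v n x" "f x"] by simp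
  qed
  moreover have "0 \<le> max_norm (aminus alg (fs (u n)) (fs (v n)))" for n
    using N.nonneg[OF alg.minus_closed, of "fs (u n)" "fs (v n)"] u v by (simp add: function_section_mem)
  ultimately show "\<exists>M. \<forall>n\<ge>M. norm (max_norm (aminus alg (fs (u n)) (fs (v n))) - 0) < e"
    using le \<open>0 < e\<close> by (intro exI[of _ M]) fastforce
qed

lemma uniform_limit_fs_cauchys:
  assumes u: "\<And>n. u n \<in> Cc" "uniform_limit X u f sequentially"
  shows "(\<lambda>n. fs (u n)) \<in> N.cauchys"
  unfolding cauchy_seqs_def
proof (intro CollectI conjI allI impI)
  show "fs (u n) \<in> carrier alg" for n using u by (simp add: function_section_mem)
  fix e :: real assume "0 < e"
  then have "\<forall>\<^sub>F n in sequentially. \<forall>x\<in>X. dist (u n x) (f x) < e / 4"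
    using u(2) by (intro uniform_limitD) simp_all
  then obtain M where M: "\<And>n x. n \<ge> M \<Longrightarrow> x \<in> X \<Longrightarrow> dist (u n x) (f x) < e / 4"
    unfolding eventually_sequentially by blast
  have le: "max_norm (aminus alg (fs (u m)) (fs (u n))) \<le> e / 2" if "m \<ge> M" "n \<ge> M" for m n
  proof (rule max_norm_fs_minus_le[OF u(1) u(1)])
    fix x assume "x \<in> X"
    then show "dist (u m x) (u n x) \<le> e / 2"
      using M[OF that(1), of x] M[OF that(2), of x] dist_triangle2[of "u m x" "u n x" "f x"] by simp
  qed
  then show "\<exists>M. \<forall>m\<ge>M. \<forall>n\<ge>M. max_norm (aminus alg (fs (u m)) (fs (u n))) < e"
    using \<open>0 < e\<close> by (intro exI[of _ M]) fastforce
qed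

text \<open>Sequences of compactly supported functions with the same uniform limit are equivalent, so
  that the definite description determines its value.\<close>

lemma C0_into_full_eq:
  assumes u: "\<And>n. u n \<in> Cc" "uniform_limit X u f sequentially"
  shows "C0_into_full G L f = N.cls (\<lambda>n. fs (u n))"
  unfolding C0_into_full_def full_eq
proof (rule the_equality)
  note uc = uniform_limit_fs_cauchys[OF u]
  have "(\<lambda>n. anorm N.completion (aminus N.completion (into_completion alg max_norm (fs (u n))) (N.cls (\<lambda>n. fs (u n))))) \<longlonglongrightarrow> 0"
  proof -
    have "anorm N.completion (aminus N.completion (into_completion alg max_norm (fs (u n))) (N.cls (\<lambda>n. fs (u n)))) =
        anorm N.completion (aminus N.completion (N.cls (\<lambda>n. fs (u n))) (into_completion alg max_norm (fs (u n))))" for n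
    proof -
      have m: "fs (u k) \<in> carrier alg" for k using u by (simp add: function_section_mem)
      have "(\<lambda>k. max_norm (aminus alg (fs (u n)) (fs (u k)))) = (\<lambda>k. max_norm (aminus alg (fs (u k)) (fs (u n))))"
        using N.norm_minus_commute[OF m m] by simp
      then show ?thesis
        unfolding into_completion_def N.completion_minus[OF N.cauchys_const[OF m] uc] N.completion_minus[OF uc N.cauchys_const[OF m]]
        using N.tendsto_norm_completion[OF N.cauchys_minus[OF N.cauchys_const[OF m] uc], of n]
          N.tendsto_norm_completion[OF N.cauchys_minus[OF uc N.cauchys_const[OF m]], of n] LIMSEQ_unique by metis
    qed
    then show ?thesis using N.tendsto_into_completion[OF uc] by simp
  qed
  then show "N.cls (\<lambda>n. fs (u n)) \<in> carrier N.completion \<and>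
     (\<exists>w. (\<forall>n. w n \<in> Cc) \<and> uniform_limit X w f sequentially \<and>
        (\<lambda>n. anorm N.completion (aminus N.completion (into_completion alg max_norm (fs (w n))) (N.cls (\<lambda>n. fs (u n))))) \<longlonglongrightarrow> 0)"
    using u N.cls_closed[OF uc] by blast
  fix a assume a: "a \<in> carrier N.completion \<and>
     (\<exists>w. (\<forall>n. w n \<in> Cc) \<and> uniform_limit X w f sequentially \<and>
        (\<lambda>n. anorm N.completion (aminus N.completion (into_completion alg max_norm (fs (w n))) a)) \<longlonglongrightarrow> 0)"
  then obtain w where w: "\<And>n. w n \<in> Cc" "uniform_limit X w f sequentially"
    "(\<lambda>n. anorm N.completion (aminus N.completion (into_completion alg max_norm (fs (w n))) a)) \<longlonglongrightarrow> 0" by blast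
  obtain s where s: "s \<in> N.cauchys" "a = N.cls s" using a by (auto elim: N.completionE)
  note wc = uniform_limit_fs_cauchys[OF w(1,2)]
  have "(\<lambda>n. max_norm (aminus alg (fs (w n)) (s n))) \<longlonglongrightarrow> 0"
    using w by (intro N.tendsto_of_tendsto_into[OF s(1)]) (simp_all add: function_section_mem s(2))
  then have "N.cls (\<lambda>n. fs (w n)) = a" using N.cls_eqI[OF wc s(1)] s(2) by simp
  moreover have "N.cls (\<lambda>n. fs (w n)) = N.cls (\<lambda>n. fs (u n))"
    by (rule N.cls_eqI[OF wc uc]) (rule uniform_limit_fs_null[OF w(1,2) u])
  ultimately show "a = N.cls (\<lambda>n. fs (u n))" by simp
qed

lemma C0_into_full_Cc: "\<phi> \<in> Cc \<Longrightarrow> C0_into_full G L \<phi> = into_completion alg max_norm (fs \<phi>)"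
  unfolding into_completion_def by (rule C0_into_full_eq) (auto intro!: uniform_limitI)

subsection \<open>Extensions of evaluations\<close>

text \<open>A functional of norm at most 1 that extends the evaluation has norm 1, because it takes the
  value 1 at a bump function.\<close>

lemma extends_evaluationI:
  assumes x: "x \<in> X" and ext: "\<psi> \<in> extensional (carrier N.completion)"
    and add: "\<And>S S'. S \<in> carrier N.completion \<Longrightarrow> S' \<in> carrier N.completion \<Longrightarrow> \<psi> (aadd N.completion S S') = \<psi> S + \<psi> S'"
    and scale: "\<And>c S. S \<in> carrier N.completion \<Longrightarrow> \<psi> (ascale N.completion c S) = c * \<psi> S"
    and pos: "\<And>S. S \<in> carrier N.completion \<Longrightarrow> \<psi> (amult N.completion (astar N.completion S) S) \<in> \<real>\<^sub>\<ge>\<^sub>0"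
    and le: "\<And>S. S \<in> carrier N.completion \<Longrightarrow> cmod (\<psi> S) \<le> anorm N.completion S"
    and eval: "\<And>f. f \<in> C0_units G \<Longrightarrow> \<psi> (C0_into_full G L f) = f x"
  shows "extends_evaluation G L x \<psi>"
proof -
  define B where "B = {S \<in> carrier N.completion. anorm N.completion S \<le> 1}"
  have B: "cmod (\<psi> S) \<le> 1" if "S \<in> B" for S using le[of S] that by (auto simp: B_def)
  obtain \<phi> where \<phi>: "\<phi> \<in> Cc" "\<phi> x = 1" "uniform_norm G \<phi> \<le> 1"
    using exists_bump[OF x open_units subset_refl] by metis
  define S1 where "S1 = into_completion alg max_norm (fs \<phi>)"
  have fsm: "fs \<phi> \<in> carrier alg" using \<phi> by (simp add: function_section_mem)
  have S1: "S1 \<in> B" using N.into_closed[OF fsm] N.norm_into[OF fsm] \<phi> by (simp add: B_def S1_def max_norm_fs)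
  have "\<psi> S1 = 1" using eval[OF Cc_subset_C0[OF \<phi>(1)]] \<phi> by (simp add: C0_into_full_Cc S1_def)
  have bdd: "bdd_above ((\<lambda>a. cmod (\<psi> a)) ` B)" using B by (intro bdd_aboveI2) 
  have "(SUP a\<in>B. cmod (\<psi> a)) = 1"
  proof (rule antisym)
    show "(SUP a\<in>B. cmod (\<psi> a)) \<le> 1" using S1 B by (intro cSUP_least) auto
    have "cmod (\<psi> S1) \<le> (SUP a\<in>B. cmod (\<psi> a))" using bdd S1 by (intro cSUP_upper)
    then show "1 \<le> (SUP a\<in>B. cmod (\<psi> a))" using \<open>\<psi> S1 = 1\<close> by simp
  qed
  then show ?thesis
    using assms bdd unfolding extends_evaluation_def state_def full_eq B_def by blast
qed

lemma state_norm_le: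
  assumes \<psi>: "state N.completion \<psi>" and S: "S \<in> carrier N.completion"
  shows "cmod (\<psi> S) \<le> anorm N.completion S"
proof (rule field_le_epsilon)
  fix e :: real assume "0 < e"
  have scale: "\<psi> (ascale N.completion c S) = c * \<psi> S" for c using \<psi> S by (simp add: state_def)
  obtain s where s: "s \<in> N.cauchys" "S = N.cls s" using S by (auto elim: N.completionE)
  define d where "d = anorm N.completion S + e"
  have d: "0 < d" using N.norm_completion_nonneg[OF S] \<open>0 < e\<close> by (simp add: d_def)
  define S1 where "S1 = ascale N.completion (of_real (1 / d)) S"
  have S1: "S1 = N.cls (\<lambda>n. section_scale L (of_real (1 / d)) (s n))" "(\<lambda>n. section_scale L (of_real (1 / d)) (s n)) \<in> N.cauchys"
    using s N.completion_scale[OF s(1)] N.cauchys_scale[OF s(1)] by (simp_all add: S1_def)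
  have "(\<lambda>n. max_norm (section_scale L (of_real (1 / d)) (s n))) \<longlonglongrightarrow> (1 / d) * anorm N.completion S"
    using tendsto_mult_left[OF N.tendsto_norm_completion[OF s(1)], of "1 / d"] N.norm_scale[OF N.cauchysD[OF s(1)]] d
    by (simp add: s(2) norm_divide)
  then have "anorm N.completion S1 = (1 / d) * anorm N.completion S"
    unfolding S1(1) by (rule N.norm_completion_eq[OF S1(2)])
  also have "\<dots> \<le> 1" using d \<open>0 < e\<close> by (simp add: d_def)
  finally have "S1 \<in> {a \<in> carrier N.completion. anorm N.completion a \<le> 1}"
    using S1 N.cls_closed by simp
  then have "cmod (\<psi> S1) \<le> (SUP a\<in>{a \<in> carrier N.completion. anorm N.completion a \<le> 1}. cmod (\<psi> a))"
    using \<psi> unfolding state_def by (intro cSUP_upper) simp_all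
  then have "cmod (\<psi> S1) \<le> 1" using \<psi> by (simp add: state_def)
  then show "cmod (\<psi> S) \<le> anorm N.completion S + e"
    using d unfolding S1_def scale d_def[symmetric] by (simp add: Real_Vector_Spaces.norm_mult norm_divide)
qed

text \<open>The continuous extension of the evaluation at \<open>x\<close>; it can be computed from any
  representative (\<open>tendsto_eval_state\<close>).\<close>

definition eval_state :: "'g \<Rightarrow> ('g, 'l) full_element \<Rightarrow> complex" where
  "eval_state x S = (if S \<in> carrier N.completion then lim (\<lambda>n. hat (rep S n) x) else undefined)"

lemma tendsto_eval_state:
  assumes s: "s \<in> N.cauchys"
  shows "(\<lambda>n. hat (s n) x) \<longlonglongrightarrow> eval_state x (N.cls s)"
proof -
  note r = N.rep_cls[OF s]
  have hat_le: "cmod (hat (f::'g \<Rightarrow> 'l) x - hat h x) \<le> max_norm (aminus alg f h)"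
    if "f \<in> \<A>" "h \<in> \<A>" for f h
    using hat_le_max_norm[of "aminus alg f h" x] that alg.minus_closed[of f h] by (simp add: hat_minus)
  have "Cauchy (\<lambda>n. hat (rep (N.cls s) n) x)"
  proof (rule CauchyI)
    fix e :: real assume "0 < e"
    then obtain M where M: "\<And>m n. m \<ge> M \<Longrightarrow> n \<ge> M \<Longrightarrow> max_norm (aminus alg (rep (N.cls s) m) (rep (N.cls s) n)) < e"
      using N.cauchysE[OF r(1)] by blast
    show "\<exists>M. \<forall>m\<ge>M. \<forall>n\<ge>M. norm (hat (rep (N.cls s) m) x - hat (rep (N.cls s) n) x) < e"
      using M hat_le[OF cauchys_mem[OF r(1)] cauchys_mem[OF r(1)]] by (meson le_less_trans)
  qed
  then have "(\<lambda>n. hat (rep (N.cls s) n) x) \<longlonglongrightarrow> eval_state x (N.cls s)"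
    using N.cls_closed[OF s] by (simp add: eval_state_def Cauchy_convergent_iff convergent_LIMSEQ_iff)
  moreover have "(\<lambda>n. hat (s n) x - hat (rep (N.cls s) n) x) \<longlonglongrightarrow> 0"
  proof (rule tendsto_0_le[OF r(2), where K = 1])
    show "\<forall>\<^sub>F n in sequentially. norm (hat (s n) x - hat (rep (N.cls s) n) x) \<le> norm (max_norm (aminus alg (rep (N.cls s) n) (s n))) * 1"
      using hat_le[OF cauchys_mem[OF r(1)] cauchys_mem[OF s]]
      by (intro always_eventually allI) (simp add: norm_minus_commute, meson abs_ge_self order_trans)
  qed
  ultimately show ?thesis
    using tendsto_add[of "\<lambda>n. hat (s n) x - hat (rep (N.cls s) n) x" 0] by fastforce
qed

lemma eval_state_eqI: "s \<in> N.cauchys \<Longrightarrow> (\<lambda>n. hat (s n) x) \<longlonglongrightarrow> c \<Longrightarrow> eval_state x (N.cls s) = c"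
  using tendsto_eval_state LIMSEQ_unique by blast

lemma tendsto_eval_state_square:
  assumes x: "x \<in> X" and s: "s \<in> N.cauchys"
  shows "(\<lambda>n. complex_of_real ((evnorm x (s n))\<^sup>2)) \<longlonglongrightarrow>
    eval_state x (amult N.completion (astar N.completion (N.cls s)) (N.cls s))"
proof -
  interpret pf: positive_functional alg "ev x" using x by (rule positive_functional_ev)
  have "hat (conv (adj (s n)) (s n)) x = complex_of_real ((evnorm x (s n))\<^sup>2)" for n
    using pf.fnorm_square[of "s n"] cauchys_mem[OF s, of n] by (simp add: ev_def)
  then show ?thesis
    using tendsto_eval_state[OF N.cauchys_mult[OF N.cauchys_star[OF s] s], of x]
    by (simp add: N.completion_star[OF s] N.completion_mult[OF N.cauchys_star[OF s] s, simplified])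
qed

lemma eval_state_le:
  assumes "S \<in> carrier N.completion"
  shows "cmod (eval_state x S) \<le> anorm N.completion S"
proof -
  obtain s where s: "s \<in> N.cauchys" "S = N.cls s" using assms by (auto elim: N.completionE)
  have "(\<lambda>n. cmod (hat (s n) x)) \<longlonglongrightarrow> cmod (eval_state x S)"
    unfolding s(2) by (intro tendsto_norm tendsto_eval_state s)
  then show ?thesis
    by (rule LIMSEQ_le[OF _ N.tendsto_norm_completion[OF s(1), folded s(2)]])
      (use hat_le_max_norm[OF cauchys_mem[OF s(1)]] in auto)
qed

lemma extends_evaluation_eval_state:
  assumes x: "x \<in> X"
  shows "extends_evaluation G L x (eval_state x)"
proof (rule extends_evaluationI[OF x])
  show "eval_state x \<in> extensional (carrier N.completion)" by (simp add: extensional_def eval_state_def)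
  fix S assume S: "S \<in> carrier N.completion"
  then obtain s where s: "s \<in> N.cauchys" "S = N.cls s" by (auto elim: N.completionE)
  show "cmod (eval_state x S) \<le> anorm N.completion S" using S by (rule eval_state_le)
  have "eval_state x (N.cls (\<lambda>n. section_scale L c (s n))) = c * eval_state x (N.cls s)" for c
    using N.cauchys_scale[OF s(1), of c] tendsto_mult_left[OF tendsto_eval_state[OF s(1), of x], of c]
    by (intro eval_state_eqI) (simp_all add: hat_scale)
  then show "eval_state x (ascale N.completion c S) = c * eval_state x S" for c
    using s N.completion_scale[OF s(1)] by simp
  have "\<forall>\<^sub>F n in sequentially. complex_of_real ((evnorm x (s n))\<^sup>2) \<in> \<real>\<^sub>\<ge>\<^sub>0"
    by (intro always_eventually allI) (simp only: nonneg_Reals_of_real_iff zero_le_power2)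
  from Lim_in_closed_set[OF closed_nonneg_Reals_complex this _ tendsto_eval_state_square[OF x s(1)]]
  show "eval_state x (amult N.completion (astar N.completion S) S) \<in> \<real>\<^sub>\<ge>\<^sub>0" by (simp add: s(2))
  fix S' assume "S' \<in> carrier N.completion"
  then obtain t where t: "t \<in> N.cauchys" "S' = N.cls t" by (auto elim: N.completionE)
  have "eval_state x (N.cls (\<lambda>n. section_add L (s n) (t n))) = eval_state x (N.cls s) + eval_state x (N.cls t)"
    using N.cauchys_add[OF s(1) t(1)] tendsto_add[OF tendsto_eval_state[OF s(1), of x] tendsto_eval_state[OF t(1), of x]]
    by (intro eval_state_eqI) (simp_all add: hat_alg_simps cauchys_mem[OF s(1)] cauchys_mem[OF t(1)])
  then show "eval_state x (aadd N.completion S S') = eval_state x S + eval_state x S'"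
    using s t N.completion_add[OF s(1) t(1)] by simp
next
  fix f assume "f \<in> C0_units G"
  then obtain u where u: "\<And>n. u n \<in> Cc" "uniform_limit X u f sequentially" using C0_approx by blast
  have "(\<lambda>n. hat (fs (u n)) x) \<longlonglongrightarrow> f x"
    using tendsto_uniform_limitI[OF u(2) x] x by (simp add: hat_function_section)
  then show "eval_state x (C0_into_full G L f) = f x"
    unfolding C0_into_full_eq[OF u] by (rule eval_state_eqI[OF uniform_limit_fs_cauchys[OF u]])
qed

lemma free_state_eq: "x \<in> free_points G L \<Longrightarrow> free_state G L x = eval_state x"
  unfolding free_points_def free_state_def using extends_evaluation_eval_state by (auto intro: the1_equality)

subsection \<open>Points with trivial isotropy are free\<close>

lemma exists_support_units:
  assumes "b \<in> \<A>"
  shows "\<exists>K. compact K \<and> K \<subseteq> X \<and> (\<forall>g. hat b g \<noteq> 0 \<longrightarrow> \<r> g \<in> K \<and> \<s> g \<in> K)"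
  using assms
proof (induction rule: compact_sections.induct)
  case (bisection U b)
  obtain K where K: "is_section b" "compact K" "\<And>g. g \<notin> K \<Longrightarrow> b g = lzero L g"
    using bisection(2) by (rule bisection_sectionsE) blast
  show ?case
    by (rule exI[of _ "\<r> ` K \<union> \<s> ` K"])
      (use K hat_eq_0[OF K(1)] in \<open>auto intro!: compact_Un compact_range_image compact_source_image\<close>)
next
  case (add f h)
  then obtain K M where "compact K" "K \<subseteq> X" "\<forall>g. hat f g \<noteq> 0 \<longrightarrow> \<r> g \<in> K \<and> \<s> g \<in> K"
    "compact M" "M \<subseteq> X" "\<forall>g. hat h g \<noteq> 0 \<longrightarrow> \<r> g \<in> M \<and> \<s> g \<in> M" by blast
  then show ?case
    using add(1,2) by (intro exI[of _ "K \<union> M"]) (auto simp: hat_alg_simps intro!: compact_Un; metis add.left_neutral)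
next
  case (scale f c)
  then show ?case by (auto simp: hat_scale)
qed

lemma exists_local_unit:
  assumes b: "b \<in> \<A>"
  obtains \<phi> where "\<phi> \<in> Cc" "conv (fs \<phi>) b = b" "conv b (fs \<phi>) = b"
proof -
  obtain K where K: "compact K" "K \<subseteq> X" "\<And>g. hat b g \<noteq> 0 \<Longrightarrow> \<r> g \<in> K \<and> \<s> g \<in> K"
    using exists_support_units[OF b] by blast
  obtain a :: "'g \<Rightarrow> real" and M where a: "continuous_on X a" "\<And>x. x \<in> K \<Longrightarrow> a x = 1"
    "compact M" "M \<subseteq> X" "\<And>x. x \<in> X \<Longrightarrow> x \<notin> M \<Longrightarrow> a x = 0"
    using exists_cutoff[OF K(1,2) open_units subset_refl] by metis
  define \<phi> where "\<phi> x = complex_of_real (a x)" for x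
  have \<phi>: "\<phi> \<in> Cc"
    by (rule Cc_unitsI[of _ M]) (use a in \<open>auto simp: \<phi>_def intro!: continuous_intros\<close>)
  note m = function_section_mem[OF \<phi>]
  have "\<phi> (\<r> g) * hat b g = hat b g" "hat b g * \<phi> (\<s> g) = hat b g" for g
    using K(3)[of g] a(2) by (cases "hat b g = 0"; simp add: \<phi>_def)+
  then have "conv (fs \<phi>) b = b" "conv b (fs \<phi>) = b"
    using b m by (auto intro!: alg_eqI simp: convolution_mem hat_alg_simps twisted_conv_fs_left twisted_conv_fs_right)
  then show ?thesis using that \<phi> by blast
qed

text \<open>Let \<open>\<theta>\<close> be the restriction of the state \<open>\<psi>\<close> to the convolution algebra. If a function \<open>d\<close>
  vanishes at \<open>x\<close>, then \<open>\<theta> (d\<^sup>*d) = 0\<close>, and \<open>\<theta>\<close> vanishes on all products with \<open>d\<close> by the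
  Cauchy--Schwarz inequality. With a bump function \<open>\<phi>\<close> at \<open>x\<close> and a local unit \<open>e\<close> for \<open>b\<close>, the
  function \<open>e - \<phi>e\<close> is of this kind. Thus \<open>\<theta>\<close> takes the same value at \<open>b\<close>, at \<open>b\<phi>\<close> and at \<open>\<phi>b\<phi>\<close>, and
  the last of these is a function on the unit space if the support of \<open>\<phi>\<close> is small.\<close>

lemma extension_at_T_unique:
  assumes x: "x \<in> T" and \<psi>: "extends_evaluation G L x \<psi>"
  shows "\<psi> = eval_state x"
proof -
  note xX = T_D(1)[OF x]
  have st: "state N.completion \<psi>" and eval: "\<And>f. f \<in> C0_units G \<Longrightarrow> \<psi> (C0_into_full G L f) = f x"
    using \<psi> by (auto simp: extends_evaluation_def full_eq)
  define \<theta> where "\<theta> b = \<psi> (into_completion alg max_norm b)" for b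
  have lin: "\<psi> (aadd N.completion S S') = \<psi> S + \<psi> S'" "\<psi> (ascale N.completion c S) = c * \<psi> S"
    "\<psi> (amult N.completion (astar N.completion S) S) \<in> \<real>\<^sub>\<ge>\<^sub>0"
    if "S \<in> carrier N.completion" "S' \<in> carrier N.completion" for S S' c
    using st that unfolding state_def by blast+
  interpret pf: positive_functional alg \<theta>
  proof
    fix a b k assume a: "a \<in> carrier alg"
    note ca = N.cauchys_const[OF a] and ia = N.into_closed[OF a]
    show "\<theta> (ascale alg k a) = k * \<theta> a"
      using lin(2)[OF ia ia, of k] N.completion_scale[OF ca, of k] by (simp add: \<theta>_def into_completion_def)
    show "\<theta> (amult alg (astar alg a) a) \<in> \<real>\<^sub>\<ge>\<^sub>0"
      using lin(3)[OF ia ia] N.completion_star[OF ca] N.completion_mult[OF N.cauchys_star[OF ca] ca]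
      by (simp add: \<theta>_def into_completion_def)
    assume b: "b \<in> carrier alg"
    show "\<theta> (aadd alg a b) = \<theta> a + \<theta> b"
      using lin(1)[OF ia N.into_closed[OF b]] N.completion_add[OF ca N.cauchys_const[OF b]]
      by (simp add: \<theta>_def into_completion_def)
  qed
  have \<theta>_fs: "\<theta> (fs \<phi>) = \<phi> x" if "\<phi> \<in> Cc" for \<phi>
    using eval[OF Cc_subset_C0[OF that]] that by (simp add: \<theta>_def C0_into_full_Cc)
  have vanish: "\<theta> (conv (fs d) c) = 0" "\<theta> (conv c (fs d)) = 0"
    if d: "d \<in> Cc" "d x = 0" and c: "c \<in> \<A>" for d c
  proof -
    have null: "pf.fnorm (fs e) = 0" if e: "e \<in> Cc" "e x = 0" for e
      using pf.fnorm_square[of "fs e"] e \<theta>_fs[of "\<lambda>x. cnj (e x) * e x"]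
      by (simp add: function_section_mem fs_star fs_mult Cc_units_cnj Cc_units_times)
    have star: "adj (fs (\<lambda>x. cnj (d x))) = fs d"
      using fs_star[OF Cc_units_cnj[OF d(1)]] by simp
    have "cmod (\<theta> (conv (fs d) c)) \<le> pf.fnorm (fs (\<lambda>x. cnj (d x))) * pf.fnorm c"
      using pf.Cauchy_Schwarz[of c "fs (\<lambda>x. cnj (d x))"] c d star by (simp add: function_section_mem Cc_units_cnj)
    then show "\<theta> (conv (fs d) c) = 0" using null[of "\<lambda>x. cnj (d x)"] d by (simp add: Cc_units_cnj)
    have "cmod (\<theta> (conv c (fs d))) \<le> pf.fnorm (adj c) * pf.fnorm (fs d)"
      using pf.Cauchy_Schwarz[of "fs d" "adj c"] c d star_mem[OF c] alg.star_star[of c]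
      by (simp add: function_section_mem)
    then show "\<theta> (conv c (fs d)) = 0" using null[OF d] by simp
  qed
  have \<theta>_hat: "\<theta> b = hat b x" if b: "b \<in> \<A>" for b
  proof -
    obtain \<phi> \<beta> where \<phi>: "\<phi> \<in> Cc" "\<phi> x = 1" and \<beta>: "\<beta> \<in> Cc" "\<beta> x = hat b x"
      "conv (fs \<phi>) (conv b (fs \<phi>)) = fs \<beta>" using exists_compression[OF x b] by metis
    obtain e where e: "e \<in> Cc" "conv (fs e) b = b" "conv b (fs e) = b"
      using exists_local_unit[OF b] .
    define d where "d y = e y - \<phi> y * e y" for y
    have d: "d \<in> Cc" "d x = 0"
      unfolding d_def using e \<phi> by (auto intro!: Cc_units_diff Cc_units_times)
    define c where "c = conv b (fs \<phi>)"
    have m: "fs \<phi> \<in> \<A>" "fs e \<in> \<A>" "fs d \<in> \<A>"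
      "c \<in> \<A>"
      using \<phi> e d b by (auto simp: c_def function_section_mem convolution_mem)
    have hb: "hat b g * e (\<s> g) = hat b g" "e (\<r> g) * hat b g = hat b g" for g
      using arg_cong[OF e(3), of "\<lambda>f. hat f g"] arg_cong[OF e(2), of "\<lambda>f. hat f g"] b m
      by (simp_all add: hat_alg_simps twisted_conv_fs_left twisted_conv_fs_right)
    have hc: "e (\<r> g) * hat c g = hat c g" for g
      using hb[of g] b m by (simp add: c_def hat_alg_simps twisted_conv_fs_right) (metis mult.assoc)
    have "aminus alg b c = conv b (fs d)"
    proof (rule alg_eqI)
      fix g
      have "hat (aminus alg b c) g = hat b g - \<phi> (\<s> g) * hat b g"
        using b m by (simp add: hat_minus) (simp add: c_def hat_alg_simps b m twisted_conv_fs_right)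
      also have "\<dots> = hat b g * e (\<s> g) - \<phi> (\<s> g) * (hat b g * e (\<s> g))" by (simp only: hb)
      also have "\<dots> = hat b g * d (\<s> g)" by (simp add: d_def algebra_simps)
      finally show "hat (aminus alg b c) g = hat (conv b (fs d)) g"
        using b m by (simp add: hat_alg_simps twisted_conv_fs_right)
    qed (use b m alg.minus_closed[of b c] in \<open>simp_all add: convolution_mem\<close>)
    then have "\<theta> b = \<theta> c" using pf.minus[of b c] vanish(2)[OF d b] b m by simp
    have "aminus alg c (fs \<beta>) = conv (fs d) c"
    proof (rule alg_eqI)
      fix g
      have "hat (fs \<beta>) g = \<phi> (\<r> g) * hat c g"
        unfolding \<beta>(3)[symmetric] c_def[symmetric] using m by (simp add: hat_alg_simps twisted_conv_fs_left)
      then have "hat (aminus alg c (fs \<beta>)) g = hat c g - \<phi> (\<r> g) * hat c g"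
        using m \<beta>(1) by (simp add: hat_minus function_section_mem)
      also have "\<dots> = e (\<r> g) * hat c g - \<phi> (\<r> g) * (e (\<r> g) * hat c g)" by (simp only: hc)
      also have "\<dots> = d (\<r> g) * hat c g" by (simp add: d_def algebra_simps)
      finally show "hat (aminus alg c (fs \<beta>)) g = hat (conv (fs d) c) g"
        using m by (simp add: hat_alg_simps twisted_conv_fs_left)
    qed (use m \<beta> alg.minus_closed[of c "fs \<beta>"] in \<open>simp_all add: convolution_mem function_section_mem\<close>)
    then have "\<theta> c = \<theta> (fs \<beta>)" using pf.minus[of c "fs \<beta>"] vanish(1)[OF d m(4)] \<beta> m by (simp add: function_section_mem)
    then show ?thesis using \<open>\<theta> b = \<theta> c\<close> \<theta>_fs[OF \<beta>(1)] \<beta>(2) by simp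
  qed
  show ?thesis
  proof
    fix S
    show "\<psi> S = eval_state x S"
    proof (cases "S \<in> carrier N.completion")
      case False
      then show ?thesis using st by (simp add: state_def extensional_def eval_state_def)
    next
      case True
      then obtain s where s: "s \<in> N.cauchys" "S = N.cls s" by (auto elim: N.completionE)
      have "(\<lambda>n. \<psi> S - hat (s n) x) \<longlonglongrightarrow> 0"
      proof (rule tendsto_0_le[OF N.tendsto_into_completion[OF s(1)], where K = 1])
        have "cmod (\<psi> S - hat (s n) x) \<le> anorm N.completion (aminus N.completion (N.cls s) (into_completion alg max_norm (s n)))" for n
        proof -
          define I where "I = into_completion alg max_norm (s n)"
          have I: "I \<in> carrier N.completion" using N.into_closed[OF N.cauchysD[OF s(1)]] by (simp add: I_def)
          obtain i where i: "i \<in> N.cauchys" "I = N.cls i" using I by (auto elim: N.completionE)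
          have sc: "ascale N.completion (-1) I \<in> carrier N.completion"
            using i N.completion_scale[OF i(1)] N.cls_closed[OF N.cauchys_scale[OF i(1)]] by simp
          have mc: "aminus N.completion S I \<in> carrier N.completion"
            using i s N.completion_minus[OF s(1) i(1)] N.cls_closed[OF N.cauchys_minus[OF s(1) i(1)]] by simp
          have "\<psi> (aminus N.completion S I) = \<psi> S - \<psi> I"
            using lin(1)[OF True sc] lin(2)[OF I I, of "-1"] by (simp add: aminus_def)
          also have "\<psi> I = hat (s n) x" using \<theta>_hat[OF cauchys_mem[OF s(1)]] by (simp add: I_def \<theta>_def)
          finally show ?thesis using state_norm_le[OF st mc] s(2) by (simp add: I_def)
        qed
        then show "\<forall>\<^sub>F n in sequentially. norm (\<psi> S - hat (s n) x) \<le>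
            norm (anorm N.completion (aminus N.completion (N.cls s) (into_completion alg max_norm (s n)))) * 1"
          by (intro always_eventually allI) (simp, meson abs_ge_self order_trans)
      qed
      then have "(\<lambda>n. \<psi> S - (\<psi> S - hat (s n) x)) \<longlonglongrightarrow> \<psi> S - 0" by (intro tendsto_diff tendsto_const)
      then have "eval_state x S = \<psi> S" unfolding s(2) by (intro eval_state_eqI[OF s(1)]) simp
      then show ?thesis by simp
    qed
  qed
qed

lemma T_subset_free_points: "T \<subseteq> free_points G L"
proof
  fix x assume x: "x \<in> T"
  have "\<exists>!\<psi>. extends_evaluation G L x \<psi>"
    using extends_evaluation_eval_state[OF T_D(1)[OF x]] extension_at_T_unique[OF x] by (rule ex1I)
  then show "x \<in> free_points G L" using T_D(1)[OF x] by (simp add: free_points_def)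
qed

text \<open>States form a weakly compact set, so that the evaluations at points of \<open>T\<close> near \<open>x\<close> have a
  cluster point. It extends the evaluation at \<open>x\<close>, and hence is the only extension.\<close>

lemma eval_state_square_closure:
  assumes x: "x \<in> free_points G L" and cl: "x \<in> closure T" and S: "S \<in> carrier N.completion"
    and zero: "\<And>y. y \<in> T \<Longrightarrow> eval_state y (amult N.completion (astar N.completion S) S) = 0"
  shows "eval_state x (amult N.completion (astar N.completion S) S) = 0"
proof (cases "x \<in> T")
  case True
  then show ?thesis using zero by blast
next
  case False
  have xX: "x \<in> X" using x by (simp add: free_points_def)
  have nontriv: "at x within T \<noteq> bot"
    using False cl trivial_limit_within[of x T] by (auto simp: closure_def trivial_limit_def)
  define D where "D S' = (if S' \<in> carrier N.completion then cball (0::complex) (anorm N.completion S') else {undefined})"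
    for S' :: "('g, 'l) full_element"
  define K where "K = PiE UNIV D"
  have "compactin (product_topology (\<lambda>i. euclidean) UNIV) K"
    unfolding K_def compactin_PiE by (auto simp: D_def)
  then have "compact K" by (simp add: euclidean_product_topology)
  define F0 where "F0 = filtermap eval_state (at x within T)"
  have "eval_state y \<in> K" for y
    using eval_state_le by (auto simp: K_def D_def eval_state_def)
  then have "eventually (\<lambda>w. w \<in> K) F0" by (simp add: F0_def eventually_filtermap)
  moreover have "F0 \<noteq> bot" using nontriv by (simp add: F0_def filtermap_bot_iff)
  ultimately obtain \<psi> where \<psi>: "\<psi> \<in> K" "inf (nhds \<psi>) F0 \<noteq> bot"
    using \<open>compact K\<close> unfolding compact_filter by blast
  define F where "F = inf (nhds \<psi>) F0"
  have F: "F \<noteq> bot" "F \<le> nhds \<psi>" "F \<le> F0" using \<psi> by (auto simp: F_def)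
  have "((\<lambda>w. w) \<longlongrightarrow> \<psi>) F" using F(2) by (simp add: filterlim_def)
  then have coord_lim: "((\<lambda>w. w S') \<longlongrightarrow> \<psi> S') F" for S'
    by (rule continuous_on_tendsto_compose[OF continuous_on_product_coordinates]) simp_all
  have ev_F: "eventually P F" if "\<And>y. y \<in> T \<Longrightarrow> P (eval_state y)" for P
  proof (rule filter_leD[OF F(3)])
    show "eventually P F0"
      unfolding F0_def eventually_filtermap by (simp add: eventually_at_filter that)
  qed
  have ext: "extends_evaluation G L y (eval_state y)" if "y \<in> T" for y
    using T_D(1)[OF that] by (rule extends_evaluation_eval_state)
  then have st: "state N.completion (eval_state y)" if "y \<in> T" for y
    using that by (auto simp: extends_evaluation_def full_eq)
  have lin: "eval_state y (aadd N.completion S1 S2) = eval_state y S1 + eval_state y S2"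
    "eval_state y (ascale N.completion c S1) = c * eval_state y S1"
    "eval_state y (amult N.completion (astar N.completion S1) S1) \<in> \<real>\<^sub>\<ge>\<^sub>0"
    if "y \<in> T" "S1 \<in> carrier N.completion" "S2 \<in> carrier N.completion" for y S1 S2 c
    using st[OF that(1)] that(2,3) unfolding state_def by blast+
  have eqI: "\<psi> S1 = c" if "((\<lambda>w. w S1) \<longlongrightarrow> c) F" for S1 c
    using tendsto_unique[OF F(1) coord_lim that] .
  have "extends_evaluation G L x \<psi>"
  proof (rule extends_evaluationI[OF xX])
    show "\<psi> \<in> extensional (carrier N.completion)"
      unfolding extensional_def
    proof (intro CollectI allI impI)
      fix S' :: "('g, 'l) full_element" assume "S' \<notin> carrier N.completion"
      then show "\<psi> S' = undefined" using PiE_mem[OF \<psi>(1)[unfolded K_def], of S'] by (simp add: D_def)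
    qed
    fix S1 assume S1: "S1 \<in> carrier N.completion"
    then show "cmod (\<psi> S1) \<le> anorm N.completion S1"
      using PiE_mem[OF \<psi>(1)[unfolded K_def], of S1] by (simp add: D_def)
    show "\<psi> (ascale N.completion c S1) = c * \<psi> S1" for c
    proof (rule eqI, rule tendsto_cong[THEN iffD1])
      show "\<forall>\<^sub>F w in F. c * w S1 = w (ascale N.completion c S1)"
        by (rule ev_F) (simp add: lin(2)[OF _ S1 S1])
      show "((\<lambda>w. c * w S1) \<longlongrightarrow> c * \<psi> S1) F" by (intro tendsto_intros coord_lim)
    qed
    show "\<psi> (amult N.completion (astar N.completion S1) S1) \<in> \<real>\<^sub>\<ge>\<^sub>0"
      by (rule Lim_in_closed_set[OF closed_nonneg_Reals_complex _ F(1) coord_lim])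
        (rule ev_F, rule lin(3)[OF _ S1 S1])
    fix S2 assume S2: "S2 \<in> carrier N.completion"
    show "\<psi> (aadd N.completion S1 S2) = \<psi> S1 + \<psi> S2"
    proof (rule eqI, rule tendsto_cong[THEN iffD1])
      show "\<forall>\<^sub>F w in F. w S1 + w S2 = w (aadd N.completion S1 S2)"
        by (rule ev_F) (simp add: lin(1)[OF _ S1 S2])
      show "((\<lambda>w. w S1 + w S2) \<longlongrightarrow> \<psi> S1 + \<psi> S2) F" by (intro tendsto_intros coord_lim)
    qed
  next
    fix f assume f: "f \<in> C0_units G"
    have "(f \<longlongrightarrow> f x) (at x within X)" using f xX by (simp add: C0_units_def continuous_on_def)
    then have "(f \<longlongrightarrow> f x) (at x within T)" by (rule tendsto_within_subset) (auto simp: T_def)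
    moreover have "\<forall>\<^sub>F y in at x within T. f y = eval_state y (C0_into_full G L f)"
      using ext f by (simp add: eventually_at_filter extends_evaluation_def)
    ultimately have "((\<lambda>y. eval_state y (C0_into_full G L f)) \<longlongrightarrow> f x) (at x within T)"
      by (rule tendsto_cong[THEN iffD1, rotated])
    then have "((\<lambda>w. w (C0_into_full G L f)) \<longlongrightarrow> f x) F0"
      by (simp add: F0_def filterlim_filtermap)
    then show "\<psi> (C0_into_full G L f) = f x"
      by (intro eqI) (rule filterlim_mono[OF _ order_refl F(3)])
  qed
  then have "\<psi> = eval_state x"
    using x extends_evaluation_eval_state[OF xX] by (auto simp: free_points_def)
  moreover have "\<psi> (amult N.completion (astar N.completion S) S) = 0"
  proof (rule eqI, rule tendsto_cong[THEN iffD1])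
    show "\<forall>\<^sub>F w in F. 0 = w (amult N.completion (astar N.completion S) S)" by (rule ev_F) (simp add: zero)
  qed simp
  ultimately show ?thesis by simp
qed

subsection \<open>The minimal seminorm\<close>

text \<open>In the regular representation, the column of \<open>bc\<close> at \<open>x\<close> is a combination of the columns of
  \<open>b\<close> at the ranges of the finitely many arrows \<open>a\<close> in \<open>C\<close>, up to unimodular factors and a right
  translation by \<open>\<iota> a\<close>. The factor \<open>card C\<close> comes from the Cauchy--Schwarz inequality for the sum
  over \<open>C\<close>.\<close>

lemma evnorm_mult_le_columns:
  assumes x: "x \<in> X" and b: "b \<in> \<A>" and c: "c \<in> \<A>"
  defines "C \<equiv> {a. \<s> a = x \<and> hat c a \<noteq> 0}"
  shows "(evnorm x (conv b c))\<^sup>2 \<le> real (card C) * (\<Sum>a\<in>C. (cmod (hat c a))\<^sup>2 * (evnorm (\<r> a) b)\<^sup>2)"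
proof -
  have m: "conv b c \<in> \<A>" using b c by (rule convolution_mem)
  have fC: "finite C" unfolding C_def by (rule fibre_finiteD(2)[OF compact_sections_finite[OF c]])
  define E where "E = {g. \<s> g = x \<and> hat (conv b c) g \<noteq> 0}"
  have fE: "finite E" unfolding E_def by (rule fibre_finiteD(2)[OF compact_sections_finite[OF m]])
  have entry: "(cmod (hat (conv b c) g))\<^sup>2 \<le> real (card C) * (\<Sum>a\<in>C. (cmod (hat c a))\<^sup>2 * (cmod (hat b (g \<diamondop> \<iota> a)))\<^sup>2)"
    if g: "\<s> g = x" for g
  proof -
    have "hat (conv b c) g = (\<Sum>(d, a)\<in>(\<lambda>a. (g \<diamondop> \<iota> a, a)) ` C. hat b d * hat c a * cocycle d a)"
      unfolding hat_alg_simps(2)[OF b c]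
    proof (rule twisted_conv_eq_sum)
      show "finite ((\<lambda>a. (g \<diamondop> \<iota> a, a)) ` C)" using fC by simp
      show "factor_pairs (hat b) (hat c) g \<subseteq> (\<lambda>a. (g \<diamondop> \<iota> a, a)) ` C"
        using g by (auto simp: factor_pairs_def C_def image_iff)
      show "(\<lambda>a. (g \<diamondop> \<iota> a, a)) ` C \<subseteq> {(a, b). \<s> a = \<r> b \<and> a \<diamondop> b = g}"
        using g by (auto simp: C_def)
    qed
    also have "\<dots> = (\<Sum>a\<in>C. hat b (g \<diamondop> \<iota> a) * hat c a * cocycle (g \<diamondop> \<iota> a) a)"
      by (subst sum.reindex) (auto intro!: inj_onI)
    finally have "cmod (hat (conv b c) g) \<le> (\<Sum>a\<in>C. cmod (hat b (g \<diamondop> \<iota> a) * hat c a * cocycle (g \<diamondop> \<iota> a) a))"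
      by (simp add: norm_sum)
    also have "\<dots> = (\<Sum>a\<in>C. cmod (hat c a) * cmod (hat b (g \<diamondop> \<iota> a)))"
      using g by (intro sum.cong) (auto simp: Real_Vector_Spaces.norm_mult C_def norm_cocycle mult.commute)
    finally have "(cmod (hat (conv b c) g))\<^sup>2 \<le> (\<Sum>a\<in>C. cmod (hat c a) * cmod (hat b (g \<diamondop> \<iota> a)))\<^sup>2"
      by (intro power_mono) simp_all
    also have "\<dots> \<le> (\<Sum>a\<in>C. (cmod (hat c a) * cmod (hat b (g \<diamondop> \<iota> a)))\<^sup>2) * real (card C)"
      by (rule sum_squared_le_sum_of_squares)
    finally show ?thesis by (simp add: power_mult_distrib mult.commute)
  qed
  have column: "(\<Sum>g\<in>E. (cmod (hat b (g \<diamondop> \<iota> a)))\<^sup>2) \<le> (evnorm (\<r> a) b)\<^sup>2" if a: "a \<in> C" for a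
  proof -
    define E' where "E' = {g \<in> E. hat b (g \<diamondop> \<iota> a) \<noteq> 0}"
    have "inj_on (\<lambda>g. g \<diamondop> \<iota> a) E'"
    proof (rule inj_onI)
      fix g h assume "g \<in> E'" "h \<in> E'" and eq: "g \<diamondop> \<iota> a = h \<diamondop> \<iota> a"
      then have "\<s> g = \<s> a" "\<s> h = \<s> a"
        using a by (simp_all add: E'_def E_def C_def)
      then show "g = h" using inv_mult_cancel_right[of g a] inv_mult_cancel_right[of h a] eq by metis
    qed
    then have "(\<Sum>g\<in>E'. (cmod (hat b (g \<diamondop> \<iota> a)))\<^sup>2) = (\<Sum>h\<in>(\<lambda>g. g \<diamondop> \<iota> a) ` E'. (cmod (hat b h))\<^sup>2)"
      by (simp add: sum.reindex)
    also have "\<dots> \<le> (\<Sum>h\<in>{h. \<s> h = \<r> a \<and> hat b h \<noteq> 0}. (cmod (hat b h))\<^sup>2)"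
      by (rule sum_mono2[OF fibre_finiteD(2)[OF compact_sections_finite[OF b]]])
        (use a in \<open>auto simp: E'_def E_def C_def\<close>)
    also have "\<dots> = (evnorm (\<r> a) b)\<^sup>2" using b by (simp add: evnorm_square)
    also have "(\<Sum>g\<in>E'. (cmod (hat b (g \<diamondop> \<iota> a)))\<^sup>2) = (\<Sum>g\<in>E. (cmod (hat b (g \<diamondop> \<iota> a)))\<^sup>2)"
      by (rule sum.mono_neutral_left) (use fE in \<open>auto simp: E'_def\<close>)
    finally show ?thesis .
  qed
  have "(evnorm x (conv b c))\<^sup>2 = (\<Sum>g\<in>E. (cmod (hat (conv b c) g))\<^sup>2)"
    unfolding evnorm_square[OF x m] E_def ..
  also have "\<dots> \<le> (\<Sum>g\<in>E. real (card C) * (\<Sum>a\<in>C. (cmod (hat c a))\<^sup>2 * (cmod (hat b (g \<diamondop> \<iota> a)))\<^sup>2))"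
    by (rule sum_mono) (simp add: entry E_def)
  also have "\<dots> = real (card C) * (\<Sum>a\<in>C. (cmod (hat c a))\<^sup>2 * (\<Sum>g\<in>E. (cmod (hat b (g \<diamondop> \<iota> a)))\<^sup>2))"
    unfolding sum_distrib_left by (subst sum.swap) simp
  also have "\<dots> \<le> real (card C) * (\<Sum>a\<in>C. (cmod (hat c a))\<^sup>2 * (evnorm (\<r> a) b)\<^sup>2)"
    by (intro mult_left_mono sum_mono column) simp_all
  finally show ?thesis .
qed

text \<open>Isotropy groups at the two ends of an arrow are conjugate.\<close>

lemma T_invariant: "\<s> a \<in> T \<Longrightarrow> \<r> a \<in> T"
proof -
  assume a: "\<s> a \<in> T"
  have "g = \<r> a" if g: "\<s> g = \<r> a" "\<r> g = \<r> a" for g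
  proof -
    have "\<iota> a \<diamondop> (g \<diamondop> a) = \<s> a" by (rule T_D(2)[OF a]) (use g in simp_all)
    then have "a \<diamondop> (\<iota> a \<diamondop> (g \<diamondop> a)) = a" by simp
    then have "g \<diamondop> a = a" using g by simp
    then show ?thesis using mult_inv_cancel_right[of g a] g by simp
  qed
  then show ?thesis by (auto simp: T_def isotropy_def)
qed

text \<open>The norm of the part of the regular representation that lives over \<open>T\<close>.\<close>

definition ess_norm :: "('g \<Rightarrow> 'l) \<Rightarrow> real" where
  "ess_norm = gns_family.gns_norm alg (ev ` T)"

context
  assumes dense: "X \<subseteq> closure T"
begin

lemma T_nonempty: "T \<noteq> {}"
proof
  assume "T = {}"
  then have "X = {}" using dense by simp
  then show False using range_mem by blast
qed

lemma T_subset: "T \<subseteq> X"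
  by (auto simp: T_def)

interpretation gns: gns_family alg "ev ` T"
  by (rule gns_family_ev[OF T_subset T_nonempty])

lemma cstar_seminorm_ess_norm: "cstar_seminorm alg ess_norm"
  unfolding ess_norm_def by (rule gns.cstar_seminorm_gns_norm)

lemma ess_norm_le:
  assumes q: "q \<in> uniform_cstar_seminorms G L" and b: "b \<in> \<A>"
  shows "ess_norm b \<le> q b"
  unfolding ess_norm_def
proof (rule gns.gns_norm_le)
  show "cstar_seminorm alg q" using q by (simp add: uniform_cstar_seminorms_def)
qed (use b hat_le_uniform_seminorm[OF _ _ q] in \<open>auto simp: ev_def\<close>)

lemma uniform_ess_norm:
  assumes \<phi>: "\<phi> \<in> Cc"
  shows "ess_norm (fs \<phi>) = uniform_norm G \<phi>"
proof (rule antisym)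
  show "ess_norm (fs \<phi>) \<le> uniform_norm G \<phi>"
    by (rule seminorm_fs_le_uniform_norm[OF cstar_seminorm_ess_norm \<phi>])
  have le: "cmod (\<phi> y) \<le> ess_norm (fs \<phi>)" if y: "y \<in> T" for y
    using hat_le_gns_norm[OF T_subset T_nonempty, of y "fs \<phi>"] y T_D(1)[OF y] function_section_mem[OF \<phi>]
    by (simp add: hat_function_section ess_norm_def)
  show "uniform_norm G \<phi> \<le> ess_norm (fs \<phi>)"
  proof (rule uniform_norm_least)
    fix x assume x: "x \<in> X"
    show "cmod (\<phi> x) \<le> ess_norm (fs \<phi>)"
    proof (cases "x \<in> T")
      case False
      then have "at x within T \<noteq> bot"
        using x dense trivial_limit_within[of x T] by (auto simp: closure_def trivial_limit_def)
      moreover have "(\<phi> \<longlongrightarrow> \<phi> x) (at x within T)"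
        using \<phi> x T_subset by (auto simp: Cc_units_def continuous_on_def intro: tendsto_within_subset)
      then have "((\<lambda>y. cmod (\<phi> y)) \<longlongrightarrow> cmod (\<phi> x)) (at x within T)" by (rule tendsto_norm)
      moreover have "\<forall>\<^sub>F y in at x within T. cmod (\<phi> y) \<le> ess_norm (fs \<phi>)"
        by (simp add: eventually_at_filter le)
      ultimately show ?thesis using tendsto_upperbound by blast
    qed (rule le)
  qed
qed

lemma two_seminorms: "two_cstar_seminorms alg max_norm ess_norm"
  by unfold_locales (use cstar_seminorm_ess_norm ess_norm_le[OF uniform_max_norm] in auto)

interpretation ess: two_cstar_seminorms alg max_norm ess_norm
  by (rule two_seminorms)

text \<open>For each fixed \<open>c\<close>, the seminorms of \<open>s n \<odot> c\<close> at a point of \<open>T\<close> tend to 0 by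
  \<open>evnorm_mult_le_columns\<close>, as \<open>T\<close> is invariant. The convergence is uniform in \<open>c\<close> because \<open>s\<close> is a
  Cauchy sequence under \<open>ess_norm\<close>.\<close>

lemma tendsto_ess_norm_0:
  assumes s: "s \<in> N.cauchys" and null: "\<And>y. y \<in> T \<Longrightarrow> (\<lambda>n. evnorm y (s n)) \<longlonglongrightarrow> 0"
  shows "(\<lambda>n. ess_norm (s n)) \<longlonglongrightarrow> 0"
proof (rule LIMSEQ_I)
  fix e :: real assume e: "0 < e"
  note sc = cauchys_mem[OF s]
  obtain M where M: "\<And>m n. m \<ge> M \<Longrightarrow> n \<ge> M \<Longrightarrow> ess_norm (aminus alg (s m) (s n)) < e / 2"
    using ess.p.cauchysE[OF ess.cauchys_mono[OF s], of "e / 2"] e by auto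
  have "ess_norm (s m) \<le> e / 2" if m: "m \<ge> M" for m
    unfolding ess_norm_def
  proof (rule gns.gns_norm_least)
    fix \<psi> c assume "\<psi> \<in> ev ` T" and c': "c \<in> carrier alg" "alg.functional_norm \<psi> c \<le> 1"
    then obtain x where x: "x \<in> T" "\<psi> = ev x" by blast
    have xX: "x \<in> X" using x(1) by (rule T_D(1))
    have c: "c \<in> \<A>" "evnorm x c \<le> 1" using c' x by auto
    interpret pf: positive_functional alg "ev x" using xX by (rule positive_functional_ev)
    define C where "C = {a. \<s> a = x \<and> hat c a \<noteq> 0}"
    have "(\<lambda>n. real (card C) * (\<Sum>a\<in>C. (cmod (hat c a))\<^sup>2 * (evnorm (\<r> a) (s n))\<^sup>2)) \<longlonglongrightarrow>
        real (card C) * (\<Sum>a\<in>C. (cmod (hat c a))\<^sup>2 * 0\<^sup>2)"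
      by (intro tendsto_intros null T_invariant) (use x in \<open>auto simp: C_def\<close>)
    then have "(\<lambda>n. real (card C) * (\<Sum>a\<in>C. (cmod (hat c a))\<^sup>2 * (evnorm (\<r> a) (s n))\<^sup>2)) \<longlonglongrightarrow> 0" by simp
    then have "(\<lambda>n. (evnorm x (conv (s n) c))\<^sup>2) \<longlonglongrightarrow> 0"
      by (rule tendsto_sandwich[OF _ _ tendsto_const, rotated 2])
        (use evnorm_mult_le_columns[OF xX sc c(1)] in \<open>auto simp: C_def intro!: always_eventually\<close>)
    then have lim: "(\<lambda>n. evnorm x (conv (s n) c)) \<longlonglongrightarrow> 0"
      using tendsto_real_sqrt[of "\<lambda>n. (evnorm x (conv (s n) c))\<^sup>2" 0] pf.fnorm_nonneg[of "conv (s _) c"] sc c(1)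
      by (simp add: convolution_mem)
    have "evnorm x (conv (s m) c) \<le> e / 2 + evnorm x (conv (s n) c)" if n: "n \<ge> M" for n
    proof -
      have mm: "aminus alg (s m) (s n) \<in> carrier alg" by (rule alg.minus_closed) (use sc in simp_all)
      have "conv (s m) c = section_add L (conv (aminus alg (s m) (s n)) c) (conv (s n) c)"
        using alg.add_mult[of "aminus alg (s m) (s n)" "s n" c] alg.add_minus_cancel[of "s m" "s n"]
          alg.add_commute[of "s n" "aminus alg (s m) (s n)"] mm sc c(1) by simp
      then have "evnorm x (conv (s m) c) \<le> evnorm x (conv (aminus alg (s m) (s n)) c) + evnorm x (conv (s n) c)"
        using pf.fnorm_add[of "conv (aminus alg (s m) (s n)) c" "conv (s n) c"] mm sc c(1)
        by (simp add: convolution_mem)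
      moreover have "evnorm x (conv (aminus alg (s m) (s n)) c) \<le> ess_norm (aminus alg (s m) (s n))"
        using gns.gns_norm_upper1[OF mm, of "ev x" c] x c by (simp add: ess_norm_def)
      ultimately show ?thesis using M[OF m n] by simp
    qed
    then have "evnorm x (conv (s m) c) \<le> e / 2 + 0"
      by (intro LIMSEQ_le_const[OF tendsto_add[OF tendsto_const lim]]) blast
    then show "alg.functional_norm \<psi> (amult alg (s m) c) \<le> e / 2" using x by simp
  qed
  moreover have "0 \<le> ess_norm (s m)" for m using ess.p.nonneg[of "s m"] sc by simp
  ultimately show "\<exists>M. \<forall>m\<ge>M. norm (ess_norm (s m) - 0) < e" using e by (intro exI[of _ M]) fastforce
qed

text \<open>Both sides amount to the convergence of \<open>evnorm y (s n)\<close> to 0 for all \<open>y\<close> in \<open>T\<close>: the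
  left-hand side because \<open>T\<close> consists of free points and the evaluations at the others are weak
  limits, the right-hand side because \<open>ess_norm\<close> is the GNS seminorm over \<open>T\<close>.\<close>

lemma gray_ideal_eq: "gray_ideal G L = ess.null_ideal"
proof -
  have "(\<forall>x\<in>free_points G L. free_state G L x (amult N.completion (astar N.completion S) S) = 0) \<longleftrightarrow> S \<in> ess.null_ideal"
    if S: "S \<in> carrier N.completion" for S
  proof -
    obtain s where s: "s \<in> N.cauchys" "S = N.cls s" using S by (auto elim: N.completionE)
    note sc = cauchys_mem[OF s(1)]
    have evn: "0 \<le> evnorm y (s n)" if "y \<in> X" for y n
    proof -
      interpret pf: positive_functional alg "ev y" using that by (rule positive_functional_ev)
      show ?thesis using sc by simp
    qed
    have state_zero: "eval_state y (amult N.completion (astar N.completion S) S) = 0 \<longleftrightarrow> (\<lambda>n. evnorm y (s n)) \<longlonglongrightarrow> 0"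
      if y: "y \<in> X" for y
    proof
      assume "eval_state y (amult N.completion (astar N.completion S) S) = 0"
      then have "(\<lambda>n. complex_of_real ((evnorm y (s n))\<^sup>2)) \<longlonglongrightarrow> complex_of_real 0"
        using tendsto_eval_state_square[OF y s(1)] s(2) by simp
      then have "(\<lambda>n. (evnorm y (s n))\<^sup>2) \<longlonglongrightarrow> 0" by (simp only: tendsto_of_real_iff)
      then show "(\<lambda>n. evnorm y (s n)) \<longlonglongrightarrow> 0"
        using tendsto_real_sqrt[of "\<lambda>n. (evnorm y (s n))\<^sup>2" 0] evn[OF y] by simp
    next
      assume "(\<lambda>n. evnorm y (s n)) \<longlonglongrightarrow> 0"
      then have "(\<lambda>n. complex_of_real ((evnorm y (s n))\<^sup>2)) \<longlonglongrightarrow> complex_of_real (0\<^sup>2)"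
        by (intro tendsto_of_real tendsto_power)
      then show "eval_state y (amult N.completion (astar N.completion S) S) = 0"
        using tendsto_eval_state_square[OF y s(1)] s(2) LIMSEQ_unique by fastforce
    qed
    show ?thesis
    proof
      assume zero: "\<forall>x\<in>free_points G L. free_state G L x (amult N.completion (astar N.completion S) S) = 0"
      have "(\<lambda>n. evnorm y (s n)) \<longlonglongrightarrow> 0" if y: "y \<in> T" for y
      proof -
        have yF: "y \<in> free_points G L" using T_subset_free_points y by blast
        have "eval_state y (amult N.completion (astar N.completion S) S) = 0"
          using bspec[OF zero yF] unfolding free_state_eq[OF yF] .
        then show ?thesis using state_zero[OF T_D(1)[OF y]] by blast
      qed
      then have "(\<lambda>n. ess_norm (s n)) \<longlonglongrightarrow> 0" by (rule tendsto_ess_norm_0[OF s(1)])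
      then show "S \<in> ess.null_ideal" using ess.cls_mem_null_ideal[OF s(1)] s(2) by simp
    next
      assume "S \<in> ess.null_ideal"
      then have lim: "(\<lambda>n. ess_norm (s n)) \<longlonglongrightarrow> 0" using ess.cls_mem_null_ideal[OF s(1)] s(2) by simp
      have zero: "eval_state y (amult N.completion (astar N.completion S) S) = 0" if y: "y \<in> T" for y
      proof -
        have "(\<lambda>n. evnorm y (s n)) \<longlonglongrightarrow> 0"
          by (rule tendsto_sandwich[OF _ _ tendsto_const lim])
            (use evn[OF T_D(1)[OF y]] evnorm_le_gns_norm[OF T_subset T_nonempty y sc]
              in \<open>auto intro!: always_eventually simp: ess_norm_def\<close>)
        then show ?thesis using state_zero[OF T_D(1)[OF y]] by simp
      qed
      show "\<forall>x\<in>free_points G L. free_state G L x (amult N.completion (astar N.completion S) S) = 0"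
      proof
        fix x assume x: "x \<in> free_points G L"
        then have "x \<in> closure T" using dense by (auto simp: free_points_def)
        then show "free_state G L x (amult N.completion (astar N.completion S) S) = 0"
          using eval_state_square_closure[OF x _ S zero] free_state_eq[OF x] by simp
      qed
    qed
  qed
  then show ?thesis by (auto simp: gray_ideal_def full_eq ess.null_ideal_def)
qed

lemma ess_cstar_eq: "ess_cstar G L = ess.quot" "q_ess G L = coset N.completion ess.null_ideal"
  by (simp_all add: ess_cstar_def q_ess_def gray_ideal_eq full_eq fun_eq_iff)

lemma min_seminorm_eq: "b \<in> \<A> \<Longrightarrow> min_seminorm G L b = ess_norm b"
  using ess.norm_coset_into[of b] by (simp add: min_seminorm_def ess_cstar_eq full_eq)

lemma cstar_seminorm_min: "cstar_seminorm alg (min_seminorm G L)"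
  using cstar_seminorm_ess_norm unfolding cstar_seminorm_def
  by (simp add: min_seminorm_eq mem_simps)

text \<open>Off the carrier, \<open>min_seminorm G L\<close> may differ from \<open>ess_norm\<close>. The isomorphism of
  completions is therefore constructed for the former, and has the same kernel.\<close>

lemma min_seminorm_isomorphism:
  obtains \<Phi> where "isometric_star_isomorphism (hausdorff_completion alg (min_seminorm G L)) (ess_cstar G L) \<Phi>"
    "\<And>b. b \<in> \<A> \<Longrightarrow>
      \<Phi> (into_completion alg (min_seminorm G L) b) = q_ess G L (into_full G L b)"
proof -
  interpret min: two_cstar_seminorms alg max_norm "min_seminorm G L"
    by unfold_locales (use cstar_seminorm_min ess_norm_le[OF uniform_max_norm] in \<open>auto simp: min_seminorm_eq\<close>)
  have "(\<lambda>n. min_seminorm G L (s n)) \<longlonglongrightarrow> 0 \<longleftrightarrow> (\<lambda>n. ess_norm (s n)) \<longlonglongrightarrow> 0" if "s \<in> N.cauchys" for s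
    using cauchys_mem[OF that] by (simp add: min_seminorm_eq)
  then have "min.null_ideal = ess.null_ideal"
    unfolding min.null_ideal_def ess.null_ideal_def using N.completion_member(1) by blast
  then show ?thesis
    using min.isometric_star_isomorphism_quot_iso min.quot_iso_into
    by (intro that[of min.quot_iso]) (simp_all add: ess_cstar_eq full_eq)
qed

end

end

theorem theorem18p6:
  fixes G :: "('g::topological_space) groupoid"
    and L :: "('g, 'l::topological_space) line_bundle"
  assumes "etale_groupoid G"
    and "fell_line_bundle G L"
    and "topologically_free G"
  shows "min_seminorm G L \<in> uniform_cstar_seminorms G L \<and>
    (\<forall>p\<in>uniform_cstar_seminorms G L. \<forall>b\<in>carrier (section_algebra G L). min_seminorm G L b \<le> p b) \<and>
    (\<exists>\<Phi>. isometric_star_isomorphism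
            (hausdorff_completion (section_algebra G L) (min_seminorm G L)) (ess_cstar G L) \<Phi> \<and>
         (\<forall>b\<in>carrier (section_algebra G L).
            \<Phi> (into_completion (section_algebra G L) (min_seminorm G L) b)
            = q_ess G L (into_full G L b)))"
proof -
  interpret fell_line_bundle G L by (rule assms(2))
  have dense: "units G \<subseteq> closure T"
    using assms(3) by (simp add: topologically_free_def T_def)
  obtain \<Phi> where \<Phi>: "isometric_star_isomorphism (hausdorff_completion alg (min_seminorm G L)) (ess_cstar G L) \<Phi>"
    "\<And>b. b \<in> \<A> \<Longrightarrow>
      \<Phi> (into_completion alg (min_seminorm G L) b) = q_ess G L (into_full G L b)"
    using min_seminorm_isomorphism[OF dense] by metis
  have "min_seminorm G L \<in> uniform_cstar_seminorms G L"
    using cstar_seminorm_min[OF dense] uniform_ess_norm[OF dense] function_section_mem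
    by (simp add: uniform_cstar_seminorms_def min_seminorm_eq[OF dense])
  moreover have "min_seminorm G L b \<le> p b"
    if "p \<in> uniform_cstar_seminorms G L" "b \<in> carrier (section_algebra G L)" for p b
    using ess_norm_le[OF dense that(1)] that(2) by (simp add: min_seminorm_eq[OF dense])
  ultimately show ?thesis using \<Phi> by auto
qed

end
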